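(* Let $\boldsymbol{Q}\subset\mathbb{R}^d$ with interfaces $(\Gamma_k)_{k\in\mathbb{N}}$ and constants $(C_k)_{k\in\mathbb{N}}$ be a multiscale interface network, and for $\mathfrak{c}>0$ let $\mathcal{H}_{\mathfrak{c}}$ be the associated fractal space. Then for every $\mathfrak{c}>0$ and every $s\in[0,\tfrac12)$ the continuous embeddings $$\mathcal{H}_{\mathfrak{c}}\subset L^2(\boldsymbol{Q})\qquad\text{and}\qquad \mathcal{H}_{\mathfrak{c}}\subset H^s(\boldsymbol{Q})$$ hold. In particular, the Poincaré-type inequality $$\|v\|_{L^2(\boldsymbol{Q})}^2\le C_0\Big(\|\nabla v\|^2_{L^2(\boldsymbol{Q}\setminus\Gamma)}+\sum_{k=1}^\infty(1+\mathfrak{c})^kC_k\|[\![v]\!]\|^2_{L^2(\Gamma_k)}\Big)$$ holds for all $v\in\mathcal{H}_{\mathfrak{c}}$ with $C_0=\left(1+\tfrac1{\mathfrak{c}}\right)\operatorname{diam}(\boldsymbol{Q})\max\{\operatorname{diam}(\boldsymbol{Q}),1\}$.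
   Context: **Multiscale interface network.** $\boldsymbol{Q}\subset\mathbb{R}^d$ is a bounded domain with Lipschitz boundary containing mutually disjoint interfaces $\Gamma_k$, $k\in\mathbb{N}$, each piecewise affine with finite $(d-1)$-dimensional Hausdorff measure. Put $\Gamma=\bigcup_{k=1}^\infty\Gamma_k$ and $\Gamma^{(K)}=\bigcup_{k=1}^K\Gamma_k$. For each $K\in\mathbb{N}$, $\boldsymbol{Q}\setminus\Gamma^{(K)}=\bigcup_{G\in\mathcal{G}^{(K)}}G$ splits into mutually disjoint, open, simply connected cells $G$ with $\partial G=\partial\overline G$. Let $\mathcal{G}^{(K)}_\infty=\{G\in\mathcal{G}^{(K)}: G\in\mathcal{G}^{(L)}\ \forall L>K\}$ and $d_K=\max\{\operatorname{diam}G: G\in\mathcal{G}^{(K)}\setminus\mathcal{G}^{(K)}_\infty\}$; it is assumed that $d_K\to0$ as $K\to\infty$. With $(x,y)=\{x+s(y-x): s\in(0,1)\}$, it is assumed that $\#\big((x,y)\cap\Gamma_k\big)\le C_k$ for almost all $x,y\in\boldsymbol{Q}$, with $C_k\in\mathbb{N}$ depending only on $k$. **Level-$K$ spaces.** $\mathcal{C}^1_{K,0}(\boldsymbol{Q})$ is the space of $v:\overline{\boldsymbol{Q}}\setminus\Gamma^{(K)}\to\mathbb{R}$ with $v|_G\in C^1(\overline G)$ for all $G\in\mathcal{G}^{(K)}$ and $v|_{\partial\boldsymbol{Q}}\equiv0$. At almost every $\xi\in\Gamma_k$ there is a unit normal $\nu_\xi$, oriented so that $\nu_\xi\cdot e_m>0$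 where $m=\min\{i:\nu_\xi\cdot e_i\ne0\}$ ($e_1,\dots,e_d$ the canonical basis). The normal jump is $[\![v]\!](\xi)=\lim_{s\downarrow0}\big(v(\xi+s\nu_\xi)-v(\xi-s\nu_\xi)\big)$. For $\mathfrak{c}>0$ set $$\langle v,w\rangle_{K,\mathfrak{c}}=\int_{\boldsymbol{Q}\setminus\Gamma^{(K)}}\nabla v\cdot\nabla w\,dx+\sum_{k=1}^K(1+\mathfrak{c})^kC_k\int_{\Gamma_k}[\![v]\!][\![w]\!]\,d\Gamma_k,\qquad \|v\|_{K,\mathfrak{c}}=\langle v,v\rangle_{K,\mathfrak{c}}^{1/2},$$ and let $\mathcal{H}_K$ be the closure (completion) of $\mathcal{C}^1_{K,0}(\boldsymbol{Q})$ in $\|\cdot\|_{K,\mathfrak{c}}$ (gradients and jumps extend by continuity). Then $\mathcal{H}_1\subset\mathcal{H}_2\subset\cdots$ with isometric embeddings. **Fractal space.** $\mathcal{H}^\circ=\bigcup_K\mathcal{H}_K$ carries the scalar product $\langle v,w\rangle_{\mathfrak{c}}=\langle v,w\rangle_{\max\{K,L\},\mathfrak{c}}$ for $v\in\mathcal{H}_L$, $w\in\mathcal{H}_K$. $\mathcal{H}_{\mathfrak{c}}$ is the completion of $\mathcal{H}^\circ$, i.e. the set of equivalence classes of Cauchy sequences; each class has a representative $(v_K)_{K\in\mathbb{N}}$ with $v_K\in\mathcal{H}_K$. Its norm is $\|v\|_{\mathfrak{c}}=\lim_K\|v_K\|_{K,\mathfrak{c}}$. The embeddings into $L^2$ and $H^s$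 are the maps extending continuously the inclusion of the functions in $\bigcup_K\mathcal{C}^1_{K,0}(\boldsymbol{Q})$ (dense in $\mathcal{H}_{\mathfrak{c}}$). **Weak gradient and generalized jump.** For $v=(v_K)_K\in\mathcal{H}_{\mathfrak{c}}$, $\nabla v=\lim_K\nabla v_K$ in $L^2(\boldsymbol{Q}\setminus\Gamma)^d$ and $[\![v]\!]=\lim_K[\![v_K]\!]$ in the space of sequences $(j_k)_k$, $j_k\in L^2(\Gamma_k)$, with norm $\big(\sum_k(1+\mathfrak{c})^kC_k\|j_k\|_{L^2(\Gamma_k)}^2\big)^{1/2}$ (both limits exist). **Fractional Sobolev norm.** $\|v\|_{H^s(\boldsymbol{Q})}^2=\int_{\boldsymbol{Q}}|v|^2dx+\int_{\boldsymbol{Q}}\int_{\boldsymbol{Q}}\frac{|v(x)-v(y)|^2}{|x-y|^{d+2s}}dx\,dy$ for $s\in(0,\frac12)$, and $H^0=L^2$. *)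

theory Defs
  imports "HOL-Analysis.Analysis"
begin

section \<open>Hausdorff measure\<close>

text \<open>The factor \<^term>\<open>unit_ball_vol r / 2 ^ r\<close> is the usual normalisation under which the
  \<open>r\<close>-dimensional Hausdorff measure is Lebesgue measure on \<open>r\<close>-dimensional affine subspaces. Empty
  covering sets contribute nothing, which matters only for \<open>r = 0\<close> (counting measure).\<close>

definition hausdorff_outer :: "nat \<Rightarrow> 'a::metric_space set \<Rightarrow> ennreal" where
  "hausdorff_outer r A =
     (SUP \<delta>\<in>{0::real<..}.
        INF U\<in>{U :: nat \<Rightarrow> 'a set. A \<subseteq> (\<Union>i. U i) \<and> (\<forall>i. bounded (U i) \<and> diameter (U i) \<le> \<delta>)}.
          (\<Sum>i. if U i = {} then 0
                else ennreal (unit_ball_vol (real r) * (diameter (U i) / 2) ^ r)))"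

text \<open>The measurable sets are those in the sense of Caratheodory, so the measure is complete.\<close>

definition hausdorff_measure :: "nat \<Rightarrow> 'a::metric_space measure" where
  "hausdorff_measure r =
     measure_of UNIV (lambda_system UNIV UNIV (hausdorff_outer r)) (hausdorff_outer r)"


section \<open>Square integrable functions and fractional Sobolev spaces\<close>

definition l2_sq :: "'a measure \<Rightarrow> ('a \<Rightarrow> 'b::real_normed_vector) \<Rightarrow> ennreal" where
  "l2_sq M f = (\<integral>\<^sup>+x. ennreal ((norm (f x))\<^sup>2) \<partial>M)"

definition l2_space :: "'a measure \<Rightarrow> ('a \<Rightarrow> 'b::real_normed_vector) set" where
  "l2_space M = {f \<in> borel_measurable M. l2_sq M f < \<infinity>}"

definition l2_norm :: "'a measure \<Rightarrow> ('a \<Rightarrow> 'b::real_normed_vector) \<Rightarrow> real" where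
  "l2_norm M f = sqrt (enn2real (l2_sq M f))"

definition sobolev_sq :: "'a::euclidean_space set \<Rightarrow> real \<Rightarrow> ('a \<Rightarrow> real) \<Rightarrow> ennreal" where
  "sobolev_sq Q s v =
     l2_sq (lebesgue_on Q) v +
     (if s = 0 then 0
      else \<integral>\<^sup>+x. (\<integral>\<^sup>+y. ennreal (\<bar>v x - v y\<bar>\<^sup>2 / norm (x - y) powr (real DIM('a) + 2 * s))
             \<partial>lebesgue_on Q) \<partial>lebesgue_on Q)"

definition sobolev_space :: "'a::euclidean_space set \<Rightarrow> real \<Rightarrow> ('a \<Rightarrow> real) set" where
  "sobolev_space Q s = {v \<in> borel_measurable (lebesgue_on Q). sobolev_sq Q s v < \<infinity>}"

definition sobolev_norm :: "'a::euclidean_space set \<Rightarrow> real \<Rightarrow> ('a \<Rightarrow> real) \<Rightarrow> real" where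
  "sobolev_norm Q s v = sqrt (enn2real (sobolev_sq Q s v))"


section \<open>Completion of a (semi)normed space\<close>

text \<open>The spaces below are carriers inside function or set types that carry no suitable vector
  space class instance, so a space is given by its points, the operation
  \<open>a, b, x, y \<mapsto> a x + b y\<close> and a (semi)norm.\<close>

record 'x prenormed =
  points :: "'x set"
  lincomb :: "real \<Rightarrow> real \<Rightarrow> 'x \<Rightarrow> 'x \<Rightarrow> 'x"
  pnorm :: "'x \<Rightarrow> real"

definition pdist :: "'x prenormed \<Rightarrow> 'x \<Rightarrow> 'x \<Rightarrow> real" where
  "pdist V x y = pnorm V (lincomb V 1 (- 1) x y)"

definition cauchy_seqs :: "'x prenormed \<Rightarrow> (nat \<Rightarrow> 'x) set" where
  "cauchy_seqs V =
     {X. (\<forall>n. X n \<in> points V) \<and> (\<forall>e>0. \<exists>n0. \<forall>m\<ge>n0. \<forall>n\<ge>n0. pdist V (X m) (X n) < e)}"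

definition null_rel :: "'x prenormed \<Rightarrow> (nat \<Rightarrow> 'x) rel" where
  "null_rel V =
     {(X, Y). X \<in> cauchy_seqs V \<and> Y \<in> cauchy_seqs V \<and> (\<lambda>n. pdist V (X n) (Y n)) \<longlonglongrightarrow> 0}"

definition space_completion :: "'x prenormed \<Rightarrow> (nat \<Rightarrow> 'x) set prenormed" where
  "space_completion V =
     \<lparr> points = cauchy_seqs V // null_rel V,
       lincomb = (\<lambda>a b P R. null_rel V `` {\<lambda>n. lincomb V a b (X n) (Y n) | X Y. X \<in> P \<and> Y \<in> R}),
       pnorm = (\<lambda>P. THE l. \<forall>X\<in>P. (\<lambda>n. pnorm V (X n)) \<longlonglongrightarrow> l) \<rparr>"

definition to_completion :: "'x prenormed \<Rightarrow> 'x \<Rightarrow> (nat \<Rightarrow> 'x) set" where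
  "to_completion V x = null_rel V `` {\<lambda>_. x}"


section \<open>Multiscale interface networks\<close>

text \<open>Interfaces, cells and crossing numbers are indexed from 1; the values at index 0 are
  never used. The index type \<open>'n\<close> of the coordinates is linearly ordered because the orientation
  of normals refers to the first nonvanishing coordinate.\<close>

type_synonym 'n point = "real ^ 'n"

record ('n::finite) network =
  region :: "'n point set"
  iface :: "nat \<Rightarrow> 'n point set"
  cells :: "nat \<Rightarrow> 'n point set set"
  crossings :: "nat \<Rightarrow> nat"

definition iface_upto :: "'n::finite network \<Rightarrow> nat \<Rightarrow> 'n point set" where
  "iface_upto N K = (\<Union>k\<in>{1..K}. iface N k)"

definition iface_all :: "'n::finite network \<Rightarrow> 'n point set" where
  "iface_all N = (\<Union>k\<in>{1..}. iface N k)"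

text \<open>Near each boundary point the set is the strict subgraph of a Lipschitz function over the
  hyperplane orthogonal to some unit vector \<open>\<nu>\<close>.\<close>

definition lipschitz_boundary :: "'a::euclidean_space set \<Rightarrow> bool" where
  "lipschitz_boundary Q \<longleftrightarrow>
     (\<forall>x\<in>frontier Q. \<exists>\<nu> r h L f.
        norm \<nu> = 1 \<and> 0 < r \<and> 0 < h \<and>
        L-lipschitz_on {z. z \<bullet> \<nu> = 0 \<and> norm z < r} f \<and>
        (\<forall>z. z \<bullet> \<nu> = 0 \<and> norm z < r \<longrightarrow> \<bar>f z\<bar> < h) \<and>
        (\<forall>z t. z \<bullet> \<nu> = 0 \<and> norm z < r \<and> \<bar>t\<bar> < h \<longrightarrow>
           (x + z + t *\<^sub>R \<nu> \<in> Q \<longleftrightarrow> t < (f z :: real))))"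

text \<open>A family of polytopes of codimension 1, locally finite in \<open>Q\<close>, describes \<open>S\<close> up to the
  relative boundaries of the pieces, parts of which may be missing from \<open>S\<close>: disjoint interfaces
  must be able to abut on each other and on the boundary of \<open>Q\<close>. Families that are only locally
  finite admit flat interfaces ending at a curved boundary of \<open>Q\<close>.\<close>

definition piecewise_affine :: "'a::euclidean_space set \<Rightarrow> 'a set \<Rightarrow> bool" where
  "piecewise_affine Q S \<longleftrightarrow>
     (\<exists>\<P>. (\<forall>p\<in>\<P>. polytope p \<and> aff_dim p = int DIM('a) - 1) \<and>
          (\<forall>x\<in>Q. \<exists>e>0. finite {p\<in>\<P>. p \<inter> ball x e \<noteq> {}}) \<and>
          (\<Union>p\<in>\<P>. rel_interior p) \<subseteq> S \<and> S \<subseteq> \<Union>\<P>)"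

definition permanent_cells :: "'n::finite network \<Rightarrow> nat \<Rightarrow> 'n point set set" where
  "permanent_cells N K = {G \<in> cells N K. \<forall>L>K. G \<in> cells N L}"

text \<open>In \<^typ>\<open>ennreal\<close> the supremum over the empty set is 0.\<close>

definition mesh_size :: "'n::finite network \<Rightarrow> nat \<Rightarrow> ennreal" where
  "mesh_size N K = (SUP G\<in>cells N K - permanent_cells N K. ennreal (diameter G))"

definition multiscale_interface_network :: "'n::{finite,linorder} network \<Rightarrow> bool" where
  "multiscale_interface_network N \<longleftrightarrow>
     region N \<noteq> {} \<and> open (region N) \<and> connected (region N) \<and> bounded (region N) \<and>
     lipschitz_boundary (region N) \<and>
     (\<forall>k\<ge>1. iface N k \<subseteq> region N \<and> piecewise_affine (region N) (iface N k) \<and>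
        hausdorff_outer (CARD('n) - 1) (iface N k) < \<infinity>) \<and>
     (\<forall>k\<ge>1. \<forall>l\<ge>1. k \<noteq> l \<longrightarrow> iface N k \<inter> iface N l = {}) \<and>
     (\<forall>K\<ge>1. region N - iface_upto N K = \<Union>(cells N K) \<and> pairwise disjnt (cells N K) \<and>
        (\<forall>G\<in>cells N K. G \<noteq> {} \<and> open G \<and> simply_connected G \<and>
           frontier G = frontier (closure G))) \<and>
     mesh_size N \<longlonglongrightarrow> 0 \<and>
     (\<forall>k\<ge>1. 1 \<le> crossings N k \<and>
        (AE z in lborel \<Otimes>\<^sub>M lborel. fst z \<in> region N \<longrightarrow> snd z \<in> region N \<longrightarrow>
           finite (open_segment (fst z) (snd z) \<inter> iface N k) \<and>
           card (open_segment (fst z) (snd z) \<inter> iface N k) \<le> crossings N k))"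


section \<open>Gradients, normals and jumps of piecewise smooth functions\<close>

definition gradient :: "('a::real_inner \<Rightarrow> real) \<Rightarrow> 'a \<Rightarrow> 'a" where
  "gradient v x = (THE D. GDERIV v x :> D)"

definition unit_normal :: "'n::{finite,linorder} point set \<Rightarrow> 'n point \<Rightarrow> 'n point" where
  "unit_normal S \<xi> =
     (THE \<nu>. norm \<nu> = 1 \<and>
        (\<exists>e>0. S \<inter> ball \<xi> e = {y \<in> ball \<xi> e. (y - \<xi>) \<bullet> \<nu> = 0}) \<and>
        \<nu> $ Min {i. \<nu> $ i \<noteq> 0} > 0)"

definition jump ::
    "'n::{finite,linorder} point set \<Rightarrow> ('n point \<Rightarrow> real) \<Rightarrow> 'n point \<Rightarrow> real" where
  "jump S v \<xi> = Lim (at_right 0)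
     (\<lambda>s. v (\<xi> + s *\<^sub>R unit_normal S \<xi>) - v (\<xi> - s *\<^sub>R unit_normal S \<xi>))"

definition surface :: "'n::finite network \<Rightarrow> nat \<Rightarrow> 'n point measure" where
  "surface N k = restrict_space (hausdorff_measure (CARD('n) - 1)) (iface N k)"


section \<open>The level spaces\<close>

text \<open>Functions are total; their values on the interfaces up to level \<open>K\<close> and outside the closure
  of the domain are irrelevant. A function \<open>u\<close> is in \<open>C\<^sup>1\<close> of the closure of \<open>G\<close> if it and its
  gradient on \<open>G\<close> extend continuously to the closure; the points of the closure of \<open>G\<close> off the
  interfaces are those of \<open>G\<close> and of the boundary of the domain, so \<open>u\<close> attains the boundary
  values of \<open>v\<close>. The last two conditions say that the norm is finite; they hold automatically if
  there are finitely many cells.\<close>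

definition c1_level :: "'n::{finite,linorder} network \<Rightarrow> nat \<Rightarrow> ('n point \<Rightarrow> real) set" where
  "c1_level N K =
     {v. (\<forall>G\<in>cells N K. \<exists>u D.
            continuous_on (closure G) u \<and> continuous_on (closure G) D \<and>
            (\<forall>x\<in>G. GDERIV u x :> D x) \<and>
            (\<forall>x\<in>closure G - iface_upto N K. v x = u x)) \<and>
         (\<forall>x\<in>frontier (region N). v x = 0) \<and>
         gradient v \<in> l2_space (lebesgue_on (region N - iface_upto N K)) \<and>
         (\<forall>k\<in>{1..K}. jump (iface N k) v \<in> l2_space (surface N k))}"

definition level_inner ::
    "'n::{finite,linorder} network \<Rightarrow> nat \<Rightarrow> real \<Rightarrow>
     ('n point \<Rightarrow> real) \<Rightarrow> ('n point \<Rightarrow> real) \<Rightarrow> real" where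
  "level_inner N K c v w =
     (\<integral>x. gradient v x \<bullet> gradient w x \<partial>lebesgue_on (region N - iface_upto N K)) +
     (\<Sum>k=1..K. (1 + c) ^ k * real (crossings N k) *
        (\<integral>\<xi>. jump (iface N k) v \<xi> * jump (iface N k) w \<xi> \<partial>surface N k))"

definition smooth_space ::
    "'n::{finite,linorder} network \<Rightarrow> real \<Rightarrow> nat \<Rightarrow> ('n point \<Rightarrow> real) prenormed" where
  "smooth_space N c K =
     \<lparr> points = c1_level N K,
       lincomb = (\<lambda>a b v w x. a * v x + b * w x),
       pnorm = (\<lambda>v. sqrt (level_inner N K c v v)) \<rparr>"

definition level_space ::
    "'n::{finite,linorder} network \<Rightarrow> real \<Rightarrow> nat \<Rightarrow> (nat \<Rightarrow> 'n point \<Rightarrow> real) set prenormed" where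
  "level_space N c K = space_completion (smooth_space N c K)"

text \<open>The isometric embedding of a lower level into level \<open>L\<close>: it enlarges a class of Cauchy
  sequences to the class at level \<open>L\<close> which contains it.\<close>

definition lift_level ::
    "'n::{finite,linorder} network \<Rightarrow> real \<Rightarrow> nat \<Rightarrow>
     (nat \<Rightarrow> 'n point \<Rightarrow> real) set \<Rightarrow> (nat \<Rightarrow> 'n point \<Rightarrow> real) set" where
  "lift_level N c L P = null_rel (smooth_space N c L) `` P"


section \<open>The fractal space\<close>

text \<open>The union of the increasing spaces is taken as their direct limit: a pair \<open>(K, P)\<close> is the
  element \<open>P\<close> of level \<open>K\<close>, and \<open>(K, P)\<close> has distance 0 from its images at higher levels.\<close>

definition union_space ::
    "'n::{finite,linorder} network \<Rightarrow> real \<Rightarrow> (nat \<times> (nat \<Rightarrow> 'n point \<Rightarrow> real) set) prenormed" where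
  "union_space N c =
     \<lparr> points = (SIGMA K:{1..}. points (level_space N c K)),
       lincomb = (\<lambda>a b (K, P) (L, R).
         (max K L, lincomb (level_space N c (max K L)) a b
                     (lift_level N c (max K L) P) (lift_level N c (max K L) R))),
       pnorm = (\<lambda>(K, P). pnorm (level_space N c K) P) \<rparr>"

type_synonym 'n fractal_element = "(nat \<Rightarrow> nat \<times> (nat \<Rightarrow> 'n point \<Rightarrow> real) set) set"

definition fractal_space ::
    "'n::{finite,linorder} network \<Rightarrow> real \<Rightarrow> 'n fractal_element prenormed" where
  "fractal_space N c = space_completion (union_space N c)"

definition of_smooth ::
    "'n::{finite,linorder} network \<Rightarrow> real \<Rightarrow> nat \<Rightarrow> ('n point \<Rightarrow> real) \<Rightarrow> 'n fractal_element" where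
  "of_smooth N c K u =
     to_completion (union_space N c) (K, to_completion (smooth_space N c K) u)"


section \<open>Weak gradients and generalized jumps\<close>

definition is_level_gradient ::
    "'n::{finite,linorder} network \<Rightarrow> nat \<Rightarrow> (nat \<Rightarrow> 'n point \<Rightarrow> real) set \<Rightarrow>
     ('n point \<Rightarrow> 'n point) \<Rightarrow> bool" where
  "is_level_gradient N K P g \<longleftrightarrow>
     g \<in> l2_space (lebesgue_on (region N - iface_upto N K)) \<and>
     (\<forall>X\<in>P. (\<lambda>n. l2_sq (lebesgue_on (region N - iface_upto N K)) (\<lambda>x. gradient (X n) x - g x))
        \<longlonglongrightarrow> 0)"

definition is_weak_gradient ::
    "'n::{finite,linorder} network \<Rightarrow> 'n fractal_element \<Rightarrow> ('n point \<Rightarrow> 'n point) \<Rightarrow> bool" where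
  "is_weak_gradient N v g \<longleftrightarrow>
     g \<in> l2_space (lebesgue_on (region N - iface_all N)) \<and>
     (\<forall>V\<in>v. \<exists>h. (\<forall>n. is_level_gradient N (fst (V n)) (snd (V n)) (h n)) \<and>
        (\<lambda>n. l2_sq (lebesgue_on (region N - iface_all N)) (\<lambda>x. h n x - g x)) \<longlonglongrightarrow> 0)"

definition jump_sq ::
    "'n::finite network \<Rightarrow> real \<Rightarrow> (nat \<Rightarrow> 'n point \<Rightarrow> real) \<Rightarrow> ennreal" where
  "jump_sq N c j =
     (\<Sum>k. ennreal ((1 + c) ^ Suc k * real (crossings N (Suc k))) *
           l2_sq (surface N (Suc k)) (j (Suc k)))"

definition jump_space ::
    "'n::finite network \<Rightarrow> real \<Rightarrow> (nat \<Rightarrow> 'n point \<Rightarrow> real) set" where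
  "jump_space N c = {j. (\<forall>k\<ge>1. j k \<in> l2_space (surface N k)) \<and> jump_sq N c j < \<infinity>}"

definition is_level_jump ::
    "'n::{finite,linorder} network \<Rightarrow> real \<Rightarrow> (nat \<Rightarrow> 'n point \<Rightarrow> real) set \<Rightarrow>
     (nat \<Rightarrow> 'n point \<Rightarrow> real) \<Rightarrow> bool" where
  "is_level_jump N c P j \<longleftrightarrow>
     j \<in> jump_space N c \<and>
     (\<forall>X\<in>P. (\<lambda>n. jump_sq N c (\<lambda>k \<xi>. jump (iface N k) (X n) \<xi> - j k \<xi>)) \<longlonglongrightarrow> 0)"

definition is_jump ::
    "'n::{finite,linorder} network \<Rightarrow> real \<Rightarrow> 'n fractal_element \<Rightarrow>
     (nat \<Rightarrow> 'n point \<Rightarrow> real) \<Rightarrow> bool" where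
  "is_jump N c v j \<longleftrightarrow>
     j \<in> jump_space N c \<and>
     (\<forall>V\<in>v. \<exists>h. (\<forall>n. is_level_jump N c (snd (V n)) (h n)) \<and>
        (\<lambda>n. jump_sq N c (\<lambda>k \<xi>. h n k \<xi> - j k \<xi>)) \<longlonglongrightarrow> 0)"


section \<open>Continuous embeddings of the fractal space\<close>

text \<open>The target \<open>Y\<close> with norm \<open>\<phi>\<close> is a space of functions on the domain modulo equality almost
  everywhere.\<close>

definition continuous_embedding ::
    "'n::{finite,linorder} network \<Rightarrow> real \<Rightarrow> ('n point \<Rightarrow> real) set \<Rightarrow>
     (('n point \<Rightarrow> real) \<Rightarrow> real) \<Rightarrow> ('n fractal_element \<Rightarrow> 'n point \<Rightarrow> real) \<Rightarrow> bool" where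
  "continuous_embedding N c Y \<phi> E \<longleftrightarrow>
     (\<forall>v\<in>points (fractal_space N c). E v \<in> Y) \<and>
     (\<forall>K\<ge>1. \<forall>u\<in>c1_level N K. AE x in lebesgue_on (region N). E (of_smooth N c K u) x = u x) \<and>
     (\<forall>a b. \<forall>v\<in>points (fractal_space N c). \<forall>w\<in>points (fractal_space N c).
        AE x in lebesgue_on (region N).
          E (lincomb (fractal_space N c) a b v w) x = a * E v x + b * E w x) \<and>
     (\<forall>v\<in>points (fractal_space N c). \<forall>w\<in>points (fractal_space N c).
        (AE x in lebesgue_on (region N). E v x = E w x) \<longrightarrow> v = w) \<and>
     (\<exists>B. \<forall>v\<in>points (fractal_space N c). \<phi> (E v) \<le> B * pnorm (fractal_space N c) v)"

end

theory Submission imports Defs begin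

text \<open>Up to a set of vanishing surface measure the interfaces lie in countably many hyperplanes and are
 locally flat. Along almost every line a piecewise smooth \<open>u\<close> changes between \<open>x\<close> and \<open>x + h\<close> by the integral of
 its gradient and by at most \<open>C\<^sub>k\<close> jumps on \<open>\<Gamma>\<^sub>k\<close>, so the inequality of Cauchy and Schwarz with the weights
 \<open>(1 + c)\<^sup>k\<close> bounds the square of the difference. Integrating over \<open>x\<close> turns crossings into surface integrals, because
 Lebesgue measure of cylinders over a hyperplane is bounded by its Hausdorff measure (isodiametric inequality): the
 squared \<open>L\<^sup>2\<close> distance of \<open>u\<close> and its shift by \<open>h\<close> is at most \<open>(1 + 1/c) (\<bar>h\<bar>\<^sup>2 + \<bar>h\<bar>)\<close> times the squared norm.
 A shift by the diameter leaves the domain and gives the inequality of Poincare; dividing by \<open>\<bar>h\<bar>\<^bsup>d + 2s\<^esup>\<close> gives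
 the embedding into \<open>H\<^sup>s\<close>. For injectivity let \<open>z\<^sub>n\<close> be a Cauchy sequence that tends to 0 in \<open>L\<^sup>2\<close>. The estimate for
 \<open>z\<^sub>m - z\<^sub>n\<close> with \<open>n \<rightarrow> \<infinity>\<close> bounds the difference quotients of \<open>z\<^sub>m\<close> by the tail of the sequence; short shifts
 in normal direction recover the jumps of \<open>z\<^sub>m\<close> and, once these vanish in the limit, shifts within the cells
 recover its gradient.\<close>

text \<open>The constant in the inequality of Poincare is explicit, so the volume of a cylinder has
  to be bounded by the Hausdorff measure of its base with factor exactly 1; this calls for the
  isodiametric inequality. The opposite comparison, by which injectivity returns from volumes to
  surface integrals, may lose a factor. The domain need not be convex: functions are extended by
  zero, and the boundary condition makes crossings of the boundary free of cost. The crossing bound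
  is given for almost all pairs of end points, whereas the estimate fixes h and varies x alone;
  transversality at regular points bridges this gap. In the estimate jumps carry the factor |h| and
  gradients the factor |h|^2. Jumps can therefore be recovered while gradients are present, but
  division by |h|^2 requires that the jump terms have disappeared before. Hence, for fixed h, the
  limit along the sequence is taken first, and it uses that the jumps tend to 0. The levels along a
  Cauchy sequence may be unbounded, so no single level space can carry this argument.\<close>

abbreviation nn_lborel :: "('a::euclidean_space => ennreal) => ennreal" (binder "LB " 10)
 where "nn_lborel f == nn_integral lborel f"

abbreviation (input) LIMSEQ_ascii :: "(nat => 'a::topological_space) => 'a => bool" (infixr "---->" 60)
 where "X ----> l == X \<longlonglongrightarrow> l"

section \<open>Hausdorff measure as a metric outer measure\<close>

definition hausdorff_weight :: "nat => 'a::metric_space set => ennreal" where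
 "hausdorff_weight r U =
   (if U = {} then 0 else ennreal (unit_ball_vol (real r) * (diameter U / 2) ^ r))"

definition delta_covers :: "real => 'a::metric_space set => (nat => 'a set) set" where
 "delta_covers \<delta> A = {U. A \<subseteq> (\<Union>i. U i) & (\<forall>i. bounded (U i) & diameter (U i) <= \<delta>)}"

definition hausdorff_pre :: "nat => real => 'a::metric_space set => ennreal" where
 "hausdorff_pre r \<delta> A = (INF U\<in>delta_covers \<delta> A. \<Sum>i. hausdorff_weight r (U i))"

lemma hausdorff_outer_eq_SUP: "hausdorff_outer r A = (SUP \<delta>\<in>{0<..}. hausdorff_pre r \<delta> A)"
 unfolding hausdorff_outer_def hausdorff_pre_def hausdorff_weight_def delta_covers_def ..

lemma hausdorff_weight_empty [simp]: "hausdorff_weight r {} = 0"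
 by (simp add: hausdorff_weight_def)

lemma hausdorff_pre_le_outer: "\<delta> > 0 ==> hausdorff_pre r \<delta> A <= hausdorff_outer r A"
 unfolding hausdorff_outer_eq_SUP by (rule SUP_upper) simp

lemma hausdorff_pre_mono: "A \<subseteq> B ==> hausdorff_pre r \<delta> A <= hausdorff_pre r \<delta> B"
 unfolding hausdorff_pre_def by (rule INF_superset_mono) (auto simp: delta_covers_def)

lemma hausdorff_pre_antimono: "\<delta> <= \<delta>' ==> hausdorff_pre r \<delta>' A <= hausdorff_pre r \<delta> A"
 unfolding hausdorff_pre_def
proof (rule INF_superset_mono)
 assume d: "\<delta> <= \<delta>'"
 show "delta_covers \<delta> A \<subseteq> delta_covers \<delta>' A"
  unfolding delta_covers_def using order_trans[OF _ d] by blast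
qed simp

lemma hausdorff_outer_mono: "A \<subseteq> B ==> hausdorff_outer r A <= hausdorff_outer r B"
 unfolding hausdorff_outer_eq_SUP by (rule SUP_mono) (use hausdorff_pre_mono in blast)

lemma hausdorff_outer_empty [simp]: "hausdorff_outer r {} = 0"
proof -
 have "hausdorff_pre r \<delta> ({}::'a set) <= 0" if "\<delta> > 0" for \<delta>
  unfolding hausdorff_pre_def
  by (rule INF_lower2[of "%_. {}"]) (use that in \<open>auto simp: delta_covers_def\<close>)
 then show ?thesis unfolding hausdorff_outer_eq_SUP by (auto simp: SUP_eq_const)
qed

lemma hausdorff_pre_subadditive:
 "hausdorff_pre r \<delta> (\<Union>n. A n) <= (\<Sum>n. hausdorff_pre r \<delta> (A n))"
proof (rule ennreal_le_epsilon)
 fix e :: real assume fin: "(\<Sum>n. hausdorff_pre r \<delta> (A n)) < top" and e: "0 < e"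
 have "\<exists>U\<in>delta_covers \<delta> (A n).
   (\<Sum>i. hausdorff_weight r (U i)) < hausdorff_pre r \<delta> (A n) + ennreal (e * (1/2)^Suc n)" for n
 proof -
  have "hausdorff_pre r \<delta> (A n) < top"
   using fin ennreal_suminf_lessD by blast
  then have "hausdorff_pre r \<delta> (A n) < hausdorff_pre r \<delta> (A n) + ennreal (e * (1/2)^Suc n)"
   using e ennreal_add_left_cancel_less[of "hausdorff_pre r \<delta> (A n)" 0 "ennreal (e * (1/2)^Suc n)"]
   by (simp add: ennreal_zero_less_mult_iff)
  then show ?thesis
   by (subst (asm) (1) hausdorff_pre_def) (simp add: INF_less_iff)
 qed
 then obtain U where U: "\<And>n. U n \<in> delta_covers \<delta> (A n)"
  "\<And>n. (\<Sum>i. hausdorff_weight r (U n i)) < hausdorff_pre r \<delta> (A n) + ennreal (e * (1/2)^Suc n)"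
  by metis
 define V where "V m = (case prod_decode m of (n, i) => U n i)" for m
 have "A n \<subseteq> (\<Union>m. V m)" for n
 proof
  fix x assume "x \<in> A n"
  then obtain i where "x \<in> U n i" using U(1)[of n] by (auto simp: delta_covers_def)
  then have "x \<in> V (prod_encode (n, i))" by (simp add: V_def)
  then show "x \<in> (\<Union>m. V m)" by blast
 qed
 then have "V \<in> delta_covers \<delta> (\<Union>n. A n)"
  using U(1) unfolding delta_covers_def V_def by (auto split: prod.split)
 then have "hausdorff_pre r \<delta> (\<Union>n. A n) <= (\<Sum>m. hausdorff_weight r (V m))"
  unfolding hausdorff_pre_def by (rule INF_lower)
 also have "... = (\<Sum>n. \<Sum>i. hausdorff_weight r (U n i))"
  using suminf_ennreal_2dimen[of "%n. \<Sum>i. hausdorff_weight r (U n i)" "%(n,i). hausdorff_weight r (U n i)"]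
  by (simp add: V_def comp_def case_prod_beta)
 also have "... <= (\<Sum>n. hausdorff_pre r \<delta> (A n) + ennreal (e * (1/2)^Suc n))"
  by (intro suminf_le) (use U(2) less_imp_le in blast)+
 also have "... = (\<Sum>n. hausdorff_pre r \<delta> (A n)) + (\<Sum>n. ennreal (e * (1/2)^Suc n))"
  by (rule suminf_add[symmetric]) auto
 also have "(\<Sum>n. ennreal (e * (1/2)^Suc n)) = ennreal e"
  using e sums_mult[OF power_half_series, of e] by (intro suminf_ennreal_eq) auto
 finally show "hausdorff_pre r \<delta> (\<Union>n. A n) <= (\<Sum>n. hausdorff_pre r \<delta> (A n)) + ennreal e" .
qed

lemma hausdorff_outer_subadditive:
 "hausdorff_outer r (\<Union>n. A n) <= (\<Sum>n. hausdorff_outer r (A n))"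
 unfolding hausdorff_outer_eq_SUP[of r "\<Union>n. A n"]
proof (rule SUP_least)
 fix \<delta> :: real assume "\<delta> \<in> {0<..}"
 then show "hausdorff_pre r \<delta> (\<Union>n. A n) <= (\<Sum>n. hausdorff_outer r (A n))"
  by (intro order_trans[OF hausdorff_pre_subadditive] suminf_le hausdorff_pre_le_outer) auto
qed

lemma hausdorff_outer_Un: "hausdorff_outer r (A \<union> B) <= hausdorff_outer r A + hausdorff_outer r B"
proof -
 have "hausdorff_outer r (\<Union>n::nat. binaryset A B n) <= (\<Sum>n. hausdorff_outer r (binaryset A B n))"
  by (rule hausdorff_outer_subadditive)
 then show ?thesis
  unfolding UN_binaryset_eq using suminf_binaryset_eq[of "hausdorff_outer r" A B] by simp
qed

lemma outer_measure_space_hausdorff: "outer_measure_space UNIV (hausdorff_outer r)"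
 unfolding outer_measure_space_def positive_def increasing_def countably_subadditive_def
 using hausdorff_outer_mono hausdorff_outer_subadditive by auto

text \<open>Once \<open>\<delta> < e\<close>, a covering set meets at most one of \<open>A\<close>
  and \<open>B\<close>, so a cover of the union splits into a cover of each without changing the
  total weight.\<close>

lemma hausdorff_outer_separated:
 assumes sep: "\<And>a b. a \<in> A ==> b \<in> B ==> dist a b >= e" and e: "e > 0"
 shows "hausdorff_outer r A + hausdorff_outer r B <= hausdorff_outer r (A \<union> B)"
proof -
 have pre: "hausdorff_pre r \<delta> A + hausdorff_pre r \<delta> B <= hausdorff_pre r \<delta> (A \<union> B)"
  if d: "\<delta> < e" for \<delta>
  unfolding hausdorff_pre_def[of r \<delta> "A \<union> B"]
 proof (rule INF_greatest)
  fix U assume U: "U \<in> delta_covers \<delta> (A \<union> B)"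
  define V where "V i = (if U i \<inter> A ~= {} then U i else {})" for i
  define W where "W i = (if U i \<inter> A ~= {} then {} else U i)" for i
  have d0: "\<delta> >= 0"
   using U unfolding delta_covers_def using diameter_ge_0 order_trans by blast
  have "V \<in> delta_covers \<delta> A"
   using U d0 unfolding delta_covers_def V_def by auto blast
  moreover have "W \<in> delta_covers \<delta> B"
  proof -
   have "b \<in> (\<Union>i. W i)" if b: "b \<in> B" for b
   proof -
    obtain i where i: "b \<in> U i" using U b by (auto simp: delta_covers_def)
    have "U i \<inter> A = {}"
    proof (rule ccontr)
     assume "U i \<inter> A ~= {}"
     then obtain a where a: "a \<in> U i" "a \<in> A" by auto
     have "dist a b <= diameter (U i)"
      using U a i by (intro diameter_bounded_bound) (auto simp: delta_covers_def)
     also have "... <= \<delta>" using U by (auto simp: delta_covers_def)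
     finally show False using sep[OF a(2) b] d by simp
    qed
    then show ?thesis using i by (auto simp: W_def intro!: exI[of _ i])
   qed
   then show ?thesis using U d0 unfolding delta_covers_def W_def by auto
  qed
  ultimately have "hausdorff_pre r \<delta> A + hausdorff_pre r \<delta> B \<le>
    (\<Sum>i. hausdorff_weight r (V i)) + (\<Sum>i. hausdorff_weight r (W i))"
   unfolding hausdorff_pre_def by (intro add_mono INF_lower)
  also have "... = (\<Sum>i. hausdorff_weight r (V i) + hausdorff_weight r (W i))"
   by (rule suminf_add) auto
  also have "... = (\<Sum>i. hausdorff_weight r (U i))"
   by (rule suminf_cong) (simp add: V_def W_def)
  finally show "hausdorff_pre r \<delta> A + hausdorff_pre r \<delta> B <= (\<Sum>i. hausdorff_weight r (U i))" .
 qed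
 \<comment> \<open>Independent scales for \<open>A\<close> and \<open>B\<close> allow the two
   suprema to be taken one after the other.\<close>
 have two: "hausdorff_pre r \<delta> A + hausdorff_pre r \<delta>' B <= hausdorff_outer r (A \<union> B)"
  if "\<delta> > 0" "\<delta>' > 0" for \<delta> \<delta>'
 proof -
  define \<eta> where "\<eta> = min (min \<delta> \<delta>') (e/2)"
  have "hausdorff_pre r \<delta> A + hausdorff_pre r \<delta>' B <= hausdorff_pre r \<eta> A + hausdorff_pre r \<eta> B"
   by (intro add_mono hausdorff_pre_antimono) (auto simp: \<eta>_def)
  also have "... <= hausdorff_pre r \<eta> (A \<union> B)" using e by (intro pre) (auto simp: \<eta>_def)
  also have "... <= hausdorff_outer r (A \<union> B)"
   using that e by (intro hausdorff_pre_le_outer) (auto simp: \<eta>_def)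
  finally show ?thesis .
 qed
 have "hausdorff_pre r \<delta> A + hausdorff_outer r B <= hausdorff_outer r (A \<union> B)" if "\<delta> > 0" for \<delta>
  unfolding hausdorff_outer_eq_SUP[of r B]
  by (subst ennreal_SUP_add_right) (use that in \<open>auto intro!: SUP_least two\<close>)
 then show ?thesis
  unfolding hausdorff_outer_eq_SUP[of r A]
  by (subst ennreal_SUP_add_left[symmetric]) (auto intro!: SUP_least)
qed

lemma hausdorff_outer_sum_separated:
 assumes sep: "\<And>i j a b. i < j ==> a \<in> D i ==> b \<in> D j ==> dist a b >= \<epsilon> i j"
  and pos: "\<And>i j. i < j ==> \<epsilon> i j > (0::real)"
 shows "(\<Sum>i<n. hausdorff_outer r (D (i::nat))) <= hausdorff_outer r (\<Union>i<n. D i)"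
proof (induction n)
 case (Suc n)
 have "(\<Sum>i<Suc n. hausdorff_outer r (D i)) <= hausdorff_outer r (\<Union>i<n. D i) + hausdorff_outer r (D n)"
  using Suc by (simp add: add_mono)
 also have "... <= hausdorff_outer r ((\<Union>i<n. D i) \<union> D n)"
 proof (rule hausdorff_outer_separated)
  fix a b assume a: "a \<in> (\<Union>i<n. D i)" and b: "b \<in> D n"
  then obtain i where i: "i < n" "a \<in> D i" by auto
  \<comment> \<open>Only finitely many gaps occur at each stage; the inserted 1 keeps
    \<open>Min\<close> defined for \<open>n = 0\<close>.\<close>
  have "Min (insert 1 ((%i. \<epsilon> i n) ` {..<n})) <= \<epsilon> i n" using i by (intro Min_le) auto
  also have "... <= dist a b" by (rule sep[OF i(1) i(2) b])
  finally show "Min (insert 1 ((%i. \<epsilon> i n) ` {..<n})) <= dist a b" .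
 qed (use pos in auto)
 also have "(\<Union>i<n. D i) \<union> D n = (\<Union>i<Suc n. D i)" by (auto simp: less_Suc_eq)
 finally show ?case .
qed simp

text \<open>The shells of a closed set \<open>C\<close> at mutual positive distance are summable, so the part of \<open>X\<close>
 very close to \<open>C\<close> has small outer measure.\<close>

lemma closed_in_lambda_system_hausdorff:
 assumes C: "closed C"
 shows "C \<in> lambda_system UNIV UNIV (hausdorff_outer r)"
proof (cases "C = {}")
 case True
 then show ?thesis by (simp add: lambda_system_def)
next
 case False
 have main: "hausdorff_outer r (C \<inter> X) + hausdorff_outer r (X - C) <= hausdorff_outer r X" for X
 proof (cases "hausdorff_outer r X = top")
  case fin: False
  let ?H = "hausdorff_outer r"
  define f where "f x = infdist x C" for x :: 'a
  define X' where "X' n = {x\<in>X. f x >= 1/real (Suc n)}" for n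
  define D where "D n = {x\<in>X. 1/real (Suc (Suc n)) <= f x & f x < 1/real (Suc n)}" for n
  have lip: "f x <= f y + dist x y" for x y unfolding f_def by (rule infdist_triangle)
  have gap: "1 / real (Suc (Suc i)) - 1 / real (Suc j) > 0" if "i < j" "j ~= Suc i" for i j
  proof -
   have "real (Suc (Suc i)) < real (Suc j)" using that by simp
   then have "1 / real (Suc j) < 1 / real (Suc (Suc i))" by (intro divide_strict_left_mono) auto
   then show ?thesis by simp
  qed
  have sepD: "dist a b >= 1 / real (Suc (Suc i)) - 1 / real (Suc j)" if "a \<in> D i" "b \<in> D j" for a b i j
   using that lip[of a b] unfolding D_def by auto
  \<comment> \<open>Neighbouring shells may touch, but distinct shells with indices of equal parity
    are separated. Even and odd shells are therefore summed separately, each sum staying below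
    \<open>?H X\<close>.\<close>
  have half: "(\<Sum>i<n. ?H (D (2*i + p))) <= ?H X" for n p
  proof -
   have "(\<Sum>i<n. ?H (D (2*i + p))) <= ?H (\<Union>i<n. D (2*i + p))"
   proof (rule hausdorff_outer_sum_separated)
    fix i j a b assume "i < j" "a \<in> D (2*i + p)" "b \<in> D (2*j + p)"
    then show "1 / real (Suc (Suc (2*i+p))) - 1 / real (Suc (2*j+p)) <= dist a b" by (intro sepD)
   next
    fix i j :: nat assume "i < j"
    then show "0 < 1 / real (Suc (Suc (2*i+p))) - 1 / real (Suc (2*j+p))" by (intro gap) auto
   qed
   also have "... <= ?H X" by (rule hausdorff_outer_mono) (auto simp: D_def)
   finally show ?thesis .
  qed
  have sumD: "(\<Sum>i. ?H (D i)) < top"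
  proof -
   have "(\<Sum>i<n. ?H (D i)) <= ?H X + ?H X" for n
   proof -
    have "(\<Sum>i<n. ?H (D i)) <= (\<Sum>i<2*n. ?H (D i))" by (rule sum_mono2) auto
    also have "... = (\<Sum>i<n. ?H (D (2*i + 0))) + (\<Sum>i<n. ?H (D (2*i + 1)))"
     by (induction n) (auto simp: algebra_simps)
    also have "... <= ?H X + ?H X" by (intro add_mono half)
    finally show ?thesis .
   qed
   then have "(\<Sum>i. ?H (D i)) <= ?H X + ?H X" by (intro suminf_le_const) auto
   also have "... < top" using fin by (simp add: less_top)
   finally show ?thesis .
  qed
  have step: "?H (C \<inter> X) + ?H (X - C) <= ?H X + (\<Sum>i. ?H (D (i + n)))" for n
  proof -
   have "X - C \<subseteq> X' n \<union> (\<Union>i. D (i + n))"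
   proof
    fix x assume x: "x \<in> X - C"
    then have fx: "f x > 0"
     using C False infdist_pos_not_in_closed[of C x] by (auto simp: f_def)
    then obtain m where m: "1 / real (Suc m) < f x"
     using reals_Archimedean[OF fx] by (auto simp: inverse_eq_divide)
    show "x \<in> X' n \<union> (\<Union>i. D (i + n))"
    proof (cases "x \<in> X' n")
     case False
     define k where "k = (LEAST k. 1 / real (Suc k) <= f x)"
     have k: "1 / real (Suc k) <= f x" unfolding k_def by (rule LeastI[of _ m]) (use m in simp)
     have kn: "k > n"
     proof (rule ccontr)
      assume "\<not> k > n"
      then have "1 / real (Suc n) <= 1 / real (Suc k)" by (simp add: field_simps)
      then show False using False x k by (auto simp: X'_def)
     qed
     then obtain j where j: "k = Suc j" by (cases k) auto
     have "\<not> 1 / real (Suc j) <= f x" using not_less_Least[of j "%k. 1 / real (Suc k) <= f x"] j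
      unfolding k_def by simp
     then have "x \<in> D j" using x k j by (auto simp: D_def)
     moreover have "j = (j - n) + n" using kn j by simp
     ultimately show ?thesis by (metis UN_I UNIV_I UnI2)
    qed auto
   qed
   then have "?H (X - C) <= ?H (X' n) + ?H (\<Union>i. D (i + n))"
    by (intro order_trans[OF hausdorff_outer_mono hausdorff_outer_Un])
   also have "... <= ?H (X' n) + (\<Sum>i. ?H (D (i + n)))"
    by (intro add_left_mono hausdorff_outer_subadditive)
   finally have "?H (C \<inter> X) + ?H (X - C) <= ?H (C \<inter> X) + ?H (X' n) + (\<Sum>i. ?H (D (i + n)))"
    by (simp add: add_left_mono add.assoc)
   also have "?H (C \<inter> X) + ?H (X' n) <= ?H ((C \<inter> X) \<union> X' n)"
   proof (rule hausdorff_outer_separated)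
    fix a b assume "a \<in> C \<inter> X" "b \<in> X' n"
    then show "1 / real (Suc n) <= dist a b"
     using infdist_le[of a C b] by (auto simp: X'_def f_def dist_commute)
   qed simp
   also have "... <= ?H X" by (rule hausdorff_outer_mono) (auto simp: X'_def)
   finally show ?thesis by (simp add: add_right_mono)
  qed
  have "(%n. \<Sum>i. ?H (D (i + n))) ----> 0"
  proof -
   define s where "s i = enn2real (?H (D i))" for i
   have fi: "?H (D i) = ennreal (s i)" for i
    using sumD ennreal_suminf_lessD[of "%i. ?H (D i)" top i] by (simp add: s_def)
   have sm: "summable s"
    using sumD unfolding fi by (intro summable_suminf_not_top) (auto simp: s_def)
   have "(\<Sum>i. ?H (D (i + n))) = ennreal (\<Sum>i. s (i + n))" for n
    unfolding fi using summable_ignore_initial_segment[OF sm, of n]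
    by (intro suminf_ennreal_eq summable_sums) (auto simp: s_def)
   moreover have "(%n. \<Sum>i. s (i + n)) ----> 0" by (rule suminf_exist_split2[OF sm])
   ultimately show ?thesis by (auto intro: tendsto_ennrealI[where x = 0, simplified])
  qed
  then have "(%n. ?H X + (\<Sum>i. ?H (D (i + n)))) ----> ?H X + 0"
   by (intro tendsto_add) auto
  then have "?H (C \<inter> X) + ?H (X - C) <= ?H X + 0"
   by (rule LIMSEQ_le_const) (use step in auto)
  then show ?thesis by simp
 qed simp
 show ?thesis
  unfolding lambda_system_def
 proof (intro CollectI conjI ballI UNIV_I antisym)
  fix X :: "'a set"
  show "hausdorff_outer r (C \<inter> X) + hausdorff_outer r ((UNIV - C) \<inter> X) <= hausdorff_outer r X"
   using main[of X] by (simp add: Diff_eq Int_commute)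
  have "X = (C \<inter> X) \<union> ((UNIV - C) \<inter> X)" by auto
  then show "hausdorff_outer r X <= hausdorff_outer r (C \<inter> X) + hausdorff_outer r ((UNIV - C) \<inter> X)"
   using hausdorff_outer_Un[of r "C \<inter> X"] by metis
 qed
qed

lemma measure_space_hausdorff:
 "measure_space UNIV (lambda_system UNIV UNIV (hausdorff_outer r)) (hausdorff_outer r)"
proof -
 interpret sigma_algebra UNIV "UNIV :: 'a set set" by (metis Pow_UNIV sigma_algebra_Pow)
 show ?thesis by (rule caratheodory_lemma) (rule outer_measure_space_hausdorff)
qed

lemma sets_hausdorff_measure:
 "sets (hausdorff_measure r) = lambda_system UNIV UNIV (hausdorff_outer r)"
 unfolding hausdorff_measure_def
 using measure_space_hausdorff[of r] unfolding measure_space_def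
 using sigma_algebra.sets_measure_of_eq by blast

lemma space_hausdorff_measure [simp]: "space (hausdorff_measure r) = UNIV"
 by (simp add: hausdorff_measure_def)

lemma emeasure_hausdorff_measure:
 fixes A :: "'a::metric_space set"
 assumes "A \<in> sets (hausdorff_measure r)"
 shows "emeasure (hausdorff_measure r) A = hausdorff_outer r A"
proof (rule emeasure_measure_of[OF hausdorff_measure_def])
 have "measure_space UNIV (lambda_system UNIV UNIV (hausdorff_outer r)) (hausdorff_outer r :: 'a set => _)" for r
  by (rule measure_space_hausdorff)
 from this[of r] show "positive (sets (hausdorff_measure r)) (hausdorff_outer r :: 'a set => _)"
  "countably_additive (sets (hausdorff_measure r)) (hausdorff_outer r :: 'a set => _)"
  unfolding sets_hausdorff_measure unfolding measure_space_def by auto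
qed (use assms in auto)

lemma borel_subset_sets_hausdorff: "sets borel \<subseteq> sets (hausdorff_measure r :: 'a::metric_space measure)"
proof -
 have "sigma_sets UNIV (Collect closed) \<subseteq> sets (hausdorff_measure r :: 'a measure)"
  by (rule sets.sigma_sets_subset'[where a = "Collect closed", simplified])
    (auto simp: sets_hausdorff_measure closed_in_lambda_system_hausdorff)
 then show ?thesis by (simp add: borel_eq_closed)
qed

lemma hausdorff_null_measurable:
 assumes "hausdorff_outer r A = 0"
 shows "A \<in> null_sets (hausdorff_measure r)"
proof -
 have "A \<in> lambda_system UNIV UNIV (hausdorff_outer r)"
  unfolding lambda_system_def
 proof (intro CollectI conjI ballI UNIV_I antisym)
  fix X :: "'a set"
  have "hausdorff_outer r (A \<inter> X) <= 0" using assms hausdorff_outer_mono[of "A \<inter> X" A r] by simp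
  then show "hausdorff_outer r (A \<inter> X) + hausdorff_outer r ((UNIV - A) \<inter> X) <= hausdorff_outer r X"
   using hausdorff_outer_mono[of "(UNIV - A) \<inter> X" X r] by simp
  have "X = (A \<inter> X) \<union> ((UNIV - A) \<inter> X)" by auto
  then show "hausdorff_outer r X <= hausdorff_outer r (A \<inter> X) + hausdorff_outer r ((UNIV - A) \<inter> X)"
   using hausdorff_outer_Un[of r "A \<inter> X"] by metis
 qed
 then show ?thesis using assms
  by (auto simp: null_sets_def sets_hausdorff_measure emeasure_hausdorff_measure)
qed

section \<open>Lebesgue measure and linear maps\<close>

lemma nn_integral_lborel_translate:
 fixes f :: "'a::euclidean_space => ennreal"
 assumes [measurable]: "f \<in> borel_measurable borel"
 shows "(LB x. f (c + x)) = (LB x. f x)"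
proof -
 have "(LB x. f x) = (\<integral>\<^sup>+x. f x \<partial>distr lborel borel ((+) c))"
  by (simp add: lborel_distr_plus)
 also have "... = (LB x. f (c + x))" by (subst nn_integral_distr) auto
 finally show ?thesis ..
qed

lemma nn_integral_lborel_reflect:
 fixes f :: "'a::euclidean_space => ennreal"
 assumes [measurable]: "f \<in> borel_measurable borel"
 shows "(LB x. f (c - x)) = (LB x. f x)"
proof -
 have "(LB x. f x) = (\<integral>\<^sup>+x. f x \<partial>distr lborel borel (%x. c + (-1) *\<^sub>R x))"
  by (subst lborel_affine[of "-1" c]) (auto simp: density_1)
 also have "... = (LB x. f (c - x))" by (subst nn_integral_distr) auto
 finally show ?thesis ..
qed

text \<open>Uniqueness of Haar measure: evaluate the double integral of
 \<open>1\<^sub>A(x) 1\<^sub>B(x + y)\<close> in both orders.\<close>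

lemma translation_invariant_eq_lborel:
 fixes M :: "'a::euclidean_space measure"
 assumes sets: "sets M = sets borel" and sf: "sigma_finite_measure M"
  and inv: "\<And>c. distr M borel ((+) c) = M"
  and A: "A \<in> sets borel" and B: "B \<in> sets borel"
 shows "emeasure M A * emeasure lborel B = emeasure lborel A * emeasure M B"
proof -
 note [measurable] = A B and [measurable_cong] = sets
 interpret sigma_finite_measure M by fact
 interpret pair_sigma_finite M "lborel :: 'a measure" ..
 have trM: "(\<integral>\<^sup>+x. f (c + x) \<partial>M) = (\<integral>\<^sup>+x. f x \<partial>M)"
  if [measurable]: "f \<in> borel_measurable borel" for f c
 proof -
  have "(\<integral>\<^sup>+x. f x \<partial>M) = (\<integral>\<^sup>+x. f x \<partial>distr M borel ((+) c))" by (simp add: inv)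
  also have "... = (\<integral>\<^sup>+x. f (c + x) \<partial>M)" by (subst nn_integral_distr) auto
  finally show ?thesis ..
 qed
 have "emeasure M A * emeasure lborel B = (\<integral>\<^sup>+x. indicator A x * emeasure lborel B \<partial>M)"
  by (subst nn_integral_multc) (auto simp: sets)
 also have "... = (\<integral>\<^sup>+x. \<integral>\<^sup>+y. indicator A x * indicator B (x + y) \<partial>lborel \<partial>M)"
 proof (rule nn_integral_cong)
  fix x
  have "(LB y. indicator A x * indicator B (x + y)) =
    indicator A x * (LB y. indicator B (x + y))"
   by (rule nn_integral_cmult) measurable
  also have "(LB y. indicator B (x + y)) = emeasure lborel B"
   by (subst nn_integral_lborel_translate[of "indicator B"]) auto
  finally show "indicator A x * emeasure lborel B = (LB y. indicator A x * indicator B (x + y))" ..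
 qed
 also have "... = (LB y. \<integral>\<^sup>+x. indicator A x * indicator B (x + y) \<partial>M)"
  by (rule Fubini'[symmetric]) measurable
 also have "... = (LB y. \<integral>\<^sup>+x. indicator A (x - y) * indicator B x \<partial>M)"
 proof (rule nn_integral_cong)
  fix y
  show "(\<integral>\<^sup>+x. indicator A x * indicator B (x + y) \<partial>M) = (\<integral>\<^sup>+x. indicator A (x - y) * indicator B x \<partial>M)"
   by (subst trM[where c = "y", symmetric]) (auto simp: algebra_simps)
 qed
 also have "... = (\<integral>\<^sup>+x. \<integral>\<^sup>+y. indicator A (x - y) * indicator B x \<partial>lborel \<partial>M)"
  by (rule Fubini') measurable
 also have "... = (\<integral>\<^sup>+x. emeasure lborel A * indicator B x \<partial>M)"
 proof (rule nn_integral_cong)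
  fix x
  have "(LB y. indicator A (x - y) * indicator B x) =
    (LB y. indicator A (x - y)) * indicator B x"
   by (rule nn_integral_multc) measurable
  also have "(LB y. indicator A (x - y)) = emeasure lborel A"
   by (subst nn_integral_lborel_reflect[of "indicator A"]) auto
  finally show "(LB y. indicator A (x - y) * indicator B x) = emeasure lborel A * indicator B x" .
 qed
 also have "... = emeasure lborel A * emeasure M B"
  by (subst nn_integral_cmult) (auto simp: sets)
 finally show ?thesis .
qed

text \<open>For invertible \<open>F\<close> this is \<open>1 / |det F|\<close>. By uniqueness of
  Haar measure any set of positive finite measure could serve; the unit ball makes the value for
  isometries evident.\<close>

definition lscale :: "('a::euclidean_space => 'a) => ennreal" where
 "lscale F = emeasure lborel (F -` cball 0 1) / emeasure lborel (cball (0::'a) 1)"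

lemma borel_measurable_linear: "linear F ==> F \<in> borel_measurable borel"
 for F :: "'a::euclidean_space => 'b::euclidean_space"
 by (intro borel_measurable_continuous_onI linear_continuous_on linear_conv_bounded_linear[THEN iffD1])

lemma emeasure_lborel_unit_cball:
 "emeasure lborel (cball (0::'a::euclidean_space) 1) ~= 0"
 "emeasure lborel (cball (0::'a::euclidean_space) 1) ~= top"
 "emeasure lborel (cball (0::'a::euclidean_space) 1) / emeasure lborel (cball (0::'a) 1) = 1"
 by (simp_all add: emeasure_cball ennreal_eq_0_iff not_le ennreal_divide_self)

text \<open>The image of Lebesgue measure under \<open>F\<close> is again translation invariant,
  since a shift by \<open>c\<close> after \<open>F\<close> is a shift by \<open>G c\<close> before
  it. It is thus a multiple of Lebesgue measure, and the unit ball determines the factor.\<close>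

lemma emeasure_lborel_linear_vimage:
 fixes F :: "'a::euclidean_space => 'a"
 assumes F: "linear F" "inj F" and A: "A \<in> sets borel"
 shows "emeasure lborel (F -` A) = lscale F * emeasure lborel A"
proof -
 have [measurable]: "F \<in> borel_measurable borel" by (rule borel_measurable_linear[OF F(1)])
 obtain G where G: "linear G" "\<And>x. G (F x) = x" "\<And>x. F (G x) = x"
  using linear_injective_isomorphism[OF F] by blast
 define M where "M = distr lborel borel F"
 have em: "emeasure M A = emeasure lborel (F -` A)" if "A \<in> sets borel" for A
  unfolding M_def using that by (subst emeasure_distr) auto
 have sf: "sigma_finite_measure M"
 proof
  show "\<exists>A. countable A & A \<subseteq> sets M & \<Union> A = space M & (\<forall>a\<in>A. emeasure M a ~= \<infinity>)"
  proof (intro exI[of _ "range (%n::nat. cball 0 (real n))"] conjI ballI)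
   show "\<Union> (range (%n. cball 0 (real n))) = space M"
    by (auto simp: M_def intro: real_arch_simple)
   fix C assume "C \<in> range (%n. cball (0::'a) (real n))"
   then have C: "compact C" by auto
   have "F -` C = G ` C" by (auto simp: G) (metis G(2) imageI)
   then have "compact (F -` C)"
    using compact_continuous_image[OF linear_continuous_on C, of G] G(1) by (simp add: linear_conv_bounded_linear)
   then have "emeasure lborel (F -` C) < \<infinity>" by (rule emeasure_compact_finite)
   then show "emeasure M C ~= \<infinity>" using C em[of C] by (simp add: borel_compact)
  qed (auto simp: M_def)
 qed
 have inv: "distr M borel ((+) c) = M" for c
 proof -
  have "distr M borel ((+) c) = distr lborel borel (%x. F (G c + x))"
   unfolding M_def by (subst distr_distr) (auto simp: comp_def linear_add[OF F(1)] G)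
  also have "... = distr (distr lborel borel ((+) (G c))) borel F"
   by (subst distr_distr) (auto simp: comp_def)
  finally show ?thesis by (simp add: lborel_distr_plus M_def)
 qed
 have *: "emeasure M A * emeasure lborel (cball (0::'a) 1) = emeasure lborel A * emeasure M (cball 0 1)"
  by (rule translation_invariant_eq_lborel[OF _ sf inv A]) (auto simp: M_def)
 have "emeasure M A = emeasure M A * emeasure lborel (cball (0::'a) 1) / emeasure lborel (cball (0::'a) 1)"
  using emeasure_lborel_unit_cball[where 'a = 'a] by (simp add: ennreal_times_divide[symmetric])
 then show ?thesis
  unfolding * using A by (simp add: em lscale_def ennreal_times_divide mult.commute)
qed

section \<open>Scaling factors of isometries, shears and stretches\<close>

lemma lscale_orthogonal:
 assumes "orthogonal_transformation F"
 shows "lscale F = 1"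
proof -
 have "F -` cball 0 1 = cball 0 1"
  using assms by (auto simp: orthogonal_transformation)
 then show ?thesis
  using emeasure_lborel_unit_cball[where 'a = 'a] by (simp add: lscale_def)
qed

lemma lscale_comp:
 fixes F G :: "'a::euclidean_space => 'a"
 assumes F: "linear F" "inj F" and G: "linear G" "inj G"
 shows "lscale (F \<circ> G) = lscale F * lscale G"
proof -
 have "F -` cball 0 1 \<in> sets borel"
  using measurable_sets[OF borel_measurable_linear[OF F(1)], of "cball 0 1"] by simp
 from emeasure_lborel_linear_vimage[OF G this] show ?thesis
  by (simp add: lscale_def vimage_comp[symmetric] ennreal_times_divide mult.commute)
qed

text \<open>Householder reflection in the hyperplane orthogonal to \<open>w\<close>; for
  \<open>w = 0\<close> division by zero turns it into the identity.\<close>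

definition hyper_reflect :: "'a::euclidean_space => 'a => 'a" where
 "hyper_reflect w z = z - (2 * (z \<bullet> w) / (w \<bullet> w)) *\<^sub>R w"

lemma orthogonal_hyper_reflect: "orthogonal_transformation (hyper_reflect w)"
proof (cases "w = 0")
 case True
 then show ?thesis
  by (simp add: hyper_reflect_def[abs_def] orthogonal_transformation_def linear_id[unfolded id_def])
next
 case False
 have "linear (hyper_reflect w)"
  unfolding hyper_reflect_def[abs_def]
  by (rule linearI) (simp_all add: inner_add_left algebra_simps add_divide_distrib)
 moreover have "hyper_reflect w x \<bullet> hyper_reflect w y = x \<bullet> y" for x y
  using False by (simp add: hyper_reflect_def inner_diff_left inner_diff_right inner_commute field_simps)
 ultimately show ?thesis by (simp add: orthogonal_transformation_def)
qed

lemma hyper_reflect_swap: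
 assumes "norm e = 1" "norm \<nu> = 1"
 shows "hyper_reflect (e - \<nu>) e = \<nu>"
proof (cases "e = \<nu>")
 case False
 have n: "e \<bullet> e = 1" "\<nu> \<bullet> \<nu> = 1" using assms by (simp_all add: dot_square_norm)
 then have eq: "(e - \<nu>) \<bullet> (e - \<nu>) = 2 * (e \<bullet> (e - \<nu>))"
  by (simp add: inner_diff_left inner_diff_right inner_commute)
 have "2 * (e \<bullet> (e - \<nu>)) ~= 0" unfolding eq[symmetric] using False by simp
 then have "2 * (e \<bullet> (e - \<nu>)) / ((e - \<nu>) \<bullet> (e - \<nu>)) = 1" unfolding eq by (rule divide_self)
 then show ?thesis unfolding hyper_reflect_def by (simp only: scaleR_one) simp
qed (simp add: hyper_reflect_def)

lemma exists_orthogonal_basis_to: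
 fixes \<nu> :: "'a::euclidean_space"
 assumes "norm \<nu> = 1"
 obtains R :: "'a => 'a" and e where "orthogonal_transformation R" "e \<in> Basis" "R e = \<nu>"
proof -
 obtain e :: 'a where e: "e \<in> Basis" using nonempty_Basis by blast
 show ?thesis
  using that[of "hyper_reflect (e - \<nu>)" e] orthogonal_hyper_reflect
   hyper_reflect_swap[of e \<nu>] assms norm_Basis[OF e] e by blast
qed

text \<open>For a unit vector \<open>\<nu>\<close> this linear map fixes the hyperplane orthogonal
  to \<open>\<nu>\<close> and sends \<open>\<nu>\<close> to \<open>h\<close>, so its determinant is
  \<open>h \<bullet> \<nu>\<close>. It turns cylinders with axis \<open>\<nu>\<close> into cylinders
  with axis \<open>h\<close> over the same base.\<close>

definition hyper_map :: "'a::euclidean_space => 'a => 'a => 'a" where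
 "hyper_map \<nu> h z = z + (z \<bullet> \<nu>) *\<^sub>R (h - \<nu>)"

lemma linear_hyper_map: "linear (hyper_map \<nu> h)"
 unfolding hyper_map_def[abs_def] by (rule linearI) (simp_all add: inner_add_left algebra_simps)

lemma hyper_map_inner: "norm \<nu> = 1 ==> hyper_map \<nu> h z \<bullet> \<nu> = (z \<bullet> \<nu>) * (h \<bullet> \<nu>)"
 by (simp add: hyper_map_def inner_add_left inner_diff_left dot_square_norm algebra_simps)

lemma inj_hyper_map: "norm \<nu> = 1 ==> h \<bullet> \<nu> ~= 0 ==> inj (hyper_map \<nu> h)"
proof (rule injI)
 fix x y assume a: "norm \<nu> = 1" "h \<bullet> \<nu> ~= 0" "hyper_map \<nu> h x = hyper_map \<nu> h y"
 have "(x \<bullet> \<nu>) * (h \<bullet> \<nu>) = (y \<bullet> \<nu>) * (h \<bullet> \<nu>)"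
  using arg_cong[OF a(3), of "%v. v \<bullet> \<nu>"] by (simp add: hyper_map_inner[OF a(1)])
 then have "x \<bullet> \<nu> = y \<bullet> \<nu>" using a(2) by simp
 then show "x = y" using a(3) by (simp add: hyper_map_def)
qed

text \<open>A shear and its inverse are conjugate under a reflection, hence scale by the same factor.\<close>

lemma lscale_shear:
 fixes \<nu> :: "'a::euclidean_space"
 assumes \<nu>: "norm \<nu> = 1" and a: "a \<bullet> \<nu> = 0"
 shows "lscale (hyper_map \<nu> (\<nu> + a)) = 1"
proof -
 have ne: "(\<nu> + b) \<bullet> \<nu> ~= 0" if "b \<bullet> \<nu> = 0" for b
  using \<nu> that by (simp add: inner_add_left dot_square_norm)
 have na: "(- a) \<bullet> \<nu> = 0" using a by simp
 let ?S = "hyper_map \<nu> (\<nu> + a)" and ?S' = "hyper_map \<nu> (\<nu> + - a)" and ?R = "hyper_reflect \<nu>"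
 have R: "linear ?R" "inj ?R"
  using orthogonal_hyper_reflect[of \<nu>]
  by (auto simp: orthogonal_transformation_def intro: orthogonal_transformation_inj orthogonal_hyper_reflect)
 have S: "linear ?S" "inj ?S" and S': "linear ?S'" "inj ?S'"
  using linear_hyper_map inj_hyper_map[OF \<nu>] ne[OF a] ne[OF na] by blast+
 have \<nu>\<nu>: "\<nu> \<bullet> \<nu> = 1" using \<nu> by (simp add: dot_square_norm)
 have "?R \<circ> ?S \<circ> ?R = ?S'"
  by (rule ext) (simp add: hyper_map_def hyper_reflect_def \<nu>\<nu> a inner_add_left inner_diff_left algebra_simps)
 moreover have "lscale (?R \<circ> ?S \<circ> ?R) = lscale ?R * lscale ?S * lscale ?R"
  using R S by (subst lscale_comp) (auto simp: lscale_comp linear_compose inj_compose)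
 ultimately have "lscale ?S' = lscale ?S"
  by (simp add: lscale_orthogonal[OF orthogonal_hyper_reflect])
 moreover have "?S \<circ> ?S' = (%x. x)"
  by (rule ext) (simp add: hyper_map_def a inner_diff_left inner_add_left)
 then have "lscale ?S * lscale ?S' = 1"
  using lscale_comp[OF S S'] lscale_orthogonal[OF orthogonal_transformation_id] by metis
 ultimately have "lscale ?S * lscale ?S = 1" by simp
 then show ?thesis
 proof (cases "lscale ?S")
  case (real r)
  then have "r * r = 1"
   using \<open>lscale ?S * lscale ?S = 1\<close> by (simp flip: ennreal_mult add: ennreal_eq_1)
  then have "r = 1" using real(1) by (simp add: square_eq_1_iff)
  then show ?thesis using real by simp
 qed (use \<open>lscale ?S * lscale ?S = 1\<close> in \<open>simp add: ennreal_mult_top\<close>)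
qed

lemma lscale_stretch_Basis:
 fixes e :: "'a::euclidean_space"
 assumes e: "e \<in> Basis" and a: "a ~= 0"
 shows "lscale (hyper_map e (a *\<^sub>R e)) = ennreal (1 / \<bar>a\<bar>)"
proof -
 let ?F = "hyper_map e (a *\<^sub>R e)"
 have F: "?F x = 0 + (\<Sum>j\<in>Basis. ((if j = e then a else 1) * (x \<bullet> j)) *\<^sub>R j)" for x
 proof -
  have "(\<Sum>j\<in>Basis. ((if j = e then a else 1) * (x \<bullet> j)) *\<^sub>R j) =
    (\<Sum>j\<in>Basis. (x \<bullet> j) *\<^sub>R j + (if j = e then ((a - 1) * (x \<bullet> j)) *\<^sub>R j else 0))"
   by (rule sum.cong) (auto simp: algebra_simps)
  also have "... = x + ((a - 1) * (x \<bullet> e)) *\<^sub>R e"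
   using e by (simp add: sum.distrib euclidean_representation)
  finally show ?thesis by (simp add: hyper_map_def algebra_simps)
 qed
 have lb: "(lborel::'a measure) = density (distr lborel borel ?F) (%_. ennreal \<bar>a\<bar>)"
  using lborel_affine_euclidean[of "%j. if j = e then a else 1" "0::'a"] a e
  unfolding F[symmetric] by (simp add: prod.delta if_distrib[of abs] cong: if_cong)
 have [measurable]: "?F \<in> borel_measurable borel" by (rule borel_measurable_linear[OF linear_hyper_map])
 have "emeasure lborel (cball (0::'a) 1) = ennreal \<bar>a\<bar> * emeasure lborel (?F -` cball 0 1)"
  by (subst (1) lb, subst emeasure_density_const) (auto simp: emeasure_distr)
 then have "ennreal (1/\<bar>a\<bar>) * emeasure lborel (cball (0::'a) 1) = emeasure lborel (?F -` cball 0 1)"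
  using a by (simp add: mult.assoc[symmetric] ennreal_mult[symmetric])
 then show ?thesis
  using emeasure_lborel_unit_cball[where 'a = 'a]
  by (simp add: lscale_def ennreal_times_divide[symmetric] flip: \<open>_ = emeasure lborel (?F -` cball 0 1)\<close>)
qed

text \<open>With \<open>a = h \<bullet> \<nu>\<close> and \<open>h = a (\<nu> + w)\<close>, where
  \<open>w\<close> is orthogonal to \<open>\<nu>\<close>, the map is a stretch by \<open>a\<close>
  along \<open>\<nu>\<close> followed by a shear. The shear preserves volume, and an isometry
  carries the stretch to one along a coordinate axis.\<close>

lemma lscale_hyper_map:
 fixes \<nu> :: "'a::euclidean_space"
 assumes \<nu>: "norm \<nu> = 1" and h: "h \<bullet> \<nu> ~= 0"
 shows "lscale (hyper_map \<nu> h) = ennreal (1 / \<bar>h \<bullet> \<nu>\<bar>)"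
proof -
 let ?a = "h \<bullet> \<nu>"
 have \<nu>\<nu>: "\<nu> \<bullet> \<nu> = 1" using \<nu> by (simp add: dot_square_norm)
 obtain R :: "'a => 'a" and e where R: "orthogonal_transformation R" and e: "e \<in> Basis" and Re: "R e = \<nu>"
  by (rule exists_orthogonal_basis_to[OF \<nu>])
 have lR: "linear R" "inj R"
  using R by (auto simp: orthogonal_transformation_def intro: orthogonal_transformation_inj)
 have Rin: "R x \<bullet> \<nu> = x \<bullet> e" for x
  using R Re by (metis orthogonal_transformation_def)
 let ?D = "hyper_map \<nu> (?a *\<^sub>R \<nu>)" and ?De = "hyper_map e (?a *\<^sub>R e)"
 have De: "linear ?De" "inj ?De" and D: "linear ?D" "inj ?D"
  using h \<nu>\<nu> e \<nu> by (auto intro!: linear_hyper_map inj_hyper_map)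
 have "R \<circ> ?De = ?D \<circ> R"
  by (rule ext) (simp add: hyper_map_def Rin linear_add[OF lR(1)] linear_cmul[OF lR(1)] linear_diff[OF lR(1)] Re)
 then have "lscale R * lscale ?De = lscale ?D * lscale R"
  using lscale_comp[OF lR De] lscale_comp[OF D lR] by simp
 then have lD: "lscale ?D = ennreal (1 / \<bar>?a\<bar>)"
  using lscale_orthogonal[OF R] lscale_stretch_Basis[OF e h] by simp
 define w where "w = (1/?a) *\<^sub>R h - \<nu>"
 have w: "w \<bullet> \<nu> = 0" using h \<nu>\<nu> by (simp add: w_def inner_diff_left)
 let ?S = "hyper_map \<nu> (\<nu> + w)"
 have S: "linear ?S" "inj ?S"
  using w \<nu>\<nu> \<nu> by (auto intro!: linear_hyper_map inj_hyper_map simp: inner_add_left)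
 have "?S (?D z) = hyper_map \<nu> h z" for z
 proof -
  have "?S (?D z) = ?D z + ((z \<bullet> \<nu>) * ?a) *\<^sub>R w"
   using hyper_map_inner[OF \<nu>, of "?a *\<^sub>R \<nu>" z] \<nu>\<nu> by (simp add: hyper_map_def[of _ "\<nu> + w"])
  also have "... = hyper_map \<nu> h z"
   using h by (simp add: hyper_map_def w_def algebra_simps)
  finally show ?thesis .
 qed
 then have "hyper_map \<nu> h = ?S \<circ> ?D" by (auto simp: fun_eq_iff)
 then show ?thesis
  using lscale_comp[OF S D] lscale_shear[OF \<nu> w] lD by simp
qed

section \<open>The isodiametric inequality\<close>

definition sq_dist_on :: "'i set => ('i => real) => ('i => real) => real" where
 "sq_dist_on I x y = (\<Sum>i\<in>I. (x i - y i)^2)"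

text \<open>Steiner symmetrization in the coordinate \<open>i\<close>: every section in this
  direction is replaced by the open centred interval of the same length.\<close>

definition steiner :: "'i set => 'i => ('i => real) set => ('i => real) set" where
 "steiner I i A = {x \<in> space (Pi\<^sub>M I (%_. lborel)).
   ennreal (2 * \<bar>x i\<bar>) < emeasure lborel {s. x(i := s) \<in> A}}"

lemma emeasure_centered_interval: "emeasure lborel {y::real. ennreal (2 * \<bar>y\<bar>) < m} = m"
proof (cases m)
 case (real r)
 then have "{y::real. ennreal (2 * \<bar>y\<bar>) < m} = {-r/2<..<r/2}"
  by (auto simp: ennreal_less_iff abs_if split: if_splits)
 then show ?thesis using real by simp
next
 case top
 then show ?thesis by simp
qed

lemma measurable_PiM_fun_upd [measurable]:
 assumes "i \<in> I"
 shows "(%(x, s). x(i := s)) \<in> measurable (Pi\<^sub>M I (%_. lborel) \<Otimes>\<^sub>M lborel) (Pi\<^sub>M I (%_. lborel :: real measure))"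
proof (rule measurable_PiM_single')
 fix j assume j: "j \<in> I"
 show "(%p. (case p of (x, s) => x(i := s)) j) \<in> Pi\<^sub>M I (%_. lborel) \<Otimes>\<^sub>M lborel \<rightarrow>\<^sub>M (lborel :: real measure)"
  using j by (cases "j = i") (auto simp: case_prod_beta)
qed (use assms in \<open>auto simp: space_pair_measure space_PiM PiE_iff extensional_def\<close>)

lemma sets_PiM_section:
 assumes A: "A \<in> sets (Pi\<^sub>M I (%_. lborel))" and i: "i \<in> I" and x: "x \<in> space (Pi\<^sub>M I (%_. lborel))"
 shows "{s. x(i := s) \<in> A} \<in> sets (borel :: real measure)"
proof -
 have "(%s. (x, s)) \<in> measurable lborel (Pi\<^sub>M I (%_. lborel) \<Otimes>\<^sub>M (lborel :: real measure))"
  by (rule measurable_Pair1'[OF x])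
 from measurable_sets[OF measurable_compose[OF this measurable_PiM_fun_upd[OF i]] A]
 show ?thesis by (simp add: vimage_def)
qed

lemma sets_steiner [measurable]:
 assumes [measurable]: "A \<in> sets (Pi\<^sub>M I (%_. lborel))" and i: "i \<in> I"
 shows "steiner I i A \<in> sets (Pi\<^sub>M I (%_. lborel))"
proof -
 let ?P = "Pi\<^sub>M I (%_. lborel :: real measure)"
 have [measurable]: "(%(x, s). x(i := s)) \<in> measurable (?P \<Otimes>\<^sub>M lborel) ?P"
  by (rule measurable_PiM_fun_upd[OF i])
 have [measurable]: "(%x. x i) \<in> borel_measurable ?P"
  using measurable_component_singleton[OF i, of "%_. lborel"] by simp
 have "(%x. \<integral>\<^sup>+s. indicator A ((%(x, s). x(i := s)) (x, s)) \<partial>lborel) \<in> borel_measurable ?P"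
  by measurable
 moreover have "(LB s. indicator A ((%(x, s). x(i := s)) (x, s))) = emeasure lborel {s. x(i := s) \<in> A}"
  if "x \<in> space ?P" for x
 proof -
  have "(LB s. indicator A ((%(x, s). x(i := s)) (x, s))) =
    (LB s. indicator {s. x(i := s) \<in> A} s)"
   by (simp add: indicator_def)
  then show ?thesis using sets_PiM_section[OF assms(1) i that] by simp
 qed
 ultimately have [measurable]: "(%x. emeasure lborel {s. x(i := s) \<in> A}) \<in> borel_measurable ?P"
  by (subst measurable_cong) auto
 show ?thesis unfolding steiner_def by measurable
qed

lemma emeasure_PiM_by_sections:
 assumes fin: "finite I" and i: "i \<in> I" and A: "A \<in> sets (Pi\<^sub>M I (%_. lborel))"
 shows "emeasure (Pi\<^sub>M I (%_. lborel)) A =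
  (\<integral>\<^sup>+x. emeasure lborel {s. x(i := s) \<in> A} \<partial>Pi\<^sub>M (I - {i}) (%_. lborel :: real measure))"
proof -
 interpret product_sigma_finite "%_. lborel :: real measure" ..
 define J where "J = I - {i}"
 have I: "I = insert i J" and J: "finite J" "i \<notin> J" using fin i by (auto simp: J_def)
 have "emeasure (Pi\<^sub>M I (%_. lborel)) A = (\<integral>\<^sup>+x. indicator A x \<partial>Pi\<^sub>M I (%_. lborel))"
  using A by simp
 also have "... = (\<integral>\<^sup>+x. \<integral>\<^sup>+y. indicator A (x(i := y)) \<partial>lborel \<partial>Pi\<^sub>M J (%_. lborel))"
  using A unfolding I by (intro product_nn_integral_insert J) auto
 also have "... = (\<integral>\<^sup>+x. emeasure lborel {s. x(i := s) \<in> A} \<partial>Pi\<^sub>M J (%_. lborel))"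
 proof (rule nn_integral_cong)
  fix x assume x: "x \<in> space (Pi\<^sub>M J (%_. lborel :: real measure))"
  then have "x(i := 0) \<in> space (Pi\<^sub>M I (%_. lborel :: real measure))"
   unfolding I by (auto simp: space_PiM PiE_iff extensional_def)
  from sets_PiM_section[OF A i this] have "{s. x(i := s) \<in> A} \<in> sets borel" by simp
  moreover have "(LB y. indicator A (x(i := y))) =
    (LB y. indicator {s. x(i := s) \<in> A} y)"
   by (simp add: indicator_def)
  ultimately show "(LB y. indicator A (x(i := y))) = emeasure lborel {s. x(i := s) \<in> A}"
   by simp
 qed
 finally show ?thesis by (simp add: J_def)
qed

lemma emeasure_steiner:
 assumes fin: "finite I" and i: "i \<in> I" and A: "A \<in> sets (Pi\<^sub>M I (%_. lborel))"
 shows "emeasure (Pi\<^sub>M I (%_. lborel)) (steiner I i A) = emeasure (Pi\<^sub>M I (%_. lborel)) A"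
 unfolding emeasure_PiM_by_sections[OF fin i A] emeasure_PiM_by_sections[OF fin i sets_steiner[OF A i]]
proof (rule nn_integral_cong)
 fix x assume x: "x \<in> space (Pi\<^sub>M (I - {i}) (%_. lborel :: real measure))"
 have "x(i := s) \<in> space (Pi\<^sub>M I (%_. lborel :: real measure))" for s
  using x i by (auto simp: space_PiM PiE_iff extensional_def)
 then have "{s. x(i := s) \<in> steiner I i A} =
   {s. ennreal (2 * \<bar>s\<bar>) < emeasure lborel {s. x(i := s) \<in> A}}"
  by (simp add: steiner_def)
 then show "emeasure lborel {s. x(i := s) \<in> steiner I i A} = emeasure lborel {s. x(i := s) \<in> A}"
  by (simp add: emeasure_centered_interval)
qed

lemma emeasure_le_Sup_minus_Inf:
 fixes S :: "real set"
 assumes "bounded S"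
 shows "emeasure lborel S <= ennreal (Sup S - Inf S)"
proof (cases "S = {}")
 case False
 have "S \<subseteq> {Inf S..Sup S}"
  using bounded_imp_bdd_above[OF assms] bounded_imp_bdd_below[OF assms] by (auto intro: cInf_lower cSup_upper)
 then have "emeasure lborel S <= emeasure lborel {Inf S..Sup S}" by (rule emeasure_mono) simp
 also have "... = ennreal (Sup S - Inf S)"
  using False bounded_imp_bdd_above[OF assms] bounded_imp_bdd_below[OF assms]
  by (subst emeasure_lborel_Icc) (auto intro: cInf_le_cSup)
 finally show ?thesis .
qed simp

text \<open>If all distances were below \<open>a + b\<close>, then \<open>Sup S - Inf R\<close> and
  \<open>Sup R - Inf S\<close> would be at most \<open>a + b\<close>. Their sum is also the sum of
  the two extents \<open>Sup - Inf\<close>, which exceed \<open>2 * a\<close> and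
  \<open>2 * b\<close>.\<close>

lemma sections_far_points:
 fixes S R :: "real set"
 assumes S: "ennreal (2 * a) < emeasure lborel S" and R: "ennreal (2 * b) < emeasure lborel R"
  and ab: "a >= 0" "b >= 0"
 shows "\<exists>s\<in>S. \<exists>r\<in>R. \<bar>s - r\<bar> >= a + b"
proof (rule ccontr)
 assume "\<not> ?thesis"
 then have near: "\<bar>s - r\<bar> < a + b" if "s \<in> S" "r \<in> R" for s r using that by force
 have ne: "S ~= {}" "R ~= {}" using S R by auto
 obtain s0 r0 where s0: "s0 \<in> S" and r0: "r0 \<in> R" using ne by auto
 have bS: "bounded S"
  by (rule boundedI[of _ "\<bar>r0\<bar> + (a + b)"]) (use near[OF _ r0] in \<open>fastforce simp: abs_if split: if_splits\<close>)
 have bR: "bounded R"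
  by (rule boundedI[of _ "\<bar>s0\<bar> + (a + b)"]) (use near[OF s0] in \<open>fastforce simp: abs_if split: if_splits\<close>)
 have 1: "Sup S - Inf S > 2 * a"
  using order_less_le_trans[OF S emeasure_le_Sup_minus_Inf[OF bS]] ab by (simp add: ennreal_less_iff)
 have 2: "Sup R - Inf R > 2 * b"
  using order_less_le_trans[OF R emeasure_le_Sup_minus_Inf[OF bR]] ab by (simp add: ennreal_less_iff)
 have d: "s - (a + b) <= r & r - (a + b) <= s" if "s \<in> S" "r \<in> R" for s r
  using near[OF that] by (simp add: abs_if split: if_splits)
 have "Sup S <= Inf R + (a + b)"
 proof (rule cSup_least[OF ne(1)])
  fix s assume "s \<in> S"
  then have "s - (a + b) <= Inf R" using d by (intro cInf_greatest[OF ne(2)]) auto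
  then show "s <= Inf R + (a + b)" by simp
 qed
 moreover have "Sup R <= Inf S + (a + b)"
 proof (rule cSup_least[OF ne(2)])
  fix s assume "s \<in> R"
  then have "s - (a + b) <= Inf S" using d by (intro cInf_greatest[OF ne(1)]) auto
  then show "s <= Inf S + (a + b)" by simp
 qed
 ultimately show False using 1 2 by linarith
qed

text \<open>The sections of \<open>A\<close> over the two points are longer than
  \<open>2 * |x i|\<close> and \<open>2 * |y i|\<close>, so they contain points at distance at least
  \<open>|x i| + |y i|\<close>, which dominates \<open>|x i - y i|\<close>. The other coordinates
  stay as they are, so symmetrization does not increase the diameter.\<close>

lemma sq_dist_steiner:
 assumes fin: "finite I" and i: "i \<in> I"
  and diam: "\<And>x y. x \<in> A ==> y \<in> A ==> sq_dist_on I x y <= D"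
  and x: "x \<in> steiner I i A" and y: "y \<in> steiner I i A"
 shows "sq_dist_on I x y <= D"
proof -
 obtain s r where s: "x(i := s) \<in> A" and r: "y(i := r) \<in> A" and sr: "\<bar>s - r\<bar> >= \<bar>x i\<bar> + \<bar>y i\<bar>"
  using sections_far_points[of "\<bar>x i\<bar>" "{s. x(i := s) \<in> A}" "\<bar>y i\<bar>" "{s. y(i := s) \<in> A}"] x y
  by (auto simp: steiner_def)
 have eq: "sq_dist_on I u v = (u i - v i)^2 + (\<Sum>j\<in>I-{i}. (u j - v j)^2)" for u v
  unfolding sq_dist_on_def using fin i by (simp add: sum.remove)
 have "\<bar>x i - y i\<bar> <= \<bar>s - r\<bar>" using sr by linarith
 then have "(x i - y i)^2 <= (s - r)^2" by (simp add: abs_le_square_iff)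
 then have "sq_dist_on I x y <= sq_dist_on I (x(i := s)) (y(i := r))" unfolding eq by simp
 also have "... <= D" by (rule diam[OF s r])
 finally show ?thesis .
qed

text \<open>The second part keeps earlier symmetries alive: a reflection in another coordinate maps
  sections in direction \<open>i\<close> onto sections of the same length.\<close>

lemma steiner_symmetric:
 assumes i: "i \<in> I" and x: "x \<in> steiner I i A"
 shows "x(i := - x i) \<in> steiner I i A"
  and "j \<in> I ==> (\<And>x. x \<in> A ==> x(j := - x j) \<in> A) ==> x(j := - x j) \<in> steiner I i A"
proof -
 have sp: "x \<in> space (Pi\<^sub>M I (%_. lborel :: real measure))" using x by (simp add: steiner_def)
 have sp': "x(j := t) \<in> space (Pi\<^sub>M I (%_. lborel :: real measure))" if "j \<in> I" for j t
  using sp that by (auto simp: space_PiM PiE_iff extensional_def)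
 show *: "x(i := - x i) \<in> steiner I i A" using x sp'[OF i] by (simp add: steiner_def)
 show "x(j := - x j) \<in> steiner I i A" if j: "j \<in> I" and sym: "\<And>x. x \<in> A ==> x(j := - x j) \<in> A"
 proof (cases "j = i")
  case False
  have "{s. (x(j := - x j))(i := s) \<in> A} = {s. x(i := s) \<in> A}"
  proof safe
   fix s assume "(x(j := - x j))(i := s) \<in> A"
   from sym[OF this] have "((x(j := - x j))(i := s))(j := x j) \<in> A" using False by simp
   also have "((x(j := - x j))(i := s))(j := x j) = x(i := s)" using False by auto
   finally show "x(i := s) \<in> A" .
  next
   fix s assume "x(i := s) \<in> A"
   from sym[OF this] have "(x(i := s))(j := - x j) \<in> A" using False by simp
   also have "(x(i := s))(j := - x j) = (x(j := - x j))(i := s)" using False by auto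
   finally show "(x(j := - x j))(i := s) \<in> A" .
  qed
  then show ?thesis using x sp'[OF j] False by (simp add: steiner_def)
 qed (use * in simp)
qed

lemma symmetrize:
 assumes fin: "finite I" and A: "A \<in> sets (Pi\<^sub>M I (%_. lborel))"
  and diam: "\<And>x y. x \<in> A ==> y \<in> A ==> sq_dist_on I x y <= D"
  and J: "finite J" "J \<subseteq> I"
 shows "\<exists>B\<in>sets (Pi\<^sub>M I (%_. lborel)).
  emeasure (Pi\<^sub>M I (%_. lborel)) B = emeasure (Pi\<^sub>M I (%_. lborel)) A \<and>
  (\<forall>x\<in>B. \<forall>y\<in>B. sq_dist_on I x y <= D) & (\<forall>j\<in>J. \<forall>x\<in>B. x(j := - x j) \<in> B)"
 using J
proof (induction J)
 case empty
 then show ?case using A diam by (intro bexI[of _ A]) auto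
next
 case (insert i J)
 then obtain B where B: "B \<in> sets (Pi\<^sub>M I (%_. lborel))"
  "emeasure (Pi\<^sub>M I (%_. lborel)) B = emeasure (Pi\<^sub>M I (%_. lborel)) A"
  "\<And>x y. x \<in> B ==> y \<in> B ==> sq_dist_on I x y <= D" "\<And>j x. j \<in> J ==> x \<in> B ==> x(j := - x j) \<in> B"
  using insert.prems by blast
 have i: "i \<in> I" using insert by auto
 show ?case
 proof (intro bexI[of _ "steiner I i B"] conjI ballI sets_steiner[OF B(1) i])
  show "emeasure (Pi\<^sub>M I (%_. lborel)) (steiner I i B) = emeasure (Pi\<^sub>M I (%_. lborel)) A"
   using emeasure_steiner[OF fin i B(1)] B(2) by simp
  show "sq_dist_on I x y <= D" if "x \<in> steiner I i B" "y \<in> steiner I i B" for x y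
   by (rule sq_dist_steiner[OF fin i B(3) that])
  show "x(j := - x j) \<in> steiner I i B" if j: "j \<in> insert i J" and x: "x \<in> steiner I i B" for j x
   using steiner_symmetric(1)[OF i x] steiner_symmetric(2)[OF i x _ B(4)] j insert.prems by blast
 qed
qed

text \<open>After symmetrization in all coordinates the set contains \<open>-x\<close> together with
  \<open>x\<close>, so \<open>2 |x|\<close> is at most the diameter and the set lies in the ball of
  radius \<open>\<Delta> / 2\<close> about the origin, while its volume is unchanged.\<close>

theorem isodiametric_PiM:
 assumes fin: "finite I" and A: "A \<in> sets (Pi\<^sub>M I (%_. lborel))" and \<Delta>: "\<Delta> >= 0"
  and diam: "\<And>x y. x \<in> A ==> y \<in> A ==> sq_dist_on I x y <= \<Delta>\<^sup>2"
 shows "emeasure (Pi\<^sub>M I (%_. lborel)) A <= ennreal (unit_ball_vol (real (card I)) * (\<Delta> / 2) ^ card I)"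
proof -
 let ?P = "Pi\<^sub>M I (%_. lborel :: real measure)"
 obtain B where B: "B \<in> sets ?P" "emeasure ?P B = emeasure ?P A"
  "\<And>x y. x \<in> B ==> y \<in> B ==> sq_dist_on I x y <= \<Delta>\<^sup>2" "\<And>j x. j \<in> I ==> x \<in> B ==> x(j := - x j) \<in> B"
  using symmetrize[OF fin A diam fin order_refl] by blast
 have flip: "(%j. if j \<in> K then - x j else x j) \<in> B" if "finite K" "K \<subseteq> I" "x \<in> B" for K x
  using that
 proof (induction K)
  case (insert k K)
  from B(4)[OF _ insert.IH, of k] insert.prems insert.hyps
  have "(%j. if j \<in> K then - x j else x j)(k := - x k) \<in> B" by auto
  also have "(%j. if j \<in> K then - x j else x j)(k := - x k) = (%j. if j \<in> insert k K then - x j else x j)"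
   by auto
  finally show ?case .
 qed simp
 have small: "sqrt (\<Sum>i\<in>I. (x i)^2) <= \<Delta> / 2" if x: "x \<in> B" for x
 proof -
  have "sq_dist_on I x (%j. if j \<in> I then - x j else x j) <= \<Delta>\<^sup>2"
   by (rule B(3)[OF x flip[OF fin order_refl x]])
  also have "sq_dist_on I x (%j. if j \<in> I then - x j else x j) = 4 * (\<Sum>i\<in>I. (x i)^2)"
   unfolding sq_dist_on_def sum_distrib_left by (rule sum.cong) (auto simp: power2_eq_square)
  finally have "(\<Sum>i\<in>I. (x i)^2) <= (\<Delta> / 2)^2" by (simp add: power_divide)
  then show ?thesis using \<Delta> by (intro real_le_lsqrt) (auto simp: sum_nonneg)
 qed
 \<comment> \<open>The volume formula for balls is applied with a positive radius;
   \<open>\<Delta> = 0\<close> is reached by letting the radius decrease to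
   \<open>\<Delta> / 2\<close>.\<close>
 have bound: "emeasure ?P A <= ennreal (unit_ball_vol (real (card I)) * r ^ card I)" if r: "r > 0" "r >= \<Delta> / 2" for r
 proof -
  have "emeasure ?P A = emeasure ?P B" using B(2) by simp
  also have "... <= emeasure ?P ({f. sqrt (\<Sum>i\<in>I. (f i)^2) <= r} \<inter> space ?P)"
  proof (rule emeasure_mono)
   show "B \<subseteq> {f. sqrt (\<Sum>i\<in>I. (f i)^2) <= r} \<inter> space ?P"
    using small r(2) sets.sets_into_space[OF B(1)] by force
   have "(%f. sqrt (\<Sum>i\<in>I. (f i)^2)) \<in> borel_measurable ?P" by measurable
   then have "{f \<in> space ?P. sqrt (\<Sum>i\<in>I. (f i)^2) <= r} \<in> sets ?P" by measurable
   also have "{f \<in> space ?P. sqrt (\<Sum>i\<in>I. (f i)^2) <= r} = {f. sqrt (\<Sum>i\<in>I. (f i)^2) <= r} \<inter> space ?P" by auto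
   finally show "{f. sqrt (\<Sum>i\<in>I. (f i)^2) <= r} \<inter> space ?P \<in> sets ?P" .
  qed
  also have "... = ennreal (unit_ball_vol (real (card I)) * r ^ card I)"
   by (rule emeasure_cball_aux[OF fin r(1)])
  finally show ?thesis .
 qed
 have "(%n. ennreal (unit_ball_vol (real (card I)) * (\<Delta> / 2 + inverse (real (Suc n))) ^ card I))
   ----> ennreal (unit_ball_vol (real (card I)) * (\<Delta> / 2 + 0) ^ card I)"
  by (intro tendsto_intros tendsto_ennrealI LIMSEQ_inverse_real_of_nat)
 moreover have "emeasure ?P A <= ennreal (unit_ball_vol (real (card I)) * (\<Delta> / 2 + inverse (real (Suc n))) ^ card I)" for n
  using \<Delta> by (intro bound) (auto intro: add_nonneg_pos)
 ultimately show ?thesis by (intro LIMSEQ_le_const) auto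
qed

section \<open>Hausdorff measure on hyperplanes\<close>

text \<open>\<open>cyl \<nu> b h U\<close> is the cylinder over the part of \<open>U\<close> in the hyperplane \<open>x \<bullet> \<nu> = b\<close> whose axis
 is the segment from \<open>-h\<close> to \<open>0\<close>; its volume is \<open>\<bar>h \<bullet> \<nu>\<bar>\<close> times the area of that part.\<close>

definition hit_time :: "'a::euclidean_space => real => 'a => 'a => real" where
 "hit_time \<nu> b h x = (b - x \<bullet> \<nu>) / (h \<bullet> \<nu>)"

definition hit_point :: "'a::euclidean_space => real => 'a => 'a => 'a" where
 "hit_point \<nu> b h x = x + hit_time \<nu> b h x *\<^sub>R h"

definition cyl :: "'a::euclidean_space => real => 'a => 'a set => 'a set" where
 "cyl \<nu> b h U = {x. 0 < hit_time \<nu> b h x & hit_time \<nu> b h x < 1 & hit_point \<nu> b h x \<in> U}"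

lemma borel_hit [measurable]:
 "hit_time \<nu> b h \<in> borel_measurable borel" "hit_point \<nu> b h \<in> borel_measurable borel"
 unfolding hit_point_def[abs_def] hit_time_def[abs_def] by measurable

lemma sets_cyl [measurable]:
 assumes [measurable]: "U \<in> sets borel"
 shows "cyl \<nu> b h U \<in> sets borel"
 unfolding cyl_def by measurable

lemma cyl_mono: "U \<subseteq> V ==> cyl \<nu> b h U \<subseteq> cyl \<nu> b h V"
 by (auto simp: cyl_def)

lemma cyl_UN: "cyl \<nu> b h (\<Union>i\<in>I. U i) = (\<Union>i\<in>I. cyl \<nu> b h (U i))"
 by (auto simp: cyl_def)

lemma emeasure_lborel_translate_vimage:
 fixes A :: "'a::euclidean_space set"
 assumes [measurable]: "A \<in> sets borel"
 shows "emeasure lborel {y. c + y \<in> A} = emeasure lborel A"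
proof -
 have "emeasure lborel A = emeasure (distr lborel borel ((+) c)) A" by (simp add: lborel_distr_plus)
 also have "... = emeasure lborel {y. c + y \<in> A}" by (subst emeasure_distr) (auto simp: vimage_def)
 finally show ?thesis ..
qed

text \<open>\<open>G z\<close> equals \<open>z + (z \<bullet> \<nu> - b) (h - \<nu>)\<close>: an
  affine map that fixes the hyperplane pointwise and tilts the axis \<open>\<nu>\<close> to
  \<open>h\<close>. It therefore respects the time and the point at which the hyperplane is
  hit.\<close>

lemma hit_time_eq_hyper_map:
 fixes \<nu> h :: "'a::euclidean_space" and b :: real
 assumes "norm \<nu> = 1" "h \<bullet> \<nu> ~= 0"
 defines "G z \<equiv> - (b *\<^sub>R (h - \<nu>)) + hyper_map \<nu> h z"
 shows "hit_time \<nu> b h (G z) = hit_time \<nu> b \<nu> z" "hit_point \<nu> b h (G z) = hit_point \<nu> b \<nu> z"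
proof -
 have \<nu>\<nu>: "\<nu> \<bullet> \<nu> = 1" using assms(1) by (simp add: dot_square_norm)
 have "b - G z \<bullet> \<nu> = (b - z \<bullet> \<nu>) * (h \<bullet> \<nu>)"
  by (simp add: G_def inner_add_left inner_diff_left hyper_map_inner[OF assms(1)] \<nu>\<nu> algebra_simps)
 then show t: "hit_time \<nu> b h (G z) = hit_time \<nu> b \<nu> z" using assms(2) \<nu>\<nu> by (simp add: hit_time_def)
 show "hit_point \<nu> b h (G z) = hit_point \<nu> b \<nu> z"
  unfolding hit_point_def t by (simp add: hit_time_def \<nu>\<nu> G_def hyper_map_def algebra_simps)
qed

lemma emeasure_hyper_map_vimage:
 fixes A :: "'a::euclidean_space set"
 assumes \<nu>: "norm \<nu> = 1" and h: "h \<bullet> \<nu> ~= 0" and A: "A \<in> sets borel"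
 shows "emeasure lborel A = ennreal \<bar>h \<bullet> \<nu>\<bar> * emeasure lborel {z. c + hyper_map \<nu> h z \<in> A}"
proof -
 have B: "{y. c + y \<in> A} \<in> sets borel" using A by measurable
 have "emeasure lborel (hyper_map \<nu> h -` {y. c + y \<in> A}) = ennreal (1 / \<bar>h \<bullet> \<nu>\<bar>) * emeasure lborel A"
  using emeasure_lborel_linear_vimage[OF linear_hyper_map inj_hyper_map[OF \<nu> h] B]
  by (simp add: lscale_hyper_map[OF \<nu> h] emeasure_lborel_translate_vimage[OF A])
 then have "ennreal \<bar>h \<bullet> \<nu>\<bar> * emeasure lborel {z. c + hyper_map \<nu> h z \<in> A} =
   ennreal \<bar>h \<bullet> \<nu>\<bar> * (ennreal (1 / \<bar>h \<bullet> \<nu>\<bar>) * emeasure lborel A)"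
  by (simp add: vimage_def)
 also have "... = ennreal (\<bar>h \<bullet> \<nu>\<bar> * (1 / \<bar>h \<bullet> \<nu>\<bar>)) * emeasure lborel A"
  by (subst ennreal_mult) (auto simp: mult.assoc)
 finally show ?thesis using h by simp
qed

lemma emeasure_cyl_direction:
 fixes \<nu> :: "'a::euclidean_space"
 assumes \<nu>: "norm \<nu> = 1" and h: "h \<bullet> \<nu> ~= 0" and U: "U \<in> sets borel"
 shows "emeasure lborel (cyl \<nu> b h U) = ennreal \<bar>h \<bullet> \<nu>\<bar> * emeasure lborel (cyl \<nu> b \<nu> U)"
proof -
 have "{z. - (b *\<^sub>R (h - \<nu>)) + hyper_map \<nu> h z \<in> cyl \<nu> b h U} = cyl \<nu> b \<nu> U"
  unfolding cyl_def mem_Collect_eq by (simp only: hit_time_eq_hyper_map[OF \<nu> h])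
 then show ?thesis
  using emeasure_hyper_map_vimage[OF \<nu> h sets_cyl[OF U]] by metis
qed

text \<open>The lines in direction \<open>e\<close> meet the cylinder in intervals of length at most
  1, and only over the projection of the slice of \<open>U\<close> in the hyperplane. The
  isodiametric inequality in one dimension less bounds this projection.\<close>

lemma emeasure_cyl_Basis_le:
 fixes e :: "'a::euclidean_space"
 assumes e: "e \<in> Basis" and U [measurable]: "U \<in> sets borel" and \<Delta>: "\<Delta> >= 0"
  and diam: "\<And>x y. x \<in> U ==> y \<in> U ==> norm (x - y) <= \<Delta>"
 shows "emeasure lborel (cyl e b e U) \<le>
  ennreal (unit_ball_vol (real (DIM('a) - 1)) * (\<Delta> / 2) ^ (DIM('a) - 1))"
proof -
 let ?I = "Basis - {e}" and ?L = "%_. lborel :: real measure"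
 define P where "P x = (\<Sum>j\<in>Basis. x j *\<^sub>R j)" for x :: "'a => real"
 have Pm [measurable]: "P \<in> measurable (Pi\<^sub>M Basis ?L) borel" unfolding P_def[abs_def] by measurable
 define B where "B = {x \<in> space (Pi\<^sub>M ?I ?L). (\<Sum>j\<in>?I. x j *\<^sub>R j) + b *\<^sub>R e \<in> U}"
 have B: "B \<in> sets (Pi\<^sub>M ?I ?L)" unfolding B_def by measurable
 have Pe: "P x \<bullet> e = x e" for x
  using e by (simp add: P_def inner_sum_left inner_Basis if_distrib cong: if_cong)
 have Pupd: "P (x(e := s)) = (\<Sum>j\<in>?I. x j *\<^sub>R j) + s *\<^sub>R e" for x s
  unfolding P_def using e by (subst sum.remove[OF _ e]) (auto simp: add.commute)
 have ee: "e \<bullet> e = 1" using e by simp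
 define A where "A = {x \<in> space (Pi\<^sub>M Basis ?L). P x \<in> cyl e b e U}"
 have A: "A \<in> sets (Pi\<^sub>M Basis ?L)" unfolding A_def by measurable
 have "emeasure lborel (cyl e b e U) = emeasure (distr (Pi\<^sub>M Basis ?L) borel P) (cyl e b e U)"
  by (subst lborel_eq) (simp add: P_def[abs_def])
 also have "... = emeasure (Pi\<^sub>M Basis ?L) A"
  by (subst emeasure_distr) (auto simp: A_def vimage_def Int_def conj_commute)
 also have "... = (\<integral>\<^sup>+x. emeasure lborel {s. x(e := s) \<in> A} \<partial>Pi\<^sub>M ?I ?L)"
  by (rule emeasure_PiM_by_sections[OF finite_Basis e A])
 also have "... <= (\<integral>\<^sup>+x. indicator B x \<partial>Pi\<^sub>M ?I ?L)"
 proof (rule nn_integral_mono)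
  fix x assume x: "x \<in> space (Pi\<^sub>M ?I ?L)"
  have "s \<in> {b - 1<..<b} & x \<in> B" if "x(e := s) \<in> A" for s
  proof -
   have c: "P (x(e := s)) \<in> cyl e b e U" using that by (simp add: A_def)
   have t: "hit_time e b e (P (x(e := s))) = b - s" by (simp add: hit_time_def Pe ee)
   have "hit_point e b e (P (x(e := s))) = (\<Sum>j\<in>?I. x j *\<^sub>R j) + b *\<^sub>R e"
    unfolding hit_point_def t unfolding Pupd by (simp add: algebra_simps)
   then show ?thesis using c t x by (simp add: cyl_def B_def)
  qed
  then have "{s. x(e := s) \<in> A} \<subseteq> (if x \<in> B then {b - 1<..<b} else {})" by auto
  then have "emeasure lborel {s. x(e := s) \<in> A} <= emeasure lborel (if x \<in> B then {b - 1<..<b} else {})"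
   by (rule emeasure_mono) auto
  then show "emeasure lborel {s. x(e := s) \<in> A} <= indicator B x" by (simp split: if_splits)
 qed
 also have "... = emeasure (Pi\<^sub>M ?I ?L) B" using B by simp
 also have "... <= ennreal (unit_ball_vol (real (card ?I)) * (\<Delta> / 2) ^ card ?I)"
 proof (rule isodiametric_PiM[OF _ B \<Delta>])
  fix x y assume "x \<in> B" "y \<in> B"
  then have "norm (P (x(e := b)) - P (y(e := b))) <= \<Delta>"
   unfolding B_def Pupd by (intro diam) auto
  also have "P (x(e := b)) - P (y(e := b)) = (\<Sum>j\<in>?I. (x j - y j) *\<^sub>R j)"
   unfolding Pupd by (simp add: sum_subtractf scaleR_diff_left)
  finally have "(norm (\<Sum>j\<in>?I. (x j - y j) *\<^sub>R j))^2 <= \<Delta>\<^sup>2" by (intro power_mono) auto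
  moreover have "(norm (\<Sum>j\<in>?I. (x j - y j) *\<^sub>R j))^2 = sq_dist_on ?I x y"
   unfolding sq_dist_on_def
   by (subst norm_sum_Pythagorean)
     (auto simp: pairwise_def orthogonal_def inner_Basis power_mult_distrib intro!: sum.cong)
  ultimately show "sq_dist_on ?I x y <= \<Delta>\<^sup>2" by simp
 qed simp
 also have "card ?I = DIM('a) - 1" using e by simp
 finally show ?thesis .
qed

lemma emeasure_cyl_diameter_le:
 fixes \<nu> :: "'a::euclidean_space"
 assumes \<nu>: "norm \<nu> = 1" and U [measurable]: "U \<in> sets borel" and \<Delta>: "\<Delta> >= 0"
  and diam: "\<And>x y. x \<in> U ==> y \<in> U ==> norm (x - y) <= \<Delta>"
 shows "emeasure lborel (cyl \<nu> b \<nu> U) \<le>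
  ennreal (unit_ball_vol (real (DIM('a) - 1)) * (\<Delta> / 2) ^ (DIM('a) - 1))"
proof -
 obtain R :: "'a => 'a" and e where R: "orthogonal_transformation R" and e: "e \<in> Basis" and Re: "R e = \<nu>"
  by (rule exists_orthogonal_basis_to[OF \<nu>])
 have lR: "linear R" "inj R"
  using R by (auto simp: orthogonal_transformation_def intro: orthogonal_transformation_inj)
 have Rin: "R x \<bullet> \<nu> = x \<bullet> e" for x using R Re by (metis orthogonal_transformation_def)
 have \<nu>\<nu>: "\<nu> \<bullet> \<nu> = 1" using \<nu> by (simp add: dot_square_norm)
 have t: "hit_time \<nu> b \<nu> (R z) = hit_time e b e z" for z
  using e \<nu>\<nu> by (simp add: hit_time_def Rin)
 have "hit_point \<nu> b \<nu> (R z) = R (hit_point e b e z)" for z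
  by (simp add: hit_point_def t linear_add[OF lR(1)] linear_cmul[OF lR(1)] Re)
 then have eq: "R -` cyl \<nu> b \<nu> U = cyl e b e (R -` U)" by (auto simp: cyl_def t)
 have "emeasure lborel (cyl \<nu> b \<nu> U) = emeasure lborel (R -` cyl \<nu> b \<nu> U)"
  using emeasure_lborel_linear_vimage[OF lR sets_cyl[OF U]] lscale_orthogonal[OF R] by simp
 also have "... <= ennreal (unit_ball_vol (real (DIM('a) - 1)) * (\<Delta> / 2) ^ (DIM('a) - 1))"
  unfolding eq
 proof (rule emeasure_cyl_Basis_le[OF e _ \<Delta>])
  show "R -` U \<in> sets borel" using measurable_sets[OF borel_measurable_linear[OF lR(1)] U] by simp
  fix x y assume "x \<in> R -` U" "y \<in> R -` U"
  then have "norm (R x - R y) <= \<Delta>" by (intro diam) auto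
  then show "norm (x - y) <= \<Delta>"
   using R by (simp add: linear_diff[OF lR(1), symmetric] orthogonal_transformation)
 qed
 finally show ?thesis .
qed

text \<open>A cover of \<open>A\<close> gives a cover of the cylinder by cylinders, and by the
  isodiametric inequality each of them has volume at most the Hausdorff weight of its base. The
  factor 1 is what later yields the explicit constant.\<close>

lemma emeasure_cyl_le_hausdorff:
 fixes \<nu> :: "'a::euclidean_space"
 assumes \<nu>: "norm \<nu> = 1" and A: "A \<in> sets borel"
 shows "emeasure lborel (cyl \<nu> b \<nu> A) <= hausdorff_outer (DIM('a) - 1) A"
proof -
 let ?r = "DIM('a) - 1"
 \<comment> \<open>Covering sets are arbitrary; passing to the closure makes them Borel and keeps
   the diameter.\<close>
 have single: "emeasure lborel (cyl \<nu> b \<nu> (closure U)) <= hausdorff_weight ?r U" if U: "bounded U" for U :: "'a set"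
 proof (cases "U = {}")
  case False
  have "emeasure lborel (cyl \<nu> b \<nu> (closure U)) <= ennreal (unit_ball_vol (real ?r) * (diameter U / 2) ^ ?r)"
  proof (rule emeasure_cyl_diameter_le[OF \<nu>])
   fix x y assume "x \<in> closure U" "y \<in> closure U"
   then show "norm (x - y) <= diameter U"
    using diameter_bounded_bound[of "closure U" x y] U by (simp add: diameter_closure dist_norm bounded_closure)
  qed (auto simp: diameter_ge_0 U)
  then show ?thesis using False by (simp add: hausdorff_weight_def)
 qed (simp add: cyl_def)
 have "emeasure lborel (cyl \<nu> b \<nu> A) <= hausdorff_pre ?r 1 A"
  unfolding hausdorff_pre_def
 proof (rule INF_greatest)
  fix U assume U: "U \<in> delta_covers 1 A"
  then have "A \<subseteq> (\<Union>i. U i)" by (simp add: delta_covers_def)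
  also have "... \<subseteq> (\<Union>i. closure (U i))" by (intro UN_mono closure_subset order_refl)
  finally have "A \<subseteq> (\<Union>i. closure (U i))" .
  then have "cyl \<nu> b \<nu> A \<subseteq> (\<Union>i. cyl \<nu> b \<nu> (closure (U i)))"
   using cyl_mono[of A "\<Union>i. closure (U i)"] by (simp add: cyl_UN)
  then have "emeasure lborel (cyl \<nu> b \<nu> A) <= emeasure lborel (\<Union>i. cyl \<nu> b \<nu> (closure (U i)))"
   by (rule emeasure_mono) (auto intro!: sets.countable_UN)
  also have "... <= (\<Sum>i. emeasure lborel (cyl \<nu> b \<nu> (closure (U i))))"
   by (rule emeasure_subadditive_countably) auto
  also have "... <= (\<Sum>i. hausdorff_weight ?r (U i))"
   using U by (intro suminf_le single) (auto simp: delta_covers_def)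
  finally show "emeasure lborel (cyl \<nu> b \<nu> A) <= (\<Sum>i. hausdorff_weight ?r (U i))" .
 qed
 also have "... <= hausdorff_outer ?r A" by (rule hausdorff_pre_le_outer) simp
 finally show ?thesis .
qed

section \<open>Integrals over hyperplanes and over cylinders\<close>

lemma id_measurable_hausdorff: "(%x. x) \<in> measurable (hausdorff_measure r) borel"
proof (rule measurableI)
 fix A :: "'a set" assume "A \<in> sets borel"
 then show "(%x. x) -` A \<inter> space (hausdorff_measure r) \<in> sets (hausdorff_measure r)"
  using borel_subset_sets_hausdorff by auto
qed simp

text \<open>Projecting the cylinder along its axis onto the hyperplane turns volume into a surface
  measure there, scaled by \<open>|h \<bullet> \<nu>|\<close>. Integrals over crossing points become
  integrals over starting points \<open>x\<close>.\<close>

definition cyl_measure :: "'a::euclidean_space => real => 'a => 'a measure" where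
 "cyl_measure \<nu> b h = distr (density lborel (indicator (cyl \<nu> b h UNIV))) borel (hit_point \<nu> b h)"

lemma sets_cyl_measure [simp, measurable_cong]: "sets (cyl_measure \<nu> b h) = sets borel"
 by (simp add: cyl_measure_def)

lemma nn_integral_cyl_measure:
 assumes [measurable]: "f \<in> borel_measurable borel"
 shows "(\<integral>\<^sup>+x. f x \<partial>cyl_measure \<nu> b h) =
  (LB x. indicator (cyl \<nu> b h UNIV) x * f (hit_point \<nu> b h x))"
 unfolding cyl_measure_def
 by (subst nn_integral_distr) (auto simp: nn_integral_density)

lemma emeasure_cyl_measure:
 assumes [measurable]: "A \<in> sets borel"
 shows "emeasure (cyl_measure \<nu> b h) A = emeasure lborel (cyl \<nu> b h A)"
proof -
 have "emeasure (cyl_measure \<nu> b h) A = (\<integral>\<^sup>+x. indicator A x \<partial>cyl_measure \<nu> b h)" by simp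
 also have "... = (LB x. indicator (cyl \<nu> b h A) x)"
  unfolding nn_integral_cyl_measure[OF borel_measurable_indicator[OF assms]]
  by (rule nn_integral_cong) (auto simp: cyl_def indicator_def)
 finally show ?thesis by simp
qed

lemma nn_integral_cyl_le_hausdorff:
 fixes \<nu> :: "'a::euclidean_space"
 assumes \<nu>: "norm \<nu> = 1" and h: "h \<bullet> \<nu> ~= 0" and f [measurable]: "f \<in> borel_measurable borel"
 shows "(\<integral>\<^sup>+x. f x \<partial>cyl_measure \<nu> b h) \<le>
  ennreal \<bar>h \<bullet> \<nu>\<bar> * (\<integral>\<^sup>+x. f x \<partial>hausdorff_measure (DIM('a) - 1))"
proof -
 let ?H = "hausdorff_measure (DIM('a) - 1) :: 'a measure"
 note [measurable] = id_measurable_hausdorff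
 define M where "M = scale_measure (ennreal \<bar>h \<bullet> \<nu>\<bar>) (distr ?H borel (%x. x))"
 have "cyl_measure \<nu> b h <= M"
 proof (subst le_measure)
  show "\<forall>A\<in>sets (cyl_measure \<nu> b h). emeasure (cyl_measure \<nu> b h) A <= emeasure M A"
  proof
   fix A assume "A \<in> sets (cyl_measure \<nu> b h)"
   then have A: "A \<in> sets borel" by simp
   have "emeasure (cyl_measure \<nu> b h) A = ennreal \<bar>h \<bullet> \<nu>\<bar> * emeasure lborel (cyl \<nu> b \<nu> A)"
    by (simp add: emeasure_cyl_measure[OF A] emeasure_cyl_direction[OF \<nu> h A])
   also have "... <= ennreal \<bar>h \<bullet> \<nu>\<bar> * hausdorff_outer (DIM('a) - 1) A"
    by (intro mult_left_mono emeasure_cyl_le_hausdorff[OF \<nu> A]) simp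
   also have "... = emeasure M A"
    using A borel_subset_sets_hausdorff[of "DIM('a) - 1"]
    by (subst emeasure_hausdorff_measure[symmetric]) (auto simp: M_def emeasure_distr)
   finally show "emeasure (cyl_measure \<nu> b h) A <= emeasure M A" .
  qed
 qed (simp add: M_def)
 then have "(\<integral>\<^sup>+x. f x \<partial>cyl_measure \<nu> b h) <= (\<integral>\<^sup>+x. f x \<partial>M)"
  by (intro nn_integral_mono_measure) (simp_all add: M_def)
 also have "... = ennreal \<bar>h \<bullet> \<nu>\<bar> * (\<integral>\<^sup>+x. f x \<partial>?H)"
  unfolding M_def by (subst nn_integral_scale_measure) (auto simp: nn_integral_distr)
 finally show ?thesis .
qed

section \<open>Hausdorff measure on a hyperplane bounded by cylinder volumes\<close>

lemma exists_level_le_average: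
 fixes w :: "nat => ennreal" and I :: "nat => real set"
 assumes [measurable]: "\<And>n. I n \<in> sets borel" and c: "c < top"
  and le: "(\<Sum>n. w n * emeasure lborel (I n)) <= c" and e: "e > (0::real)"
 shows "\<exists>\<sigma>\<in>{0<..<1}. (\<Sum>n. w n * indicator (I n) \<sigma>) <= c + ennreal e"
proof (rule ccontr)
 assume "\<not> ?thesis"
 then have gt: "c + ennreal e <= (\<Sum>n. w n * indicator (I n) \<sigma>)" if "\<sigma> \<in> {0<..<1}" for \<sigma>
  using that by force
 have "c + ennreal e = (LB \<sigma>. (c + ennreal e) * indicator {0<..<1::real} \<sigma>)"
  by (subst nn_integral_cmult_indicator) (auto simp: emeasure_lborel_Ioo)
 also have "... <= (LB \<sigma>. (\<Sum>n. w n * indicator (I n) \<sigma>))"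
 proof (rule nn_integral_mono)
  fix \<sigma> :: real
  show "(c + ennreal e) * indicator {0<..<1} \<sigma> <= (\<Sum>n. w n * indicator (I n) \<sigma>)"
   using gt[of \<sigma>] by (cases "\<sigma> \<in> {0<..<1}") auto
 qed
 also have "... = (\<Sum>n. w n * emeasure lborel (I n))"
  by (subst nn_integral_suminf) (auto simp: nn_integral_cmult_indicator)
 also have "... <= c" by (rule le)
 finally show False
  using c e ennreal_add_left_cancel_less[of c 0 "ennreal e"] by (simp add: not_le[symmetric])
qed

text \<open>A cube of side \<open>t\<close> has diameter at most \<open>d t\<close>, hence weight at
  most \<open>unit_ball_vol (d - 1) * (d t)^(d - 1)\<close>, and it meets levels of a cylinder of
  height \<open>s\<close> only in an interval of length \<open>2 d t / s\<close>. The product is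
  this constant times \<open>t^d / s\<close>.\<close>

definition hausdorff_const :: "nat => real" where
 "hausdorff_const d = 2 * unit_ball_vol (real (d - 1)) * real d ^ d"

lemma cbox_cube_bounds:
 fixes u v :: "'a::euclidean_space"
 assumes side: "\<And>i. i \<in> Basis ==> (v - u) \<bullet> i = t" and t: "t >= 0"
 shows "emeasure lborel (cbox u v) = ennreal (t ^ DIM('a))"
  and "x \<in> cbox u v ==> y \<in> cbox u v ==> norm (x - y) <= real DIM('a) * t"
  and "u \<in> cbox u v"
proof -
 have le: "u \<bullet> i <= v \<bullet> i" if "i \<in> Basis" for i using side[OF that] t by (simp add: inner_diff_left)
 show "emeasure lborel (cbox u v) = ennreal (t ^ DIM('a))"
  using le side by (simp add: emeasure_lborel_cbox)
 show "u \<in> cbox u v" using le by (simp add: mem_box)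
 show "norm (x - y) <= real DIM('a) * t" if "x \<in> cbox u v" "y \<in> cbox u v"
 proof -
  have "norm (x - y) <= (\<Sum>i\<in>Basis. \<bar>(x - y) \<bullet> i\<bar>)" by (rule norm_le_l1)
  also have "... <= (\<Sum>i\<in>(Basis::'a set). t)"
  proof (rule sum_mono)
   fix i :: 'a assume i: "i \<in> Basis"
   show "\<bar>(x - y) \<bullet> i\<bar> <= t"
    using that i side[OF i] by (auto simp: mem_box inner_diff_left abs_le_iff dest!: bspec[OF _ i])
  qed
  finally show ?thesis by simp
 qed
qed

text \<open>The cylinder of height \<open>s\<close> over \<open>A\<close> is covered by small cubes of almost the same total volume.
 Averaging over the levels of the cylinder, some level meets few of these cubes; translated back,
 they cover \<open>A\<close>.\<close>

lemma hausdorff_pre_le_cyl_small: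
 fixes \<nu> :: "'a::euclidean_space"
 assumes \<nu>: "norm \<nu> = 1" and A: "A \<in> sets borel" and hyp: "\<And>x. x \<in> A ==> x \<bullet> \<nu> = b"
  and ball: "A \<subseteq> ball q s" and s: "s > 0"
 shows "hausdorff_pre (DIM('a) - 1) (real DIM('a) * (4 * s)) A \<le>
  ennreal (hausdorff_const (DIM('a))) * emeasure lborel (cyl \<nu> b \<nu> A)"
proof (rule ennreal_le_epsilon)
 fix \<epsilon> :: real assume eps: "0 < \<epsilon>"
 let ?d = "DIM('a)"
 define \<omega> where "\<omega> = unit_ball_vol (real (?d - 1))"
 have \<omega>: "\<omega> > 0" by (simp add: \<omega>_def)
 have \<nu>\<nu>: "\<nu> \<bullet> \<nu> = 1" using \<nu> by (simp add: dot_square_norm)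
 define C where "C = hausdorff_const ?d"
 have C: "C > 0" using \<omega> by (simp add: C_def hausdorff_const_def \<omega>_def)
 define S where "S = cyl \<nu> b (s *\<^sub>R \<nu>) A"
 \<comment> \<open>A cube with side \<open>4 * s\<close> that contains the cylinder; its dyadic
   subdivision produces cubes and not merely boxes.\<close>
 define l where "l = q - (2 * s) *\<^sub>R One" 
 define r where "r = q + (2 * s) *\<^sub>R (One::'a)"
 have S_eq: "S = {x. \<exists>\<xi>\<in>A. \<exists>\<sigma>\<in>{0<..<1::real}. x = \<xi> - (\<sigma> * s) *\<^sub>R \<nu>}"
 proof (intro set_eqI iffI; clarsimp)
  fix x assume "x \<in> S"
  then show "\<exists>\<xi>\<in>A. \<exists>\<sigma>\<in>{0<..<1::real}. x = \<xi> - (\<sigma> * s) *\<^sub>R \<nu>"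
   by (intro bexI[of _ "hit_point \<nu> b (s *\<^sub>R \<nu>) x"] bexI[of _ "hit_time \<nu> b (s *\<^sub>R \<nu>) x"])
    (auto simp: S_def cyl_def hit_point_def)
 next
  fix \<xi> and \<sigma> :: real assume x: "\<xi> \<in> A" "0 < \<sigma>" "\<sigma> < 1"
  have "hit_time \<nu> b (s *\<^sub>R \<nu>) (\<xi> - (\<sigma> * s) *\<^sub>R \<nu>) = \<sigma>"
   using s hyp[OF x(1)] by (simp add: hit_time_def \<nu>\<nu> inner_diff_left)
  then show "\<xi> - (\<sigma> * s) *\<^sub>R \<nu> \<in> S" using x by (simp add: S_def cyl_def hit_point_def)
 qed
 have Sborel: "S \<in> sets borel" unfolding S_def using A by simp
 have S_sub: "S \<subseteq> cbox l r"
 proof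
  fix x assume "x \<in> S"
  then obtain \<xi> \<sigma> where x: "\<xi> \<in> A" "0 < \<sigma>" "\<sigma> < 1" "x = \<xi> - (\<sigma> * s) *\<^sub>R \<nu>" by (auto simp: S_eq)
  have "norm (x - q) <= norm (\<xi> - q) + norm ((\<sigma> * s) *\<^sub>R \<nu>)"
  proof -
   have "x - q = (\<xi> - q) - (\<sigma> * s) *\<^sub>R \<nu>" using x(4) by simp
   then show ?thesis using norm_triangle_ineq4[of "\<xi> - q" "(\<sigma> * s) *\<^sub>R \<nu>"] by presburger
  qed
  also have "norm (\<xi> - q) < s" using ball x(1) by (auto simp: dist_norm norm_minus_commute)
  also have "norm ((\<sigma> * s) *\<^sub>R \<nu>) <= s" using x s \<nu> by simp
  finally have n: "norm (x - q) <= 2 * s" by simp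
  have "\<bar>(x - q) \<bullet> i\<bar> <= 2 * s" if "i \<in> Basis" for i
   using Basis_le_norm[OF that, of "x - q"] n by simp
  then show "x \<in> cbox l r"
   by (force simp: mem_box l_def r_def inner_diff_left inner_add_left abs_le_iff)
 qed
 have Sfin: "emeasure lborel S = ennreal s * emeasure lborel (cyl \<nu> b \<nu> A)"
  unfolding S_def using emeasure_cyl_direction[OF \<nu>, of "s *\<^sub>R \<nu>" A b] A s \<nu>\<nu> by simp
 have Sm: "S \<in> lmeasurable"
  using bounded_subset[OF bounded_cbox S_sub]
 proof (rule bounded_set_imp_lmeasurable)
  show "S \<in> sets lebesgue" using Sborel by simp
 qed
 have box_ne: "box l r ~= {}" using s by (auto simp: box_ne_empty l_def r_def inner_diff_left inner_add_left)
 \<comment> \<open>The surplus volume \<open>s * \<epsilon>'\<close> is multiplied by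
   \<open>C / s\<close> later and then costs exactly \<open>\<epsilon> / 2\<close>; the other half
   is lost in the choice of a level.\<close>
 define \<epsilon>' where "\<epsilon>' = \<epsilon> / (2 * C)"
 have e': "\<epsilon>' > 0" using eps C by (simp add: \<epsilon>'_def)
 obtain \<D> where D: "countable \<D>" "\<And>K. K \<in> \<D> ==> K \<subseteq> cbox l r & K ~= {} & (\<exists>c d. K = cbox c d)"
  "pairwise (%A B. interior A \<inter> interior B = {}) \<D>"
  "\<And>u v. cbox u v \<in> \<D> ==> \<exists>n. \<forall>i \<in> Basis. v \<bullet> i - u \<bullet> i = (r \<bullet> i - l \<bullet> i)/2^n"
  "\<And>K. [|K \<in> \<D>; box l r ~= {}|] ==> interior K ~= {}"
  "S \<subseteq> \<Union>\<D>" "\<Union>\<D> \<in> lmeasurable" "measure lebesgue (\<Union>\<D>) <= measure lebesgue S + s * \<epsilon>'"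
  using measurable_outer_intervals_bounded[OF Sm S_sub, of "s * \<epsilon>'"] s e' by (metis mult_pos_pos)
 define E where "E = to_nat_on \<D> ` \<D>"
 define K where "K n = from_nat_into \<D> n" for n
 have KD: "K n \<in> \<D>" if "n \<in> E" for n using that D(1) by (auto simp: E_def K_def)
 have KE: "\<exists>n\<in>E. K n = X" if "X \<in> \<D>" for X using that D(1) by (auto simp: E_def K_def)
 have Kinj: "K m ~= K n" if "m \<in> E" "n \<in> E" "m ~= n" for m n
  using that D(1) by (auto simp: E_def K_def)
 have "\<exists>u v t. K n = cbox u v & t > 0 & t <= 4 * s & (\<forall>i\<in>Basis. (v - u) \<bullet> i = t)" if n: "n \<in> E" for n
 proof -
  obtain u v where uv: "K n = cbox u v" using D(2)[OF KD[OF n]] by blast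
  obtain m where "\<And>i. i \<in> Basis ==> v \<bullet> i - u \<bullet> i = (r \<bullet> i - l \<bullet> i)/2^m"
   using D(4)[of u v] KD[OF n] uv by auto
  moreover have "r \<bullet> i - l \<bullet> i = 4 * s" if "i \<in> Basis" for i :: 'a
   using that by (simp add: l_def r_def inner_diff_left inner_add_left)
  ultimately have "\<And>i. i \<in> Basis ==> (v - u) \<bullet> i = 4 * s / 2^m" by (simp add: inner_diff_left)
  moreover have "4 * s / 2^m <= 4 * s" using s by (simp add: divide_le_eq)
  moreover have "4 * s / 2^m > 0" using s by simp
  ultimately show ?thesis using uv by blast
 qed
 then obtain u v t where uvt: "\<And>n. n \<in> E ==> K n = cbox (u n) (v n)"
  "\<And>n. n \<in> E ==> t n > 0" "\<And>n. n \<in> E ==> t n <= 4 * s"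
  "\<And>n i. n \<in> E ==> i \<in> Basis ==> (v n - u n) \<bullet> i = t n"
  by metis
 have cube: "emeasure lborel (K n) = ennreal (t n ^ ?d)"
  "\<And>x y. x \<in> K n ==> y \<in> K n ==> norm (x - y) <= real ?d * t n" "u n \<in> K n"
  if "n \<in> E" for n
  unfolding uvt(1)[OF that]
  using cbox_cube_bounds[OF uvt(4)[OF that] less_imp_le[OF uvt(2)[OF that]]] by blast+
 \<comment> \<open>\<open>w n\<close> dominates the Hausdorff weight of any translate of the cube
   \<open>K n\<close>, and \<open>I n\<close> contains every level
   \<open>(b - x \<bullet> \<nu>) / s\<close> taken by a point \<open>x\<close> of the cube, because
   such a point is within \<open>d * t n\<close> of the corner \<open>u n\<close>.\<close>
 define w where "w n = (if n \<in> E then ennreal (\<omega> * (real ?d * t n) ^ (?d - 1)) else 0)" for n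
 define I where "I n = {(b - u n \<bullet> \<nu> - real ?d * t n) / s .. (b - u n \<bullet> \<nu> + real ?d * t n) / s}" for n
 define vol where "vol n = (if n \<in> E then emeasure lborel (K n) else 0)" for n
 have sumvol: "(\<Sum>n. vol n) <= ennreal (measure lebesgue S + s * \<epsilon>')"
 proof -
  define J where "J n = (if n \<in> E then box (u n) (v n) else {})" for n
  have "(\<Sum>n. vol n) = (\<Sum>n. emeasure lborel (J n))"
  proof (rule suminf_cong)
   fix n
   show "vol n = emeasure lborel (J n)"
    by (auto simp: vol_def J_def uvt(1) emeasure_lborel_cbox_eq emeasure_lborel_box_eq)
  qed
  also have "... = emeasure lborel (\<Union>n. J n)"
  proof (rule suminf_emeasure)
   show "disjoint_family J"
   proof (unfold disjoint_family_on_def, intro ballI impI)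
    fix m n :: nat assume "m ~= n"
    then show "J m \<inter> J n = {}"
     using D(3) KD Kinj[of m n] unfolding J_def pairwise_def
     by (auto simp: uvt(1)[symmetric] interior_cbox[symmetric] simp del: interior_cbox)
   qed
  qed (auto simp: J_def)
  also have "... = emeasure lebesgue (\<Union>n. J n)" by (simp add: J_def)
  also have "... <= emeasure lebesgue (\<Union>\<D>)"
  proof (rule emeasure_mono)
   show "(\<Union>n. J n) \<subseteq> \<Union>\<D>"
    using KD uvt(1) box_subset_cbox by (fastforce simp: J_def split: if_splits)
   show "\<Union>\<D> \<in> sets lebesgue" using D(7) by auto
  qed
  also have "... = ennreal (measure lebesgue (\<Union>\<D>))"
   using D(7) by (simp add: emeasure_eq_measure2)
  finally show ?thesis using D(8) by (meson ennreal_leI order_trans)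
 qed
 have wI: "w n * emeasure lborel (I n) = ennreal (C / s) * vol n" for n
 proof (cases "n \<in> E")
  case True
  have d: "real ?d * t n ^ 1 >= 0" using uvt(2)[OF True] by simp
  have "emeasure lborel (I n) = ennreal (2 * (real ?d * t n) / s)"
   using s uvt(2)[OF True] unfolding I_def
   by (subst emeasure_lborel_Icc) (auto simp: divide_right_mono diff_divide_distrib[symmetric])
  moreover have "\<omega> * (real ?d * t n) ^ (?d - 1) * (2 * (real ?d * t n) / s) = C / s * t n ^ ?d"
  proof -
   have "(real ?d * t n) ^ (?d - 1) * (real ?d * t n) = (real ?d * t n) ^ ?d"
    by (metis DIM_positive power_minus_mult)
   then show ?thesis
    by (simp add: C_def hausdorff_const_def \<omega>_def power_mult_distrib algebra_simps)
  qed
  ultimately show ?thesis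
   using \<omega> s C uvt(2)[OF True] cube(1)[OF True] True
   by (simp add: w_def vol_def ennreal_mult[symmetric])
 qed (simp add: w_def vol_def)
 have fin: "emeasure lborel S = ennreal (measure lebesgue S)"
  using emeasure_eq_measure2[OF Sm] Sborel by simp
 define c where "c = ennreal (C / s) * ennreal (measure lebesgue S + s * \<epsilon>')"
 have "\<exists>\<sigma>\<in>{0<..<1}. (\<Sum>n. w n * indicator (I n) \<sigma>) <= c + ennreal (\<epsilon>/2)"
 proof (rule exists_level_le_average)
  show "(\<Sum>n. w n * emeasure lborel (I n)) <= c"
   unfolding wI c_def by (subst ennreal_suminf_cmult) (rule mult_left_mono[OF sumvol], simp)
  show "c < top" by (simp add: c_def ennreal_mult_less_top)
 qed (use eps in \<open>auto simp: I_def\<close>)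
 then obtain \<sigma> where \<sigma>: "0 < \<sigma>" "\<sigma> < 1" and le: "(\<Sum>n. w n * indicator (I n) \<sigma>) <= c + ennreal (\<epsilon>/2)"
  by auto
 define U where "U n = (if n \<in> E & \<sigma> \<in> I n then (%x. (\<sigma> * s) *\<^sub>R \<nu> + x) ` K n else {})" for n
 have diamU: "bounded (U n) & diameter (U n) <= (if n \<in> E then real ?d * t n else 0)" for n
 proof (cases "n \<in> E & \<sigma> \<in> I n")
  case True
  have "diameter (U n) <= real ?d * t n"
  proof (rule diameter_le)
   show "U n ~= {} \<or> 0 <= real ?d * t n" using uvt(2)[of n] True by auto
   fix x y assume "x \<in> U n" "y \<in> U n"
   then obtain x' y' where "x' \<in> K n" "y' \<in> K n" "x - y = x' - y'" using True by (auto simp: U_def)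
   then show "norm (x - y) <= real ?d * t n" using cube(2)[of n x' y'] True by simp
  qed
  moreover have "bounded (U n)"
   using True uvt(1)[of n] bounded_translation[of "K n" "(\<sigma> * s) *\<^sub>R \<nu>"] by (simp add: U_def)
  ultimately show ?thesis using True by simp
 next
  case False
  then have "U n = {}" by (auto simp: U_def)
  then show ?thesis using uvt(2)[of n] by (auto intro: less_imp_le)
 qed
 have "U \<in> delta_covers (real ?d * (4 * s)) A"
 proof -
  have "\<exists>n. \<xi> \<in> U n" if \<xi>: "\<xi> \<in> A" for \<xi>
  proof -
   define x where "x = \<xi> - (\<sigma> * s) *\<^sub>R \<nu>"
   have "x \<in> S" unfolding S_eq x_def using \<xi> \<sigma> by (auto intro!: bexI[of _ \<xi>] bexI[of _ \<sigma>])
   then obtain X where "X \<in> \<D>" "x \<in> X" using D(6) by auto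
   then obtain n where n: "n \<in> E" "x \<in> K n" using KE by blast
   have "\<bar>(x - u n) \<bullet> \<nu>\<bar> <= norm (x - u n)" using Cauchy_Schwarz_ineq2[of "x - u n" \<nu>] \<nu> by simp
   also have "... <= real ?d * t n"
    using cube(2)[of n x "u n"] cube(3)[of n] n by simp
   finally have "\<bar>(x - u n) \<bullet> \<nu>\<bar> <= real ?d * t n" .
   moreover have "x \<bullet> \<nu> = b - \<sigma> * s" by (simp add: x_def inner_diff_left hyp[OF \<xi>] \<nu>\<nu>)
   ultimately have "\<sigma> \<in> I n"
    using s by (auto simp: I_def inner_diff_left abs_le_iff pos_divide_le_eq pos_le_divide_eq)
   then have "\<xi> \<in> U n" using n by (auto simp: U_def x_def intro!: image_eqI[of _ _ x])
   then show ?thesis ..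
  qed
  moreover have "diameter (U n) <= real ?d * (4 * s)" for n
  proof -
   have "(if n \<in> E then real ?d * t n else 0) <= real ?d * (4 * s)"
    using uvt(3)[of n] s by (auto intro: mult_left_mono)
   then show ?thesis using diamU[of n] by linarith
  qed
  ultimately show ?thesis using diamU by (auto simp: delta_covers_def)
 qed
 then have "hausdorff_pre (?d - 1) (real ?d * (4 * s)) A <= (\<Sum>n. hausdorff_weight (?d - 1) (U n))"
  unfolding hausdorff_pre_def by (rule INF_lower)
 also have "... <= (\<Sum>n. w n * indicator (I n) \<sigma>)"
 proof (rule suminf_le)
  fix n
  show "hausdorff_weight (?d - 1) (U n) <= w n * indicator (I n) \<sigma>"
  proof (cases "n \<in> E & \<sigma> \<in> I n")
   case True
   have "diameter (U n) / 2 <= real ?d * t n" "diameter (U n) >= 0"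
    using diamU[of n] diameter_ge_0[of "U n"] True by auto
   then have "\<omega> * (diameter (U n) / 2) ^ (?d - 1) <= \<omega> * (real ?d * t n) ^ (?d - 1)"
    using \<omega> by (intro mult_left_mono power_mono) auto
   then show ?thesis using True by (auto simp: hausdorff_weight_def w_def \<omega>_def intro!: ennreal_leI)
  next
   case False
   then show ?thesis by (auto simp: U_def)
  qed
 qed auto
 also have "... <= c + ennreal (\<epsilon>/2)" by (rule le)
 also have "c = ennreal C * emeasure lborel (cyl \<nu> b \<nu> A) + ennreal (\<epsilon>/2)"
 proof -
  have "ennreal (C / s) * (ennreal s * X) = ennreal C * X" for X
   using s C by (simp add: mult.assoc[symmetric] ennreal_mult[symmetric])
  moreover have "ennreal (C * \<epsilon>') = ennreal (\<epsilon>/2)" using C by (simp add: \<epsilon>'_def)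
  ultimately show ?thesis
   unfolding c_def using s e' C Sfin fin
   by (simp add: ennreal_plus distrib_left ennreal_mult[symmetric])
 qed
 also have "... + ennreal (\<epsilon>/2) = ennreal C * emeasure lborel (cyl \<nu> b \<nu> A) + ennreal \<epsilon>"
  using eps by (simp add: add.assoc ennreal_plus[symmetric] del: ennreal_plus)
 finally show "hausdorff_pre (?d - 1) (real ?d * (4 * s)) A \<le>
   ennreal (hausdorff_const ?d) * emeasure lborel (cyl \<nu> b \<nu> A) + ennreal \<epsilon>"
  by (simp add: C_def)
qed

text \<open>Covers at scale \<open>\<delta>\<close> are available for sets in balls of radius
  \<open>\<delta> / (4 d)\<close>. So \<open>A\<close> is cut into countably many disjoint pieces of
  this size; the cylinders over them are disjoint as well and their volumes add up.\<close>

lemma hausdorff_le_cyl: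
 fixes \<nu> :: "'a::euclidean_space"
 assumes \<nu>: "norm \<nu> = 1" and A: "A \<in> sets borel" and hyp: "\<And>x. x \<in> A ==> x \<bullet> \<nu> = b"
 shows "hausdorff_outer (DIM('a) - 1) A \<le>
  ennreal (hausdorff_const (DIM('a))) * emeasure lborel (cyl \<nu> b \<nu> A)"
 unfolding hausdorff_outer_eq_SUP
proof (rule SUP_least)
 fix \<delta> :: real assume d: "\<delta> \<in> {0<..}"
 define s where "s = \<delta> / (4 * real DIM('a))"
 have s: "s > 0" "real DIM('a) * (4 * s) = \<delta>" using d by (auto simp: s_def)
 obtain Q :: "'a set" where Q: "countable Q" "\<And>X. open X ==> X ~= {} ==> \<exists>q\<in>Q. q \<in> X"
  using countable_dense_setE by blast
 have Qne: "Q ~= {}" using Q(2)[of UNIV] by auto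
 define B where "B n = ball (from_nat_into Q n) s" for n
 define A' where "A' n = A \<inter> disjointed B n" for n
 have "x \<in> (\<Union>n. B n)" for x
 proof -
  obtain q where "q \<in> Q" "q \<in> ball x s" using Q(2)[of "ball x s"] s by auto
  moreover obtain n where "from_nat_into Q n = q" using from_nat_into_surj[OF Q(1)] \<open>q \<in> Q\<close> by blast
  ultimately show ?thesis by (intro UN_I[of n]) (auto simp: B_def dist_commute)
 qed
 then have cover: "A = (\<Union>n. A' n)" by (auto simp: A'_def UN_disjointed_eq simp flip: Int_UN_distrib)
 have A'b [measurable]: "A' n \<in> sets borel" for n
  using A by (auto simp: A'_def disjointed_def B_def)
 have disj: "disjoint_family (%n. cyl \<nu> b \<nu> (A' n))"
  using disjoint_family_disjointed[of B] by (fastforce simp: disjoint_family_on_def A'_def cyl_def)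
 have "hausdorff_pre (DIM('a) - 1) \<delta> A <= (\<Sum>n. hausdorff_pre (DIM('a) - 1) \<delta> (A' n))"
  by (subst cover) (rule hausdorff_pre_subadditive)
 also have "... <= (\<Sum>n. ennreal (hausdorff_const (DIM('a))) * emeasure lborel (cyl \<nu> b \<nu> (A' n)))"
 proof (rule suminf_le)
  fix n
  have "A' n \<subseteq> ball (from_nat_into Q n) s"
   using disjointed_subset[of B n] by (auto simp: A'_def B_def)
  from hausdorff_pre_le_cyl_small[OF \<nu> A'b _ this s(1), of b]
  show "hausdorff_pre (DIM('a) - 1) \<delta> (A' n) \<le>
    ennreal (hausdorff_const (DIM('a))) * emeasure lborel (cyl \<nu> b \<nu> (A' n))"
   unfolding s(2) using hyp by (auto simp: A'_def)
 qed auto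
 also have "... = ennreal (hausdorff_const (DIM('a))) * emeasure lborel (\<Union>n. cyl \<nu> b \<nu> (A' n))"
  by (subst ennreal_suminf_cmult, subst suminf_emeasure) (use disj in auto)
 also have "(\<Union>n. cyl \<nu> b \<nu> (A' n)) = cyl \<nu> b \<nu> A" using arg_cong[OF cover, of "cyl \<nu> b \<nu>"] by (simp add: cyl_UN)
 finally show "hausdorff_pre (DIM('a) - 1) \<delta> A \<le>
   ennreal (hausdorff_const (DIM('a))) * emeasure lborel (cyl \<nu> b \<nu> A)" .
qed

lemma nn_integral_hausdorff_le_cyl:
 fixes \<nu> :: "'a::euclidean_space"
 assumes \<nu>: "norm \<nu> = 1" and f [measurable]: "f \<in> borel_measurable borel"
  and supp: "\<And>x. x \<bullet> \<nu> ~= b ==> f x = 0"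
 shows "(\<integral>\<^sup>+x. f x \<partial>hausdorff_measure (DIM('a) - 1)) \<le>
  ennreal (hausdorff_const (DIM('a))) * (\<integral>\<^sup>+x. f x \<partial>cyl_measure \<nu> b \<nu>)"
proof -
 let ?H = "hausdorff_measure (DIM('a) - 1) :: 'a measure"
 note [measurable] = id_measurable_hausdorff
 define P where "P = {x. x \<bullet> \<nu> = b}"
 have P [measurable]: "P \<in> sets borel" unfolding P_def by measurable
 define M1 where "M1 = density (distr ?H borel (%x. x)) (indicator P)"
 define M2 where "M2 = scale_measure (ennreal (hausdorff_const (DIM('a)))) (cyl_measure \<nu> b \<nu>)"
 have [simp]: "sets M1 = sets borel" "sets M2 = sets borel" by (simp_all add: M1_def M2_def)
 have "M1 <= M2"
 proof (subst le_measure)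
  show "\<forall>A\<in>sets M1. emeasure M1 A <= emeasure M2 A"
  proof
   fix A assume "A \<in> sets M1"
   then have A [measurable]: "A \<in> sets borel" by simp
   have AP: "A \<inter> P \<in> sets borel" by measurable
   have "emeasure M1 A = emeasure (distr ?H borel (%x. x)) (A \<inter> P)"
    unfolding M1_def by (subst emeasure_density) (auto simp: nn_integral_indicator[symmetric] indicator_inter_arith[symmetric] Int_commute simp del: nn_integral_indicator)
   also have "... = hausdorff_outer (DIM('a) - 1) (A \<inter> P)"
    using AP borel_subset_sets_hausdorff[of "DIM('a) - 1"]
    by (subst emeasure_hausdorff_measure[symmetric]) (auto simp: emeasure_distr)
   also have "... <= ennreal (hausdorff_const (DIM('a))) * emeasure lborel (cyl \<nu> b \<nu> (A \<inter> P))"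
    by (rule hausdorff_le_cyl[OF \<nu> AP]) (auto simp: P_def)
   also have "... <= ennreal (hausdorff_const (DIM('a))) * emeasure lborel (cyl \<nu> b \<nu> A)"
    by (intro mult_left_mono emeasure_mono cyl_mono) auto
   finally show "emeasure M1 A <= emeasure M2 A" by (simp add: M2_def emeasure_cyl_measure)
  qed
 qed simp
 then have "(\<integral>\<^sup>+x. f x \<partial>M1) <= (\<integral>\<^sup>+x. f x \<partial>M2)" by (intro nn_integral_mono_measure) simp_all
 moreover have "(\<integral>\<^sup>+x. f x \<partial>M1) = (\<integral>\<^sup>+x. f x \<partial>?H)"
 proof -
  have "indicator P x * f x = f x" for x using supp[of x] by (auto simp: P_def indicator_def)
  then show ?thesis unfolding M1_def by (subst nn_integral_density) (auto simp: nn_integral_distr)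
 qed
 moreover have "(\<integral>\<^sup>+x. f x \<partial>M2) = ennreal (hausdorff_const (DIM('a))) * (\<integral>\<^sup>+x. f x \<partial>cyl_measure \<nu> b \<nu>)"
  unfolding M2_def
  by (rule nn_integral_scale_measure) (use f measurable_cong_sets[OF sets_cyl_measure refl] in blast)
 ultimately show ?thesis by simp
qed

section \<open>Geometry of interface networks\<close>

lemma AE_lborel_not_hyperplane:
 fixes a :: "'a::euclidean_space"
 assumes "a ~= 0"
 shows "AE x in lborel. a \<bullet> x ~= c"
proof -
 have "{x. a \<bullet> x = c} \<in> null_sets lebesgue"
  using negligible_hyperplane[of a c] assms by (simp add: negligible_iff_null_sets)
 moreover have "{x. a \<bullet> x = c} \<in> sets borel" by (intro borel_closed closed_hyperplane)
 ultimately have "{x. a \<bullet> x = c} \<in> null_sets lborel" by (simp add: null_sets_def)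
 then show ?thesis by (rule AE_I') auto
qed

text \<open>Adding one point displaced by \<open>h\<close> raises the affine dimension by at most
  one, so the enlarged set still lies in a hyperplane. Its normal is orthogonal to \<open>h\<close>,
  hence it contains all lines through \<open>A\<close> parallel to \<open>h\<close>.\<close>

lemma low_dim_shadow_hyperplane:
 fixes A :: "'a::euclidean_space set"
 assumes "aff_dim A < int DIM('a) - 1"
 obtains a c where "a ~= 0" "\<And>x t. x + t *\<^sub>R h \<in> A ==> a \<bullet> x = c"
proof (cases "A = {}")
 case True
 obtain e :: 'a where "e \<in> Basis" using nonempty_Basis by blast
 then show ?thesis using that[of e 0] True nonzero_Basis by blast
next
 case False
 then obtain a0 where a0: "a0 \<in> A" by auto
 have "aff_dim (insert (a0 + h) A) < int DIM('a)" using assms by (auto simp: aff_dim_insert)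
 then obtain a c where a: "a ~= 0" "insert (a0 + h) A \<subseteq> {x. a \<bullet> x = c}"
  using aff_lowdim_subset_hyperplane by blast
 have h: "a \<bullet> h = 0" using a(2) a0 by (auto simp: inner_add_right)
 show ?thesis using that[OF a(1), of c] a(2) h by (fastforce simp: inner_add_right)
qed

lemma AE_line_avoids_low_dim:
 fixes A :: "'a::euclidean_space set"
 assumes "aff_dim A < int DIM('a) - 1"
 shows "AE x in lborel. \<forall>t. x + t *\<^sub>R h \<notin> A"
proof -
 obtain a c where a: "a ~= 0" "\<And>x t. x + t *\<^sub>R h \<in> A ==> a \<bullet> x = c"
  using low_dim_shadow_hyperplane[OF assms, of h] by blast
 show ?thesis using AE_lborel_not_hyperplane[OF a(1), of c] by eventually_elim (use a(2) in blast)
qed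

text \<open>The set lies in a hyperplane, and almost every line in the normal direction misses it.
  The cylinder over it is therefore null, and cylinder volumes control Hausdorff measure on a
  hyperplane.\<close>

lemma hausdorff_low_dim:
 fixes A :: "'a::euclidean_space set"
 assumes A: "aff_dim A < int DIM('a) - 1" and cl: "closed A"
 shows "hausdorff_outer (DIM('a) - 1) A = 0"
proof -
 have "aff_dim A < int DIM('a)" using A by simp
 then obtain a c where a: "a ~= 0" "A \<subseteq> {x. a \<bullet> x = c}"
  by (rule aff_lowdim_subset_hyperplane)
 define \<nu> where "\<nu> = a /\<^sub>R norm a"
 have \<nu>: "norm \<nu> = 1" using a by (simp add: \<nu>_def)
 have Ab: "A \<in> sets borel" using cl by (rule borel_closed)
 have "AE x in lborel. x \<notin> cyl \<nu> (c / norm a) \<nu> A"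
  using AE_line_avoids_low_dim[OF A, of \<nu>] by eventually_elim (auto simp: cyl_def hit_point_def)
 then have "emeasure lborel (cyl \<nu> (c / norm a) \<nu> A) = 0"
  using Ab by (subst (asm) AE_iff_measurable[OF _ refl]) auto
 moreover have "hausdorff_outer (DIM('a) - 1) A \<le>
   ennreal (hausdorff_const (DIM('a))) * emeasure lborel (cyl \<nu> (c / norm a) \<nu> A)"
 proof (rule hausdorff_le_cyl[OF \<nu> Ab])
  fix x assume "x \<in> A"
  then show "x \<bullet> \<nu> = c / norm a" using a by (auto simp: \<nu>_def inner_commute divide_inverse)
 qed
 ultimately show ?thesis by simp
qed

section \<open>Oriented normals and regular points of the interfaces\<close>

definition oriented :: "'n::{finite,linorder} point => bool" where
 "oriented \<nu> \<longleftrightarrow> \<nu> $ Min {i. \<nu> $ i ~= 0} > 0"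

lemma oriented_or_uminus:
 assumes "\<nu> ~= 0"
 shows "oriented \<nu> \<or> oriented (- \<nu>)"
proof -
 have "{i. \<nu> $ i ~= 0} ~= {}" using assms by (auto simp: vec_eq_iff)
 then have "Min {i. \<nu> $ i ~= 0} \<in> {i. \<nu> $ i ~= 0}" by (intro Min_in) auto
 then show ?thesis by (auto simp: oriented_def)
qed

lemma not_oriented_both: "\<not> (oriented \<nu> & oriented (- \<nu>))"
 by (auto simp: oriented_def)

text \<open>The component \<open>z\<close> of \<open>\<nu>'\<close> orthogonal to
  \<open>\<nu>\<close>, scaled to length below \<open>e\<close>, is annihilated by
  \<open>\<nu>'\<close>; hence \<open>z\<close> vanishes. Small vectors have to suffice because
  \<open>unit_normal\<close> only inspects a ball.\<close>

lemma unit_vectors_same_kernel: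
 fixes \<nu> \<nu>' :: "'a::real_inner"
 assumes n: "norm \<nu> = 1" "norm \<nu>' = 1" and e: "e > 0"
  and ker: "\<And>z. norm z < e ==> z \<bullet> \<nu> = 0 ==> z \<bullet> \<nu>' = 0"
 shows "\<nu>' = \<nu> \<or> \<nu>' = - \<nu>"
proof -
 have nn: "\<nu> \<bullet> \<nu> = 1" "\<nu>' \<bullet> \<nu>' = 1" using n by (simp_all add: dot_square_norm)
 define z where "z = \<nu>' - (\<nu>' \<bullet> \<nu>) *\<^sub>R \<nu>"
 define \<delta> where "\<delta> = e / (2 * (norm z + 1))"
 have d: "\<delta> > 0" using e by (simp add: \<delta>_def add_nonneg_pos)
 have "norm (\<delta> *\<^sub>R z) < e"
 proof -
  have "norm (\<delta> *\<^sub>R z) = e * (norm z / (2 * (norm z + 1)))" using d e by (simp add: \<delta>_def)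
  also have "... < e * 1" using e by (intro mult_strict_left_mono) (simp_all add: divide_less_eq add_nonneg_pos)
  finally show ?thesis by simp
 qed
 moreover have "(\<delta> *\<^sub>R z) \<bullet> \<nu> = 0" by (simp add: z_def inner_diff_left nn)
 ultimately have "(\<delta> *\<^sub>R z) \<bullet> \<nu>' = 0" by (rule ker)
 then have "z \<bullet> \<nu>' = 0" using d by simp
 then have "z \<bullet> z = 0" by (simp add: z_def inner_diff_left inner_diff_right nn inner_commute)
 then have eq: "\<nu>' = (\<nu>' \<bullet> \<nu>) *\<^sub>R \<nu>" by (simp add: z_def)
 then have "\<bar>\<nu>' \<bullet> \<nu>\<bar> = 1" using n by (metis mult.right_neutral norm_scaleR)
 then show ?thesis using eq by (metis abs_eq_iff' abs_1 scaleR_minus1_left scaleR_one)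
qed

lemma oriented_hyperplane_unique:
 assumes "norm \<nu> = 1" "norm \<nu>' = 1" "oriented \<nu>" "oriented \<nu>'"
  and sub: "{x. x \<bullet> \<nu> = b} \<subseteq> {x. x \<bullet> \<nu>' = b'}"
 shows "\<nu> = \<nu>' & b = b'"
proof -
 have nn: "\<nu> \<bullet> \<nu> = 1" using assms(1) by (simp add: dot_square_norm)
 have "b *\<^sub>R \<nu> \<in> {x. x \<bullet> \<nu> = b}" using nn by simp
 then have p: "(b *\<^sub>R \<nu>) \<bullet> \<nu>' = b'" using sub by blast
 have "z \<bullet> \<nu>' = 0" if "z \<bullet> \<nu> = 0" for z
 proof -
  have "b *\<^sub>R \<nu> + z \<in> {x. x \<bullet> \<nu> = b}" using that nn by (simp add: inner_add_left)
  then have "(b *\<^sub>R \<nu> + z) \<bullet> \<nu>' = b'" using sub by blast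
  then show ?thesis using p by (simp add: inner_add_left)
 qed
 then have "\<nu>' = \<nu> \<or> \<nu>' = - \<nu>" by (intro unit_vectors_same_kernel[of _ _ 1] assms) auto
 then have "\<nu>' = \<nu>" using assms(3,4) not_oriented_both by blast
 then show ?thesis using p nn by simp
qed

lemma unit_normal_eq:
 assumes n: "norm \<nu> = 1" "oriented \<nu>" and e: "e > 0"
  and S: "\<And>y. y \<in> ball \<xi> e ==> y \<in> S \<longleftrightarrow> (y - \<xi>) \<bullet> \<nu> = 0"
 shows "unit_normal S \<xi> = \<nu>"
 unfolding unit_normal_def oriented_def[symmetric]
proof (rule the_equality)
 show "norm \<nu> = 1 & (\<exists>e>0. S \<inter> ball \<xi> e = {y \<in> ball \<xi> e. (y - \<xi>) \<bullet> \<nu> = 0}) & oriented \<nu>"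
  using n e S by (intro conjI exI[of _ e]) auto
next
 fix \<nu>' assume "norm \<nu>' = 1 & (\<exists>e>0. S \<inter> ball \<xi> e = {y \<in> ball \<xi> e. (y - \<xi>) \<bullet> \<nu>' = 0}) & oriented \<nu>'"
 then obtain e' where n': "norm \<nu>' = 1" "oriented \<nu>'" and e': "e' > 0"
  and S': "S \<inter> ball \<xi> e' = {y \<in> ball \<xi> e'. (y - \<xi>) \<bullet> \<nu>' = 0}" by auto
 have "\<nu>' = \<nu> \<or> \<nu>' = - \<nu>"
 proof (rule unit_vectors_same_kernel[OF n(1) n'(1), of "min e e'"])
  fix z assume z: "norm z < min e e'" "z \<bullet> \<nu> = 0"
  have "\<xi> + z \<in> ball \<xi> e" "\<xi> + z \<in> ball \<xi> e'" using z by (simp_all add: dist_norm)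
  then have "\<xi> + z \<in> S \<inter> ball \<xi> e'" using S[of "\<xi> + z"] z by simp
  then show "z \<bullet> \<nu>' = 0" unfolding S' by simp
 qed (use e e' in simp)
 then show "\<nu>' = \<nu>" using n(2) n'(2) not_oriented_both by blast
qed

lemma polytope_oriented_hull:
 fixes p :: "'n::{finite,linorder} point set"
 assumes "aff_dim p = int CARD('n) - 1"
 shows "\<exists>\<nu> b. norm \<nu> = 1 & oriented \<nu> & affine hull p = {x. x \<bullet> \<nu> = b}"
proof -
 have "aff_dim p = int (DIM('n point) - 1)" using assms by (simp add: of_nat_diff)
 then have "\<exists>a c. a ~= 0 & affine hull p = {x. a \<bullet> x = c}" by (simp only: aff_dim_eq_hyperplane)
 then obtain a c where a: "a ~= 0" "affine hull p = {x. a \<bullet> x = c}" by blast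
 have hp: "affine hull p = {x. x \<bullet> (a /\<^sub>R norm a) = c / norm a}"
  unfolding a(2) using a(1) by (auto simp: inner_commute field_simps)
 have "a /\<^sub>R norm a ~= 0" using a(1) by simp
 then consider "oriented (a /\<^sub>R norm a)" | "oriented (- (a /\<^sub>R norm a))" using oriented_or_uminus by blast
 then show ?thesis
 proof cases
  case 1
  then show ?thesis using hp a(1) by (intro exI[of _ "a /\<^sub>R norm a"]) auto
 next
  case 2
  have "affine hull p = {x. x \<bullet> (- (a /\<^sub>R norm a)) = - (c / norm a)}" unfolding hp by (auto simp: field_simps)
  then show ?thesis using 2 a(1) by (intro exI[of _ "- (a /\<^sub>R norm a)"]) auto
 qed
qed

text \<open>By Lindelof, countably many of the balls cover \<open>Q\<close>, and each of them meets
  only finitely many members.\<close>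

lemma locally_finite_countable:
 fixes Q :: "'a::euclidean_space set"
 assumes lf: "\<And>x. x \<in> Q ==> \<exists>e>0. finite {p\<in>\<P>. p \<inter> ball x e ~= {}}"
  and meets: "\<And>p. p \<in> \<P> ==> p \<inter> Q ~= {}"
 shows "countable \<P>"
proof -
 obtain e where e: "\<And>x. x \<in> Q ==> e x > 0" "\<And>x. x \<in> Q ==> finite {p\<in>\<P>. p \<inter> ball x (e x) ~= {}}"
  using lf by metis
 obtain F where F: "F \<subseteq> (%x. ball x (e x)) ` Q" "countable F" "\<Union>F = \<Union>((%x. ball x (e x)) ` Q)"
  using Lindelof[of "(%x. ball x (e x)) ` Q"] by blast
 have "\<P> \<subseteq> (\<Union>B\<in>F. {p\<in>\<P>. p \<inter> B ~= {}})"
 proof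
  fix p assume p: "p \<in> \<P>"
  then obtain x where "x \<in> p" "x \<in> Q" using meets by blast
  then have "x \<in> \<Union>F" unfolding F(3) using e(1)[of x] by (intro UN_I[of x]) auto
  then show "p \<in> (\<Union>B\<in>F. {p\<in>\<P>. p \<inter> B ~= {}})" using p \<open>x \<in> p\<close> by blast
 qed
 moreover have "countable (\<Union>B\<in>F. {p\<in>\<P>. p \<inter> B ~= {}})"
  using F(1,2) e(2) by (intro countable_UN) (auto intro!: countable_finite)
 ultimately show ?thesis by (rule countable_subset)
qed

text \<open>The pairs \<open>(\<nu> i, b i)\<close> enumerate the hyperplanes that carry the
  interfaces, and \<open>B\<close> collects the points where the geometry may fail to be locally
  flat. The enumeration may repeat a hyperplane, so uniqueness off \<open>B\<close> compares normals
  and offsets instead of indices. Near a regular point the union of all interfaces up to level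
  \<open>K\<close> is a single piece of hyperplane.\<close>

locale regular_network =
 fixes N :: "'n::{finite,linorder} network" and \<nu> :: "nat => 'n point" and b :: "nat => real"
  and B :: "'n point set"
 assumes network: "multiscale_interface_network N"
  and norm_normal: "\<And>i. norm (\<nu> i) = 1" and oriented_normal: "\<And>i. oriented (\<nu> i)"
  and B_borel [measurable]: "B \<in> sets borel"
  and hausdorff_B: "hausdorff_outer (CARD('n) - 1) B = 0"
  and AE_line_avoids_B: "\<And>h. AE x in lborel. \<forall>t. x + t *\<^sub>R h \<notin> B"
  and iface_covered: "\<And>k \<xi>. 1 <= k ==> \<xi> \<in> iface N k ==> \<exists>i. \<xi> \<bullet> \<nu> i = b i"
  and unique_hyperplane: "\<And>\<xi> i j. \<xi> \<notin> B ==> \<xi> \<bullet> \<nu> i = b i ==> \<xi> \<bullet> \<nu> j = b j ==> \<nu> i = \<nu> j & b i = b j"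
  and locally_flat: "\<And>k K \<xi> i. 1 <= k ==> k <= K ==> \<xi> \<in> iface N k ==> \<xi> \<notin> B ==> \<xi> \<bullet> \<nu> i = b i ==>
   \<exists>e>0. ball \<xi> e \<subseteq> region N \<and>
    (\<forall>y\<in>ball \<xi> e. (y \<in> iface N k \<longleftrightarrow> y \<bullet> \<nu> i = b i) & (y \<in> iface_upto N K \<longleftrightarrow> y \<bullet> \<nu> i = b i))"

text \<open>Near \<open>x\<close> only finitely many closed members matter, so those that do not
  contain \<open>x\<close> stay at a positive distance from it.\<close>

lemma closed_pieces_near:
 fixes \<P> :: "'a::metric_space set set"
 assumes fin: "\<exists>e>0. finite {p\<in>\<P>. p \<inter> ball x e ~= {}}" and cl: "\<And>p. p \<in> \<P> ==> closed p"
 shows "\<exists>e>0. \<forall>p\<in>\<P>. p \<inter> ball x e ~= {} --> x \<in> p"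
proof -
 obtain e0 where e0: "e0 > 0" "finite {p\<in>\<P>. p \<inter> ball x e0 ~= {}}" using fin by auto
 define F where "F = {p\<in>\<P>. p \<inter> ball x e0 ~= {} & x \<notin> p}"
 have F: "finite F" by (rule finite_subset[OF _ e0(2)]) (auto simp: F_def)
 have "closed (\<Union>F)" using F cl by (intro closed_Union) (auto simp: F_def)
 then have "open (- \<Union>F)" by (simp add: open_Compl)
 moreover have "x \<in> - \<Union>F" by (auto simp: F_def)
 ultimately obtain e1 where e1: "e1 > 0" "ball x e1 \<subseteq> - \<Union>F" by (rule openE)
 show ?thesis
 proof (intro exI[of _ "min e0 e1"] conjI ballI impI)
  fix p assume p: "p \<in> \<P>" "p \<inter> ball x (min e0 e1) ~= {}"
  then obtain y where y: "y \<in> p" "y \<in> ball x e0" "y \<in> ball x e1" by auto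
  show "x \<in> p"
  proof (rule ccontr)
   assume "x \<notin> p"
   then have "p \<in> F" using p y by (auto simp: F_def)
   then show False using y e1 by auto
  qed
 qed (use e0 e1 in auto)
qed

theorem regular_network_exists:
 fixes N :: "'n::{finite,linorder} network"
 assumes net: "multiscale_interface_network N"
 shows "\<exists>\<nu> b B. regular_network N \<nu> b B"
proof -
 have Qo: "open (region N)" using net by (simp add: multiscale_interface_network_def)
 have ifs: "iface N k \<subseteq> region N" "piecewise_affine (region N) (iface N k)" if "k >= 1" for k
  using net that by (auto simp: multiscale_interface_network_def)
 define good where "good k \<P> \<longleftrightarrow> (\<forall>p\<in>\<P>. polytope p & aff_dim p = int CARD('n) - 1) \<and>
   (\<forall>x\<in>region N. \<exists>e>0. finite {p\<in>\<P>. p \<inter> ball x e ~= {}}) \<and>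
   (\<Union>p\<in>\<P>. rel_interior p) \<subseteq> iface N k & iface N k \<subseteq> \<Union>\<P>" for k \<P>
 have "\<forall>k. \<exists>\<P>. k >= 1 --> good k \<P>"
  using ifs(2) unfolding piecewise_affine_def good_def by simp
 from choice[OF this] obtain P where "\<forall>k. k >= 1 --> good k (P k)" by blast
 then have good: "good k (P k)" if "k >= 1" for k using that by blast
 have P: "\<And>k p. k >= 1 ==> p \<in> P k ==> polytope p"
  "\<And>k p. k >= 1 ==> p \<in> P k ==> aff_dim p = int CARD('n) - 1"
  "\<And>k x. k >= 1 ==> x \<in> region N ==> \<exists>e>0. finite {p\<in>P k. p \<inter> ball x e ~= {}}"
  "\<And>k p. k >= 1 ==> p \<in> P k ==> rel_interior p \<subseteq> iface N k"
  "\<And>k. k >= 1 ==> iface N k \<subseteq> \<Union>(P k)"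
  using good unfolding good_def by blast+
 have ne: "rel_interior p ~= {}" if "k >= 1" "p \<in> P k" for k p
 proof -
  have "p ~= {}" using P(2)[OF that] aff_dim_empty[of p] by auto
  then show ?thesis using P(1)[OF that] polytope_imp_convex rel_interior_eq_empty by blast
 qed
 have cP: "countable (P k)" if k: "k >= 1" for k
 proof (rule locally_finite_countable)
  show "\<exists>e>0. finite {p\<in>P k. p \<inter> ball x e ~= {}}" if "x \<in> region N" for x by (rule P(3)[OF k that])
  show "p \<inter> region N ~= {}" if "p \<in> P k" for p
   using ne[OF k that] P(4)[OF k that] ifs(1)[OF k] rel_interior_subset by blast
 qed
 define AP where "AP = (\<Union>k\<in>{1..}. P k)"
 have cAP: "countable AP" unfolding AP_def using cP by (intro countable_UN) auto
 have "\<exists>q. norm (fst q) = 1 & oriented (fst q) & affine hull p = {x. x \<bullet> fst q = snd q}" if "p \<in> AP" for p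
  using polytope_oriented_hull[of p] P(2) that by (force simp: AP_def)
 then obtain hyp where hyp: "\<And>p. p \<in> AP ==> norm (fst (hyp p)) = 1" "\<And>p. p \<in> AP ==> oriented (fst (hyp p))"
  "\<And>p. p \<in> AP ==> affine hull p = {x. x \<bullet> fst (hyp p) = snd (hyp p)}"
  by metis
 have "\<exists>u. norm u = 1 & oriented (u :: 'n point)"
 proof -
  obtain u :: "'n point" where u: "u \<in> Basis" using nonempty_Basis by blast
  then have "norm u = 1" "u ~= 0" by auto
  then show ?thesis using oriented_or_uminus[of u] by (metis norm_minus_cancel)
 qed
 then obtain u :: "'n point" where u: "norm u = 1" "oriented u" by blast
 \<comment> \<open>The extra pair keeps \<open>H\<close> nonempty, so that it can be enumerated even
   if no polytope occurs.\<close>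
 define H where "H = insert (u, 0) (hyp ` AP)"
 have H: "countable H" "H ~= {}" using cAP by (auto simp: H_def)
 have Hp: "norm (fst q) = 1 & oriented (fst q)" if "q \<in> H" for q using that hyp u by (auto simp: H_def)
 define \<nu> where "\<nu> i = fst (from_nat_into H i)" for i
 define b where "b i = snd (from_nat_into H i)" for i
 have inH: "(\<nu> i, b i) \<in> H" for i by (simp add: \<nu>_def b_def from_nat_into H)
 have enum: "\<exists>i. \<nu> i = fst q & b i = snd q" if "q \<in> H" for q
  using from_nat_into_surj[OF H(1) that] by (auto simp: \<nu>_def b_def)
 \<comment> \<open>The exceptional set is built from affine hulls of facets and from intersections
   of two different hyperplanes, all of dimension at most \<open>d - 2\<close>. Off these, a point
   of a polytope lies in its relative interior, and all polytopes through the point span the same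
   hyperplane.\<close>
 define A1 where "A1 = {affine hull F |F p. p \<in> AP & F facet_of p}"
 define A2 where "A2 = {{x. x \<bullet> fst q = snd q} \<inter> {x. x \<bullet> fst r = snd r} |q r. q \<in> H & r \<in> H & q ~= r}"
 have poly: "polytope p" if "p \<in> AP" for p using that P(1) by (auto simp: AP_def)
 have cA: "countable (A1 \<union> A2)"
 proof -
  have "A1 \<subseteq> (\<Union>p\<in>AP. (%F. affine hull F) ` {F. F facet_of p})" by (auto simp: A1_def)
  moreover have "countable (\<Union>p\<in>AP. (%F. affine hull F) ` {F. F facet_of p})"
   using cAP poly finite_polytope_facets by (intro countable_UN) (auto intro!: countable_finite)
  moreover have "A2 \<subseteq> (%(q, r). {x. x \<bullet> fst q = snd q} \<inter> {x. x \<bullet> fst r = snd r}) ` (H \<times> H)"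
  proof
   fix A assume "A \<in> A2"
   then obtain q r where "A = {x. x \<bullet> fst q = snd q} \<inter> {x. x \<bullet> fst r = snd r}" "q \<in> H" "r \<in> H"
    unfolding A2_def by blast
   then show "A \<in> (%(q, r). {x. x \<bullet> fst q = snd q} \<inter> {x. x \<bullet> fst r = snd r}) ` (H \<times> H)"
    by (intro image_eqI[of _ _ "(q, r)"]) auto
  qed
  moreover have "countable ((%(q, r). {x. x \<bullet> fst q = snd q} \<inter> {x. x \<bullet> fst r = snd r}) ` (H \<times> H))"
   using H(1) by (intro countable_image countable_SIGMA) auto
  ultimately show ?thesis by (blast intro: countable_subset)
 qed
 have low: "aff_dim A < int DIM('n point) - 1 & closed A" if "A \<in> A1 \<union> A2" for A
  using that
 proof
  assume "A \<in> A1"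
  then obtain F p where F: "A = affine hull F" "p \<in> AP" "F facet_of p" by (auto simp: A1_def)
  then have "aff_dim p = int CARD('n) - 1" using P(2) by (auto simp: AP_def)
  then show ?thesis using F by (auto simp: facet_of_def)
 next
  assume "A \<in> A2"
  then obtain q r where qr: "A = {x. x \<bullet> fst q = snd q} \<inter> {x. x \<bullet> fst r = snd r}" "q \<in> H" "r \<in> H" "q ~= r"
   by (auto simp: A2_def)
  have hyps: "{x. x \<bullet> fst q = snd q} = {x. fst q \<bullet> x = snd q}" "{x. x \<bullet> fst r = snd r} = {x. fst r \<bullet> x = snd r}"
   by (simp_all add: inner_commute)
  have nsub: "\<not> {x. x \<bullet> fst q = snd q} \<subseteq> {x. x \<bullet> fst r = snd r}"
   using oriented_hyperplane_unique[of "fst q" "fst r" "snd q" "snd r"] Hp qr by (auto simp: prod_eq_iff)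
  have "fst q ~= 0" using Hp[OF qr(2)] by auto
  then have "aff_dim {x. fst q \<bullet> x = snd q} = int CARD('n) - 1" by (simp add: aff_dim_hyperplane)
  moreover have "aff_dim A = -1 \<or> aff_dim A = aff_dim {x. fst q \<bullet> x = snd q} - 1"
   using aff_dim_affine_Int_hyperplane[OF affine_hyperplane[of "fst q" "snd q"], of "fst r" "snd r"] nsub
   unfolding qr(1) hyps by (auto split: if_splits)
  moreover have "closed A" unfolding qr(1) hyps by (intro closed_Int closed_hyperplane)
  ultimately show ?thesis
  proof -
   have nonempty: "A ~= {} ==> aff_dim A ~= -1" by (simp add: aff_dim_empty)
   assume a: "aff_dim {x. fst q \<bullet> x = snd q} = int CARD('n) - 1"
    "aff_dim A = -1 \<or> aff_dim A = aff_dim {x. fst q \<bullet> x = snd q} - 1" "closed A"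
   have "A ~= {} --> aff_dim A = int CARD('n) - 2" using a nonempty by auto
   then have "aff_dim A < int CARD('n) - 1 \<or> A = {}" by auto
   then show ?thesis
   proof
    \<comment> \<open>The empty set has dimension \<open>-1\<close>, which is below
      \<open>CARD('n) - 1\<close> also in dimension one.\<close>
    assume "A = {}"
    moreover have "CARD('n) > 1 \<or> CARD('n) = 1" using zero_less_card_finite[where 'a = 'n] by linarith
    ultimately show ?thesis using a by auto
   qed (use a in simp)
  qed
 qed
 define B where "B = \<Union>(A1 \<union> A2)"
 have Bb: "B \<in> sets borel" unfolding B_def using low by (intro sets.countable_Union cA) (auto intro: borel_closed)
 have HB: "hausdorff_outer (CARD('n) - 1) B = 0"
 proof -
  have "A \<in> null_sets (hausdorff_measure (CARD('n) - 1))" if "A \<in> A1 \<union> A2" for A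
   using hausdorff_low_dim[of A] low[OF that] by (intro hausdorff_null_measurable) simp
  then have "(\<Union>A\<in>A1 \<union> A2. A) \<in> null_sets (hausdorff_measure (CARD('n) - 1))"
   by (intro null_sets_UN'[OF cA])
  then have "\<Union>(A1 \<union> A2) \<in> null_sets (hausdorff_measure (CARD('n) - 1))" by simp
  then show ?thesis unfolding B_def null_sets_def by (auto simp: emeasure_hausdorff_measure)
 qed
 have lineB: "AE x in lborel. \<forall>t. x + t *\<^sub>R h \<notin> B" for h :: "'n point"
 proof -
  have "AE x in lborel. \<forall>A\<in>A1 \<union> A2. \<forall>t. x + t *\<^sub>R h \<notin> A"
   using low AE_line_avoids_low_dim by (subst AE_ball_countable[OF cA]) blast
  then show ?thesis by eventually_elim (auto simp: B_def)
 qed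
 have unique: "\<nu> i = \<nu> j & b i = b j" if "\<xi> \<notin> B" "\<xi> \<bullet> \<nu> i = b i" "\<xi> \<bullet> \<nu> j = b j" for \<xi> i j
 proof (rule ccontr)
  assume "\<not> ?thesis"
  then have "{x. x \<bullet> \<nu> i = b i} \<inter> {x. x \<bullet> \<nu> j = b j} \<in> A2"
   unfolding A2_def using inH[of i] inH[of j]
   by (intro CollectI exI[of _ "(\<nu> i, b i)"] exI[of _ "(\<nu> j, b j)"]) auto
  then show False using that by (auto simp: B_def)
 qed
 have cov: "\<exists>i. \<xi> \<bullet> \<nu> i = b i & affine hull p = {x. x \<bullet> \<nu> i = b i}" if "p \<in> AP" "\<xi> \<in> p" for \<xi> p
 proof -
  have "hyp p \<in> H" using that by (simp add: H_def)
  from enum[OF this] obtain i where i: "\<nu> i = fst (hyp p)" "b i = snd (hyp p)" by blast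
  have "\<xi> \<in> affine hull p" using that hull_subset by fastforce
  then show ?thesis using hyp(3)[OF that(1)] i by (intro exI[of _ i]) auto
 qed
 have flat: "\<exists>e>0. ball \<xi> e \<subseteq> region N \<and>
    (\<forall>y\<in>ball \<xi> e. (y \<in> iface N k \<longleftrightarrow> y \<bullet> \<nu> i = b i) & (y \<in> iface_upto N K \<longleftrightarrow> y \<bullet> \<nu> i = b i))"
  if k: "1 <= k" "k <= K" and \<xi>: "\<xi> \<in> iface N k" "\<xi> \<notin> B" and i: "\<xi> \<bullet> \<nu> i = b i" for k K \<xi> i
 proof -
  have \<xi>Q: "\<xi> \<in> region N" using ifs(1)[OF k(1)] \<xi> by auto
  obtain p where p: "p \<in> P k" "\<xi> \<in> p" using P(5)[OF k(1)] \<xi> by auto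
  have pAP: "p \<in> AP" using p k by (auto simp: AP_def)
  have hull: "affine hull q = {x. x \<bullet> \<nu> i = b i}" if "q \<in> AP" "\<xi> \<in> q" for q
   using cov[OF that] unique[OF \<xi>(2) i] by auto
  have "\<xi> \<in> rel_interior p"
  proof (rule ccontr)
   assume "\<xi> \<notin> rel_interior p"
   then have "\<xi> \<in> rel_frontier p" using p closure_subset by (auto simp: rel_frontier_def)
   then obtain F where "F facet_of p" "\<xi> \<in> F"
    using rel_frontier_of_polyhedron[OF polytope_imp_polyhedron[OF poly[OF pAP]]] by auto
   then have "\<xi> \<in> affine hull F" "affine hull F \<in> A1" using pAP hull_subset by (fastforce simp: A1_def)+
   then show False using \<xi>(2) by (auto simp: B_def)
  qed
  then obtain e1 where e1: "e1 > 0" "ball \<xi> e1 \<inter> affine hull p \<subseteq> rel_interior p"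
   using openin_rel_interior[of p] unfolding openin_contains_ball by blast
  obtain e2 where e2: "e2 > 0" "ball \<xi> e2 \<subseteq> region N" using Qo \<xi>Q by (rule openE)
  have "\<exists>e>0. \<forall>q\<in>P l. q \<inter> ball \<xi> e ~= {} --> \<xi> \<in> q" if "l \<in> {1..K}" for l
   using that P(1) by (intro closed_pieces_near P(3) \<xi>Q) (auto intro: polytope_imp_closed)
  then obtain e3 where e3: "\<And>l. l \<in> {1..K} ==> e3 l > 0"
   "\<And>l q. l \<in> {1..K} ==> q \<in> P l ==> q \<inter> ball \<xi> (e3 l) ~= {} ==> \<xi> \<in> q" by metis
  \<comment> \<open>\<open>e1\<close> places the hyperplane part of the ball inside the interface,
    \<open>e2\<close> keeps the ball in the domain, and the \<open>e3 l\<close> exclude polytopes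
    that do not pass through \<open>\<xi>\<close>; those that do lie in the same hyperplane.\<close>
  define e where "e = Min (insert e1 (insert e2 (e3 ` {1..K})))"
  have e: "e > 0" using e1 e2 e3 by (auto simp: e_def)
  have le: "e <= e1" "e <= e2" "\<And>l. l \<in> {1..K} ==> e <= e3 l"
   unfolding e_def by (rule Min_le; blast)+
  have sub: "y \<bullet> \<nu> i = b i" if y: "y \<in> ball \<xi> e" "y \<in> iface_upto N K" for y
  proof -
   obtain l where l: "l \<in> {1..K}" "y \<in> iface N l" using y by (auto simp: iface_upto_def)
   then obtain q where q: "q \<in> P l" "y \<in> q" using P(5)[of l] by auto
   have "y \<in> q \<inter> ball \<xi> (e3 l)" using q(2) y(1) le(3)[OF l(1)] by auto
   then have "\<xi> \<in> q" using e3(2)[OF l(1) q(1)] by blast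
   then have "affine hull q = {x. x \<bullet> \<nu> i = b i}" using q l by (intro hull) (auto simp: AP_def)
   then show ?thesis using q(2) hull_subset[of q affine] by auto
  qed
  have sup: "y \<in> iface N k" if y: "y \<in> ball \<xi> e" "y \<bullet> \<nu> i = b i" for y
  proof -
   have "y \<in> ball \<xi> e1 \<inter> affine hull p" using y le(1) hull[OF pAP p(2)] by auto
   then show ?thesis using e1(2) P(4)[OF k(1) p(1)] by blast
  qed
  have up: "iface N k \<subseteq> iface_upto N K" using k by (auto simp: iface_upto_def)
  show ?thesis
  proof (intro exI[of _ e] conjI ballI)
   show "ball \<xi> e \<subseteq> region N" using e2(2) le(2) by auto
  qed (use e sub sup up in blast)+
 qed
 have "regular_network N \<nu> b B"
 proof
  show "norm (\<nu> i) = 1" "oriented (\<nu> i)" for i using Hp[OF inH[of i]] by auto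
  show "\<exists>i. \<xi> \<bullet> \<nu> i = b i" if "1 <= k" "\<xi> \<in> iface N k" for k \<xi>
   using P(5)[OF that(1)] that cov by (fastforce simp: AP_def)
 qed (use net Bb HB lineB unique flat in auto)
 then show ?thesis by blast
qed

section \<open>Piecewise smooth functions along lines\<close>

text \<open>Induction on the number of exceptional points: the interval is split at one of them,
  where the jump is bounded by \<open>J\<close>. One-sided limits replace values at the ends, about
  which nothing is assumed. The gauge integral appears because \<open>g\<close> need not be
  absolutely integrable.\<close>

lemma piecewise_ftc:
 fixes w g J :: "real => real"
 assumes "finite T" "T \<subseteq> {a<..<b}" "a < b"
  and "\<And>t. t \<in> {a<..<b} - T ==> (w has_real_derivative g t) (at t)"
  and "(w \<longlongrightarrow> A) (at_right a)" "(w \<longlongrightarrow> E) (at_left b)"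
  and "\<And>t. t \<in> T ==> \<exists>L R. (w \<longlongrightarrow> L) (at_left t) & (w \<longlongrightarrow> R) (at_right t) & \<bar>R - L\<bar> <= J t"
 shows "\<exists>I. (g has_integral I) {a..b} & \<bar>E - A - I\<bar> <= (\<Sum>t\<in>T. J t)"
 using assms
proof (induction "card T" arbitrary: T a b A E rule: less_induct)
 case less
 show ?case
 proof (cases "T = {}")
  case True
  define w' where "w' t = (if t = a then A else if t = b then E else w t)" for t
  have lim: "(w' \<longlongrightarrow> l) F \<longleftrightarrow> (w \<longlongrightarrow> l) F" if "eventually (%t. t ~= a & t ~= b) F" for l F
   by (rule tendsto_cong) (use that in \<open>auto elim!: eventually_mono simp: w'_def\<close>)
  have d: "(w has_real_derivative g t) (at t)" if "t \<in> {a<..<b}" for t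
   using less.prems(4) True that by auto
  have "continuous_on {a..b} w'"
  proof (rule continuous_on_IccI)
   show "(w' \<longlongrightarrow> w' a) (at_right a)"
    using less.prems(3,5) eventually_at_right_less[of a] eventually_at_right_real[OF less.prems(3)]
    by (subst lim) (auto simp: w'_def elim: eventually_mono)
   show "(w' \<longlongrightarrow> w' b) (at_left b)"
    using less.prems(3,6) eventually_at_left_real[OF less.prems(3)]
    by (subst lim) (auto simp: w'_def elim: eventually_mono)
   fix t assume t: "a < t" "t < b"
   then have "isCont w t" using d[of t] DERIV_isCont by auto
   then have "(w \<longlongrightarrow> w' t) (at t)" using t by (simp add: isCont_def w'_def)
   moreover have "eventually (%s. s \<in> {a<..<b}) (at t)"
    using t by (intro eventually_at_in_open') auto
   ultimately show "(w' \<longlongrightarrow> w' t) (at t)"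
    by (subst lim) (auto elim: eventually_mono)
  qed (rule less.prems(3))
  moreover have "(w' has_vector_derivative g t) (at t)" if "t \<in> {a<..<b}" for t
  proof -
   have "(w' has_real_derivative g t) (at t)"
    by (rule has_field_derivative_transform_within_open[OF d[OF that], of "{a<..<b}"])
     (use that in \<open>auto simp: w'_def\<close>)
   then show ?thesis by (simp add: has_real_derivative_iff_has_vector_derivative)
  qed
  ultimately have "(g has_integral (w' b - w' a)) {a..b}"
   using less.prems(3) by (intro fundamental_theorem_of_calculus_interior) auto
  then show ?thesis using less.prems(3) True by (intro exI[of _ "w' b - w' a"]) (simp add: w'_def)
 next
  case False
  then obtain \<tau> where \<tau>: "\<tau> \<in> T" by auto
  then have ab: "a < \<tau>" "\<tau> < b" using less.prems(2) by auto
  obtain L R where LR: "(w \<longlongrightarrow> L) (at_left \<tau>)" "(w \<longlongrightarrow> R) (at_right \<tau>)" "\<bar>R - L\<bar> <= J \<tau>"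
   using less.prems(7)[OF \<tau>] by blast
  define T1 where "T1 = T \<inter> {a<..<\<tau>}"
  define T2 where "T2 = T \<inter> {\<tau><..<b}"
  have T: "T = insert \<tau> (T1 \<union> T2)" "\<tau> \<notin> T1 \<union> T2" "T1 \<inter> T2 = {}"
   using \<tau> less.prems(2) by (auto simp: T1_def T2_def)
  have fin: "finite T1" "finite T2" using less.prems(1) by (auto simp: T1_def T2_def)
  have "T1 \<subset> T" "T2 \<subset> T" using T \<tau> by auto
  then have card: "card T1 < card T" "card T2 < card T" using less.prems(1) by (auto intro: psubset_card_mono)
  obtain I1 where I1: "(g has_integral I1) {a..\<tau>}" "\<bar>L - A - I1\<bar> <= (\<Sum>t\<in>T1. J t)"
  proof -
   have "\<exists>I. (g has_integral I) {a..\<tau>} & \<bar>L - A - I\<bar> <= (\<Sum>t\<in>T1. J t)"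
   proof (rule less.hyps[OF card(1) fin(1) _ ab(1) _ less.prems(5) LR(1) less.prems(7)])
    fix t assume "t \<in> {a<..<\<tau>} - T1"
    then show "(w has_real_derivative g t) (at t)" using ab by (intro less.prems(4)) (auto simp: T1_def)
   qed (auto simp: T1_def)
   then show ?thesis using that by blast
  qed
  obtain I2 where I2: "(g has_integral I2) {\<tau>..b}" "\<bar>E - R - I2\<bar> <= (\<Sum>t\<in>T2. J t)"
  proof -
   have "\<exists>I. (g has_integral I) {\<tau>..b} & \<bar>E - R - I\<bar> <= (\<Sum>t\<in>T2. J t)"
   proof (rule less.hyps[OF card(2) fin(2) _ ab(2) _ LR(2) less.prems(6) less.prems(7)])
    fix t assume "t \<in> {\<tau><..<b} - T2"
    then show "(w has_real_derivative g t) (at t)" using ab by (intro less.prems(4)) (auto simp: T2_def)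
   qed (auto simp: T2_def)
   then show ?thesis using that by blast
  qed
  have "(g has_integral (I1 + I2)) {a..b}"
   using ab I1(1) I2(1) by (intro has_integral_combine[of a \<tau> b]) auto
  moreover have "(\<Sum>t\<in>T. J t) = J \<tau> + ((\<Sum>t\<in>T1. J t) + (\<Sum>t\<in>T2. J t))"
   unfolding T(1) using fin T(2,3) by (subst sum.insert) (auto simp: sum.union_disjoint)
  then have "\<bar>E - A - (I1 + I2)\<bar> <= (\<Sum>t\<in>T. J t)" using I1(2) I2(2) LR(3) by linarith
  ultimately show ?thesis by blast
 qed
qed

text \<open>If the right side is infinite there is nothing to show; otherwise the function is
  Lebesgue integrable and its Lebesgue integral agrees with the gauge integral. Finitely many
  changed values do no harm.\<close>

lemma has_integral_abs_le_nn_integral: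
 fixes g :: "real => real"
 assumes I: "(g has_integral I) {a..b}" and [measurable]: "f \<in> borel_measurable borel"
  and fin: "finite S" and eq: "\<And>t. t \<in> {a..b} - S ==> f t = g t"
 shows "ennreal \<bar>I\<bar> <= (LB t. indicator {a..b} t * ennreal \<bar>f t\<bar>)"
proof (cases "(LB t. indicator {a..b} t * ennreal \<bar>f t\<bar>) = top")
 case False
 define F where "F t = indicator {a..b} t *\<^sub>R f t" for t
 have [measurable]: "F \<in> borel_measurable borel" unfolding F_def by measurable
 have nF: "(LB t. ennreal (norm (F t))) = (LB t. indicator {a..b} t * ennreal \<bar>f t\<bar>)"
  by (rule nn_integral_cong) (auto simp: F_def indicator_def)
 then have int: "integrable lborel F" using False by (intro integrableI_bounded) (auto simp: less_top)
 have "(f has_integral I) {a..b}"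
  by (rule has_integral_spike_finite[OF fin eq I])
 then have "(F has_integral I) UNIV"
 proof -
  have "F = (%t. if t \<in> {a..b} then f t else 0)" by (auto simp: F_def)
  then show "(f has_integral I) {a..b} ==> ?thesis" using has_integral_restrict_UNIV[of "{a..b}" f I] by simp
 qed
 moreover have "(F has_integral integral\<^sup>L lborel F) UNIV" by (rule has_integral_integral_lborel[OF int])
 ultimately have "I = integral\<^sup>L lborel F" by (rule has_integral_unique)
 then have "ennreal \<bar>I\<bar> <= ennreal (integral\<^sup>L lborel (%t. norm (F t)))"
  by (simp add: ennreal_leI integral_norm_bound[of lborel F, simplified])
 also have "... = (LB t. ennreal (norm (F t)))"
  using int by (intro nn_integral_eq_integral[symmetric]) auto
 finally show ?thesis unfolding nF .
qed simp

section \<open>Measurability of the network and crossings of generic lines\<close>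

context regular_network
begin

abbreviation jmp where "jmp k == jump (iface N k)"

abbreviation C1 where "C1 == c1_level N"

abbreviation smooth where "smooth K == region N - iface_upto N K"

lemma open_region: "open (region N)" and bounded_region: "bounded (region N)" and region_ne: "region N ~= {}"
 using network by (simp_all add: multiscale_interface_network_def)

lemma iface_sub: "1 <= k ==> iface N k \<subseteq> region N"
 using network by (simp add: multiscale_interface_network_def)

lemma iface_disjoint: "1 <= k ==> 1 <= l ==> k ~= l ==> iface N k \<inter> iface N l = {}"
 using network by (simp add: multiscale_interface_network_def)

lemma cells_all:
 "\<forall>K\<ge>1. smooth K = \<Union>(cells N K) & pairwise disjnt (cells N K) \<and>
  (\<forall>G\<in>cells N K. G ~= {} & open G & simply_connected G & frontier G = frontier (closure G))"
 using network unfolding multiscale_interface_network_def by (elim conjE) assumption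

lemma cells_Union: "1 <= K ==> \<Union>(cells N K) = smooth K"
 and cells_disjoint: "1 <= K ==> pairwise disjnt (cells N K)"
 using cells_all by simp_all

lemma cell_props: "1 <= K ==> G \<in> cells N K ==> G ~= {} & open G & connected G"
 using cells_all simply_connected_imp_connected[of G] by simp

lemma iface_upto_mono: "K <= L ==> iface_upto N K \<subseteq> iface_upto N L"
 unfolding iface_upto_def by (intro UN_mono) auto

lemma iface_upto_sub: "iface_upto N K \<subseteq> region N"
 unfolding iface_upto_def using iface_sub by (intro UN_least) auto

lemma open_smooth_region: "1 <= K ==> open (smooth K)"
 by (subst cells_Union[symmetric]) (use cell_props in \<open>auto intro!: open_Union\<close>)

text \<open>Piecewise affinity leaves the relative boundaries of the pieces undetermined;
  measurability comes from the cells, which are open and exhaust the domain off the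
  interfaces.\<close>

lemma iface_upto_borel [measurable]: "iface_upto N K \<in> sets borel"
proof (cases "K >= 1")
 case True
 have "iface_upto N K = region N - (smooth K)" using iface_upto_sub by auto
 also have "... \<in> sets borel" using open_smooth_region[OF True] open_region by auto
 finally show ?thesis .
qed (auto simp: iface_upto_def)

lemma region_borel [measurable]: "region N \<in> sets borel"
 using open_region by simp

lemma iface_borel [measurable]:
 assumes "1 <= k"
 shows "iface N k \<in> sets borel"
proof -
 have "iface N k = iface_upto N k - iface_upto N (k - 1)"
 proof (intro set_eqI iffI)
  fix x assume x: "x \<in> iface N k"
  have "x \<notin> iface N l" if "l \<in> {1..k-1}" for l
  proof -
   have "1 <= l" "k ~= l" using that assms by auto
   then show ?thesis using iface_disjoint[OF assms] x by blast
  qed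
  then show "x \<in> iface_upto N k - iface_upto N (k - 1)" using x assms by (auto simp: iface_upto_def)
 next
  fix x assume x: "x \<in> iface_upto N k - iface_upto N (k - 1)"
  then obtain l where l: "l \<in> {1..k}" "x \<in> iface N l" by (auto simp: iface_upto_def)
  have "l \<notin> {1..k-1}" using x l(2) by (auto simp: iface_upto_def)
  then have "l = k" using l(1) by auto
  then show "x \<in> iface N k" using l(2) by simp
 qed
 also have "... \<in> sets borel" by measurable
 finally show ?thesis .
qed

lemma iface_all_eq: "iface_all N = (\<Union>K. iface_upto N K)"
proof (intro set_eqI iffI)
 fix x assume "x \<in> iface_all N"
 then obtain k where "k >= 1" "x \<in> iface N k" by (auto simp: iface_all_def)
 then show "x \<in> (\<Union>K. iface_upto N K)" by (intro UN_I[of k]) (auto simp: iface_upto_def)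
qed (auto simp: iface_all_def iface_upto_def)

lemma iface_all_borel [measurable]: "iface_all N \<in> sets borel"
 unfolding iface_all_eq by measurable

lemma normal_ne_0: "\<nu> i ~= 0"
 using norm_normal[of i] by auto

lemma normal_inner [simp]: "\<nu> i \<bullet> \<nu> i = 1"
 using norm_normal[of i] by (simp add: dot_square_norm)

lemma AE_not_hyperplane: "AE x in lborel. \<forall>i. x \<bullet> \<nu> i ~= b i"
 unfolding AE_all_countable
 using AE_lborel_not_hyperplane[OF normal_ne_0] by (simp add: inner_commute)

lemma AE_not_iface_all: "AE x in lborel. x \<notin> iface_all N"
 using AE_not_hyperplane
proof eventually_elim
 case (elim x)
 then show ?case using iface_covered by (fastforce simp: iface_all_def)
qed

text \<open>For fixed \<open>h\<close> this excludes a null set of starting points. Since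
  \<open>x\<close> lies on no hyperplane, the line through it cannot run inside one, so every hit is
  transversal; since the line avoids \<open>B\<close>, every hit of an interface is at a regular
  point.\<close>

definition generic :: "'n point => 'n point => bool" where
 "generic h x \<longleftrightarrow> (\<forall>t. x + t *\<^sub>R h \<notin> B) & (\<forall>i. x \<bullet> \<nu> i ~= b i & (x + h) \<bullet> \<nu> i ~= b i)"

lemma AE_generic: "AE x in lborel. generic h x"
proof -
 have "AE x in lborel. (x + h) \<bullet> \<nu> i ~= b i" for i
 proof -
  have "AE x in lborel. \<nu> i \<bullet> x ~= b i - h \<bullet> \<nu> i" by (rule AE_lborel_not_hyperplane[OF normal_ne_0])
  then show ?thesis by eventually_elim (simp add: inner_add_left inner_commute algebra_simps)
 qed
 then have "AE x in lborel. \<forall>i. (x + h) \<bullet> \<nu> i ~= b i" by (simp add: AE_all_countable)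
 with AE_line_avoids_B[of h] AE_not_hyperplane show ?thesis
  by eventually_elim (simp add: generic_def)
qed

lemma generic_transversal:
 assumes "generic h x" "(x + t *\<^sub>R h) \<bullet> \<nu> i = b i"
 shows "h \<bullet> \<nu> i ~= 0" "hit_time (\<nu> i) (b i) h x = t"
proof -
 show *: "h \<bullet> \<nu> i ~= 0" using assms by (auto simp: generic_def inner_add_left)
 show "hit_time (\<nu> i) (b i) h x = t"
  using assms(2) * by (simp add: hit_time_def inner_add_left field_simps)
qed

lemma generic_not_iface: "generic h x ==> x \<notin> iface_upto N K" "generic h x ==> x + h \<notin> iface_upto N K"
 using iface_covered by (fastforce simp: generic_def iface_upto_def)+

lemma unit_normal_regular:
 assumes "1 <= k" "\<xi> \<in> iface N k" "\<xi> \<notin> B" "\<xi> \<bullet> \<nu> i = b i"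
 shows "unit_normal (iface N k) \<xi> = \<nu> i"
proof -
 obtain e where e: "e > 0" "\<forall>y\<in>ball \<xi> e. y \<in> iface N k \<longleftrightarrow> y \<bullet> \<nu> i = b i"
  using locally_flat[OF assms(1) order_refl assms(2-4)] by blast
 show ?thesis
  by (rule unit_normal_eq[OF norm_normal oriented_normal e(1)]) (use e(2) assms(4) in \<open>auto simp: inner_diff_left\<close>)
qed

text \<open>Transversal crossings at regular points persist when the end points of the segment are
 perturbed, so the bound for almost all segments applies to each segment with such crossings.\<close>

lemma crossing_count:
 assumes k: "1 <= k" and x: "x \<in> region N" and y: "x + s *\<^sub>R h \<in> region N" and s: "s > 0"
  and F: "finite F" "F \<subseteq> {0<..<s}" "\<And>t. t \<in> F ==> x + t *\<^sub>R h \<in> iface N k"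
  and gen: "generic h x"
 shows "card F <= crossings N k"
proof (rule ccontr)
 assume gt: "\<not> card F <= crossings N k"
 let ?y = "x + s *\<^sub>R h"
 have "\<exists>i. (x + t *\<^sub>R h) \<bullet> \<nu> i = b i" if "t \<in> F" for t using iface_covered[OF k F(3)[OF that]] .
 then obtain i where i: "\<And>t. t \<in> F ==> (x + t *\<^sub>R h) \<bullet> \<nu> (i t) = b (i t)" by metis
 have reg: "x + t *\<^sub>R h \<notin> B" for t using gen by (simp add: generic_def)
 have "\<exists>e>0. \<forall>z\<in>ball (x + t *\<^sub>R h) e. z \<in> iface N k \<longleftrightarrow> z \<bullet> \<nu> (i t) = b (i t)" if "t \<in> F" for t
  using locally_flat[OF k order_refl F(3)[OF that] reg i[OF that]] by blast
 then obtain e where e: "\<And>t. t \<in> F ==> e t > 0"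
  "\<And>t z. t \<in> F ==> z \<in> ball (x + t *\<^sub>R h) (e t) ==> z \<in> iface N k \<longleftrightarrow> z \<bullet> \<nu> (i t) = b (i t)"
  by metis
 \<comment> \<open>\<open>\<tau> t p\<close> and \<open>pt t p\<close> are the parameter and the
   point at which the segment with end points \<open>p\<close> meets the hyperplane of the crossing
   \<open>t\<close>. Transversality keeps the denominator away from 0, so both depend continuously
   on \<open>p\<close>.\<close>
 define \<tau> where "\<tau> t p = (b (i t) - fst p \<bullet> \<nu> (i t)) / ((snd p - fst p) \<bullet> \<nu> (i t))" for t and p :: "'n point \<times> 'n point"
 define pt where "pt t p = fst p + \<tau> t p *\<^sub>R (snd p - fst p)" for t and p :: "'n point \<times> 'n point"
 let ?p = "(x, ?y)"
 have den: "(snd ?p - fst ?p) \<bullet> \<nu> (i t) ~= 0" if "t \<in> F" for t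
  using generic_transversal(1)[OF gen i[OF that]] s by simp
 have \<tau>0: "\<tau> t ?p = t / s" if "t \<in> F" for t
 proof -
  have "b (i t) - x \<bullet> \<nu> (i t) = t * (h \<bullet> \<nu> (i t))" using i[OF that] by (simp add: inner_add_left)
  then show ?thesis using generic_transversal(1)[OF gen i[OF that]] s by (simp add: \<tau>_def)
 qed
 then have pt0: "pt t ?p = x + t *\<^sub>R h" if "t \<in> F" for t using that s by (simp add: pt_def)
 have cont_\<tau>: "(\<tau> t \<longlongrightarrow> \<tau> t ?p) (nhds ?p)" if "t \<in> F" for t
  unfolding \<tau>_def using den[OF that] by (intro tendsto_intros) (auto intro!: tendsto_intros filterlim_ident)
 have cont: "(pt t \<longlongrightarrow> pt t ?p) (nhds ?p)" if "t \<in> F" for t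
  unfolding pt_def by (intro tendsto_intros cont_\<tau> that) (auto intro!: tendsto_intros filterlim_ident)
 have ev1: "eventually (%p. pt t p \<in> open_segment (fst p) (snd p) \<inter> iface N k) (nhds ?p)" if t: "t \<in> F" for t
 proof -
  have "0 < t" "t < s" using F(2) t by auto
  then have "eventually (%p. \<tau> t p \<in> {0<..<1}) (nhds ?p)"
   using s by (intro topological_tendstoD[OF cont_\<tau>[OF t]]) (auto simp: \<tau>0[OF t])
  moreover have "eventually (%p. pt t p \<in> ball (x + t *\<^sub>R h) (e t)) (nhds ?p)"
   using e(1)[OF t] by (intro topological_tendstoD[OF cont[OF t]]) (auto simp: pt0[OF t])
  moreover have "eventually (%p. (snd p - fst p) \<bullet> \<nu> (i t) ~= 0) (nhds ?p)"
  proof -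
   have "((%p. (snd p - fst p) \<bullet> \<nu> (i t)) \<longlongrightarrow> (snd ?p - fst ?p) \<bullet> \<nu> (i t)) (nhds ?p)"
    by (intro tendsto_intros) (auto intro!: tendsto_intros filterlim_ident)
   then show ?thesis using den[OF t] by (rule tendsto_imp_eventually_ne)
  qed
  ultimately show ?thesis
  proof eventually_elim
   case (elim p)
   have "pt t p \<bullet> \<nu> (i t) = b (i t)" using elim(3) by (simp add: pt_def \<tau>_def inner_add_left)
   then have "pt t p \<in> iface N k" using e(2)[OF t elim(2)] by simp
   moreover have "fst p ~= snd p" using elim(3) by auto
   then have "pt t p \<in> open_segment (fst p) (snd p)"
    using elim(1) unfolding in_segment
    by (intro conjI exI[of _ "\<tau> t p"]) (auto simp: pt_def algebra_simps)
   ultimately show ?case by simp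
  qed
 qed
 have ev2: "eventually (%p. pt t p ~= pt t' p) (nhds ?p)" if "t \<in> F" "t' \<in> F" "t ~= t'" for t t'
 proof -
  have h: "h ~= 0" using generic_transversal(1)[OF gen i[OF that(1)]] by auto
  have "((%p. pt t p - pt t' p) \<longlongrightarrow> pt t ?p - pt t' ?p) (nhds ?p)"
   using that by (intro tendsto_diff cont)
  moreover have "pt t ?p - pt t' ?p ~= 0" using that h by (simp add: pt0)
  ultimately have "eventually (%p. pt t p - pt t' p ~= 0) (nhds ?p)" by (rule tendsto_imp_eventually_ne)
  then show ?thesis by eventually_elim auto
 qed
 have "eventually (%p. \<forall>t\<in>F. pt t p \<in> open_segment (fst p) (snd p) \<inter> iface N k) (nhds ?p)"
  using ev1 F(1) by (simp add: eventually_ball_finite_distrib)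
 moreover have "eventually (%p. \<forall>t\<in>F. \<forall>t'\<in>F. t ~= t' --> pt t p ~= pt t' p) (nhds ?p)"
  using ev2 F(1) by (simp add: eventually_ball_finite_distrib)
 moreover have "eventually (%p. p \<in> region N \<times> region N) (nhds ?p)"
  using x y open_region by (intro eventually_nhds_in_open open_Times) auto
 ultimately have "eventually (%p. fst p \<in> region N & snd p \<in> region N \<and>
   (finite (open_segment (fst p) (snd p) \<inter> iface N k) \<longrightarrow>
    card (open_segment (fst p) (snd p) \<inter> iface N k) > crossings N k)) (nhds ?p)"
 proof eventually_elim
  case (elim p)
  have inj: "inj_on (%t. pt t p) F" using elim(2) by (auto simp: inj_on_def)
  have "card F <= card (open_segment (fst p) (snd p) \<inter> iface N k)"
   if "finite (open_segment (fst p) (snd p) \<inter> iface N k)"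
   using elim(1) by (intro card_inj_on_le[OF inj _ that]) auto
  then show ?case using elim(3) gt by auto
 qed
 then obtain S where S: "open S" "?p \<in> S" "\<And>p. p \<in> S ==> fst p \<in> region N & snd p \<in> region N \<and>
   (finite (open_segment (fst p) (snd p) \<inter> iface N k) \<longrightarrow>
    card (open_segment (fst p) (snd p) \<inter> iface N k) > crossings N k)"
  unfolding eventually_nhds by blast
 have "AE z in (lborel :: ('n point \<times> 'n point) measure). fst z \<in> region N --> snd z \<in> region N \<longrightarrow>
      finite (open_segment (fst z) (snd z) \<inter> iface N k) \<and>
      card (open_segment (fst z) (snd z) \<inter> iface N k) <= crossings N k"
  using network k unfolding multiscale_interface_network_def lborel_prod by blast
 then have "AE z in lborel. z \<notin> S"
  by eventually_elim (use S(3) in fastforce)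
 \<comment> \<open>All pairs in the open set \<open>S\<close> violate the crossing bound, which
   holds almost everywhere; a nonempty open set is not null.\<close>
 then have "S \<in> null_sets lborel" using S(1) by (subst (asm) AE_iff_null_sets[symmetric]) auto
 then show False using S(1,2) open_not_negligible[of S] by (auto simp: negligible_iff_null_sets null_sets_completionI)
qed

end

lemma gradient_eq:
 assumes "GDERIV v x :> D"
 shows "gradient v x = D"
 unfolding gradient_def
proof (rule the_equality)
 show "GDERIV v x :> D" by (rule assms)
 fix E assume "GDERIV v x :> E"
 then have "(%h. h \<bullet> E) = (%h. h \<bullet> D)"
  using assms unfolding gderiv_def by (rule has_derivative_unique)
 then have "(E - D) \<bullet> E = (E - D) \<bullet> D" by meson
 then have "(E - D) \<bullet> (E - D) = 0" by (simp only: inner_diff_right)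
 then show "E = D" by simp
qed

lemma has_derivative_along_line:
 assumes "GDERIV v (x + t *\<^sub>R h) :> D"
 shows "((%t. v (x + t *\<^sub>R h)) has_real_derivative D \<bullet> h) (at t)"
proof -
 have "((%t. x + t *\<^sub>R h) has_derivative (%s. s *\<^sub>R h)) (at t)"
  by (auto intro!: derivative_eq_intros)
 from has_derivative_compose[OF this assms[unfolded gderiv_def]]
 moreover have "(%s. (s *\<^sub>R h) \<bullet> D) = (*) (D \<bullet> h)" by (auto simp: inner_commute)
 ultimately show ?thesis by (simp add: has_field_derivative_def)
qed

text \<open>Cauchy-Schwarz with weights \<open>(1 + c)^k\<close>: the factor is the geometric series
  of \<open>(1 + c)^(-k)\<close>, whose sum is \<open>1 + 1/c\<close>. The index 0 is reserved for
  the gradient, which carries the weight 1.\<close>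

lemma weighted_square_sum:
 fixes s :: "nat => real"
 assumes c: "c > 0"
 shows "(\<Sum>k=0..K. s k)^2 <= (1 + 1/c) * (\<Sum>k=0..K. (1 + c)^k * (s k)^2)"
proof -
 define p where "p k = sqrt ((1 + c)^k)" for k :: nat
 have p: "p k > 0" "(p k)^2 = (1 + c)^k" for k using c by (simp_all add: p_def)
 have "(\<Sum>k=0..K. s k)^2 = (\<Sum>k=0..K. (1 / p k) * (p k * s k))^2" using p(1) by (simp add: less_imp_neq[symmetric])
 also have "... <= (\<Sum>k=0..K. (1 / p k)^2) * (\<Sum>k=0..K. (p k * s k)^2)"
  by (rule Cauchy_Schwarz_ineq_sum)
 also have "... <= (1 + 1/c) * (\<Sum>k=0..K. (p k * s k)^2)"
 proof (rule mult_right_mono)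
  have "(\<Sum>k=0..K. (1 / p k)^2) = (\<Sum>k=0..K. (1/(1 + c))^k)"
   by (simp add: power_divide p(2) power_one_over)
  also have "... <= (\<Sum>k. (1/(1 + c))^k)" using c by (intro sum_le_suminf summable_geometric) auto
  also have "... = 1 + 1/c" using c by (subst suminf_geometric) (auto simp: field_simps)
  finally show "(\<Sum>k=0..K. (1 / p k)^2) <= 1 + 1/c" .
 qed (simp add: sum_nonneg)
 finally show ?thesis using c by (simp add: power_mult_distrib p(2) mult_right_mono sum_nonneg)
qed

lemma finite_card_bound:
 assumes "\<And>F. finite F ==> F \<subseteq> A ==> card F <= n"
 shows "finite A & card A <= n"
proof -
 have "finite A"
 proof (rule ccontr)
  assume "infinite A"
  then obtain F where "finite F" "card F = Suc n" "F \<subseteq> A" using infinite_arbitrarily_large by blast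
  then show False using assms[of F] by simp
 qed
 then show ?thesis using assms by auto
qed

section \<open>One-sided traces on the interfaces\<close>

context regular_network
begin

lemma connected_in_cell:
 assumes K: "1 <= K" and S: "connected S" "S ~= {}" "S \<subseteq> smooth K"
 shows "\<exists>G\<in>cells N K. S \<subseteq> G"
proof -
 obtain x where "x \<in> S" using S by auto
 then obtain G where G: "G \<in> cells N K" "x \<in> G" using S(3) cells_Union[OF K] by blast
 let ?V = "\<Union>(cells N K - {G})"
 have "G \<inter> S = {} \<or> ?V \<inter> S = {}"
 proof (rule connectedD[OF S(1)])
  show "open G" "open ?V" using cell_props[OF K] G(1) by auto
  show "G \<inter> ?V \<inter> S = {}"
   using cells_disjoint[OF K] G(1) by (auto simp: pairwise_def disjnt_def)
  show "S \<subseteq> G \<union> ?V" using S(3) cells_Union[OF K] by blast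
 qed
 then have "S \<subseteq> G" using G(2) \<open>x \<in> S\<close> S(3) cells_Union[OF K] by blast
 then show ?thesis using G(1) by blast
qed

lemma c1_extension:
 assumes u: "u \<in> C1 K" and G: "G \<in> cells N K"
 obtains v D where "continuous_on (closure G) v" "continuous_on (closure G) D"
  "\<And>x. x \<in> G ==> GDERIV v x :> D x" "\<And>x. x \<in> closure G ==> x \<notin> iface_upto N K ==> u x = v x"
proof -
 have "\<exists>v D. continuous_on (closure G) v & continuous_on (closure G) D \<and>
   (\<forall>x\<in>G. GDERIV v x :> D x) & (\<forall>x\<in>closure G - iface_upto N K. u x = v x)"
  using u G unfolding c1_level_def by blast
 then show ?thesis using that by blast
qed

lemma c1_gderiv:
 assumes K: "1 <= K" and u: "u \<in> C1 K" and G: "G \<in> cells N K" and x: "x \<in> G"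
  and vD: "\<And>x. x \<in> G ==> GDERIV v x :> D x" "\<And>x. x \<in> closure G ==> x \<notin> iface_upto N K ==> u x = v x"
 shows "GDERIV u x :> D x"
proof -
 have G': "open G" "G \<subseteq> smooth K" using cell_props[OF K G] cells_Union[OF K] G by blast+
 have uv: "v y = u y" if "y \<in> G" for y using vD(2)[of y] that G'(2) closure_subset[of G] by fastforce
 show ?thesis using vD(1)[OF x] unfolding gderiv_def
  by (rule has_derivative_transform_within_open[OF _ G'(1) x uv])
qed

lemma c1_gradient:
 assumes K: "1 <= K" and u: "u \<in> C1 K" and x: "x \<in> smooth K"
 shows "GDERIV u x :> gradient u x"
proof -
 obtain G where G: "G \<in> cells N K" "x \<in> G" using x cells_Union[OF K] by blast
 obtain v D where "\<And>x. x \<in> G ==> GDERIV v x :> D x" "\<And>x. x \<in> closure G ==> x \<notin> iface_upto N K ==> u x = v x"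
  using c1_extension[OF u G(1)] by metis
 from c1_gderiv[OF K u G this] gradient_eq show ?thesis by fastforce
qed

lemma c1_continuous:
 assumes K: "1 <= K" and u: "u \<in> C1 K"
 shows "continuous_on (smooth K) u" "continuous_on (smooth K) (gradient u)"
proof -
 have "isCont u x & isCont (gradient u) x" if x: "x \<in> smooth K" for x
 proof
  show "isCont u x" using c1_gradient[OF K u x] unfolding gderiv_def by (rule has_derivative_continuous)
  obtain G where G: "G \<in> cells N K" "x \<in> G" using x cells_Union[OF K] by blast
  obtain v D where vD: "continuous_on (closure G) D" "\<And>x. x \<in> G ==> GDERIV v x :> D x"
   "\<And>x. x \<in> closure G ==> x \<notin> iface_upto N K ==> u x = v x"
   using c1_extension[OF u G(1)] by metis
  have eq: "gradient u y = D y" if "y \<in> G" for y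
   by (rule gradient_eq) (rule c1_gderiv[OF K u G(1) that vD(2,3)])
  have "continuous_on G D" using vD(1) closure_subset by (rule continuous_on_subset)
  then have "continuous_on G (gradient u)" using eq by (metis continuous_on_cong)
  then show "isCont (gradient u) x"
   using cell_props[OF K G(1)] G(2) by (simp add: continuous_on_eq_continuous_at)
 qed
 then show "continuous_on (smooth K) u" "continuous_on (smooth K) (gradient u)"
  by (auto intro!: continuous_at_imp_continuous_on)
qed

text \<open>A connected set off the interfaces lies in a single cell, and the extension of
  \<open>u\<close> to the closure of that cell supplies all limits. Off the interfaces, in
  particular at the boundary of the domain, these limits are the values of \<open>u\<close>.\<close>

lemma c1_trace:
 assumes K: "1 <= K" and u: "u \<in> C1 K"
  and S: "connected S" "S ~= {}" "S \<subseteq> smooth K"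
 obtains v where "continuous_on (closure S) v" "\<And>z. z \<in> closure S ==> (u \<longlongrightarrow> v z) (at z within S)"
  "\<And>z. z \<in> closure S ==> z \<notin> iface_upto N K ==> u z = v z"
proof -
 obtain G where G: "G \<in> cells N K" "S \<subseteq> G" using connected_in_cell[OF K S] by blast
 obtain v where v: "continuous_on (closure G) v" "\<And>x. x \<in> closure G ==> x \<notin> iface_upto N K ==> u x = v x"
  using c1_extension[OF u G(1)] by metis
 have cl: "closure S \<subseteq> closure G" using G(2) by (rule closure_mono)
 show ?thesis
 proof (rule that[of v])
  show "continuous_on (closure S) v" using v(1) cl by (rule continuous_on_subset)
  fix z assume z: "z \<in> closure S"
  have "(v \<longlongrightarrow> v z) (at z within closure G)" using v(1) z cl by (auto simp: continuous_on)
  then have "(v \<longlongrightarrow> v z) (at z within S)"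
   using G(2) closure_subset by (rule tendsto_within_subset[OF _ order_trans])
  moreover have "eventually (%y. u y = v y) (at z within S)"
   unfolding eventually_at_filter
   by (rule always_eventually) (use S(3) v(2) cl closure_subset in blast)
  ultimately show "(u \<longlongrightarrow> v z) (at z within S)" by (simp add: tendsto_cong)
  show "u z = v z" if "z \<notin> iface_upto N K" using v(2) z cl that by blast
 qed
qed

text \<open>A half ball is convex and hence in one cell. The limit is stated within the whole half
  space, so that it applies to every transversal direction of approach.\<close>

lemma half_ball_trace:
 assumes K: "1 <= K" and u: "u \<in> C1 K" and \<mu>: "norm \<mu> = 1" and \<xi>: "\<xi> \<bullet> \<mu> = \<beta>" and e: "e > 0"
  and S: "ball \<xi> e \<inter> {y. y \<bullet> \<mu> > \<beta>} \<subseteq> smooth K"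
 obtains v where "continuous_on (ball \<xi> e \<inter> {y. y \<bullet> \<mu> = \<beta>}) v"
  "\<And>z. z \<in> ball \<xi> e ==> z \<bullet> \<mu> = \<beta> ==> (u \<longlongrightarrow> v z) (at z within {y. y \<bullet> \<mu> > \<beta>})"
proof -
 let ?H = "{y. y \<bullet> \<mu> > \<beta>}" and ?S = "ball \<xi> e \<inter> {y. y \<bullet> \<mu> > \<beta>}"
 have \<mu>\<mu>: "\<mu> \<bullet> \<mu> = 1" using \<mu> by (simp add: dot_square_norm)
 have Hhalf: "?H = {y. \<mu> \<bullet> y > \<beta>}" by (simp add: inner_commute)
 have conv: "convex ?S" unfolding Hhalf by (intro convex_Int convex_ball convex_halfspace_gt)
 have cl: "z \<in> closure ?S" if z: "z \<in> ball \<xi> e" "z \<bullet> \<mu> = \<beta>" for z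
 proof (unfold closure_approachable, intro allI impI)
  fix \<epsilon> :: real assume "\<epsilon> > 0"
  define \<delta> where "\<delta> = min \<epsilon> (e - dist \<xi> z) / 2"
  have d: "\<delta> > 0" "\<delta> < \<epsilon>" "\<delta> < e - dist \<xi> z" using \<open>\<epsilon> > 0\<close> z by (auto simp: \<delta>_def)
  have nd: "dist z (z + \<delta> *\<^sub>R \<mu>) = \<delta>" using d \<mu> by (simp add: dist_norm)
  have "dist \<xi> (z + \<delta> *\<^sub>R \<mu>) < e" using dist_triangle[of \<xi> "z + \<delta> *\<^sub>R \<mu>" z] nd d by linarith
  moreover have "(z + \<delta> *\<^sub>R \<mu>) \<bullet> \<mu> > \<beta>" using z d \<mu>\<mu> by (simp add: inner_add_left)
  ultimately show "\<exists>y\<in>?S. dist y z < \<epsilon>" using nd d by (intro bexI[of _ "z + \<delta> *\<^sub>R \<mu>"]) (auto simp: dist_commute)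
 qed
 have "?S ~= {}" using cl[of \<xi>] \<xi> e by auto
 then obtain v where v: "continuous_on (closure ?S) v" "\<And>z. z \<in> closure ?S ==> (u \<longlongrightarrow> v z) (at z within ?S)"
  using c1_trace[OF K u convex_connected[OF conv] _ S] by metis
 show ?thesis
 proof (rule that[of v])
  show "continuous_on (ball \<xi> e \<inter> {y. y \<bullet> \<mu> = \<beta>}) v" using cl by (intro continuous_on_subset[OF v(1)]) auto
  fix z assume z: "z \<in> ball \<xi> e" "z \<bullet> \<mu> = \<beta>"
  have "at z within ?H = at z within ?S" using z by (intro at_within_nhd[of z "ball \<xi> e"]) auto
  then show "(u \<longlongrightarrow> v z) (at z within ?H)" using v(2)[OF cl[OF z]] by simp
 qed
qed

lemma line_filterlim:
 assumes "s * (h \<bullet> \<mu>) > 0" "\<xi> \<bullet> \<mu> = \<beta>"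
 shows "filterlim (%t. \<xi> + (s * (t - t0)) *\<^sub>R h) (at \<xi> within {y. y \<bullet> \<mu> > \<beta>}) (at_right t0)"
proof -
 have "((%t. \<xi> + (s * (t - t0)) *\<^sub>R h) \<longlongrightarrow> \<xi> + (s * (t0 - t0)) *\<^sub>R h) (at_right t0)" by (intro tendsto_intros)
 moreover have "eventually (%t. \<xi> + (s * (t - t0)) *\<^sub>R h \<in> {y. y \<bullet> \<mu> > \<beta>} & \<xi> + (s * (t - t0)) *\<^sub>R h ~= \<xi>) (at_right t0)"
  using eventually_at_right_less[of t0]
 proof eventually_elim
  case (elim t)
  have "(t - t0) * (s * (h \<bullet> \<mu>)) > 0" using elim assms(1) by simp
  then have "(\<xi> + (s * (t - t0)) *\<^sub>R h) \<bullet> \<mu> > \<beta>"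
   using assms(2) by (simp add: inner_add_left mult_ac)
  then show ?case using assms(2) by auto
 qed
 ultimately show ?thesis by (simp add: filterlim_at)
qed

text \<open>\<open>vp\<close> and \<open>vm\<close> are the traces from the side to which
  \<open>\<nu> i\<close> points and from the opposite side, given on a whole piece of hyperplane in
  order to obtain continuity of the jump. The formula for the jump is stated off \<open>B\<close>,
  where \<open>unit_normal\<close> is known to be \<open>\<nu> i\<close>.\<close>

definition side_traces where
 "side_traces k u i \<xi> e vp vm \<longleftrightarrow> e > 0 \<and>
  continuous_on (ball \<xi> e \<inter> {y. y \<bullet> \<nu> i = b i}) vp \<and>
  continuous_on (ball \<xi> e \<inter> {y. y \<bullet> \<nu> i = b i}) vm \<and>
  (\<forall>z\<in>ball \<xi> e. z \<in> iface N k \<longleftrightarrow> z \<bullet> \<nu> i = b i) \<and>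
  (\<forall>z\<in>ball \<xi> e. z \<bullet> \<nu> i = b i \<longrightarrow>
   (u \<longlongrightarrow> vp z) (at z within {y. y \<bullet> \<nu> i > b i}) & (u \<longlongrightarrow> vm z) (at z within {y. y \<bullet> \<nu> i < b i}) \<and>
   (z \<notin> B --> jmp k u z = vp z - vm z))"

lemma side_traces_exist:
 assumes k: "1 <= k" "k <= K" and u: "u \<in> C1 K"
  and \<xi>: "\<xi> \<in> iface N k" "\<xi> \<notin> B" "\<xi> \<bullet> \<nu> i = b i"
 shows "\<exists>e vp vm. side_traces k u i \<xi> e vp vm"
proof -
 obtain e where e: "e > 0" "ball \<xi> e \<subseteq> region N"
  "\<And>y. y \<in> ball \<xi> e ==> y \<in> iface N k \<longleftrightarrow> y \<bullet> \<nu> i = b i"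
  "\<And>y. y \<in> ball \<xi> e ==> y \<in> iface_upto N K \<longleftrightarrow> y \<bullet> \<nu> i = b i"
  using locally_flat[OF k \<xi>] by blast
 have K: "1 <= K" using k by simp
 obtain vp where vp: "continuous_on (ball \<xi> e \<inter> {y. y \<bullet> \<nu> i = b i}) vp"
  "\<And>z. z \<in> ball \<xi> e ==> z \<bullet> \<nu> i = b i ==> (u \<longlongrightarrow> vp z) (at z within {y. y \<bullet> \<nu> i > b i})"
 proof (rule half_ball_trace[OF K u norm_normal[of i] \<xi>(3) e(1)])
  show "ball \<xi> e \<inter> {y. b i < y \<bullet> \<nu> i} \<subseteq> smooth K" using e(2,4) by force
 qed (use that in blast)
 obtain vm where vm: "continuous_on (ball \<xi> e \<inter> {y. y \<bullet> (- \<nu> i) = - b i}) vm"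
  "\<And>z. z \<in> ball \<xi> e ==> z \<bullet> (- \<nu> i) = - b i ==> (u \<longlongrightarrow> vm z) (at z within {y. y \<bullet> (- \<nu> i) > - b i})"
 proof (rule half_ball_trace[OF K u _ _ e(1)])
  show "ball \<xi> e \<inter> {y. - b i < y \<bullet> (- \<nu> i)} \<subseteq> smooth K" using e(2,4) by force
 qed (use \<xi>(3) norm_normal in auto)
 have J: "jmp k u z = vp z - vm z" if z: "z \<in> ball \<xi> e" "z \<bullet> \<nu> i = b i" "z \<notin> B" for z
 proof -
  have zk: "z \<in> iface N k" using e(3) z by simp
  have un: "unit_normal (iface N k) z = \<nu> i" by (rule unit_normal_regular[OF k(1) zk z(3,2)])
  have "((%s. u (z + (1 * (s - 0)) *\<^sub>R \<nu> i)) \<longlongrightarrow> vp z) (at_right 0)"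
   by (rule filterlim_compose[OF vp(2)[OF z(1,2)] line_filterlim]) (use z in auto)
  moreover have "((%s. u (z + (1 * (s - 0)) *\<^sub>R (- \<nu> i))) \<longlongrightarrow> vm z) (at_right 0)"
   by (rule filterlim_compose[OF vm(2) line_filterlim]) (use z in auto)
  ultimately have "((%s. u (z + s *\<^sub>R \<nu> i) - u (z - s *\<^sub>R \<nu> i)) \<longlongrightarrow> vp z - vm z) (at_right 0)"
   using tendsto_diff by fastforce
  then show ?thesis unfolding jump_def un by (intro tendsto_Lim) auto
 qed
 have "side_traces k u i \<xi> e vp vm"
  unfolding side_traces_def
 proof (intro conjI ballI impI)
  show "continuous_on (ball \<xi> e \<inter> {y. y \<bullet> \<nu> i = b i}) vm" using vm(1) by simp
  show "(u \<longlongrightarrow> vm z) (at z within {y. y \<bullet> \<nu> i < b i})" if "z \<in> ball \<xi> e" "z \<bullet> \<nu> i = b i" for z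
   using vm(2)[of z] that by simp
 qed (use e vp J in auto)
 then show ?thesis by blast
qed

text \<open>The traces exist within half spaces, so the approach along any transversal
  \<open>h\<close> gives the same limits as the approach along the normal. The direction of
  \<open>h\<close> only decides which side comes first, hence the absolute value.\<close>

lemma jump_along_line:
 assumes k: "1 <= k" "k <= K" and u: "u \<in> C1 K"
  and \<xi>: "x + t0 *\<^sub>R h \<in> iface N k" and gen: "generic h x"
 shows "\<exists>L R. ((%t. u (x + t *\<^sub>R h)) \<longlongrightarrow> L) (at_left t0) & ((%t. u (x + t *\<^sub>R h)) \<longlongrightarrow> R) (at_right t0) \<and>
  \<bar>R - L\<bar> <= \<bar>jmp k u (x + t0 *\<^sub>R h)\<bar>"
proof -
 let ?\<xi> = "x + t0 *\<^sub>R h"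
 obtain i where i: "?\<xi> \<bullet> \<nu> i = b i" using iface_covered[OF k(1) \<xi>] by blast
 have nB: "?\<xi> \<notin> B" using gen by (simp add: generic_def)
 obtain e vp vm where tr: "side_traces k u i ?\<xi> e vp vm"
  using side_traces_exist[OF k u \<xi> nB i] by blast
 define p where "p = vp ?\<xi>"
 define m where "m = vm ?\<xi>"
 have p: "(u \<longlongrightarrow> p) (at ?\<xi> within {y. y \<bullet> \<nu> i > b i})" and
  m: "(u \<longlongrightarrow> m) (at ?\<xi> within {y. y \<bullet> (- \<nu> i) > - b i})" and
  j: "jmp k u ?\<xi> = p - m"
  using tr i nB by (auto simp: p_def m_def side_traces_def)
 have right: "((%t. u (x + t *\<^sub>R h)) \<longlongrightarrow> l) (at_right t0)"
  if "(u \<longlongrightarrow> l) (at ?\<xi> within {y. y \<bullet> \<mu> > \<beta>})" "h \<bullet> \<mu> > 0" "?\<xi> \<bullet> \<mu> = \<beta>" for l \<mu> \<beta>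
 proof -
  have "((%t. u (?\<xi> + (1 * (t - t0)) *\<^sub>R h)) \<longlongrightarrow> l) (at_right t0)"
   by (rule filterlim_compose[OF that(1) line_filterlim]) (use that in auto)
  then show ?thesis by (simp add: algebra_simps)
 qed
 have left: "((%t. u (x + t *\<^sub>R h)) \<longlongrightarrow> l) (at_left t0)"
  if "(u \<longlongrightarrow> l) (at ?\<xi> within {y. y \<bullet> \<mu> > \<beta>})" "h \<bullet> \<mu> < 0" "?\<xi> \<bullet> \<mu> = \<beta>" for l \<mu> \<beta>
 proof -
  have "((%t. u (?\<xi> + ((-1) * (t - (- t0))) *\<^sub>R h)) \<longlongrightarrow> l) (at_right (- t0))"
   by (rule filterlim_compose[OF that(1) line_filterlim]) (use that in auto)
  then have "((%t. u (x + (- t) *\<^sub>R h)) \<longlongrightarrow> l) (at_right (- t0))" by (simp add: algebra_simps)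
  then show ?thesis by (simp add: filterlim_at_left_to_right)
 qed
 consider "h \<bullet> \<nu> i > 0" | "h \<bullet> \<nu> i < 0" using generic_transversal(1)[OF gen i] by linarith
 then show ?thesis
 proof cases
  case 1
  then show ?thesis using right[OF p 1 i] left[OF m] i j by (intro exI[of _ m] exI[of _ p]) auto
 next
  case 2
  then show ?thesis using left[OF p 2 i] right[OF m] i j by (intro exI[of _ p] exI[of _ m]) auto
 qed
qed

definition jabs :: "nat => ('n point => real) => 'n point => real" where
 "jabs K u \<xi> = (\<Sum>k=1..K. if \<xi> \<in> iface N k then \<bar>jmp k u \<xi>\<bar> else 0)"

lemma path_estimate:
 assumes K: "1 <= K" and u: "u \<in> C1 K" and gen: "generic h x" and h: "h ~= 0" and ab: "a < b'"
  and inside: "\<And>t. t \<in> {a<..<b'} ==> x + t *\<^sub>R h \<in> region N"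
  and ends: "x + a *\<^sub>R h \<notin> iface_upto N K" "x + b' *\<^sub>R h \<notin> iface_upto N K"
  and T: "T = {t\<in>{a<..<b'}. x + t *\<^sub>R h \<in> iface_upto N K}" "finite T"
 shows "\<exists>I. ((%t. gradient u (x + t *\<^sub>R h) \<bullet> h) has_integral I) {a..b'} \<and>
  \<bar>u (x + b' *\<^sub>R h) - u (x + a *\<^sub>R h) - I\<bar> <= (\<Sum>t\<in>T. jabs K u (x + t *\<^sub>R h))"
proof (rule piecewise_ftc[OF T(2) _ ab])
 let ?\<gamma> = "%t. x + t *\<^sub>R h"
 \<comment> \<open>Between an end point and the nearest crossing the path stays in one cell. The
   trace of that cell agrees with \<open>u\<close> at the end point, which is off the interfaces but
   may lie on the boundary of the domain.\<close>
 have lim: "((%t. u (?\<gamma> t)) \<longlongrightarrow> u (?\<gamma> t0)) F"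
  if cd: "c < d" "{c<..<d} \<subseteq> {a<..<b'} - T" and t0: "t0 \<in> {c, d}" "t0 \<in> {a, b'}"
   and ev: "eventually (%t. t \<in> {c<..<d}) F" and F: "(?\<gamma> \<longlongrightarrow> ?\<gamma> t0) F" for c d t0 F
 proof -
  let ?S = "?\<gamma> ` {c<..<d}"
  have "connected ?S" by (intro connected_continuous_image continuous_intros) auto
  moreover have "?S ~= {}" using cd by auto
  moreover have "?S \<subseteq> smooth K" using cd(2) inside T(1) by auto
  ultimately obtain v where v: "\<And>z. z \<in> closure ?S ==> (u \<longlongrightarrow> v z) (at z within ?S)"
   "\<And>z. z \<in> closure ?S ==> z \<notin> iface_upto N K ==> u z = v z"
   using c1_trace[OF K u] by metis
  have "?\<gamma> t0 \<in> closure ?S"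
  proof -
   have "?\<gamma> ` closure {c<..<d} \<subseteq> closure ?S"
    by (intro image_closure_subset continuous_intros closure_subset) auto
   moreover have "t0 \<in> closure {c<..<d}" using t0(1) cd(1) by auto
   ultimately show ?thesis by blast
  qed
  then have "(u \<longlongrightarrow> u (?\<gamma> t0)) (at (?\<gamma> t0) within ?S)" using v ends t0(2) by force
  moreover have "filterlim ?\<gamma> (at (?\<gamma> t0) within ?S) F"
   unfolding filterlim_at
  proof (rule conjI[OF _ F])
   show "eventually (%t. ?\<gamma> t \<in> ?S & ?\<gamma> t ~= ?\<gamma> t0) F" using ev
    by eventually_elim (use t0 h in auto)
  qed
  ultimately show ?thesis by (rule filterlim_compose)
 qed
 obtain c where c: "a < c" "c < b'" "{a<..<c} \<inter> T = {}"
 proof -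
  have "a < Min (insert b' T)" using T ab by auto
  then obtain c where "a < c" "c < Min (insert b' T)" using dense by blast
  then show ?thesis using that[of c] T(2) by fastforce
 qed
 obtain d where d: "a < d" "d < b'" "{d<..<b'} \<inter> T = {}"
 proof -
  have "Max (insert a T) < b'" using T ab by auto
  then obtain d where "Max (insert a T) < d" "d < b'" using dense by blast
  then show ?thesis using that[of d] T(2) by fastforce
 qed
 show "((%t. u (?\<gamma> t)) \<longlongrightarrow> u (?\<gamma> a)) (at_right a)"
  by (rule lim[of a c]) (use c in \<open>auto intro!: eventually_at_right_real[unfolded greaterThanLessThan_iff] tendsto_intros\<close>)
 show "((%t. u (?\<gamma> t)) \<longlongrightarrow> u (?\<gamma> b')) (at_left b')"
  by (rule lim[of d b']) (use d in \<open>auto intro!: eventually_at_left_real[unfolded greaterThanLessThan_iff] tendsto_intros\<close>)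
 show "((%t. u (?\<gamma> t)) has_real_derivative gradient u (?\<gamma> t) \<bullet> h) (at t)" if "t \<in> {a<..<b'} - T" for t
  by (rule has_derivative_along_line, rule c1_gradient[OF K u]) (use that inside T(1) in auto)
 show "\<exists>L R. ((%t. u (?\<gamma> t)) \<longlongrightarrow> L) (at_left t) & ((%t. u (?\<gamma> t)) \<longlongrightarrow> R) (at_right t) \<and>
   \<bar>R - L\<bar> <= jabs K u (?\<gamma> t)" if t: "t \<in> T" for t
 proof -
  obtain k where k: "k \<in> {1..K}" "?\<gamma> t \<in> iface N k" using t T(1) by (auto simp: iface_upto_def)
  have "\<bar>jmp k u (?\<gamma> t)\<bar> <= jabs K u (?\<gamma> t)"
   unfolding jabs_def using k
   by (intro order_trans[OF _ member_le_sum[of k "{1..K}"]]) auto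
  then show ?thesis using jump_along_line[OF _ _ u k(2) gen] k(1) by force
 qed
qed (use T in auto)

end

section \<open>The translation estimate\<close>

lemma nn_integral_square_le:
 fixes \<phi> :: "real => real"
 assumes [measurable]: "\<phi> \<in> borel_measurable borel" and nn: "\<And>t. \<phi> t >= 0"
 shows "(LB t. indicator {0..1} t * ennreal (\<phi> t))^2 \<le>
  (LB t. indicator {0..1} t * ennreal ((\<phi> t)^2))"
proof -
 have "(LB t. indicator {0..1} t * ennreal (\<phi> t))^2 =
   (LB t. indicator {0..1::real} t * (indicator {0..1} t * ennreal (\<phi> t)))\<^sup>2"
  by (intro arg_cong[where f = "%x. x\<^sup>2"] nn_integral_cong) (auto simp: indicator_def)
 also have "... <= (LB t. (indicator {0..1::real} t)^2) * (LB t. (indicator {0..1} t * ennreal (\<phi> t))^2)"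
  by (rule Cauchy_Schwarz_nn_integral) measurable
 also have "(LB t. (indicator {0..1::real} t)^2) = (LB t. indicator {0..1::real} t)"
  by (rule nn_integral_cong) (auto simp: indicator_def)
 also have "... = 1" by simp
 also have "(LB t. (indicator {0..1} t * ennreal (\<phi> t))^2) =
   (LB t. indicator {0..1} t * ennreal ((\<phi> t)^2))"
  using nn by (intro nn_integral_cong) (auto simp: indicator_def ennreal_power)
 finally show ?thesis by simp
qed

context regular_network
begin

text \<open>Extension by zero from the smooth part, so that translates make sense on the whole
  space. Values of \<open>u\<close> on the interfaces and outside the closed domain are arbitrary
  and are removed.\<close>

definition ubar :: "nat => ('n point => real) => 'n point => real" where
 "ubar K u x = indicator (smooth K) x * u x"

definition gbar :: "nat => ('n point => real) => 'n point => 'n point" where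
 "gbar K u x = indicator (smooth K) x *\<^sub>R gradient u x"

text \<open>Assigning a regular point to the least index of a hyperplane through it makes the pieces
  disjoint, although the enumeration of hyperplanes may repeat.\<close>

definition piece :: "nat => nat => 'n point set" where
 "piece k i = {\<xi> \<in> iface N k - B. \<xi> \<bullet> \<nu> i = b i & (\<forall>j<i. \<xi> \<bullet> \<nu> j ~= b j)}"

text \<open>A segment hits a transversal hyperplane at most once. Writing the sum of
  \<open>a\<close> over the crossings between \<open>x\<close> and \<open>x + h\<close> as a series
  over hyperplanes allows integration in \<open>x\<close> term by term.\<close>

definition crossing_sum :: "nat => ('n point => ennreal) => 'n point => 'n point => ennreal" where
 "crossing_sum k a h x = (\<Sum>i. indicator (cyl (\<nu> i) (b i) h (piece k i)) x * a (hit_point (\<nu> i) (b i) h x))"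

definition jsq :: "nat => ('n point => real) => 'n point => ennreal" where
 "jsq k u \<xi> = ennreal ((jmp k u \<xi>)^2)"

lemma borel_ubar_gbar:
 assumes "1 <= K" "u \<in> C1 K"
 shows "ubar K u \<in> borel_measurable borel" "gbar K u \<in> borel_measurable borel"
 unfolding ubar_def[abs_def] gbar_def[abs_def]
 using borel_measurable_continuous_on_indicator[OF _ c1_continuous(1)[OF assms]]
  borel_measurable_continuous_on_indicator[OF _ c1_continuous(2)[OF assms]]
  open_smooth_region[OF assms(1)] by auto

lemma piece_borel [measurable]:
 assumes "1 <= k"
 shows "piece k i \<in> sets borel"
proof -
 note [measurable] = iface_borel[OF assms]
 have "piece k i = (iface N k - B) \<inter> {\<xi>. \<xi> \<bullet> \<nu> i = b i} \<inter> {\<xi>. \<forall>j<i. \<xi> \<bullet> \<nu> j ~= b j}"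
  by (auto simp: piece_def)
 also have "... \<in> sets borel" by measurable
 finally show ?thesis .
qed

lemma piece_cover:
 assumes "1 <= k" "\<xi> \<in> iface N k" "\<xi> \<notin> B"
 shows "\<exists>i. \<xi> \<in> piece k i"
proof -
 have ex: "\<exists>i. \<xi> \<bullet> \<nu> i = b i" by (rule iface_covered[OF assms(1,2)])
 define i where "i = (LEAST i. \<xi> \<bullet> \<nu> i = b i)"
 have "\<xi> \<bullet> \<nu> i = b i" unfolding i_def by (rule LeastI_ex[OF ex])
 moreover have "\<xi> \<bullet> \<nu> j ~= b j" if "j < i" for j using not_less_Least[OF that[unfolded i_def]] .
 ultimately have "\<xi> \<in> piece k i" using assms by (simp add: piece_def)
 then show ?thesis ..
qed

lemma piece_disjoint: "\<xi> \<in> piece k i ==> \<xi> \<in> piece k j ==> i = j"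
 unfolding piece_def by (cases i j rule: linorder_cases) auto

lemma crossing_sum_ge:
 assumes k: "1 <= k" and gen: "generic h x" and F: "finite F" "F \<subseteq> {0<..<1}" "\<And>t. t \<in> F ==> x + t *\<^sub>R h \<in> iface N k"
 shows "(\<Sum>t\<in>F. a (x + t *\<^sub>R h)) <= crossing_sum k a h x"
proof -
 have "\<exists>i. x + t *\<^sub>R h \<in> piece k i" if "t \<in> F" for t
  using piece_cover[OF k F(3)[OF that]] gen by (auto simp: generic_def)
 then obtain i where i: "\<And>t. t \<in> F ==> x + t *\<^sub>R h \<in> piece k (i t)" by metis
 have hit: "hit_time (\<nu> (i t)) (b (i t)) h x = t" if "t \<in> F" for t
  using generic_transversal(2)[OF gen, of t "i t"] i[OF that] by (simp add: piece_def)
 have inj: "inj_on i F" by (rule inj_onI) (metis hit)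
 let ?f = "%i. indicator (cyl (\<nu> i) (b i) h (piece k i)) x * a (hit_point (\<nu> i) (b i) h x)"
 have "?f (i t) = a (x + t *\<^sub>R h)" if t: "t \<in> F" for t
  using i[OF t] hit[OF t] F(2) t by (auto simp: hit_point_def cyl_def)
 then have "(\<Sum>t\<in>F. a (x + t *\<^sub>R h)) = (\<Sum>t\<in>F. ?f (i t))" by (intro sum.cong) auto
 also have "... = sum ?f (i ` F)" by (simp add: sum.reindex[OF inj])
 also have "... <= (\<Sum>i. ?f i)" using F(1) by (intro sum_le_suminf) auto
 finally show ?thesis by (simp add: crossing_sum_def)
qed

lemma segment_estimate:
 assumes K: "1 <= K" and u: "u \<in> C1 K" and gen: "generic h x" and h: "h ~= 0" and ab: "a < b'"
  and inside: "\<And>t. t \<in> {a<..<b'} ==> x + t *\<^sub>R h \<in> region N"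
  and ends: "x + a *\<^sub>R h \<notin> iface_upto N K" "x + b' *\<^sub>R h \<notin> iface_upto N K"
  and T: "T = {t\<in>{a<..<b'}. x + t *\<^sub>R h \<in> iface_upto N K}" "finite T"
 shows "ennreal \<bar>u (x + b' *\<^sub>R h) - u (x + a *\<^sub>R h)\<bar> \<le>
  ennreal (norm h) * (LB t. indicator {a..b'} t * ennreal (norm (gbar K u (x + t *\<^sub>R h)))) +
  ennreal (\<Sum>t\<in>T. jabs K u (x + t *\<^sub>R h))"
proof -
 obtain I where I: "((%t. gradient u (x + t *\<^sub>R h) \<bullet> h) has_integral I) {a..b'}"
  "\<bar>u (x + b' *\<^sub>R h) - u (x + a *\<^sub>R h) - I\<bar> <= (\<Sum>t\<in>T. jabs K u (x + t *\<^sub>R h))"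
  using path_estimate[OF assms] by blast
 have [measurable]: "gbar K u \<in> borel_measurable borel" using borel_ubar_gbar[OF K u] by simp
 have "ennreal \<bar>I\<bar> <= (LB t. indicator {a..b'} t * ennreal \<bar>gbar K u (x + t *\<^sub>R h) \<bullet> h\<bar>)"
 proof (rule has_integral_abs_le_nn_integral[OF I(1), of _ "T \<union> {a, b'}"])
  fix t assume "t \<in> {a..b'} - (T \<union> {a, b'})"
  then show "gbar K u (x + t *\<^sub>R h) \<bullet> h = gradient u (x + t *\<^sub>R h) \<bullet> h"
   using inside[of t] T(1) by (auto simp: gbar_def)
 qed (use T in auto)
 also have "... <= (LB t. ennreal (norm h) * (indicator {a..b'} t * ennreal (norm (gbar K u (x + t *\<^sub>R h)))))"
  by (intro nn_integral_mono)
   (auto simp: indicator_def ennreal_mult[symmetric] mult.commute[of "norm h"] intro!: ennreal_leI Cauchy_Schwarz_ineq2)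
 also have "... = ennreal (norm h) * (LB t. indicator {a..b'} t * ennreal (norm (gbar K u (x + t *\<^sub>R h))))"
  by (rule nn_integral_cmult) measurable
 finally have Ile: "ennreal \<bar>I\<bar> <= ennreal (norm h) * (LB t. indicator {a..b'} t * ennreal (norm (gbar K u (x + t *\<^sub>R h))))" .
 have "ennreal \<bar>u (x + b' *\<^sub>R h) - u (x + a *\<^sub>R h)\<bar> <= ennreal (\<bar>I\<bar> + (\<Sum>t\<in>T. jabs K u (x + t *\<^sub>R h)))"
  using I(2) by (intro ennreal_leI) linarith
 also have "... = ennreal \<bar>I\<bar> + ennreal (\<Sum>t\<in>T. jabs K u (x + t *\<^sub>R h))"
  by (rule ennreal_plus) (auto intro!: sum_nonneg simp: jabs_def)
 finally show ?thesis using Ile by (meson add_right_mono order_trans)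
qed

lemma c1_zero_frontier: "u \<in> C1 K ==> z \<in> frontier (region N) ==> u z = 0"
 unfolding c1_level_def by blast

text \<open>If the segment leaves the domain, only its parts before the first and after the last exit matter, because
 \<open>u\<close> vanishes at the exit points.\<close>

lemma variation_estimate:
 assumes K: "1 <= K" and u: "u \<in> C1 K" and gen: "generic h x" and h: "h ~= 0" and x: "x \<in> region N"
 obtains T where "finite T" "T \<subseteq> {0<..<1}"
  "\<And>t. t \<in> T ==> x + t *\<^sub>R h \<in> iface_upto N K"
  "\<And>k. k \<in> {1..K} ==> card {t\<in>T. x + t *\<^sub>R h \<in> iface N k} <= crossings N k"
  "ennreal \<bar>ubar K u (x + h) - ubar K u x\<bar> \<le>
   ennreal (norm h) * (LB t. indicator {0..1} t * ennreal (norm (gbar K u (x + t *\<^sub>R h)))) +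
   ennreal (\<Sum>t\<in>T. jabs K u (x + t *\<^sub>R h))"
proof -
 let ?\<gamma> = "%t. x + t *\<^sub>R h"
 let ?G = "%a b'. ennreal (norm h) * (LB t. indicator {a..b'} t * ennreal (norm (gbar K u (?\<gamma> t))))"
 have [measurable]: "gbar K u \<in> borel_measurable borel" using borel_ubar_gbar[OF K u] by simp
 have ux: "ubar K u x = u x" using x generic_not_iface(1)[OF gen] by (simp add: ubar_def)
 have uy: "ubar K u (x + h) = (if x + h \<in> region N then u (x + h) else 0)"
  using generic_not_iface(2)[OF gen] by (simp add: ubar_def)
 have jn: "0 <= (\<Sum>t\<in>T. jabs K u (?\<gamma> t))" for T by (auto intro!: sum_nonneg simp: jabs_def)
 have Gmono: "?G a b' <= ?G 0 1" if "0 <= a" "b' <= 1" for a b'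
  using that by (intro mult_left_mono nn_integral_mono) (auto simp: indicator_def)
 have count: "finite {t\<in>U. ?\<gamma> t \<in> iface_upto N K} \<and>
   (\<forall>k\<in>{1..K}. card {t\<in>{t\<in>U. ?\<gamma> t \<in> iface_upto N K}. ?\<gamma> t \<in> iface N k} <= crossings N k)"
  if U: "\<And>k F. 1 <= k ==> finite F ==> F \<subseteq> U ==> (\<And>t. t \<in> F ==> ?\<gamma> t \<in> iface N k) ==> card F <= crossings N k" for U
 proof -
  have c: "finite {t\<in>U. ?\<gamma> t \<in> iface N k} & card {t\<in>U. ?\<gamma> t \<in> iface N k} <= crossings N k" if "k \<in> {1..K}" for k
   using that by (intro finite_card_bound U) auto
  have "{t\<in>U. ?\<gamma> t \<in> iface_upto N K} = (\<Union>k\<in>{1..K}. {t\<in>U. ?\<gamma> t \<in> iface N k})" by (auto simp: iface_upto_def)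
  moreover have "{t\<in>{t\<in>U. ?\<gamma> t \<in> iface_upto N K}. ?\<gamma> t \<in> iface N k} = {t\<in>U. ?\<gamma> t \<in> iface N k}" if "k \<in> {1..K}" for k
   using that by (auto simp: iface_upto_def)
  ultimately show ?thesis using c by simp
 qed
 define Z where "Z = {t\<in>{0..1}. ?\<gamma> t \<notin> region N}"
 have "closed (?\<gamma> -` (- region N))"
  using open_region by (intro closed_vimage continuous_intros) auto
 moreover have "Z = {0..1} \<inter> ?\<gamma> -` (- region N)" by (auto simp: Z_def)
 ultimately have Zc: "closed Z" by (simp add: closed_Int)
 have Zb: "bdd_below Z" "bdd_above Z" by (auto simp: Z_def)
 have not_if: "?\<gamma> 0 \<notin> iface_upto N K" "?\<gamma> 1 \<notin> iface_upto N K" using generic_not_iface[OF gen] by auto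
 have no_if: "?\<gamma> t \<notin> iface_upto N K" if "t \<in> Z" for t using that iface_upto_sub by (auto simp: Z_def)
 have front: "u (?\<gamma> t0) = 0" if "t0 \<in> Z" "\<And>t. t \<in> {c<..<d} ==> ?\<gamma> t \<in> region N" "c < d" "t0 \<in> {c, d}" for t0 c d
 proof (rule c1_zero_frontier[OF u])
  have "?\<gamma> ` closure {c<..<d} \<subseteq> closure (region N)"
   using that(2) closure_subset by (intro image_closure_subset continuous_intros closed_closure) blast
  moreover have "t0 \<in> closure {c<..<d}" using that(3,4) by auto
  ultimately have "?\<gamma> t0 \<in> closure (region N)" by blast
  then show "?\<gamma> t0 \<in> frontier (region N)"
   using that(1) open_region by (auto simp: frontier_def interior_open Z_def)
 qed
 have used_y: "card F <= crossings N k"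
  if "x + h \<in> region N" "1 <= k" "finite F" "F \<subseteq> {0<..<1}" "\<And>t. t \<in> F ==> ?\<gamma> t \<in> iface N k" for k F
  by (rule crossing_count[OF that(2) x _ zero_less_one that(3) _ _ gen]) (use that in auto)
 show thesis
 proof (cases "Z = {}")
  case True
  have ins: "?\<gamma> t \<in> region N" if "t \<in> {0..1}" for t using True that by (auto simp: Z_def)
  have y: "x + h \<in> region N" using ins[of 1] by simp
  define T where "T = {t\<in>{0<..<1}. ?\<gamma> t \<in> iface_upto N K}"
  have "finite T & (\<forall>k\<in>{1..K}. card {t\<in>T. ?\<gamma> t \<in> iface N k} <= crossings N k)"
   unfolding T_def by (rule count) (rule used_y[OF y])
  then have T: "finite T" "\<forall>k\<in>{1..K}. card {t\<in>T. ?\<gamma> t \<in> iface N k} <= crossings N k" by blast+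
  have "ennreal \<bar>u (?\<gamma> 1) - u (?\<gamma> 0)\<bar> <= ?G 0 1 + ennreal (\<Sum>t\<in>T. jabs K u (?\<gamma> t))"
   by (rule segment_estimate[OF K u gen h zero_less_one _ not_if T_def T(1)]) (use ins in auto)
  then show ?thesis using T y by (intro that[of T]) (auto simp: ux uy T_def)
 next
  case False
  define \<alpha> where "\<alpha> = Inf Z"
  have \<alpha>Z: "\<alpha> \<in> Z" unfolding \<alpha>_def using False Zb Zc by (intro closed_contains_Inf)
  have \<alpha>: "0 < \<alpha>" "\<alpha> <= 1" using \<alpha>Z x by (auto simp: Z_def less_le)
  have ins\<alpha>: "?\<gamma> t \<in> region N" if "t \<in> {0<..<\<alpha>}" for t
  proof (rule ccontr)
   assume "?\<gamma> t \<notin> region N"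
   then have "t \<in> Z" using that \<alpha> by (auto simp: Z_def)
   then have "\<alpha> <= t" unfolding \<alpha>_def by (rule cInf_lower[OF _ Zb(1)])
   then show False using that by simp
  qed
  have u\<alpha>: "u (?\<gamma> \<alpha>) = 0" by (rule front[OF \<alpha>Z ins\<alpha> \<alpha>(1)]) auto
  show ?thesis
  proof (cases "x + h \<in> region N")
   case y: False
   define T where "T = {t\<in>{0<..<\<alpha>}. ?\<gamma> t \<in> iface_upto N K}"
   have "card F <= crossings N k"
    if F: "1 <= k" "finite F" "F \<subseteq> {0<..<\<alpha>}" "\<And>t. t \<in> F ==> ?\<gamma> t \<in> iface N k" for k F
   proof -
    \<comment> \<open>The whole segment ends outside the domain, where the crossing bound says
      nothing. It is cut at a point \<open>s\<close> after the finitely many crossings and before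
      the first exit.\<close>
    have "Max (insert 0 F) < \<alpha>" using F \<alpha>(1) by auto
    then obtain s where s: "Max (insert 0 F) < s" "s < \<alpha>" using dense by blast
    have s': "0 < s" "\<And>t. t \<in> F ==> t < s" using s(1) F(2) by auto
    show ?thesis
     by (rule crossing_count[OF F(1) x ins\<alpha> s'(1) F(2) _ F(4) gen]) (use s' s F(3) in auto)
   qed
   then have "finite T & (\<forall>k\<in>{1..K}. card {t\<in>T. ?\<gamma> t \<in> iface N k} <= crossings N k)"
    unfolding T_def by (rule count)
   then have T: "finite T" "\<forall>k\<in>{1..K}. card {t\<in>T. ?\<gamma> t \<in> iface N k} <= crossings N k" by blast+
   have "ennreal \<bar>u (?\<gamma> \<alpha>) - u (?\<gamma> 0)\<bar> <= ?G 0 \<alpha> + ennreal (\<Sum>t\<in>T. jabs K u (?\<gamma> t))"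
    by (rule segment_estimate[OF K u gen h \<alpha>(1) ins\<alpha> not_if(1) no_if[OF \<alpha>Z] T_def T(1)])
   then have "ennreal \<bar>u x\<bar> <= ?G 0 1 + ennreal (\<Sum>t\<in>T. jabs K u (?\<gamma> t))"
    using Gmono[of 0 \<alpha>] \<alpha> u\<alpha> by (auto intro: order_trans add_right_mono)
   then show ?thesis using T y \<alpha> by (intro that[of T]) (auto simp: ux uy T_def)
  next
   case y: True
   define \<beta> where "\<beta> = Sup Z"
   have \<beta>Z: "\<beta> \<in> Z" unfolding \<beta>_def using False Zb Zc by (intro closed_contains_Sup)
   have \<beta>: "\<beta> < 1" "\<alpha> <= \<beta>" using \<beta>Z y cInf_lower[OF \<beta>Z Zb(1)] by (auto simp: Z_def less_le \<alpha>_def)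
   have ins\<beta>: "?\<gamma> t \<in> region N" if "t \<in> {\<beta><..<1}" for t
   proof (rule ccontr)
    assume "?\<gamma> t \<notin> region N"
    then have "t \<in> Z" using that \<alpha> \<beta> by (auto simp: Z_def)
    then have "t <= \<beta>" unfolding \<beta>_def by (rule cSup_upper[OF _ Zb(2)])
    then show False using that by simp
   qed
   have u\<beta>: "u (?\<gamma> \<beta>) = 0" by (rule front[OF \<beta>Z ins\<beta> \<beta>(1)]) auto
   define T1 where "T1 = {t\<in>{0<..<\<alpha>}. ?\<gamma> t \<in> iface_upto N K}"
   define T2 where "T2 = {t\<in>{\<beta><..<1}. ?\<gamma> t \<in> iface_upto N K}"
   \<comment> \<open>Both outer parts belong to one segment with end points in the domain, so the
     constant \<open>crossings N k\<close> bounds their crossings together. Separate bounds would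
     double it.\<close>
   define U where "U = {0<..<\<alpha>} \<union> {\<beta><..<1}"
   define T where "T = {t\<in>U. ?\<gamma> t \<in> iface_upto N K}"
   have Usub: "U \<subseteq> {0<..<1}" using \<alpha> \<beta> by (auto simp: U_def)
   have "finite T & (\<forall>k\<in>{1..K}. card {t\<in>T. ?\<gamma> t \<in> iface N k} <= crossings N k)"
    unfolding T_def by (rule count) (rule used_y[OF y _ _ order_trans[OF _ Usub]])
   then have T: "finite T" "\<forall>k\<in>{1..K}. card {t\<in>T. ?\<gamma> t \<in> iface N k} <= crossings N k" by blast+
   have TT: "T = T1 \<union> T2" "T1 \<inter> T2 = {}" using \<beta> by (auto simp: T_def T1_def T2_def U_def)
   have fin: "finite T1" "finite T2" using T(1) TT(1) by auto
   have 1: "ennreal \<bar>u (?\<gamma> \<alpha>) - u (?\<gamma> 0)\<bar> <= ?G 0 \<alpha> + ennreal (\<Sum>t\<in>T1. jabs K u (?\<gamma> t))"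
    by (rule segment_estimate[OF K u gen h \<alpha>(1) ins\<alpha> not_if(1) no_if[OF \<alpha>Z] T1_def fin(1)])
   have 2: "ennreal \<bar>u (?\<gamma> 1) - u (?\<gamma> \<beta>)\<bar> <= ?G \<beta> 1 + ennreal (\<Sum>t\<in>T2. jabs K u (?\<gamma> t))"
    by (rule segment_estimate[OF K u gen h \<beta>(1) ins\<beta> no_if[OF \<beta>Z] not_if(2) T2_def fin(2)])
   have G: "?G 0 \<alpha> + ?G \<beta> 1 <= ?G 0 1"
   proof -
    \<comment> \<open>The two intervals may share the point
      \<open>\<alpha> = \<beta>\<close>.\<close>
    have "AE t in lborel. t ~= \<alpha>" by (rule AE_lborel_singleton)
    then have "AE t in lborel. indicator {0..\<alpha>} t * ennreal (norm (gbar K u (?\<gamma> t))) +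
      indicator {\<beta>..1} t * ennreal (norm (gbar K u (?\<gamma> t))) \<le>
      indicator {0..1} t * ennreal (norm (gbar K u (?\<gamma> t)))"
     by eventually_elim (use \<alpha> \<beta> in \<open>auto simp: indicator_def\<close>)
    then show ?thesis
     by (subst distrib_left[symmetric], subst nn_integral_add[symmetric])
      (auto intro!: mult_left_mono nn_integral_mono_AE)
   qed
   have "ennreal \<bar>u (x + h) - u x\<bar> <= ennreal \<bar>u (?\<gamma> 1) - u (?\<gamma> \<beta>)\<bar> + ennreal \<bar>u (?\<gamma> \<alpha>) - u (?\<gamma> 0)\<bar>"
   proof -
    have "ennreal \<bar>u (x + h) - u x\<bar> <= ennreal (\<bar>u (?\<gamma> 1) - u (?\<gamma> \<beta>)\<bar> + \<bar>u (?\<gamma> \<alpha>) - u (?\<gamma> 0)\<bar>)"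
     unfolding u\<alpha> u\<beta> by (intro ennreal_leI) simp
    then show ?thesis by (simp add: ennreal_plus)
   qed
   also have "... <= (?G \<beta> 1 + ennreal (\<Sum>t\<in>T2. jabs K u (?\<gamma> t))) + (?G 0 \<alpha> + ennreal (\<Sum>t\<in>T1. jabs K u (?\<gamma> t)))"
    by (rule add_mono[OF 2 1])
   also have "... = (?G 0 \<alpha> + ?G \<beta> 1) + ennreal (\<Sum>t\<in>T. jabs K u (?\<gamma> t))"
    unfolding TT(1) using fin TT(2) by (subst sum.union_disjoint) (auto simp: jn ennreal_plus add_ac)
   also have "... <= ?G 0 1 + ennreal (\<Sum>t\<in>T. jabs K u (?\<gamma> t))" by (rule add_right_mono[OF G])
   finally show ?thesis using T y Usub by (intro that[of T]) (auto simp: ux uy T_def)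
  qed
 qed
qed

text \<open>Cauchy-Schwarz enters three times: along the segment for the gradient, over the at most
  \<open>crossings N k\<close> crossings of one interface, which produces the factor
  \<open>crossings N k\<close>, and with weights over the levels. Interfaces outside
  \<open>S\<close> are missed by the segment and contribute nothing.\<close>

lemma pointwise_estimate:
 assumes c: "c > 0" and K: "1 <= K" and u: "u \<in> C1 K" and gen: "generic h x" and h: "h ~= 0"
  and x: "x \<in> region N" and S: "S \<subseteq> {1..K}"
  and skip: "\<And>k t. k \<in> {1..K} - S ==> t \<in> {0<..<1} ==> x + t *\<^sub>R h \<notin> iface N k"
 shows "ennreal ((ubar K u (x + h) - ubar K u x)^2) <= ennreal (1 + 1/c) *
  (ennreal ((norm h)^2) * (LB t. indicator {0..1} t * ennreal ((norm (gbar K u (x + t *\<^sub>R h)))^2)) +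
   (\<Sum>k\<in>S. ennreal ((1 + c)^k * real (crossings N k)) * crossing_sum k (jsq k u) h x))"
  (is "_ <= _ * (_ * ?E + ?J)")
proof (cases "?E = top")
 case True
 then have "ennreal ((norm h)^2) * ?E = top" using h by (simp add: ennreal_mult_top)
 then show ?thesis using c by (simp add: ennreal_mult_top)
next
 case False
 let ?\<gamma> = "%t. x + t *\<^sub>R h"
 let ?m = "LB t. indicator {0..1} t * ennreal (norm (gbar K u (?\<gamma> t)))"
 have [measurable]: "gbar K u \<in> borel_measurable borel" using borel_ubar_gbar[OF K u] by simp
 have mE: "?m\<^sup>2 <= ?E" by (rule nn_integral_square_le) auto
 then have "?m ~= top" using False by (auto simp: top_unique power2_eq_square ennreal_mult_top)
 then obtain m where m: "?m = ennreal m" "m >= 0" by (cases "?m") auto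
 obtain T where T: "finite T" "T \<subseteq> {0<..<1}" "\<And>t. t \<in> T ==> ?\<gamma> t \<in> iface_upto N K"
  "\<And>k. k \<in> {1..K} ==> card {t\<in>T. ?\<gamma> t \<in> iface N k} <= crossings N k"
  and le: "ennreal \<bar>ubar K u (x + h) - ubar K u x\<bar> <= ennreal (norm h) * ?m + ennreal (\<Sum>t\<in>T. jabs K u (?\<gamma> t))"
  by (rule variation_estimate[OF K u gen h x]) blast
 define Tk where "Tk k = {t\<in>T. ?\<gamma> t \<in> iface N k}" for k
 have Tk: "finite (Tk k)" "Tk k \<subseteq> {0<..<1}" for k using T by (auto simp: Tk_def)
 have TkS: "Tk k = {}" if "k \<in> {1..K} - S" for k using skip[OF that] T(2) by (auto simp: Tk_def)
 \<comment> \<open>Index 0 carries the gradient part, index \<open>k\<close> the jumps on the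
   interface \<open>k\<close>.\<close>
 define s where "s k = (if k = 0 then norm h * m else \<Sum>t\<in>Tk k. \<bar>jmp k u (?\<gamma> t)\<bar>)" for k
 define q where "q k = (\<Sum>t\<in>Tk k. (jmp k u (?\<gamma> t))^2)" for k
 have s0: "s k >= 0" for k using m(2) by (auto simp: s_def intro!: sum_nonneg)
 have q0: "q k >= 0" for k by (auto simp: q_def intro!: sum_nonneg)
 have split0: "(\<Sum>k=0..K. f k) = f 0 + (\<Sum>k=1..K. f k)" for f :: "nat => real"
  by (simp add: sum.atLeast_Suc_atMost)
 have "(\<Sum>t\<in>T. jabs K u (?\<gamma> t)) = (\<Sum>k=1..K. s k)"
 proof -
  have "(\<Sum>t\<in>T. jabs K u (?\<gamma> t)) = (\<Sum>k=1..K. \<Sum>t\<in>T. if ?\<gamma> t \<in> iface N k then \<bar>jmp k u (?\<gamma> t)\<bar> else 0)"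
   unfolding jabs_def by (rule sum.swap)
  also have "... = (\<Sum>k=1..K. s k)"
   using T(1) by (intro sum.cong refl) (simp add: s_def Tk_def sum.inter_filter[symmetric])
  finally show ?thesis .
 qed
 then have "ennreal \<bar>ubar K u (x + h) - ubar K u x\<bar> <= ennreal (\<Sum>k=0..K. s k)"
  using le m s0 by (simp add: split0 s_def[of 0] ennreal_mult[symmetric] ennreal_plus[symmetric] sum_nonneg del: ennreal_plus)
 then have "\<bar>ubar K u (x + h) - ubar K u x\<bar> <= (\<Sum>k=0..K. s k)"
  using s0 by (subst (asm) ennreal_le_iff) (auto intro!: sum_nonneg)
 then have "(ubar K u (x + h) - ubar K u x)^2 <= (\<Sum>k=0..K. s k)^2"
  by (metis abs_ge_zero power2_abs power_mono)
 also have "... <= (1 + 1/c) * (\<Sum>k=0..K. (1 + c)^k * (s k)^2)" by (rule weighted_square_sum[OF c])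
 also have "... <= (1 + 1/c) * ((norm h)^2 * m\<^sup>2 + (\<Sum>k\<in>S. (1 + c)^k * real (crossings N k) * q k))"
 proof (rule mult_left_mono)
  have "(\<Sum>k=1..K. (1 + c)^k * (s k)^2) <= (\<Sum>k=1..K. (1 + c)^k * (real (crossings N k) * q k))"
  proof (intro sum_mono mult_left_mono)
   fix k assume k: "k \<in> {1..K}"
   have "(s k)^2 <= (\<Sum>t\<in>Tk k. (\<bar>jmp k u (?\<gamma> t)\<bar>)^2) * real (card (Tk k))"
    using k sum_squared_le_sum_of_squares[of "%t. \<bar>jmp k u (?\<gamma> t)\<bar>" "Tk k"] by (simp add: s_def)
   also have "... = q k * real (card (Tk k))" by (simp add: q_def)
   also have "... <= real (crossings N k) * q k"
    using T(4)[OF k] q0[of k] by (subst mult.commute) (auto intro!: mult_right_mono simp: Tk_def)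
   finally show "(s k)^2 <= real (crossings N k) * q k" .
  qed (use c in auto)
  also have "... = (\<Sum>k\<in>S. (1 + c)^k * (real (crossings N k) * q k))"
   using S TkS by (intro sum.mono_neutral_right) (auto simp: q_def)
  finally show "(\<Sum>k=0..K. (1 + c)^k * (s k)^2) \<le>
    (norm h)\<^sup>2 * m\<^sup>2 + (\<Sum>k\<in>S. (1 + c)^k * real (crossings N k) * q k)"
   by (simp add: split0 s_def[of 0] power_mult_distrib mult.assoc)
 qed (use c in simp)
 finally have "ennreal ((ubar K u (x + h) - ubar K u x)^2) \<le>
   ennreal ((1 + 1/c) * ((norm h)^2 * m\<^sup>2 + (\<Sum>k\<in>S. (1 + c)^k * real (crossings N k) * q k)))"
  by (rule ennreal_leI)
 also have "... = ennreal (1 + 1/c) * (ennreal ((norm h)^2) * ?m\<^sup>2 +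
   (\<Sum>k\<in>S. ennreal ((1 + c)^k * real (crossings N k)) * (\<Sum>t\<in>Tk k. jsq k u (?\<gamma> t))))"
 proof -
  have "ennreal (\<Sum>k\<in>S. (1 + c)^k * real (crossings N k) * q k) =
    (\<Sum>k\<in>S. ennreal ((1 + c)^k * real (crossings N k)) * (\<Sum>t\<in>Tk k. jsq k u (?\<gamma> t)))"
   using c q0 by (subst sum_ennreal[symmetric]) (auto simp: q_def jsq_def ennreal_mult sum_ennreal)
  moreover have "0 <= (\<Sum>k\<in>S. (1 + c)^k * real (crossings N k) * q k)" using c q0 by (auto intro!: sum_nonneg)
  ultimately show ?thesis using c m by (simp add: ennreal_mult ennreal_plus ennreal_power)
 qed
 also have "... <= ennreal (1 + 1/c) * (ennreal ((norm h)^2) * ?E + ?J)"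
 proof (intro mult_left_mono add_mono sum_mono mE)
  fix k assume "k \<in> S"
  then have "1 <= k" using S by auto
  then show "(\<Sum>t\<in>Tk k. jsq k u (?\<gamma> t)) <= crossing_sum k (jsq k u) h x"
   using Tk by (intro crossing_sum_ge gen) (auto simp: Tk_def)
 qed auto
 finally show ?thesis .
qed

end

section \<open>Integration of the pointwise estimate\<close>

lemma l2_sq_lebesgue_on:
 fixes f :: "'a::euclidean_space => 'b::real_normed_vector" and F :: "'a => 'c::real_normed_vector"
 assumes S: "S \<in> sets borel" and [measurable]: "(%x. norm (F x)) \<in> borel_measurable borel"
  and eq: "AE x in lborel. norm (F x) = (if x \<in> S then norm (f x) else 0)"
 shows "l2_sq (lebesgue_on S) f = (LB x. ennreal ((norm (F x))^2))"
proof -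
 have "l2_sq (lebesgue_on S) f = (\<integral>\<^sup>+x. ennreal ((norm (f x))^2) * indicator S x \<partial>lebesgue)"
  using S unfolding l2_sq_def by (subst nn_integral_restrict_space) auto
 also have "... = (\<integral>\<^sup>+x. ennreal ((norm (F x))^2) \<partial>lebesgue)"
 proof (rule nn_integral_cong_AE, rule AE_completion)
  show "AE x in lborel. ennreal ((norm (f x))^2) * indicator S x = ennreal ((norm (F x))^2)"
   using eq by eventually_elim (auto simp: indicator_def)
 qed
 also have "... = (LB x. ennreal ((norm (F x))^2))" by (rule nn_integral_completion)
 finally show ?thesis .
qed

lemma nn_integral_segment_average:
 fixes f :: "'a::euclidean_space => ennreal"
 assumes [measurable]: "f \<in> borel_measurable borel"
 shows "(LB x. (LB t. indicator {0..1::real} t * f (x + t *\<^sub>R h))) = (LB x. f x)"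
proof -
 have "(LB x. (LB t. indicator {0..1::real} t * f (x + t *\<^sub>R h))) =
   (LB t. (LB x. indicator {0..1::real} t * f (x + t *\<^sub>R h)))"
  by (rule lborel_pair.Fubini') measurable
 also have "... = (LB t. indicator {0..1::real} t * (LB x. f x))"
 proof (rule nn_integral_cong)
  fix t :: real
  have "(LB x. indicator {0..1::real} t * f (x + t *\<^sub>R h)) = indicator {0..1::real} t * (LB x. f (x + t *\<^sub>R h))"
   by (rule nn_integral_cmult) measurable
  also have "(LB x. f (x + t *\<^sub>R h)) = (LB x. f x)"
   using nn_integral_lborel_translate[of f "t *\<^sub>R h"] by (simp add: add.commute)
  finally show "(LB x. indicator {0..1::real} t * f (x + t *\<^sub>R h)) = indicator {0..1::real} t * (LB x. f x)" .
 qed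
 also have "... = (LB x. f x)" by (subst nn_integral_multc) auto
 finally show ?thesis .
qed

context regular_network
begin

definition Gsq :: "nat => ('n point => real) => ennreal" where
 "Gsq K u = (LB x. ennreal ((norm (gbar K u x))^2))"

definition Jsq :: "nat => ('n point => real) => ennreal" where
 "Jsq k u = (\<integral>\<^sup>+\<xi>. jsq k u \<xi> \<partial>surface N k)"

lemma jump_tendsto:
 assumes k: "1 <= k" "k <= K" and u: "u \<in> C1 K" and \<xi>: "\<xi> \<in> iface N k" "\<xi> \<notin> B"
 shows "((%s. u (\<xi> + s *\<^sub>R unit_normal (iface N k) \<xi>) - u (\<xi> - s *\<^sub>R unit_normal (iface N k) \<xi>))
  \<longlongrightarrow> jmp k u \<xi>) (at_right 0)"
proof -
 obtain i where i: "\<xi> \<bullet> \<nu> i = b i" using iface_covered[OF k(1) \<xi>(1)] by blast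
 obtain e vp vm where "side_traces k u i \<xi> e vp vm" using side_traces_exist[OF k u \<xi> i] by blast
 then have tr: "(u \<longlongrightarrow> vp \<xi>) (at \<xi> within {y. y \<bullet> \<nu> i > b i})" "(u \<longlongrightarrow> vm \<xi>) (at \<xi> within {y. y \<bullet> (- \<nu> i) > - b i})"
  "jmp k u \<xi> = vp \<xi> - vm \<xi>"
  using i \<xi>(2) by (auto simp: side_traces_def)
 have "((%s. u (\<xi> + (1 * (s - 0)) *\<^sub>R \<nu> i)) \<longlongrightarrow> vp \<xi>) (at_right 0)"
  by (rule filterlim_compose[OF tr(1) line_filterlim]) (use i in auto)
 moreover have "((%s. u (\<xi> + (1 * (s - 0)) *\<^sub>R (- \<nu> i))) \<longlongrightarrow> vm \<xi>) (at_right 0)"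
  by (rule filterlim_compose[OF tr(2) line_filterlim]) (use i in auto)
 ultimately show ?thesis
  unfolding tr(3) unit_normal_regular[OF k(1) \<xi> i] using tendsto_diff by fastforce
qed

text \<open>Locally the jump is the difference of two continuous traces. Continuity serves to make
  the jump Borel, and thus to compare surface integrals with volume integrals.\<close>

lemma jump_continuous:
 assumes k: "1 <= k" "k <= K" and u: "u \<in> C1 K"
 shows "continuous_on (iface N k - B) (jmp k u)"
 unfolding continuous_on_def
proof
 fix \<xi> assume \<xi>: "\<xi> \<in> iface N k - B"
 obtain i where i: "\<xi> \<bullet> \<nu> i = b i" using iface_covered[OF k(1)] \<xi> by blast
 obtain e vp vm where tr: "side_traces k u i \<xi> e vp vm" using side_traces_exist[OF k u _ _ i] \<xi> by blast
 let ?P = "ball \<xi> e \<inter> {y. y \<bullet> \<nu> i = b i}" and ?S = "ball \<xi> e \<inter> (iface N k - B)"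
 have e: "e > 0" and SP: "?S \<subseteq> ?P" and c: "continuous_on ?P (%z. vp z - vm z)"
  using tr by (auto simp: side_traces_def intro!: continuous_on_diff)
 have "continuous_on ?S (%z. vp z - vm z)" by (rule continuous_on_subset[OF c SP])
 then have "continuous_on ?S (jmp k u)"
  by (rule continuous_on_eq) (use tr in \<open>auto simp: side_traces_def\<close>)
 then have "(jmp k u \<longlongrightarrow> jmp k u \<xi>) (at \<xi> within ?S)"
  using \<xi> e by (auto simp: continuous_on_def)
 moreover have "at \<xi> within (iface N k - B) = at \<xi> within ?S"
  using e by (intro at_within_nhd[of \<xi> "ball \<xi> e"]) auto
 ultimately show "(jmp k u \<longlongrightarrow> jmp k u \<xi>) (at \<xi> within (iface N k - B))" by simp
qed

lemma jump_borel:
 assumes k: "1 <= k" "k <= K" and u: "u \<in> C1 K"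
 shows "(%\<xi>. indicator (iface N k - B) \<xi> *\<^sub>R jmp k u \<xi>) \<in> borel_measurable borel"
 by (rule borel_measurable_continuous_on_indicator[OF _ jump_continuous[OF assms]])
  (use iface_borel[OF k(1)] in auto)

definition piece_density :: "nat => ('n point => real) => nat => 'n point => ennreal" where
 "piece_density k u i \<xi> = indicator (piece k i) \<xi> * jsq k u \<xi>"

lemma piece_density_borel:
 assumes k: "1 <= k" "k <= K" and u: "u \<in> C1 K"
 shows "piece_density k u i \<in> borel_measurable borel"
proof -
 note [measurable] = jump_borel[OF assms] piece_borel[OF k(1)]
 have "piece_density k u i = (%\<xi>. indicator (piece k i) \<xi> * ennreal ((indicator (iface N k - B) \<xi> *\<^sub>R jmp k u \<xi>)^2))"
  by (auto simp: piece_density_def jsq_def piece_def indicator_def fun_eq_iff)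
 also have "... \<in> borel_measurable borel" by measurable
 finally show ?thesis .
qed

lemma crossing_sum_eq:
 "crossing_sum k (jsq k u) h x =
  (\<Sum>i. indicator (cyl (\<nu> i) (b i) h UNIV) x * piece_density k u i (hit_point (\<nu> i) (b i) h x))"
 unfolding crossing_sum_def piece_density_def
 by (intro suminf_cong) (auto simp: cyl_def indicator_def)

lemma crossing_sum_borel:
 assumes "1 <= k" "k <= K" "u \<in> C1 K"
 shows "crossing_sum k (jsq k u) h \<in> borel_measurable borel"
proof -
 note [measurable] = piece_density_borel[OF assms]
 show ?thesis unfolding crossing_sum_eq[abs_def] by measurable
qed

lemma nn_integral_surface:
 assumes "1 <= k"
 shows "(\<integral>\<^sup>+\<xi>. f \<xi> \<partial>surface N k) = (\<integral>\<^sup>+\<xi>. f \<xi> * indicator (iface N k) \<xi> \<partial>hausdorff_measure (CARD('n) - 1))"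
 unfolding surface_def
 using borel_subset_sets_hausdorff iface_borel[OF assms] by (subst nn_integral_restrict_space) auto

lemma sum_piece_density:
 assumes k: "1 <= k" "k <= K" and u: "u \<in> C1 K"
 shows "(\<Sum>i. \<integral>\<^sup>+\<xi>. piece_density k u i \<xi> \<partial>hausdorff_measure (CARD('n) - 1)) <= Jsq k u"
proof -
 let ?H = "hausdorff_measure (CARD('n) - 1) :: 'n point measure"
 have [measurable]: "piece_density k u i \<in> borel_measurable ?H" for i
  using measurable_compose[OF id_measurable_hausdorff piece_density_borel[OF assms]] .
 have disj: "disjoint_family (piece k)" using piece_disjoint[of _ k] by (fastforce simp: disjoint_family_on_def)
 have "(\<Sum>i. \<integral>\<^sup>+\<xi>. piece_density k u i \<xi> \<partial>?H) = (\<integral>\<^sup>+\<xi>. (\<Sum>i. piece_density k u i \<xi>) \<partial>?H)"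
  by (rule nn_integral_suminf[symmetric]) measurable
 also have "... <= (\<integral>\<^sup>+\<xi>. jsq k u \<xi> * indicator (iface N k) \<xi> \<partial>?H)"
 proof (rule nn_integral_mono)
  fix \<xi>
  have "(\<Sum>i. piece_density k u i \<xi>) = jsq k u \<xi> * (\<Sum>i. indicator (piece k i) \<xi>)"
   unfolding piece_density_def by (subst ennreal_suminf_cmult[symmetric]) (simp add: mult.commute)
  also have "(\<Sum>i. indicator (piece k i) \<xi> :: ennreal) = indicator (\<Union>i. piece k i) \<xi>"
   by (rule suminf_indicator[OF disj])
  also have "... <= indicator (iface N k) \<xi>" by (auto simp: indicator_def piece_def)
  finally show "(\<Sum>i. piece_density k u i \<xi>) <= jsq k u \<xi> * indicator (iface N k) \<xi>" by (simp add: mult_left_mono)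
 qed
 finally show ?thesis unfolding Jsq_def nn_integral_surface[OF k(1)] .
qed

text \<open>The points \<open>x\<close> from which the shift by \<open>h\<close> hits a piece form a
  cylinder over it, so each term is an integral against \<open>cyl_measure\<close> and costs
  \<open>|h \<bullet> \<nu> i|\<close>, at most \<open>norm h\<close>, times the surface
  integral.\<close>

lemma nn_integral_crossing_sum:
 assumes k: "1 <= k" "k <= K" and u: "u \<in> C1 K"
 shows "(LB x. crossing_sum k (jsq k u) h x) <= ennreal (norm h) * Jsq k u"
proof -
 note [measurable] = piece_density_borel[OF assms]
 have "(LB x. crossing_sum k (jsq k u) h x) =
   (\<Sum>i. \<integral>\<^sup>+x. indicator (cyl (\<nu> i) (b i) h UNIV) x * piece_density k u i (hit_point (\<nu> i) (b i) h x) \<partial>lborel)"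
  unfolding crossing_sum_eq by (rule nn_integral_suminf) measurable
 also have "... <= (\<Sum>i. ennreal (norm h) * (\<integral>\<^sup>+\<xi>. piece_density k u i \<xi> \<partial>hausdorff_measure (CARD('n) - 1)))"
 proof (rule suminf_le)
  fix i
  show "(LB x. indicator (cyl (\<nu> i) (b i) h UNIV) x * piece_density k u i (hit_point (\<nu> i) (b i) h x))
    <= ennreal (norm h) * (\<integral>\<^sup>+\<xi>. piece_density k u i \<xi> \<partial>hausdorff_measure (CARD('n) - 1))"
  proof (cases "h \<bullet> \<nu> i = 0")
   case True
   \<comment> \<open>For \<open>h\<close> parallel to the hyperplane the quotient in
     \<open>hit_time\<close> is a division by zero, hence 0, and the condition
     \<open>0 < hit_time\<close> fails.\<close>
   then have "cyl (\<nu> i) (b i) h UNIV = {}" by (auto simp: cyl_def hit_time_def)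
   then show ?thesis by simp
  next
   case False
   have "(\<integral>\<^sup>+\<xi>. piece_density k u i \<xi> \<partial>cyl_measure (\<nu> i) (b i) h) \<le>
     ennreal \<bar>h \<bullet> \<nu> i\<bar> * (\<integral>\<^sup>+\<xi>. piece_density k u i \<xi> \<partial>hausdorff_measure (DIM('n point) - 1))"
    by (rule nn_integral_cyl_le_hausdorff[OF norm_normal False]) measurable
   also have "... <= ennreal (norm h) * (\<integral>\<^sup>+\<xi>. piece_density k u i \<xi> \<partial>hausdorff_measure (DIM('n point) - 1))"
    using Cauchy_Schwarz_ineq2[of h "\<nu> i"] by (intro mult_right_mono ennreal_leI) (auto simp: norm_normal)
   finally show ?thesis by (subst (asm) nn_integral_cyl_measure) auto
  qed
 qed auto
 also have "... <= ennreal (norm h) * Jsq k u"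
  by (subst ennreal_suminf_cmult) (intro mult_left_mono sum_piece_density[OF assms], simp)
 finally show ?thesis .
qed

definition jump_weight :: "real => nat => ennreal" where
 "jump_weight c k = ennreal ((1 + c)^k * real (crossings N k))"

text \<open>\<open>E\<close> and \<open>S\<close> remain general for the recovery of gradients: if
  the segments starting in \<open>E\<close> miss the interfaces outside \<open>S\<close>, only the
  jumps on interfaces in \<open>S\<close> have to be paid for.\<close>

lemma integrated_estimate:
 assumes c: "c > 0" and K: "1 <= K" and u: "u \<in> C1 K" and E [measurable]: "E \<in> sets borel" "E \<subseteq> region N"
  and S: "S \<subseteq> {1..K}"
  and skip: "\<And>x k t. x \<in> E ==> k \<in> {1..K} - S ==> t \<in> {0<..<1} ==> x + t *\<^sub>R h \<notin> iface N k"
 shows "(LB x. indicator E x * ennreal ((ubar K u (x + h) - ubar K u x)^2)) \<le>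
  ennreal (1 + 1/c) * (ennreal ((norm h)^2) * Gsq K u + ennreal (norm h) * (\<Sum>k\<in>S. jump_weight c k * Jsq k u))"
proof (cases "h = 0")
 case False
 note [measurable] = borel_ubar_gbar[OF K u]
 have finS: "finite S" using S finite_subset by blast
 have [measurable]: "k \<in> S ==> crossing_sum k (jsq k u) h \<in> borel_measurable borel" for k
  using S by (intro crossing_sum_borel[OF _ _ u]) auto
 define V where "V x = (LB t. indicator {0..1::real} t * ennreal ((norm (gbar K u (x + t *\<^sub>R h)))^2))" for x
 have [measurable]: "V \<in> borel_measurable borel" unfolding V_def by measurable
 have "(LB x. indicator E x * ennreal ((ubar K u (x + h) - ubar K u x)^2)) \<le>
   (LB x. ennreal (1 + 1/c) * (ennreal ((norm h)^2) * V x + (\<Sum>k\<in>S. jump_weight c k * crossing_sum k (jsq k u) h x)))"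
 proof (rule nn_integral_mono_AE)
  show "AE x in lborel. indicator E x * ennreal ((ubar K u (x + h) - ubar K u x)^2) \<le>
    ennreal (1 + 1/c) * (ennreal ((norm h)^2) * V x + (\<Sum>k\<in>S. jump_weight c k * crossing_sum k (jsq k u) h x))"
   using AE_generic[of h]
  proof eventually_elim
   case (elim x)
   show ?case
   proof (cases "x \<in> E")
    case True
    then show ?thesis
     using pointwise_estimate[OF c K u elim False _ S skip[OF True]] E(2)
     by (auto simp: V_def jump_weight_def)
   qed simp
  qed
 qed
 also have "... = ennreal (1 + 1/c) * (ennreal ((norm h)^2) * (LB x. V x) +
   (\<Sum>k\<in>S. jump_weight c k * (LB x. crossing_sum k (jsq k u) h x)))"
  by (simp add: nn_integral_cmult nn_integral_add nn_integral_sum)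
 also have "(LB x. V x) = Gsq K u"
  unfolding V_def Gsq_def by (rule nn_integral_segment_average) measurable
 also have "(\<Sum>k\<in>S. jump_weight c k * (LB x. crossing_sum k (jsq k u) h x)) \<le>
   (\<Sum>k\<in>S. jump_weight c k * (ennreal (norm h) * Jsq k u))"
  using S by (intro sum_mono mult_left_mono nn_integral_crossing_sum[OF _ _ u]) auto
 also have "... = ennreal (norm h) * (\<Sum>k\<in>S. jump_weight c k * Jsq k u)"
  by (simp add: sum_distrib_left mult_ac)
 finally show ?thesis by (simp add: mult_left_mono add_left_mono)
qed simp

section \<open>The inequality of Poincare for piecewise smooth functions\<close>

lemma diameter_region_pos: "diameter (region N) > 0"
proof -
 obtain x where "x \<in> region N" using region_ne by auto
 then obtain e where e: "e > 0" "ball x e \<subseteq> region N" using open_region openE by blast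
 obtain u :: "'n point" where u: "u \<in> Basis" using nonempty_Basis by blast
 have "x + (e/2) *\<^sub>R u \<in> region N" using e u by (auto simp: dist_norm subset_eq)
 then have "dist (x + (e/2) *\<^sub>R u) x <= diameter (region N)"
  using \<open>x \<in> region N\<close> by (intro diameter_bounded_bound bounded_region)
 then show ?thesis using e u by (simp add: dist_norm)
qed

text \<open>The domain is open: from a point of it at distance exactly the diameter one could move a
  little further within the domain.\<close>

lemma translate_diameter_leaves:
 assumes x: "x \<in> region N" and e: "norm e = 1"
 shows "x + diameter (region N) *\<^sub>R e \<notin> region N"
proof
 let ?D = "diameter (region N)"
 assume "x + ?D *\<^sub>R e \<in> region N"
 then obtain r where r: "r > 0" "ball (x + ?D *\<^sub>R e) r \<subseteq> region N" using open_region openE by blast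
 have "x + (?D + r/2) *\<^sub>R e \<in> ball (x + ?D *\<^sub>R e) r"
  using r(1) e by (simp add: dist_norm algebra_simps)
 then have "dist (x + (?D + r/2) *\<^sub>R e) x <= ?D"
  using x r(2) by (intro diameter_bounded_bound bounded_region) auto
 then show False using e r(1) diameter_region_pos by (simp add: dist_norm)
qed

text \<open>For a shift of length \<open>D\<close>, the diameter, gradients enter with
  \<open>D^2\<close> and jumps with \<open>D\<close>; both are at most \<open>D * max D 1\<close>.
  The factor \<open>1 + 1/c\<close> is the geometric series of the weights.\<close>

definition poincare_const :: "real => real" where
 "poincare_const c = (1 + 1/c) * diameter (region N) * max (diameter (region N)) 1"

lemma smooth_poincare:
 assumes c: "c > 0" and K: "1 <= K" and u: "u \<in> C1 K"
 shows "(LB x. ennreal ((ubar K u x)^2)) \<le>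
  ennreal (poincare_const c) * (Gsq K u + (\<Sum>k\<in>{1..K}. jump_weight c k * Jsq k u))"
proof -
 let ?D = "diameter (region N)" and ?J = "\<Sum>k\<in>{1..K}. jump_weight c k * Jsq k u"
 obtain e :: "'n point" where "e \<in> Basis" using nonempty_Basis by blast
 then have e: "norm e = 1" by simp
 define h where "h = ?D *\<^sub>R e"
 have nh: "norm h = ?D" using e diameter_region_pos by (simp add: h_def)
 have "(LB x. ennreal ((ubar K u x)^2)) =
   (LB x. indicator (region N) x * ennreal ((ubar K u (x + h) - ubar K u x)^2))"
 proof (rule nn_integral_cong)
  fix x
  show "ennreal ((ubar K u x)^2) = indicator (region N) x * ennreal ((ubar K u (x + h) - ubar K u x)^2)"
   using translate_diameter_leaves[OF _ e, of x] by (cases "x \<in> region N") (auto simp: ubar_def h_def)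
 qed
 also have "... <= ennreal (1 + 1/c) * (ennreal ((norm h)^2) * Gsq K u + ennreal (norm h) * ?J)"
  by (rule integrated_estimate[OF c K u]) auto
 also have "... <= ennreal (1 + 1/c) * (ennreal (?D * max ?D 1) * Gsq K u + ennreal (?D * max ?D 1) * ?J)"
  unfolding nh using diameter_region_pos
  by (intro mult_left_mono add_mono mult_right_mono ennreal_leI) (auto simp: power2_eq_square)
 also have "... = ennreal (poincare_const c) * (Gsq K u + ?J)"
  unfolding poincare_const_def using c diameter_region_pos
  by (simp add: ennreal_mult distrib_left mult.assoc)
 finally show ?thesis .
qed

text \<open>Both values tend to \<open>u \<xi>\<close> along every direction, so the limit is 0
  whatever vector \<open>unit_normal\<close> yields.\<close>

lemma jump_smooth_point:
 assumes K: "1 <= K" and u: "u \<in> C1 K" and \<xi>: "\<xi> \<in> smooth K"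
 shows "jump S u \<xi> = 0"
proof -
 have "isCont u \<xi>"
  using c1_continuous(1)[OF K u] \<xi> open_smooth_region[OF K] by (simp add: continuous_on_eq_continuous_at)
 then have lim: "((%s. u (\<xi> + s *\<^sub>R d)) \<longlongrightarrow> u \<xi>) (at_right 0)" for d
  by (rule isCont_tendsto_compose) (auto intro!: tendsto_eq_intros)
 have "((%s. u (\<xi> + s *\<^sub>R d) - u (\<xi> - s *\<^sub>R d)) \<longlongrightarrow> 0) (at_right 0)" for d
  using tendsto_diff[OF lim[of d] lim[of "- d"]] by simp
 then show ?thesis unfolding jump_def by (intro tendsto_Lim) auto
qed

lemma iface_above_smooth: "1 <= k ==> K < k ==> \<xi> \<in> iface N k ==> \<xi> \<in> smooth K"
 using iface_sub[of k] iface_disjoint[of k] by (fastforce simp: iface_upto_def)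

lemma Jsq_above: "1 <= K ==> u \<in> C1 K ==> K < k ==> Jsq k u = 0"
 using iface_above_smooth[of k K]
 by (simp add: Jsq_def nn_integral_surface jsq_def jump_smooth_point indicator_def cong: nn_integral_cong)
   (subst nn_integral_cong[where v = "%_. 0"], auto simp: jump_smooth_point)

lemma AE_smooth_part: "AE x in lborel. x \<in> region N --> x \<in> smooth K"
 using AE_not_iface_all by eventually_elim (auto simp: iface_all_eq)

text \<open>All interfaces together are a null set, so the level of the domain of integration does
  not matter. This makes the energy independent of the level.\<close>

lemma l2_sq_gradient:
 assumes K: "1 <= K" and u: "u \<in> C1 K"
 shows "l2_sq (lebesgue_on (smooth L)) (gradient u) = Gsq K u"
  "l2_sq (lebesgue_on (region N - iface_all N)) (gradient u) = Gsq K u"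
proof -
 note [measurable] = borel_ubar_gbar[OF K u]
 have *: "l2_sq (lebesgue_on (region N - A)) (gradient u) = Gsq K u"
  if [measurable]: "A \<in> sets borel" and A: "A \<subseteq> iface_all N" for A
  unfolding Gsq_def
 proof (rule l2_sq_lebesgue_on)
  show "AE x in lborel. norm (gbar K u x) = (if x \<in> region N - A then norm (gradient u x) else 0)"
   using AE_smooth_part[of K] AE_not_iface_all by eventually_elim (use A in \<open>auto simp: gbar_def\<close>)
 qed measurable
 show "l2_sq (lebesgue_on (smooth L)) (gradient u) = Gsq K u"
  by (rule *) (auto simp: iface_all_eq)
 show "l2_sq (lebesgue_on (region N - iface_all N)) (gradient u) = Gsq K u" by (rule *) auto
qed

lemma l2_sq_jump: "l2_sq (surface N k) (jmp k u) = Jsq k u"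
 by (simp add: l2_sq_def Jsq_def jsq_def)

lemma jump_sq_smooth:
 assumes K: "1 <= K" and u: "u \<in> C1 K"
 shows "jump_sq N c (%k. jmp k u) = (\<Sum>k\<in>{1..K}. jump_weight c k * Jsq k u)"
proof -
 have "jump_sq N c (%k. jmp k u) = (\<Sum>k. jump_weight c (Suc k) * Jsq (Suc k) u)"
  by (simp add: jump_sq_def l2_sq_jump jump_weight_def)
 also have "... = (\<Sum>k<K. jump_weight c (Suc k) * Jsq (Suc k) u)"
  using Jsq_above[OF K u] by (intro suminf_finite) auto
 also have "... = (\<Sum>k\<in>{1..K}. jump_weight c k * Jsq k u)"
  by (simp add: sum.atLeast1_atMost_eq)
 finally show ?thesis .
qed

end

section \<open>Completions\<close>

text \<open>The usual vector space laws are absent because in \<open>union_space\<close> they hold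
  only up to distance 0: a combination with coefficient 0 can still raise the level. What remains
  are statements about norms and distances, which survive limits.\<close>

locale seminormed =
 fixes V :: "'x prenormed"
 assumes lincomb_points: "\<And>a b x y. x \<in> points V ==> y \<in> points V ==> lincomb V a b x y \<in> points V"
  and pdist_self: "\<And>x. x \<in> points V ==> pdist V x x = 0"
  and pdist_sym: "\<And>x y. x \<in> points V ==> y \<in> points V ==> pdist V x y = pdist V y x"
  and pdist_triangle: "\<And>x y z. x \<in> points V ==> y \<in> points V ==> z \<in> points V ==>
   pdist V x z <= pdist V x y + pdist V y z"
  and pnorm_diff: "\<And>x y. x \<in> points V ==> y \<in> points V ==> \<bar>pnorm V x - pnorm V y\<bar> <= pdist V x y"
  and pnorm_nonneg: "\<And>x. x \<in> points V ==> 0 <= pnorm V x"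
  and pdist_lincomb: "\<And>a b x y x' y'. x \<in> points V ==> y \<in> points V ==> x' \<in> points V ==> y' \<in> points V ==>
   pdist V (lincomb V a b x y) (lincomb V a b x' y') <= \<bar>a\<bar> * pdist V x x' + \<bar>b\<bar> * pdist V y y'"
begin

abbreviation "cls X \<equiv> null_rel V `` {X}"

lemma pdist_nonneg: "x \<in> points V ==> y \<in> points V ==> 0 <= pdist V x y"
 using pnorm_diff[of x y] by linarith

lemma cauchy_points: "X \<in> cauchy_seqs V ==> X n \<in> points V"
 by (simp add: cauchy_seqs_def)

lemma cauchy_real:
 assumes X: "X \<in> cauchy_seqs V" and Y: "Y \<in> cauchy_seqs V"
  and f: "\<And>m n. \<bar>f m - f n\<bar> <= \<alpha> * pdist V (X m) (X n) + \<beta> * pdist V (Y m) (Y n)"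
  and ab: "\<alpha> >= 0" "\<beta> >= 0"
 shows "convergent (f :: nat => real)"
proof (rule Cauchy_convergent, rule metric_CauchyI)
 fix e :: real assume e: "e > 0"
 define \<epsilon> where "\<epsilon> = e / (\<alpha> + \<beta> + 1)"
 have eps: "\<epsilon> > 0" using e ab by (simp add: \<epsilon>_def)
 obtain n1 n2 where n1: "\<forall>m\<ge>n1. \<forall>n\<ge>n1. pdist V (X m) (X n) < \<epsilon>" and n2: "\<forall>m\<ge>n2. \<forall>n\<ge>n2. pdist V (Y m) (Y n) < \<epsilon>"
  using X Y eps unfolding cauchy_seqs_def by blast
 have "dist (f m) (f n) < e" if "m >= max n1 n2" "n >= max n1 n2" for m n
 proof -
  have "\<bar>f m - f n\<bar> <= \<alpha> * pdist V (X m) (X n) + \<beta> * pdist V (Y m) (Y n)" by (rule f)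
  also have "... <= \<alpha> * \<epsilon> + \<beta> * \<epsilon>"
   using n1 n2 that ab by (intro add_mono mult_left_mono) (auto intro: less_imp_le)
  also have "... < (\<alpha> + \<beta> + 1) * \<epsilon>" using eps by (simp add: algebra_simps)
  also have "... = e" using ab by (simp add: \<epsilon>_def)
  finally show ?thesis by (simp add: dist_real_def)
 qed
 then show "\<exists>M. \<forall>m\<ge>M. \<forall>n\<ge>M. dist (f m) (f n) < e" by blast
qed

lemma pnorm_convergent: "X \<in> cauchy_seqs V ==> convergent (%n. pnorm V (X n))"
 by (rule cauchy_real[of X X _ 1 0]) (auto intro!: pnorm_diff cauchy_points)

lemma lincomb_cauchy:
 assumes X: "X \<in> cauchy_seqs V" and Y: "Y \<in> cauchy_seqs V"
 shows "(%n. lincomb V a b (X n) (Y n)) \<in> cauchy_seqs V"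
 unfolding cauchy_seqs_def
proof (intro CollectI conjI allI impI)
 fix e :: real assume e: "e > 0"
 define \<epsilon> where "\<epsilon> = e / (\<bar>a\<bar> + \<bar>b\<bar> + 1)"
 have eps: "\<epsilon> > 0" using e by (simp add: \<epsilon>_def)
 obtain n1 n2 where n1: "\<forall>m\<ge>n1. \<forall>n\<ge>n1. pdist V (X m) (X n) < \<epsilon>" and n2: "\<forall>m\<ge>n2. \<forall>n\<ge>n2. pdist V (Y m) (Y n) < \<epsilon>"
  using X Y eps unfolding cauchy_seqs_def by blast
 have "pdist V (lincomb V a b (X m) (Y m)) (lincomb V a b (X n) (Y n)) < e" if "m >= max n1 n2" "n >= max n1 n2" for m n
 proof -
  have "pdist V (lincomb V a b (X m) (Y m)) (lincomb V a b (X n) (Y n)) \<le>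
    \<bar>a\<bar> * pdist V (X m) (X n) + \<bar>b\<bar> * pdist V (Y m) (Y n)"
   by (intro pdist_lincomb cauchy_points X Y)
  also have "... <= \<bar>a\<bar> * \<epsilon> + \<bar>b\<bar> * \<epsilon>"
   using n1 n2 that by (intro add_mono mult_left_mono) (auto intro: less_imp_le)
  also have "... < (\<bar>a\<bar> + \<bar>b\<bar> + 1) * \<epsilon>" using eps by (simp add: algebra_simps)
  also have "... = e" by (simp add: \<epsilon>_def)
  finally show ?thesis .
 qed
 then show "\<exists>n0. \<forall>m\<ge>n0. \<forall>n\<ge>n0. pdist V (lincomb V a b (X m) (Y m)) (lincomb V a b (X n) (Y n)) < e" by blast
qed (intro lincomb_points cauchy_points X Y)

lemma null_relI:
 "X \<in> cauchy_seqs V ==> Y \<in> cauchy_seqs V ==> (%n. pdist V (X n) (Y n)) ----> 0 ==> (X, Y) \<in> null_rel V"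
 by (simp add: null_rel_def)

lemma null_relD:
 assumes "(X, Y) \<in> null_rel V"
 shows "X \<in> cauchy_seqs V" "Y \<in> cauchy_seqs V" "(%n. pdist V (X n) (Y n)) ----> 0"
 using assms by (simp_all add: null_rel_def)

lemma equiv_null_rel: "equiv (cauchy_seqs V) (null_rel V)"
proof (rule equivI)
 show "null_rel V \<subseteq> cauchy_seqs V \<times> cauchy_seqs V" by (auto simp: null_rel_def)
 show "refl_on (cauchy_seqs V) (null_rel V)"
  by (auto simp: refl_on_def null_rel_def pdist_self cauchy_points)
 show "sym (null_rel V)"
 proof (rule symI)
  fix X Y assume r: "(X, Y) \<in> null_rel V"
  have "(%n. pdist V (Y n) (X n)) = (%n. pdist V (X n) (Y n))"
   using null_relD(1,2)[OF r] by (intro ext pdist_sym cauchy_points)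
  then show "(Y, X) \<in> null_rel V" using null_relD[OF r] by (intro null_relI) auto
 qed
 show "trans (null_rel V)"
 proof (rule transI)
  fix X Y Z assume a: "(X, Y) \<in> null_rel V" "(Y, Z) \<in> null_rel V"
  have "(%n. pdist V (X n) (Z n)) ----> 0"
  proof (rule tendsto_sandwich[of "%_. 0" _ _ "%n. pdist V (X n) (Y n) + pdist V (Y n) (Z n)"])
   show "(%n. pdist V (X n) (Y n) + pdist V (Y n) (Z n)) ----> 0"
    using tendsto_add[OF null_relD(3)[OF a(1)] null_relD(3)[OF a(2)]] by simp
  qed (use null_relD(1,2)[OF a(1)] null_relD(1,2)[OF a(2)] in
    \<open>auto intro!: eventuallyI pdist_nonneg pdist_triangle cauchy_points\<close>)
  then show "(X, Z) \<in> null_rel V" using null_relD[OF a(1)] null_relD[OF a(2)] by (intro null_relI) auto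
 qed
qed

lemma points_completion: "points (space_completion V) = cauchy_seqs V // null_rel V"
 by (simp add: space_completion_def)

lemma cls_point: "X \<in> cauchy_seqs V ==> cls X \<in> points (space_completion V)"
 unfolding points_completion by (rule quotientI)

lemma cls_self: "X \<in> cauchy_seqs V ==> X \<in> cls X"
 using equiv_class_self[OF equiv_null_rel] .

lemma point_rep: "p \<in> points (space_completion V) ==> X \<in> p ==> X \<in> cauchy_seqs V & p = cls X"
proof -
 assume p: "p \<in> points (space_completion V)" and X: "X \<in> p"
 then obtain Y where Y: "Y \<in> cauchy_seqs V" "p = cls Y" unfolding points_completion by (auto elim!: quotientE)
 then have r: "(Y, X) \<in> null_rel V" using X by simp
 then show ?thesis using null_relD(2)[OF r] equiv_class_eq[OF equiv_null_rel r] Y(2) by simp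
qed

lemma point_nonempty: "p \<in> points (space_completion V) ==> \<exists>X. X \<in> p"
 unfolding points_completion using cls_self by (auto elim!: quotientE)

lemma pnorm_cls:
 assumes X: "X \<in> cauchy_seqs V"
 shows "(%n. pnorm V (X n)) ----> pnorm (space_completion V) (cls X)"
proof -
 obtain l where l: "(%n. pnorm V (X n)) ----> l" using pnorm_convergent[OF X] by (auto simp: convergent_def)
 have all: "(%n. pnorm V (Y n)) ----> l" if "Y \<in> cls X" for Y
 proof -
  have r: "(X, Y) \<in> null_rel V" using that by simp
  have "(%n. pnorm V (Y n) - pnorm V (X n)) ----> 0"
  proof (rule Lim_null_comparison[OF _ null_relD(3)[OF r]], intro always_eventually allI)
   fix n
   show "norm (pnorm V (Y n) - pnorm V (X n)) <= pdist V (X n) (Y n)"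
    using pnorm_diff[of "X n" "Y n"] null_relD(1,2)[OF r] by (simp add: cauchy_points abs_minus_commute)
  qed
  from tendsto_add[OF this l] show ?thesis by simp
 qed
 have "pnorm (space_completion V) (cls X) = l"
  unfolding space_completion_def prenormed.simps
 proof (rule the_equality)
  show "\<forall>Y\<in>cls X. (%n. pnorm V (Y n)) ----> l" using all by blast
  show "l' = l" if "\<forall>Y\<in>cls X. (%n. pnorm V (Y n)) ----> l'" for l'
   using that cls_self[OF X] l LIMSEQ_unique by blast
 qed
 then show ?thesis using l by simp
qed

lemma lincomb_cls:
 assumes X: "X \<in> cauchy_seqs V" and Y: "Y \<in> cauchy_seqs V"
 shows "lincomb (space_completion V) a b (cls X) (cls Y) = cls (%n. lincomb V a b (X n) (Y n))"
proof -
 have sub: "(%n. lincomb V a b (X n) (Y n), %n. lincomb V a b (X' n) (Y' n)) \<in> null_rel V"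
  if r: "(X, X') \<in> null_rel V" "(Y, Y') \<in> null_rel V" for X' Y'
 proof (rule null_relI[OF lincomb_cauchy[OF X Y] lincomb_cauchy])
  show c: "X' \<in> cauchy_seqs V" "Y' \<in> cauchy_seqs V" using null_relD r by blast+
  show "(%n. pdist V (lincomb V a b (X n) (Y n)) (lincomb V a b (X' n) (Y' n))) ----> 0"
  proof (rule tendsto_sandwich[of "%_. 0" _ _ "%n. \<bar>a\<bar> * pdist V (X n) (X' n) + \<bar>b\<bar> * pdist V (Y n) (Y' n)"])
   show "(%n. \<bar>a\<bar> * pdist V (X n) (X' n) + \<bar>b\<bar> * pdist V (Y n) (Y' n)) ----> 0"
    by (rule tendsto_eq_intros null_relD(3)[OF r(1)] null_relD(3)[OF r(2)] refl | simp)+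
  next
   show "\<forall>\<^sub>F n in sequentially. 0 <= pdist V (lincomb V a b (X n) (Y n)) (lincomb V a b (X' n) (Y' n))"
    by (intro always_eventually allI pdist_nonneg lincomb_points cauchy_points[OF X] cauchy_points[OF Y]
      cauchy_points[OF c(1)] cauchy_points[OF c(2)])
   show "\<forall>\<^sub>F n in sequentially. pdist V (lincomb V a b (X n) (Y n)) (lincomb V a b (X' n) (Y' n)) \<le>
     \<bar>a\<bar> * pdist V (X n) (X' n) + \<bar>b\<bar> * pdist V (Y n) (Y' n)"
    by (intro always_eventually allI pdist_lincomb cauchy_points[OF X] cauchy_points[OF Y]
      cauchy_points[OF c(1)] cauchy_points[OF c(2)])
  qed simp
 qed
 have "lincomb (space_completion V) a b (cls X) (cls Y) =
   null_rel V `` {%n. lincomb V a b (X' n) (Y' n) | X' Y'. X' \<in> cls X & Y' \<in> cls Y}"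
  by (simp add: space_completion_def)
 also have "... = cls (%n. lincomb V a b (X n) (Y n))"
 proof
  show "null_rel V `` {%n. lincomb V a b (X' n) (Y' n) | X' Y'. X' \<in> cls X & Y' \<in> cls Y} \<subseteq> cls (%n. lincomb V a b (X n) (Y n))"
  proof
   fix Z assume "Z \<in> null_rel V `` {%n. lincomb V a b (X' n) (Y' n) | X' Y'. X' \<in> cls X & Y' \<in> cls Y}"
   then obtain X' Y' where r: "(X, X') \<in> null_rel V" "(Y, Y') \<in> null_rel V" "(%n. lincomb V a b (X' n) (Y' n), Z) \<in> null_rel V"
    by auto
   have "trans (null_rel V)" using equiv_null_rel by (simp add: equiv_def)
   from transD[OF this sub[OF r(1,2)] r(3)] show "Z \<in> cls (%n. lincomb V a b (X n) (Y n))" by simp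
  qed
  show "cls (%n. lincomb V a b (X n) (Y n)) \<subseteq> null_rel V `` {%n. lincomb V a b (X' n) (Y' n) | X' Y'. X' \<in> cls X & Y' \<in> cls Y}"
   using cls_self[OF X] cls_self[OF Y] by blast
 qed
 finally show ?thesis .
qed

lemma pdist_cls:
 assumes X: "X \<in> cauchy_seqs V" and Y: "Y \<in> cauchy_seqs V"
 shows "(%n. pdist V (X n) (Y n)) ----> pdist (space_completion V) (cls X) (cls Y)"
 using pnorm_cls[OF lincomb_cauchy[OF X Y, of 1 "-1"]] unfolding pdist_def lincomb_cls[OF X Y] .

lemma const_cauchy: "x \<in> points V ==> (%_. x) \<in> cauchy_seqs V"
 by (simp add: cauchy_seqs_def pdist_self)

theorem seminormed_completion: "seminormed (space_completion V)"
proof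
 let ?W = "space_completion V"
 have rep: "\<exists>X\<in>cauchy_seqs V. p = cls X" if "p \<in> points ?W" for p
  using point_rep[OF that] point_nonempty[OF that] by blast
 show "lincomb ?W a b p q \<in> points ?W" if pq: "p \<in> points ?W" "q \<in> points ?W" for a b p q
 proof -
  obtain X Y where X: "X \<in> cauchy_seqs V" "p = cls X" and Y: "Y \<in> cauchy_seqs V" "q = cls Y"
   using rep[OF pq(1)] rep[OF pq(2)] by blast
  show ?thesis unfolding X(2) Y(2) lincomb_cls[OF X(1) Y(1)] by (rule cls_point[OF lincomb_cauchy[OF X(1) Y(1)]])
 qed
 show "0 <= pnorm ?W p" if p: "p \<in> points ?W" for p
 proof -
  obtain X where X: "X \<in> cauchy_seqs V" "p = cls X" using rep[OF p] by blast
  show ?thesis unfolding X(2)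
   by (rule LIMSEQ_le_const[OF pnorm_cls[OF X(1)]]) (auto intro!: pnorm_nonneg cauchy_points X)
 qed
 show "pdist ?W p p = 0" if p: "p \<in> points ?W" for p
 proof -
  obtain X where X: "X \<in> cauchy_seqs V" "p = cls X" using rep[OF p] by blast
  have "(%n. pdist V (X n) (X n)) ----> 0" using X by (simp add: pdist_self cauchy_points)
  then show ?thesis unfolding X(2) using pdist_cls[OF X(1) X(1)] LIMSEQ_unique by blast
 qed
 show "pdist ?W p q = pdist ?W q p" if pq: "p \<in> points ?W" "q \<in> points ?W" for p q
 proof -
  obtain X Y where X: "X \<in> cauchy_seqs V" "p = cls X" and Y: "Y \<in> cauchy_seqs V" "q = cls Y"
   using rep[OF pq(1)] rep[OF pq(2)] by blast
  have "(%n. pdist V (X n) (Y n)) = (%n. pdist V (Y n) (X n))"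
   using X Y by (intro ext pdist_sym cauchy_points)
  then show ?thesis using pdist_cls[OF X(1) Y(1)] pdist_cls[OF Y(1) X(1)] X(2) Y(2) LIMSEQ_unique by metis
 qed
 show "\<bar>pnorm ?W p - pnorm ?W q\<bar> <= pdist ?W p q" if pq: "p \<in> points ?W" "q \<in> points ?W" for p q
 proof -
  obtain X Y where X: "X \<in> cauchy_seqs V" "p = cls X" and Y: "Y \<in> cauchy_seqs V" "q = cls Y"
   using rep[OF pq(1)] rep[OF pq(2)] by blast
  have "(%n. \<bar>pnorm V (X n) - pnorm V (Y n)\<bar>) ----> \<bar>pnorm ?W p - pnorm ?W q\<bar>"
   unfolding X(2) Y(2) by (intro tendsto_intros pnorm_cls X Y)
  then show ?thesis
   using pdist_cls[OF X(1) Y(1)] unfolding X(2) Y(2)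
   by (rule LIMSEQ_le) (auto intro!: pnorm_diff cauchy_points X Y)
 qed
 show "pdist ?W p r <= pdist ?W p q + pdist ?W q r"
  if pqr: "p \<in> points ?W" "q \<in> points ?W" "r \<in> points ?W" for p q r
 proof -
  obtain X Y Z where X: "X \<in> cauchy_seqs V" "p = cls X" and Y: "Y \<in> cauchy_seqs V" "q = cls Y"
   and Z: "Z \<in> cauchy_seqs V" "r = cls Z"
   using rep[OF pqr(1)] rep[OF pqr(2)] rep[OF pqr(3)] by blast
  show ?thesis unfolding X(2) Y(2) Z(2)
   by (rule LIMSEQ_le[OF pdist_cls[OF X(1) Z(1)] tendsto_add[OF pdist_cls[OF X(1) Y(1)] pdist_cls[OF Y(1) Z(1)]]])
    (auto intro!: pdist_triangle cauchy_points X Y Z)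
 qed
 show "pdist ?W (lincomb ?W a b p q) (lincomb ?W a b p' q') <= \<bar>a\<bar> * pdist ?W p p' + \<bar>b\<bar> * pdist ?W q q'"
  if pq: "p \<in> points ?W" "q \<in> points ?W" "p' \<in> points ?W" "q' \<in> points ?W" for a b p q p' q'
 proof -
  obtain X Y where X: "X \<in> cauchy_seqs V" "p = cls X" and Y: "Y \<in> cauchy_seqs V" "q = cls Y"
   using rep[OF pq(1)] rep[OF pq(2)] by blast
  obtain X' Y' where X': "X' \<in> cauchy_seqs V" "p' = cls X'" and Y': "Y' \<in> cauchy_seqs V" "q' = cls Y'"
   using rep[OF pq(3)] rep[OF pq(4)] by blast
  note lim = pdist_cls[OF lincomb_cauchy[OF X(1) Y(1)] lincomb_cauchy[OF X'(1) Y'(1)], of a b a b]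
  show ?thesis unfolding X(2) Y(2) X'(2) Y'(2) lincomb_cls[OF X(1) Y(1)] lincomb_cls[OF X'(1) Y'(1)]
   by (rule LIMSEQ_le[OF lim tendsto_add[OF tendsto_mult_left[OF pdist_cls[OF X(1) X'(1)]]
     tendsto_mult_left[OF pdist_cls[OF Y(1) Y'(1)]]]]) (auto intro!: pdist_lincomb cauchy_points X Y X' Y')
 qed
qed

text \<open>This replaces an arbitrary Cauchy sequence of a class by one of convenient members, such
  as embedded piecewise smooth functions.\<close>

lemma close_sequence_in_class:
 assumes p: "p \<in> points (space_completion V)" "X \<in> p" and Y: "\<And>n. Y n \<in> points V"
  and lim: "(%n. pdist V (X n) (Y n)) ----> 0"
 shows "Y \<in> p"
proof -
 have X: "X \<in> cauchy_seqs V" "p = cls X" using point_rep[OF p] by auto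
 note Xn = cauchy_points[OF X(1)]
 have "Y \<in> cauchy_seqs V"
  unfolding cauchy_seqs_def
 proof (intro CollectI conjI allI impI Y)
  fix e :: real assume e: "e > 0"
  then have e3: "e/3 > 0" by simp
  obtain n1 where n1: "\<forall>m\<ge>n1. \<forall>n\<ge>n1. pdist V (X m) (X n) < e/3"
   using X(1) e3 unfolding cauchy_seqs_def by blast
  obtain n2 where "\<forall>n\<ge>n2. norm (pdist V (X n) (Y n) - 0) < e/3"
   using LIMSEQ_D[OF lim e3] by blast
  then have n2: "\<forall>n\<ge>n2. pdist V (X n) (Y n) < e/3" by auto
  have "pdist V (Y m) (Y n) < e" if "m >= max n1 n2" "n >= max n1 n2" for m n
  proof -
   have "pdist V (Y m) (Y n) <= pdist V (Y m) (X m) + (pdist V (X m) (X n) + pdist V (X n) (Y n))"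
    using pdist_triangle[OF Y[of m] Xn[of m] Y[of n]] pdist_triangle[OF Xn[of m] Xn[of n] Y[of n]] by linarith
   also have "pdist V (Y m) (X m) = pdist V (X m) (Y m)" by (rule pdist_sym[OF Y Xn])
   moreover have "pdist V (X m) (X n) < e/3" "pdist V (X m) (Y m) < e/3" "pdist V (X n) (Y n) < e/3"
    using n1 n2 that by auto
   ultimately show ?thesis by linarith
  qed
  then show "\<exists>n0. \<forall>m\<ge>n0. \<forall>n\<ge>n0. pdist V (Y m) (Y n) < e" by blast
 qed
 then show ?thesis unfolding X(2) using null_relI[OF X(1) _ lim] by simp
qed

end

text \<open>All laws are instances of \<open>sub\<close>: coefficients \<open>0, 0\<close> give the
  vanishing of \<open>pdist\<close> on the diagonal, \<open>-1\<close> the symmetry, and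
  \<open>1, 1\<close> both triangle inequalities.\<close>

lemma seminormed_function_space:
 fixes q :: "('a => real) => real" and S :: "('a => real) set"
 defines "V \<equiv> \<lparr>points = S, lincomb = (%a b v w x. a * v x + b * w x), pnorm = q\<rparr>"
 assumes cl: "\<And>a b v w. v \<in> S ==> w \<in> S ==> (%x. a * v x + b * w x) \<in> S"
  and nn: "\<And>v. v \<in> S ==> 0 <= q v"
  and sub: "\<And>a b v w. v \<in> S ==> w \<in> S ==> q (%x. a * v x + b * w x) <= \<bar>a\<bar> * q v + \<bar>b\<bar> * q w"
 shows "seminormed V"
proof -
 have d: "pdist V x y = q (%z. 1 * x z + (- 1) * y z)" for x y by (simp add: pdist_def V_def)
 have diff: "(%z. 1 * x z + (- 1) * y z) \<in> S" if "x \<in> S" "y \<in> S" for x y by (rule cl[OF that])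
 have sym: "q (%z. 1 * y z + (- 1) * x z) <= q (%z. 1 * x z + (- 1) * y z)" if "x \<in> S" "y \<in> S" for x y
 proof -
  have "q (%z. (- 1) * (1 * x z + (- 1) * y z) + 0 * (1 * x z + (- 1) * y z)) <= q (%z. 1 * x z + (- 1) * y z)"
   using sub[OF diff[OF that] diff[OF that], of "- 1" 0] by simp
  then show ?thesis by (simp add: algebra_simps)
 qed
 have tri: "q (%z. 1 * x z + (- 1) * w z) <= q (%z. 1 * x z + (- 1) * y z) + q (%z. 1 * y z + (- 1) * w z)"
  if "x \<in> S" "y \<in> S" "w \<in> S" for x y w
 proof -
  have "q (%z. 1 * (1 * x z + (- 1) * y z) + 1 * (1 * y z + (- 1) * w z)) \<le>
    q (%z. 1 * x z + (- 1) * y z) + q (%z. 1 * y z + (- 1) * w z)"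
   using sub[OF diff[OF that(1,2)] diff[OF that(2,3)], of 1 1] by simp
  then show ?thesis by simp
 qed
 have le: "q x <= q y + q (%z. 1 * x z + (- 1) * y z)" if "x \<in> S" "y \<in> S" for x y
 proof -
  have "q (%z. 1 * y z + 1 * (1 * x z + (- 1) * y z)) <= q y + q (%z. 1 * x z + (- 1) * y z)"
   using sub[OF that(2) diff[OF that], of 1 1] by simp
  then show ?thesis by simp
 qed
 show ?thesis
 proof
  fix x y assume "x \<in> points V" "y \<in> points V"
  then have xy: "x \<in> S" "y \<in> S" by (simp_all add: V_def)
  show "lincomb V a b x y \<in> points V" for a b using cl[OF xy] by (simp add: V_def)
  show "pdist V x y = pdist V y x" unfolding d using sym[OF xy] sym[OF xy(2,1)] by (rule antisym[rotated])
  have "\<bar>q x - q y\<bar> <= q (%z. 1 * x z + (- 1) * y z)"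
   using le[OF xy] le[OF xy(2,1)] sym[OF xy] by linarith
  then show "\<bar>pnorm V x - pnorm V y\<bar> <= pdist V x y" unfolding d by (simp add: V_def)
  show "pdist V x z <= pdist V x y + pdist V y z" if "z \<in> points V" for z
   unfolding d using that by (intro tri xy) (simp add: V_def)
  show "pdist V (lincomb V a b x y) (lincomb V a b x' y') <= \<bar>a\<bar> * pdist V x x' + \<bar>b\<bar> * pdist V y y'"
   if "x' \<in> points V" "y' \<in> points V" for a b x' y'
  proof -
   have xy': "x' \<in> S" "y' \<in> S" using that by (simp_all add: V_def)
   have "q (%z. a * (1 * x z + (- 1) * x' z) + b * (1 * y z + (- 1) * y' z)) \<le>
     \<bar>a\<bar> * q (%z. 1 * x z + (- 1) * x' z) + \<bar>b\<bar> * q (%z. 1 * y z + (- 1) * y' z)"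
    by (rule sub[OF diff[OF xy(1) xy'(1)] diff[OF xy(2) xy'(2)]])
   then show ?thesis unfolding d by (simp add: V_def algebra_simps)
  qed
  have "q (%z. 0 * x z + 0 * x z) <= 0" using sub[OF xy(1) xy(1), of 0 0] by simp
  then have "q (%z. 0) = 0" using nn[OF cl[OF xy(1) xy(1), of 0 0]] by simp
  then show "pdist V x x = 0" unfolding d by simp
  show "0 <= pnorm V x" using nn[OF xy(1)] by (simp add: V_def)
 qed
qed

text \<open>Cauchy-Schwarz for a form that is only positive semidefinite, obtained from the sign of
  the quadratic polynomial \<open>Q (s v + t w) (s v + t w)\<close>; it is taken at
  \<open>s = Q w w\<close> and \<open>t = - Q v w\<close> unless \<open>Q w w = 0\<close>.\<close>

lemma bilinear_sqrt_sublinear: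
 fixes Q :: "('a => real) => ('a => real) => real"
 assumes cl: "\<And>a b v w. v \<in> S ==> w \<in> S ==> (%x. a * v x + b * w x) \<in> S"
  and bil: "\<And>a b u v w. u \<in> S ==> v \<in> S ==> w \<in> S ==> Q (%x. a * u x + b * v x) w = a * Q u w + b * Q v w"
  and sym: "\<And>u v. Q u v = Q v u" and pos: "\<And>u. u \<in> S ==> 0 <= Q u u"
  and v: "v \<in> S" and w: "w \<in> S"
 shows "sqrt (Q (%x. a * v x + b * w x) (%x. a * v x + b * w x)) <= \<bar>a\<bar> * sqrt (Q v v) + \<bar>b\<bar> * sqrt (Q w w)"
proof -
 have expand: "Q (%x. s * v x + t * w x) (%x. s * v x + t * w x) = s\<^sup>2 * Q v v + 2 * s * t * Q v w + t\<^sup>2 * Q w w" for s t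
 proof -
  have z: "(%x. s * v x + t * w x) \<in> S" by (rule cl[OF v w])
  have "Q (%x. s * v x + t * w x) (%x. s * v x + t * w x) =
    s * Q (%x. s * v x + t * w x) v + t * Q (%x. s * v x + t * w x) w"
   unfolding bil[OF v w z] by (simp add: sym)
  also have "... = s\<^sup>2 * Q v v + 2 * s * t * Q v w + t\<^sup>2 * Q w w"
   unfolding bil[OF v w v] bil[OF v w w] using sym[of v w] by (simp add: power2_eq_square algebra_simps)
  finally show ?thesis .
 qed
 have nn: "0 <= s\<^sup>2 * Q v v + 2 * s * t * Q v w + t\<^sup>2 * Q w w" for s t
  unfolding expand[symmetric] by (rule pos[OF cl[OF v w]])
 have CS: "(Q v w)^2 <= Q v v * Q w w"
 proof (cases "Q w w = 0")
  case True
  have "Q v w = 0"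
  proof (rule ccontr)
   assume ne: "Q v w ~= 0"
   \<comment> \<open>With \<open>Q w w = 0\<close> and this \<open>t\<close> the polynomial at
     \<open>s = 1\<close> takes the value \<open>-1\<close>.\<close>
   define t where "t = - (Q v v + 1) / (2 * Q v w)"
   have "2 * t * Q v w = - (Q v v + 1)" using ne by (simp add: t_def)
   then show False using nn[of 1 t] True by simp
  qed
  then show ?thesis using True by simp
 next
  case False
  then have "Q w w > 0" using pos[OF w] by simp
  moreover have "0 <= Q w w * (Q v v * Q w w - (Q v w)^2)"
   using nn[of "Q w w" "- Q v w"] by (simp add: power2_eq_square algebra_simps)
  ultimately show ?thesis by (simp add: zero_le_mult_iff)
 qed
 have "\<bar>Q v w\<bar> <= sqrt (Q v v) * sqrt (Q w w)"
  using real_sqrt_le_mono[OF CS] by (simp add: real_sqrt_mult)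
 then have "a * b * Q v w <= \<bar>a\<bar> * \<bar>b\<bar> * (sqrt (Q v v) * sqrt (Q w w))"
  by (metis (no_types, opaque_lifting) abs_ge_self abs_mult abs_ge_zero mult_left_mono mult_nonneg_nonneg order_trans)
 then have "Q (%x. a * v x + b * w x) (%x. a * v x + b * w x) <= (\<bar>a\<bar> * sqrt (Q v v) + \<bar>b\<bar> * sqrt (Q w w))^2"
  unfolding expand using pos[OF v] pos[OF w] by (simp add: power2_sum power_mult_distrib algebra_simps)
 then show ?thesis using pos[OF v] pos[OF w] by (intro real_le_lsqrt) auto
qed

section \<open>Linear combinations of square integrable functions\<close>

lemma norm_lincomb_sq:
 fixes p q :: "'b::real_normed_vector"
 shows "(norm (a *\<^sub>R p + b *\<^sub>R q))^2 <= 2 * a\<^sup>2 * (norm p)^2 + 2 * b\<^sup>2 * (norm q)^2"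
proof -
 have "(norm (a *\<^sub>R p + b *\<^sub>R q))^2 <= (\<bar>a\<bar> * norm p + \<bar>b\<bar> * norm q)^2"
  by (intro power_mono) (auto intro: order_trans[OF norm_triangle_ineq])
 also have "... <= 2 * (\<bar>a\<bar> * norm p)^2 + 2 * (\<bar>b\<bar> * norm q)^2"
  using sum_squares_bound[of "\<bar>a\<bar> * norm p" "\<bar>b\<bar> * norm q"] by (simp add: power2_sum)
 finally show ?thesis by (simp add: power_mult_distrib)
qed

lemma l2_sq_lincomb:
 fixes f g :: "'a => 'b::{real_normed_vector,second_countable_topology}"
 assumes [measurable]: "f \<in> borel_measurable M" "g \<in> borel_measurable M"
 shows "l2_sq M (%x. a *\<^sub>R f x + b *\<^sub>R g x) <= ennreal (2 * a\<^sup>2) * l2_sq M f + ennreal (2 * b\<^sup>2) * l2_sq M g"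
proof -
 have "l2_sq M (%x. a *\<^sub>R f x + b *\<^sub>R g x) \<le>
   (\<integral>\<^sup>+x. ennreal (2 * a\<^sup>2) * ennreal ((norm (f x))^2) + ennreal (2 * b\<^sup>2) * ennreal ((norm (g x))^2) \<partial>M)"
  unfolding l2_sq_def
  by (intro nn_integral_mono)
   (auto simp: ennreal_mult[symmetric] ennreal_plus[symmetric] simp del: ennreal_plus intro!: ennreal_leI norm_lincomb_sq)
 also have "... = ennreal (2 * a\<^sup>2) * l2_sq M f + ennreal (2 * b\<^sup>2) * l2_sq M g"
  unfolding l2_sq_def by (simp add: nn_integral_add nn_integral_cmult)
 finally show ?thesis .
qed

lemma l2_space_lincomb:
 fixes f g :: "'a => 'b::{real_normed_vector,second_countable_topology}"
 assumes "f \<in> l2_space M" "g \<in> l2_space M"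
 shows "(%x. a *\<^sub>R f x + b *\<^sub>R g x) \<in> l2_space M"
proof -
 have [measurable]: "f \<in> borel_measurable M" "g \<in> borel_measurable M" using assms by (auto simp: l2_space_def)
 have "ennreal (2 * a\<^sup>2) * l2_sq M f + ennreal (2 * b\<^sup>2) * l2_sq M g < \<infinity>"
  using assms by (auto simp: l2_space_def ennreal_mult_less_top)
 then have "l2_sq M (%x. a *\<^sub>R f x + b *\<^sub>R g x) < \<infinity>"
  using l2_sq_lincomb[of f M g a b] by (auto intro: order_le_less_trans)
 then show ?thesis by (simp add: l2_space_def)
qed

lemma l2_sq_cong: "(AE x in M. f x = g x) ==> l2_sq M f = l2_sq M g"
 unfolding l2_sq_def by (intro nn_integral_cong_AE) (auto elim: eventually_mono)

lemma integrable_inner_l2: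
 fixes f g :: "'a => 'b::euclidean_space"
 assumes "f \<in> l2_space M" "g \<in> l2_space M"
 shows "integrable M (%x. f x \<bullet> g x)"
proof -
 have [measurable]: "f \<in> borel_measurable M" "g \<in> borel_measurable M" using assms by (auto simp: l2_space_def)
 have sq: "integrable M (%x. (norm (h x))^2)" if "h \<in> l2_space M" for h :: "'a => 'b"
  using that by (intro integrableI_bounded) (auto simp: l2_space_def l2_sq_def)
 show ?thesis
 proof (rule Bochner_Integration.integrable_bound[OF Bochner_Integration.integrable_add[OF sq[OF assms(1)] sq[OF assms(2)]]])
  have "\<bar>f x \<bullet> g x\<bar> <= (norm (f x))^2 + (norm (g x))^2" for x
  proof -
   have "\<bar>f x \<bullet> g x\<bar> <= norm (f x) * norm (g x)" by (rule Cauchy_Schwarz_ineq2)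
   also have "... <= 2 * norm (f x) * norm (g x)" by simp
   also have "... <= (norm (f x))^2 + (norm (g x))^2" by (rule sum_squares_bound)
   finally show ?thesis .
  qed
  then show "AE x in M. norm (f x \<bullet> g x) <= norm ((norm (f x))^2 + (norm (g x))^2)" by simp
 qed measurable
qed

lemma integral_inner_self: "f \<in> l2_space M ==> (\<integral>x. f x \<bullet> f x \<partial>M) = enn2real (l2_sq M f)"
 for f :: "'a => 'b::euclidean_space"
 unfolding l2_sq_def power2_norm_eq_inner
 by (rule integral_eq_nn_integral) (auto simp: l2_space_def)

section \<open>The level spaces and their inner product\<close>

context regular_network
begin

lemma space_surface [simp]: "space (surface N k) = iface N k"
 by (simp add: surface_def space_restrict_space)

lemma hausdorff_sets: "A \<in> sets borel ==> A \<in> sets (hausdorff_measure r)" for A :: "'n point set"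
 using borel_subset_sets_hausdorff by blast

lemma sets_surface: "1 <= k ==> A \<in> sets (surface N k) \<longleftrightarrow> A \<subseteq> iface N k & A \<in> sets (hausdorff_measure (CARD('n) - 1))"
 unfolding surface_def using hausdorff_sets[OF iface_borel]
 by (subst sets_restrict_space_iff) auto

lemma null_subset_B: "A \<subseteq> B ==> A \<in> null_sets (hausdorff_measure (CARD('n) - 1))"
 using hausdorff_outer_mono[of A B "CARD('n) - 1"] hausdorff_B by (intro hausdorff_null_measurable) simp

lemma AE_surface_regular:
 assumes "1 <= k"
 shows "AE \<xi> in surface N k. \<xi> \<notin> B"
 unfolding surface_def
 using hausdorff_sets[OF iface_borel[OF assms]] null_subset_B[OF order_refl]
 by (subst AE_restrict_space_iff) (auto intro: AE_I'[of B])

text \<open>Every subset of \<open>B\<close> is measurable, because the Caratheodory measure is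
  complete. Arbitrary values on \<open>B\<close> therefore do not affect measurability.\<close>

lemma surface_measurable_cong:
 fixes f g :: "'n point => real"
 assumes k: "1 <= k" and f: "f \<in> borel_measurable (surface N k)"
  and eq: "\<And>\<xi>. \<xi> \<in> iface N k ==> \<xi> \<notin> B ==> g \<xi> = f \<xi>"
 shows "g \<in> borel_measurable (surface N k)"
proof (rule measurableI)
 fix A :: "real set" assume A: "A \<in> sets borel"
 let ?I = "iface N k"
 have "g -` A \<inter> space (surface N k) = ((f -` A \<inter> space (surface N k)) - B) \<union> (g -` A \<inter> ?I \<inter> B)"
  using eq by auto
 moreover have "(f -` A \<inter> space (surface N k)) - B \<in> sets (surface N k)"
 proof -
  have "f -` A \<inter> space (surface N k) \<in> sets (surface N k)" using f A by (rule measurable_sets)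
  then have "f -` A \<inter> space (surface N k) \<in> sets (hausdorff_measure (CARD('n) - 1))" by (simp only: sets_surface[OF k])
  then have "f -` A \<inter> space (surface N k) - B \<in> sets (hausdorff_measure (CARD('n) - 1))"
   using hausdorff_sets[OF B_borel] by (rule sets.Diff)
  then show ?thesis by (auto simp: sets_surface[OF k])
 qed
 moreover have "g -` A \<inter> ?I \<inter> B \<in> sets (surface N k)"
  using k null_subset_B[of "g -` A \<inter> ?I \<inter> B"] by (auto simp: sets_surface null_sets_def)
 ultimately show "g -` A \<inter> space (surface N k) \<in> sets (surface N k)" by (metis sets.Un)
qed simp

lemma gradient_lincomb:
 assumes K: "1 <= K" and u: "u \<in> C1 K" and v: "v \<in> C1 K" and x: "x \<in> smooth K"
 shows "gradient (%x. \<alpha> * u x + \<beta> * v x) x = \<alpha> *\<^sub>R gradient u x + \<beta> *\<^sub>R gradient v x"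
proof (rule gradient_eq)
 have "(u has_derivative (%h. h \<bullet> gradient u x)) (at x)" "(v has_derivative (%h. h \<bullet> gradient v x)) (at x)"
  using c1_gradient[OF K u x] c1_gradient[OF K v x] by (simp_all add: gderiv_def)
 then show "GDERIV (%x. \<alpha> * u x + \<beta> * v x) x :> \<alpha> *\<^sub>R gradient u x + \<beta> *\<^sub>R gradient v x"
  unfolding gderiv_def by (auto intro!: derivative_eq_intros simp: inner_add_right)
qed

lemma jump_lincomb:
 assumes k: "1 <= k" "k <= K" and u: "u \<in> C1 K" and v: "v \<in> C1 K"
  and \<xi>: "\<xi> \<in> iface N k" "\<xi> \<notin> B"
 shows "jmp k (%x. \<alpha> * u x + \<beta> * v x) \<xi> = \<alpha> * jmp k u \<xi> + \<beta> * jmp k v \<xi>"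
proof -
 let ?n = "unit_normal (iface N k) \<xi>"
 have "((%s. \<alpha> * (u (\<xi> + s *\<^sub>R ?n) - u (\<xi> - s *\<^sub>R ?n)) + \<beta> * (v (\<xi> + s *\<^sub>R ?n) - v (\<xi> - s *\<^sub>R ?n)))
   \<longlongrightarrow> \<alpha> * jmp k u \<xi> + \<beta> * jmp k v \<xi>) (at_right 0)"
  by (intro tendsto_intros jump_tendsto[OF k u \<xi>] jump_tendsto[OF k v \<xi>])
 then show ?thesis
  unfolding jump_def[of _ "%x. \<alpha> * u x + \<beta> * v x"] by (intro tendsto_Lim) (auto simp: algebra_simps)
qed

lemma c1_gradient_l2: "u \<in> C1 K ==> gradient u \<in> l2_space (lebesgue_on (smooth K))"
 and c1_jump_l2: "u \<in> C1 K ==> k \<in> {1..K} ==> jmp k u \<in> l2_space (surface N k)"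
 by (simp_all add: c1_level_def)

lemma c1_lincomb:
 assumes K: "1 <= K" and u: "u \<in> C1 K" and v: "v \<in> C1 K"
 shows "(%x. \<alpha> * u x + \<beta> * v x) \<in> C1 K"
 unfolding c1_level_def
proof (intro CollectI conjI ballI)
 let ?w = "%x. \<alpha> * u x + \<beta> * v x"
 fix G assume G: "G \<in> cells N K"
 obtain u' D where u': "continuous_on (closure G) u'" "continuous_on (closure G) D"
  "\<And>x. x \<in> G ==> GDERIV u' x :> D x" "\<And>x. x \<in> closure G ==> x \<notin> iface_upto N K ==> u x = u' x"
  by (rule c1_extension[OF u G]) blast
 obtain v' E where v': "continuous_on (closure G) v'" "continuous_on (closure G) E"
  "\<And>x. x \<in> G ==> GDERIV v' x :> E x" "\<And>x. x \<in> closure G ==> x \<notin> iface_upto N K ==> v x = v' x"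
  by (rule c1_extension[OF v G]) blast
 show "\<exists>w D. continuous_on (closure G) w & continuous_on (closure G) D & (\<forall>x\<in>G. GDERIV w x :> D x) \<and>
   (\<forall>x\<in>closure G - iface_upto N K. ?w x = w x)"
 proof (intro exI conjI ballI)
  show "continuous_on (closure G) (%x. \<alpha> * u' x + \<beta> * v' x)"
   "continuous_on (closure G) (%x. \<alpha> *\<^sub>R D x + \<beta> *\<^sub>R E x)"
   by (intro continuous_intros u' v')+
  fix x
  show "?w x = \<alpha> * u' x + \<beta> * v' x" if "x \<in> closure G - iface_upto N K" using that u'(4) v'(4) by simp
  assume "x \<in> G"
  then have "(u' has_derivative (%h. h \<bullet> D x)) (at x)" "(v' has_derivative (%h. h \<bullet> E x)) (at x)"
   using u'(3) v'(3) by (simp_all add: gderiv_def)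
  then show "GDERIV (%x. \<alpha> * u' x + \<beta> * v' x) x :> \<alpha> *\<^sub>R D x + \<beta> *\<^sub>R E x"
   unfolding gderiv_def by (auto intro!: derivative_eq_intros simp: inner_add_right)
 qed
next
 fix x assume "x \<in> frontier (region N)"
 then show "\<alpha> * u x + \<beta> * v x = 0" using c1_zero_frontier[OF u] c1_zero_frontier[OF v] by simp
next
 let ?M = "lebesgue_on (smooth K)"
 have l: "(%x. \<alpha> *\<^sub>R gradient u x + \<beta> *\<^sub>R gradient v x) \<in> l2_space ?M"
  by (intro l2_space_lincomb c1_gradient_l2 u v)
 have eq: "gradient (%x. \<alpha> * u x + \<beta> * v x) x = \<alpha> *\<^sub>R gradient u x + \<beta> *\<^sub>R gradient v x" if "x \<in> space ?M" for x
  using gradient_lincomb[OF K u v] that by simp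
 have "l2_sq ?M (gradient (%x. \<alpha> * u x + \<beta> * v x)) = l2_sq ?M (%x. \<alpha> *\<^sub>R gradient u x + \<beta> *\<^sub>R gradient v x)"
  unfolding l2_sq_def using eq by (intro nn_integral_cong) simp
 then show "gradient (%x. \<alpha> * u x + \<beta> * v x) \<in> l2_space ?M"
  using l measurable_cong[of ?M "gradient (%x. \<alpha> * u x + \<beta> * v x)", OF eq] by (simp add: l2_space_def)
next
 fix k assume k: "k \<in> {1..K}"
 then have k': "1 <= k" "k <= K" by auto
 let ?S = "surface N k"
 have l: "(%\<xi>. \<alpha> *\<^sub>R jmp k u \<xi> + \<beta> *\<^sub>R jmp k v \<xi>) \<in> l2_space ?S"
  by (intro l2_space_lincomb c1_jump_l2[OF u k] c1_jump_l2[OF v k])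
 have eq: "jmp k (%x. \<alpha> * u x + \<beta> * v x) \<xi> = \<alpha> *\<^sub>R jmp k u \<xi> + \<beta> *\<^sub>R jmp k v \<xi>"
  if "\<xi> \<in> iface N k" "\<xi> \<notin> B" for \<xi>
  using jump_lincomb[OF k' u v that] by simp
 have m: "jmp k (%x. \<alpha> * u x + \<beta> * v x) \<in> borel_measurable ?S"
  using l by (intro surface_measurable_cong[OF k'(1) _ eq]) (auto simp: l2_space_def)
 have "AE \<xi> in ?S. jmp k (%x. \<alpha> * u x + \<beta> * v x) \<xi> = \<alpha> *\<^sub>R jmp k u \<xi> + \<beta> *\<^sub>R jmp k v \<xi>"
  using AE_surface_regular[OF k'(1)] AE_space by eventually_elim (use eq in simp)
 from l2_sq_cong[OF this] show "jmp k (%x. \<alpha> * u x + \<beta> * v x) \<in> l2_space ?S"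
  using l m by (simp add: l2_space_def)
qed

text \<open>A cell of level \<open>L\<close> is connected and avoids the interfaces up to level
  \<open>K\<close>, so it lies in one cell of level \<open>K\<close>. Across the additional
  interfaces \<open>u\<close> is continuous and its jumps vanish.\<close>

lemma c1_mono:
 assumes K: "1 <= K" "K <= L" and u: "u \<in> C1 K"
 shows "u \<in> C1 L"
 unfolding c1_level_def
proof (intro CollectI conjI ballI)
 have L: "1 <= L" using K by simp
 have sub: "smooth L \<subseteq> smooth K" using iface_upto_mono[OF K(2)] by blast
 {
  fix G' assume G': "G' \<in> cells N L"
  have "G' \<subseteq> smooth K" using G' cells_Union[OF L] sub by blast
  then obtain G where G: "G \<in> cells N K" "G' \<subseteq> G"
   using connected_in_cell[OF K(1), of G'] cell_props[OF L G'] by blast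
  obtain v D where v: "continuous_on (closure G) v" "continuous_on (closure G) D"
   "\<And>x. x \<in> G ==> GDERIV v x :> D x" "\<And>x. x \<in> closure G ==> x \<notin> iface_upto N K ==> u x = v x"
   by (rule c1_extension[OF u G(1)]) blast
  have cl: "closure G' \<subseteq> closure G" using G(2) by (rule closure_mono)
  show "\<exists>v D. continuous_on (closure G') v & continuous_on (closure G') D & (\<forall>x\<in>G'. GDERIV v x :> D x) \<and>
    (\<forall>x\<in>closure G' - iface_upto N L. u x = v x)"
  proof (intro exI conjI ballI)
   show "continuous_on (closure G') v" "continuous_on (closure G') D"
    using v(1,2) cl by (auto intro: continuous_on_subset)
   show "GDERIV v x :> D x" if "x \<in> G'" for x using v(3) G(2) that by blast
   show "u x = v x" if "x \<in> closure G' - iface_upto N L" for x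
    using v(4) cl iface_upto_mono[OF K(2)] that by blast
  qed
 }
 show "u x = 0" if "x \<in> frontier (region N)" for x using c1_zero_frontier[OF u that] .
 have "gradient u \<in> borel_measurable (lebesgue_on (smooth L))"
  using c1_gradient_l2[OF u] sub by (auto simp: l2_space_def intro: measurable_restrict_mono)
 moreover have "l2_sq (lebesgue_on (smooth L)) (gradient u) < \<infinity>"
  using c1_gradient_l2[OF u] l2_sq_gradient(1)[OF K(1) u] by (simp add: l2_space_def)
 ultimately show "gradient u \<in> l2_space (lebesgue_on (smooth L))" by (simp add: l2_space_def)
 fix k assume k: "k \<in> {1..L}"
 show "jmp k u \<in> l2_space (surface N k)"
 proof (cases "k <= K")
  case True
  then show ?thesis using c1_jump_l2[OF u] k by simp
 next
  case False
  have z: "jmp k u \<xi> = 0" if "\<xi> \<in> space (surface N k)" for \<xi>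
   using jump_smooth_point[OF K(1) u iface_above_smooth[of k K]] that k False by simp
  have "Jsq k u = 0" using Jsq_above[OF K(1) u] False by simp
  then show ?thesis using measurable_cong[of "surface N k" "jmp k u" "%_. 0", OF z]
   by (simp add: l2_space_def l2_sq_jump)
 qed
qed

lemma level_inner_bilinear:
 assumes K: "1 <= K" and u: "u \<in> C1 K" and v: "v \<in> C1 K" and w: "w \<in> C1 K"
 shows "level_inner N K c (%x. \<alpha> * u x + \<beta> * v x) w = \<alpha> * level_inner N K c u w + \<beta> * level_inner N K c v w"
proof -
 let ?M = "lebesgue_on (smooth K)"
 have ig: "integrable ?M (%x. gradient u x \<bullet> gradient w x)" "integrable ?M (%x. gradient v x \<bullet> gradient w x)"
  by (intro integrable_inner_l2 c1_gradient_l2 u v w)+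
 have G: "(\<integral>x. gradient (%x. \<alpha> * u x + \<beta> * v x) x \<bullet> gradient w x \<partial>?M) =
   \<alpha> * (\<integral>x. gradient u x \<bullet> gradient w x \<partial>?M) + \<beta> * (\<integral>x. gradient v x \<bullet> gradient w x \<partial>?M)"
 proof -
  have "(\<integral>x. gradient (%x. \<alpha> * u x + \<beta> * v x) x \<bullet> gradient w x \<partial>?M) =
    (\<integral>x. \<alpha> * (gradient u x \<bullet> gradient w x) + \<beta> * (gradient v x \<bullet> gradient w x) \<partial>?M)"
   by (rule Bochner_Integration.integral_cong) (auto simp: gradient_lincomb[OF K u v] inner_add_left)
  then show ?thesis using ig by simp
 qed
 have J: "(\<integral>\<xi>. jmp k (%x. \<alpha> * u x + \<beta> * v x) \<xi> * jmp k w \<xi> \<partial>surface N k) =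
   \<alpha> * (\<integral>\<xi>. jmp k u \<xi> * jmp k w \<xi> \<partial>surface N k) +
   \<beta> * (\<integral>\<xi>. jmp k v \<xi> * jmp k w \<xi> \<partial>surface N k)" if k: "k \<in> {1..K}" for k
 proof -
  have k': "1 <= k" "k <= K" using k by auto
  note l2 = c1_jump_l2[OF u k] c1_jump_l2[OF v k] c1_jump_l2[OF w k]
  have i: "integrable (surface N k) (%\<xi>. jmp k u \<xi> * jmp k w \<xi>)"
   "integrable (surface N k) (%\<xi>. jmp k v \<xi> * jmp k w \<xi>)"
   using integrable_inner_l2[OF l2(1,3)] integrable_inner_l2[OF l2(2,3)] by simp_all
  have "(\<integral>\<xi>. jmp k (%x. \<alpha> * u x + \<beta> * v x) \<xi> * jmp k w \<xi> \<partial>surface N k) =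
    (\<integral>\<xi>. \<alpha> * (jmp k u \<xi> * jmp k w \<xi>) + \<beta> * (jmp k v \<xi> * jmp k w \<xi>) \<partial>surface N k)"
  proof (rule integral_cong_AE)
   show "(%\<xi>. jmp k (%x. \<alpha> * u x + \<beta> * v x) \<xi> * jmp k w \<xi>) \<in> borel_measurable (surface N k)"
    using c1_jump_l2[OF c1_lincomb[OF K u v] k] l2(3) by (intro borel_measurable_times) (auto simp: l2_space_def)
   show "AE \<xi> in surface N k. jmp k (%x. \<alpha> * u x + \<beta> * v x) \<xi> * jmp k w \<xi> =
     \<alpha> * (jmp k u \<xi> * jmp k w \<xi>) + \<beta> * (jmp k v \<xi> * jmp k w \<xi>)"
    using AE_surface_regular[OF k'(1)] AE_space
    by eventually_elim (simp add: jump_lincomb[OF k' u v] algebra_simps)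
  qed (use i in measurable)
  then show ?thesis using i by simp
 qed
 have "(\<Sum>k=1..K. (1 + c)^k * real (crossings N k) *
   (\<integral>\<xi>. jmp k (%x. \<alpha> * u x + \<beta> * v x) \<xi> * jmp k w \<xi> \<partial>surface N k)) =
  (\<Sum>k=1..K. \<alpha> * ((1 + c)^k * real (crossings N k) * (\<integral>\<xi>. jmp k u \<xi> * jmp k w \<xi> \<partial>surface N k)) +
   \<beta> * ((1 + c)^k * real (crossings N k) * (\<integral>\<xi>. jmp k v \<xi> * jmp k w \<xi> \<partial>surface N k)))"
  by (rule sum.cong[OF refl]) (simp only: J distrib_left mult.left_commute[of _ "\<alpha>"] mult.left_commute[of _ "\<beta>"])
 then show ?thesis
  unfolding level_inner_def G by (simp add: sum.distrib sum_distrib_left algebra_simps)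
qed

text \<open>An expression without a level that agrees with the squared norm at every level to which
  \<open>u\<close> belongs. It turns the isometry of the embeddings between levels into an equality
  of terms.\<close>

definition energy :: "real => ('n point => real) => ennreal" where
 "energy c u = l2_sq (lebesgue_on (region N - iface_all N)) (gradient u) + jump_sq N c (%k. jmp k u)"

definition snorm :: "real => ('n point => real) => real" where
 "snorm c u = sqrt (enn2real (energy c u))"

lemma energy_smooth:
 assumes K: "1 <= K" and u: "u \<in> C1 K"
 shows "energy c u = Gsq K u + (\<Sum>k\<in>{1..K}. jump_weight c k * Jsq k u)"
 unfolding energy_def l2_sq_gradient(2)[OF assms] jump_sq_smooth[OF assms] ..

lemma Gsq_finite: "1 <= K ==> u \<in> C1 K ==> Gsq K u < top"
 using c1_gradient_l2[of u K] l2_sq_gradient(1)[of K u K] by (simp add: l2_space_def)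

lemma Jsq_finite: "1 <= K ==> u \<in> C1 K ==> 1 <= k ==> Jsq k u < top"
 using c1_jump_l2[of u K k] Jsq_above[of K u k] by (cases "k <= K") (auto simp: l2_space_def l2_sq_jump)

lemma energy_finite:
 assumes K: "1 <= K" and u: "u \<in> C1 K"
 shows "energy c u < top"
 unfolding energy_smooth[OF assms]
 using Gsq_finite[OF assms] Jsq_finite[OF assms] by (auto simp: jump_weight_def ennreal_mult_less_top)

lemma level_inner_self:
 assumes c: "c > 0" and K: "1 <= K" and u: "u \<in> C1 K"
 shows "level_inner N K c u u = enn2real (energy c u)"
proof -
 have "(\<integral>x. gradient u x \<bullet> gradient u x \<partial>lebesgue_on (smooth K)) = enn2real (Gsq K u)"
  using integral_inner_self[OF c1_gradient_l2[OF u]] l2_sq_gradient(1)[OF K u] by simp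
 moreover have "(\<integral>\<xi>. jmp k u \<xi> * jmp k u \<xi> \<partial>surface N k) = enn2real (Jsq k u)" if "k \<in> {1..K}" for k
  using integral_inner_self[OF c1_jump_l2[OF u that]] by (simp add: l2_sq_jump)
 ultimately have "level_inner N K c u u = enn2real (Gsq K u) + (\<Sum>k=1..K. enn2real (jump_weight c k * Jsq k u))"
  unfolding level_inner_def using c by (simp add: jump_weight_def enn2real_mult)
 also have "(\<Sum>k=1..K. enn2real (jump_weight c k * Jsq k u)) = enn2real (\<Sum>k=1..K. jump_weight c k * Jsq k u)"
  using Jsq_finite[OF K u] by (subst enn2real_sum) (auto simp: jump_weight_def ennreal_mult_less_top)
 also have "enn2real (Gsq K u) + \<dots> = enn2real (energy c u)"
  unfolding energy_smooth[OF K u]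
  using Gsq_finite[OF K u] Jsq_finite[OF K u]
  by (subst enn2real_plus) (auto simp: jump_weight_def ennreal_mult_less_top)
 finally show ?thesis .
qed

end

section \<open>The fractal space\<close>

locale fractal_network = regular_network N \<nu> b B
 for N :: "'n::{finite,linorder} network" and \<nu> :: "nat => 'n point" and b :: "nat => real" and B :: "'n point set" +
 fixes c :: real
 assumes c_pos: "c > 0"
begin

abbreviation "Sm K \<equiv> smooth_space N c K"
abbreviation "W K \<equiv> level_space N c K"
abbreviation "U \<equiv> union_space N c"

text \<open>Written with the coefficients \<open>1\<close> and \<open>- 1\<close> of
  \<open>pdist\<close>, so that it coincides literally with the linear combination used
  there.\<close>

definition sdist :: "('n point => real) => ('n point => real) => real" where
 "sdist u v = snorm c (%x. 1 * u x + (- 1) * v x)"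

lemma level_inner_sym: "level_inner N K c u v = level_inner N K c v u"
 unfolding level_inner_def by (simp add: inner_commute mult.commute)

lemma pnorm_smooth: "1 <= K ==> u \<in> C1 K ==> pnorm (Sm K) u = snorm c u"
 by (simp add: smooth_space_def snorm_def level_inner_self[OF c_pos])

lemma points_smooth [simp]: "points (Sm K) = C1 K"
 by (simp add: smooth_space_def)

lemma lincomb_smooth: "lincomb (Sm K) \<alpha> \<beta> u v = (%x. \<alpha> * u x + \<beta> * v x)"
 by (simp add: smooth_space_def)

lemma seminormed_smooth:
 assumes K: "1 <= K"
 shows "seminormed (Sm K)"
 unfolding smooth_space_def
proof (rule seminormed_function_space)
 have pos: "0 <= level_inner N K c u u" if "u \<in> C1 K" for u
  by (simp add: level_inner_self[OF c_pos K that])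
 show "(%x. a * v x + b * w x) \<in> C1 K" if "v \<in> C1 K" "w \<in> C1 K" for a b v w
  by (rule c1_lincomb[OF K that])
 show "0 <= sqrt (level_inner N K c v v)" if "v \<in> C1 K" for v using pos[OF that] by simp
 show "sqrt (level_inner N K c (%x. a * v x + b * w x) (%x. a * v x + b * w x)) \<le>
   \<bar>a\<bar> * sqrt (level_inner N K c v v) + \<bar>b\<bar> * sqrt (level_inner N K c w w)"
  if vw: "v \<in> C1 K" "w \<in> C1 K" for a b v w
  by (rule bilinear_sqrt_sublinear[where S = "C1 K" and Q = "level_inner N K c"])
   (rule c1_lincomb[OF K] level_inner_bilinear[OF K] level_inner_sym pos vw; assumption)+
qed

lemma pdist_smooth:
 assumes "1 <= K" "u \<in> C1 K" "v \<in> C1 K"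
 shows "pdist (Sm K) u v = sdist u v"
 unfolding pdist_def lincomb_smooth sdist_def by (rule pnorm_smooth[OF assms(1) c1_lincomb[OF assms]])

lemma cauchy_smooth_mono:
 assumes K: "1 <= K" "K <= L" and X: "X \<in> cauchy_seqs (Sm K)"
 shows "X \<in> cauchy_seqs (Sm L)"
proof -
 have L: "1 <= L" using K by simp
 have Xn: "X n \<in> C1 K" for n using X by (simp add: cauchy_seqs_def)
 then have "X n \<in> C1 L" for n using c1_mono[OF K] by blast
 then show ?thesis using X by (simp add: cauchy_seqs_def pdist_smooth[OF L] pdist_smooth[OF K(1) Xn Xn])
qed

lemma null_rel_smooth_mono:
 assumes K: "1 <= K" "K <= L" and r: "(X, Y) \<in> null_rel (Sm K)"
 shows "(X, Y) \<in> null_rel (Sm L)"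
proof -
 have L: "1 <= L" using K by simp
 have XY: "X \<in> cauchy_seqs (Sm K)" "Y \<in> cauchy_seqs (Sm K)" using r by (auto simp: null_rel_def)
 then have n: "X n \<in> C1 K" "Y n \<in> C1 K" for n by (auto simp: cauchy_seqs_def)
 then have "X n \<in> C1 L" "Y n \<in> C1 L" for n using c1_mono[OF K] by blast+
 then show ?thesis
  using r cauchy_smooth_mono[OF K XY(1)] cauchy_smooth_mono[OF K XY(2)] n
  by (simp add: null_rel_def pdist_smooth[OF L] pdist_smooth[OF K(1)])
qed

lemma level_rep:
 assumes "1 <= K" "P \<in> points (W K)" "X \<in> P"
 shows "X \<in> cauchy_seqs (Sm K)" "P = null_rel (Sm K) `` {X}"
 using seminormed.point_rep[OF seminormed_smooth[OF assms(1)] assms(2)[unfolded level_space_def] assms(3)] by blast+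

text \<open>All members of \<open>P\<close> remain equivalent at level \<open>L\<close>, so the
  image of the whole class is the class of any single member.\<close>

lemma lift_level_rep:
 assumes K: "1 <= K" "K <= L" and P: "P \<in> points (W K)" "X \<in> P"
 shows "lift_level N c L P = null_rel (Sm L) `` {X}"
proof -
 have L: "1 <= L" using K by simp
 have eq: "equiv (cauchy_seqs (Sm L)) (null_rel (Sm L))" by (rule seminormed.equiv_null_rel[OF seminormed_smooth[OF L]])
 have "null_rel (Sm L) `` {Y} = null_rel (Sm L) `` {X}" if "Y \<in> P" for Y
 proof -
  have "(X, Y) \<in> null_rel (Sm K)" using level_rep(2)[OF K(1) P] that by auto
  from equiv_class_eq[OF eq null_rel_smooth_mono[OF K this]] show ?thesis ..
 qed
 then have "(\<Union>Y\<in>P. null_rel (Sm L) `` {Y}) = (\<Union>Y\<in>P. null_rel (Sm L) `` {X})" by (rule SUP_cong[OF refl])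
 moreover have "lift_level N c L P = (\<Union>Y\<in>P. null_rel (Sm L) `` {Y})" by (auto simp: lift_level_def)
 moreover have "P ~= {}" using P(2) by blast
 ultimately show ?thesis by (simp only: UN_constant if_False)
qed

lemma points_union: "(K, P) \<in> points U \<longleftrightarrow> 1 <= K & P \<in> points (W K)"
 by (simp add: union_space_def)

lemma union_lincomb:
 assumes p: "(K, P) \<in> points U" "(L, R) \<in> points U" and X: "X \<in> P" and Y: "Y \<in> R"
 shows "lincomb U \<alpha> \<beta> (K, P) (L, R) = (max K L, null_rel (Sm (max K L)) `` {%n x. \<alpha> * X n x + \<beta> * Y n x})"
proof -
 let ?M = "max K L"
 have K: "1 <= K" "P \<in> points (W K)" and L: "1 <= L" "R \<in> points (W L)" using p by (simp_all add: points_union)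
 have M: "1 <= ?M" using K by simp
 have "X \<in> cauchy_seqs (Sm ?M)" "Y \<in> cauchy_seqs (Sm ?M)"
  using cauchy_smooth_mono[OF K(1) _ level_rep(1)[OF K X]] cauchy_smooth_mono[OF L(1) _ level_rep(1)[OF L Y]] by auto
 from seminormed.lincomb_cls[OF seminormed_smooth[OF M] this, of \<alpha> \<beta>]
 show ?thesis
  using lift_level_rep[OF K(1) _ K(2) X, of ?M] lift_level_rep[OF L(1) _ L(2) Y, of ?M]
  by (simp add: union_space_def level_space_def lincomb_smooth)
qed

lemma union_pnorm:
 assumes p: "(K, P) \<in> points U" and X: "X \<in> P"
 shows "(%n. snorm c (X n)) ----> pnorm U (K, P)"
proof -
 have K: "1 <= K" "P \<in> points (W K)" using p by (simp_all add: points_union)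
 note r = level_rep[OF K X]
 have "(%n. pnorm (Sm K) (X n)) ----> pnorm (W K) P"
  using seminormed.pnorm_cls[OF seminormed_smooth[OF K(1)] r(1)] r(2) by (simp add: level_space_def)
 moreover have "X n \<in> C1 K" for n using r(1) by (simp add: cauchy_seqs_def)
 ultimately show ?thesis by (simp add: pnorm_smooth[OF K(1)] union_space_def)
qed

lemma union_rep:
 assumes "p \<in> points U"
 obtains K P X where "p = (K, P)" "(K, P) \<in> points U" "X \<in> P" "1 <= K" "X \<in> cauchy_seqs (Sm K)" "\<And>n. X n \<in> C1 K"
proof -
 obtain K P where p: "p = (K, P)" by (cases p)
 have K: "1 <= K" "P \<in> points (W K)" using assms by (simp_all add: p points_union)
 obtain X where X: "X \<in> P"
  using seminormed.point_nonempty[OF seminormed_smooth[OF K(1)]] K(2) by (auto simp: level_space_def)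
 have Xc: "X \<in> cauchy_seqs (Sm K)" by (rule level_rep(1)[OF K X])
 then have "\<And>n. X n \<in> C1 K" by (simp add: cauchy_seqs_def)
 then show ?thesis using that[OF p _ X K(1) Xc] assms p by blast
qed

lemma union_pdist:
 assumes p: "(K, P) \<in> points U" "(L, R) \<in> points U" and X: "X \<in> P" and Y: "Y \<in> R"
 shows "(%n. sdist (X n) (Y n)) ----> pdist U (K, P) (L, R)"
proof -
 let ?M = "max K L" and ?Z = "%n x. 1 * X n x + (- 1) * Y n x"
 have K: "1 <= K" "P \<in> points (W K)" and L: "1 <= L" "R \<in> points (W L)" using p by (simp_all add: points_union)
 have M: "1 <= ?M" using K by simp
 have "X \<in> cauchy_seqs (Sm ?M)" "Y \<in> cauchy_seqs (Sm ?M)"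
  using cauchy_smooth_mono[OF K(1) _ level_rep(1)[OF K X]] cauchy_smooth_mono[OF L(1) _ level_rep(1)[OF L Y]] by auto
 from seminormed.lincomb_cauchy[OF seminormed_smooth[OF M] this, of 1 "- 1"]
 have Z: "?Z \<in> cauchy_seqs (Sm ?M)" by (simp add: lincomb_smooth)
 have pt: "(?M, null_rel (Sm ?M) `` {?Z}) \<in> points U"
  using seminormed.cls_point[OF seminormed_smooth[OF M] Z] M by (simp add: points_union level_space_def)
 show ?thesis
  unfolding pdist_def union_lincomb[OF p X Y] sdist_def
  by (rule union_pnorm[OF pt]) (rule seminormed.cls_self[OF seminormed_smooth[OF M] Z])
qed

lemma sdist_triangle:
 assumes "1 <= K" "u \<in> C1 K" "v \<in> C1 K" "w \<in> C1 K"
 shows "sdist u w <= sdist u v + sdist v w"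
 using seminormed.pdist_triangle[OF seminormed_smooth[OF assms(1)], of u v w] assms by (simp add: pdist_smooth)

text \<open>Representatives of finitely many points lie in a common level. There the laws hold for
  the piecewise smooth functions of each index, and they pass to the limit.\<close>

lemma seminormed_union: "seminormed U"
proof
 fix p q assume pq: "p \<in> points U" "q \<in> points U"
 obtain K P X where p: "p = (K, P)" "(K, P) \<in> points U" "X \<in> P" "1 <= K" "X \<in> cauchy_seqs (Sm K)" "\<And>n. X n \<in> C1 K"
  by (rule union_rep[OF pq(1)]) blast
 obtain L R Y where q: "q = (L, R)" "(L, R) \<in> points U" "Y \<in> R" "1 <= L" "Y \<in> cauchy_seqs (Sm L)" "\<And>n. Y n \<in> C1 L"
  by (rule union_rep[OF pq(2)]) blast
 let ?M = "max K L"
 have M: "1 <= ?M" using p(4) by simp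
 interpret M: seminormed "Sm ?M" by (rule seminormed_smooth[OF M])
 have Xc: "X \<in> cauchy_seqs (Sm ?M)" and Yc: "Y \<in> cauchy_seqs (Sm ?M)"
  using cauchy_smooth_mono p(4,5) q(4,5) by auto
 have c1: "X n \<in> C1 ?M" "Y n \<in> C1 ?M" for n
  using c1_mono[OF p(4) _ p(6)] c1_mono[OF q(4) _ q(6)] by auto
 note lim = union_pdist[OF p(2) q(2) p(3) q(3)]
 show "lincomb U a b p q \<in> points U" for a b
  unfolding p(1) q(1) union_lincomb[OF p(2) q(2) p(3) q(3)]
  using M.cls_point[OF M.lincomb_cauchy[OF Xc Yc, of a b]] M
  by (simp add: points_union level_space_def lincomb_smooth)
 show "0 <= pnorm U p"
  unfolding p(1) by (rule LIMSEQ_le_const[OF union_pnorm[OF p(2,3)]]) (simp add: snorm_def)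
 show "pdist U p p = 0"
 proof -
  have "sdist (X n) (X n) = 0" for n
   using M.pdist_self[of "X n"] c1 by (simp add: pdist_smooth[OF M])
  then show ?thesis using union_pdist[OF p(2) p(2) p(3) p(3)] unfolding p(1) by (simp add: LIMSEQ_const_iff)
 qed
 show "pdist U p q = pdist U q p"
 proof -
  have "sdist (X n) (Y n) = sdist (Y n) (X n)" for n
   using M.pdist_sym[of "X n" "Y n"] c1 by (simp add: pdist_smooth[OF M])
  then show ?thesis using lim union_pdist[OF q(2) p(2) q(3) p(3)] LIMSEQ_unique unfolding p(1) q(1) by auto
 qed
 show "\<bar>pnorm U p - pnorm U q\<bar> <= pdist U p q"
 proof (unfold p(1) q(1), rule LIMSEQ_le[OF _ lim])
  show "(%n. \<bar>snorm c (X n) - snorm c (Y n)\<bar>) ----> \<bar>pnorm U (K, P) - pnorm U (L, R)\<bar>"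
   by (intro tendsto_intros union_pnorm p q)
  show "\<exists>n0. \<forall>n\<ge>n0. \<bar>snorm c (X n) - snorm c (Y n)\<bar> <= sdist (X n) (Y n)"
   using M.pnorm_diff c1 by (simp add: pdist_smooth[OF M] pnorm_smooth[OF M])
 qed
 show "pdist U p s <= pdist U p q + pdist U q s" if s: "s \<in> points U" for s
 proof -
  obtain L' S Z where s': "s = (L', S)" "(L', S) \<in> points U" "Z \<in> S" "1 <= L'" "Z \<in> cauchy_seqs (Sm L')" "\<And>n. Z n \<in> C1 L'"
   by (rule union_rep[OF s]) blast
  let ?T = "max ?M L'"
  have "sdist (X n) (Z n) <= sdist (X n) (Y n) + sdist (Y n) (Z n)" for n
  proof (rule sdist_triangle[of ?T])
   show "1 <= ?T" using M by simp
   show "X n \<in> C1 ?T" "Y n \<in> C1 ?T" "Z n \<in> C1 ?T"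
    by (rule c1_mono[OF M max.cobounded1 c1(1)] c1_mono[OF M max.cobounded1 c1(2)]
      c1_mono[OF s'(4) max.cobounded2 s'(6)])+
  qed
  then show ?thesis
   unfolding p(1) q(1) s'(1)
   by (intro LIMSEQ_le[OF union_pdist[OF p(2) s'(2) p(3) s'(3)]
      tendsto_add[OF lim union_pdist[OF q(2) s'(2) q(3) s'(3)]]]) auto
 qed
 show "pdist U (lincomb U a b p q) (lincomb U a b p' q') <= \<bar>a\<bar> * pdist U p p' + \<bar>b\<bar> * pdist U q q'"
  if p'q': "p' \<in> points U" "q' \<in> points U" for a b p' q'
 proof -
  obtain K' P' X' where p': "p' = (K', P')" "(K', P') \<in> points U" "X' \<in> P'" "1 <= K'" "X' \<in> cauchy_seqs (Sm K')" "\<And>n. X' n \<in> C1 K'"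
   by (rule union_rep[OF p'q'(1)]) blast
  obtain L' R' Y' where q': "q' = (L', R')" "(L', R') \<in> points U" "Y' \<in> R'" "1 <= L'" "Y' \<in> cauchy_seqs (Sm L')" "\<And>n. Y' n \<in> C1 L'"
   by (rule union_rep[OF p'q'(2)]) blast
  let ?M' = "max K' L'" and ?Z = "%n x. a * X n x + b * Y n x" and ?Z' = "%n x. a * X' n x + b * Y' n x"
  have M': "1 <= ?M'" using p'(4) by simp
  interpret M': seminormed "Sm ?M'" by (rule seminormed_smooth[OF M'])
  have X'c: "X' \<in> cauchy_seqs (Sm ?M')" and Y'c: "Y' \<in> cauchy_seqs (Sm ?M')"
   using cauchy_smooth_mono p'(4,5) q'(4,5) by auto
  have Zc: "?Z \<in> cauchy_seqs (Sm ?M)" using M.lincomb_cauchy[OF Xc Yc, of a b] by (simp add: lincomb_smooth)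
  have Z'c: "?Z' \<in> cauchy_seqs (Sm ?M')" using M'.lincomb_cauchy[OF X'c Y'c, of a b] by (simp add: lincomb_smooth)
  have pt: "(?M, M.cls ?Z) \<in> points U" "(?M', M'.cls ?Z') \<in> points U"
   using M.cls_point[OF Zc] M'.cls_point[OF Z'c] M M' by (simp_all add: points_union level_space_def)
  note lim' = union_pdist[OF pt M.cls_self[OF Zc] M'.cls_self[OF Z'c]]
  let ?T = "max ?M ?M'"
  have T: "1 <= ?T" using M by simp
  interpret T: seminormed "Sm ?T" by (rule seminormed_smooth[OF T])
  have cT: "X n \<in> C1 ?T" "Y n \<in> C1 ?T" "X' n \<in> C1 ?T" "Y' n \<in> C1 ?T" for n
   using c1_mono[OF p(4) _ p(6)] c1_mono[OF q(4) _ q(6)] c1_mono[OF p'(4) _ p'(6)] c1_mono[OF q'(4) _ q'(6)] by auto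
  have "sdist (?Z n) (?Z' n) <= \<bar>a\<bar> * sdist (X n) (X' n) + \<bar>b\<bar> * sdist (Y n) (Y' n)" for n
   using T.pdist_lincomb[of "X n" "Y n" "X' n" "Y' n" a b] cT c1_lincomb[OF T]
   by (simp add: pdist_smooth[OF T] lincomb_smooth)
  then show ?thesis
   unfolding p(1) q(1) p'(1) q'(1) union_lincomb[OF p(2) q(2) p(3) q(3)] union_lincomb[OF p'(2) q'(2) p'(3) q'(3)]
   by (intro LIMSEQ_le[OF lim' tendsto_add[OF tendsto_mult_left[OF union_pdist[OF p(2) p'(2) p(3) p'(3)]]
      tendsto_mult_left[OF union_pdist[OF q(2) q'(2) q(3) q'(3)]]]]) auto
 qed
qed

section \<open>Density of piecewise smooth functions in the fractal space\<close>

definition emb :: "nat => ('n point => real) => nat \<times> (nat => 'n point => real) set" where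
 "emb K u = (K, to_completion (Sm K) u)"

lemma emb_rep:
 assumes "1 <= K" "u \<in> C1 K"
 shows "emb K u \<in> points U" "(%_. u) \<in> to_completion (Sm K) u"
proof -
 interpret seminormed "Sm K" by (rule seminormed_smooth[OF assms(1)])
 have c: "(%_. u) \<in> cauchy_seqs (Sm K)" using const_cauchy assms by simp
 show "emb K u \<in> points U" "(%_. u) \<in> to_completion (Sm K) u"
  using cls_point[OF c] cls_self[OF c] assms by (simp_all add: emb_def points_union level_space_def to_completion_def)
qed

lemma pdist_emb:
 assumes "1 <= K" "u \<in> C1 K" "1 <= L" "w \<in> C1 L"
 shows "pdist U (emb K u) (emb L w) = sdist u w"
 using union_pdist[of K "to_completion (Sm K) u" L "to_completion (Sm L) w" "%_. u" "%_. w"]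
  emb_rep[OF assms(1,2)] emb_rep[OF assms(3,4)] by (simp add: emb_def LIMSEQ_const_iff)

lemma pnorm_emb:
 assumes "1 <= K" "u \<in> C1 K"
 shows "pnorm U (emb K u) = snorm c u"
 using union_pnorm[of K "to_completion (Sm K) u" "%_. u"] emb_rep[OF assms] by (simp add: emb_def LIMSEQ_const_iff)

lemma lincomb_emb:
 assumes "1 <= K" "u \<in> C1 K" "1 <= L" "w \<in> C1 L"
 shows "lincomb U \<alpha> \<beta> (emb K u) (emb L w) = emb (max K L) (%x. \<alpha> * u x + \<beta> * w x)"
 using union_lincomb[of K "to_completion (Sm K) u" L "to_completion (Sm L) w" "%_. u" "%_. w"]
  emb_rep[OF assms(1,2)] emb_rep[OF assms(3,4)] by (simp add: emb_def to_completion_def)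

lemma union_density:
 assumes p: "p \<in> points U" and e: "e > 0"
 shows "\<exists>u. u \<in> C1 (fst p) & pdist U p (emb (fst p) u) < e"
proof -
 obtain K P X where r: "p = (K, P)" "(K, P) \<in> points U" "X \<in> P" "1 <= K" "X \<in> cauchy_seqs (Sm K)" "\<And>n. X n \<in> C1 K"
  by (rule union_rep[OF p]) blast
 obtain n0 where n0: "\<And>m n. m >= n0 ==> n >= n0 ==> pdist (Sm K) (X m) (X n) < e/2"
  using r(5) half_gt_zero[OF e] unfolding cauchy_seqs_def by blast
 have "(%n. sdist (X n) (X n0)) ----> pdist U (K, P) (K, to_completion (Sm K) (X n0))"
  using emb_rep[OF r(4,6), of n0] by (intro union_pdist[OF r(2) _ r(3)]) (auto simp: emb_def)
 then have "pdist U (K, P) (K, to_completion (Sm K) (X n0)) <= e/2"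
  by (rule LIMSEQ_le_const2) (use n0[of _ n0] pdist_smooth[OF r(4) r(6) r(6)] in \<open>auto intro!: exI[of _ n0] less_imp_le\<close>)
 then show ?thesis using r(1,6) e by (intro exI[of _ "X n0"]) (auto simp: emb_def)
qed

abbreviation "F \<equiv> fractal_space N c"

text \<open>The space is a completion of a union of completions. Its elements are handled through
  sequences of honest functions \<open>u n\<close> of levels \<open>K n\<close> which, once
  embedded, belong to the class \<open>v\<close> itself.\<close>

definition approximates :: "'n fractal_element => (nat => nat) => (nat => 'n point => real) => bool" where
 "approximates v K u \<longleftrightarrow> (\<forall>n. 1 <= K n & u n \<in> C1 (K n)) & (%n. emb (K n) (u n)) \<in> v"

lemma approximatesD:
 assumes "approximates v K u"
 shows "1 <= K n" "u n \<in> C1 (K n)" "(%n. emb (K n) (u n)) \<in> v"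
 using assms by (simp_all add: approximates_def)

sublocale U: seminormed U by (rule seminormed_union)

lemma fractal_rep: "v \<in> points F ==> V \<in> v ==> V \<in> cauchy_seqs U & v = U.cls V"
 unfolding fractal_space_def by (rule U.point_rep)

lemma approximates_near:
 assumes v: "v \<in> points F" "V \<in> v" and u: "\<And>n. u n \<in> C1 (fst (V n))"
  and lim: "(%n. pdist U (V n) (emb (fst (V n)) (u n))) ----> 0"
 shows "approximates v (%n. fst (V n)) u"
proof -
 have "V n \<in> points U" for n using fractal_rep[OF v] U.cauchy_points by blast
 then have K: "1 <= fst (V n)" for n using points_union[of "fst (V n)" "snd (V n)"] by simp
 have "(%n. emb (fst (V n)) (u n)) \<in> v"
  by (rule U.close_sequence_in_class[OF v[unfolded fractal_space_def] emb_rep(1)[OF K u] lim])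
 then show ?thesis using K u by (simp add: approximates_def)
qed

lemma approximates_exists:
 assumes v: "v \<in> points F"
 shows "\<exists>K u. approximates v K u"
proof -
 obtain V where V: "V \<in> v" using U.point_nonempty v by (auto simp: fractal_space_def)
 have pt: "V n \<in> points U" for n using fractal_rep[OF v V] U.cauchy_points by blast
 have "\<exists>u. u \<in> C1 (fst (V n)) & pdist U (V n) (emb (fst (V n)) u) < inverse (real (Suc n))" for n
  using union_density[OF pt[of n], of "inverse (real (Suc n))"] by auto
 then obtain u where u: "\<And>n. u n \<in> C1 (fst (V n))"
  "\<And>n. pdist U (V n) (emb (fst (V n)) (u n)) < inverse (real (Suc n))" by metis
 have K: "1 <= fst (V n)" for n using pt[of n] points_union[of "fst (V n)" "snd (V n)"] by simp
 have "(%n. pdist U (V n) (emb (fst (V n)) (u n))) ----> 0"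
 proof (rule tendsto_sandwich[OF _ _ tendsto_const LIMSEQ_inverse_real_of_nat])
  show "\<forall>\<^sub>F n in sequentially. 0 <= pdist U (V n) (emb (fst (V n)) (u n))"
   using U.pdist_nonneg[OF pt emb_rep(1)[OF K u(1)]] by simp
 qed (use u(2) less_imp_le in \<open>auto intro!: always_eventually\<close>)
 then show ?thesis using approximates_near[OF v V u(1)] by blast
qed

lemma approximates_cauchy:
 assumes v: "v \<in> points F" and a: "approximates v K u" and e: "e > 0"
 shows "\<exists>n0. \<forall>m\<ge>n0. \<forall>n\<ge>n0. sdist (u m) (u n) < e"
 using fractal_rep[OF v approximatesD(3)[OF a]] e approximatesD(1,2)[OF a]
 unfolding cauchy_seqs_def by (simp add: pdist_emb)

lemma approximates_pnorm:
 assumes v: "v \<in> points F" and a: "approximates v K u"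
 shows "(%n. snorm c (u n)) ----> pnorm F v"
proof -
 note r = fractal_rep[OF v approximatesD(3)[OF a]]
 have "(%n. pnorm U (emb (K n) (u n))) ----> pnorm F v"
  using U.pnorm_cls[OF conjunct1[OF r]] conjunct2[OF r] by (simp add: fractal_space_def)
 then show ?thesis using approximatesD(1,2)[OF a] by (simp add: pnorm_emb)
qed

lemma approximates_lincomb:
 assumes v: "v \<in> points F" and w: "w \<in> points F" and au: "approximates v K u" and az: "approximates w L z"
 shows "approximates (lincomb F \<alpha> \<beta> v w) (%n. max (K n) (L n)) (%n x. \<alpha> * u n x + \<beta> * z n x)"
  "lincomb F \<alpha> \<beta> v w \<in> points F"
proof -
 note rv = fractal_rep[OF v approximatesD(3)[OF au]] and rw = fractal_rep[OF w approximatesD(3)[OF az]]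
 note A = approximatesD(1,2)[OF au] and D = approximatesD(1,2)[OF az]
 have M: "1 <= max (K n) (L n)" for n using A(1)[of n] by simp
 have c1: "(%x. \<alpha> * u n x + \<beta> * z n x) \<in> C1 (max (K n) (L n))" for n
  by (rule c1_lincomb[OF M c1_mono[OF A(1) _ A(2)] c1_mono[OF D(1) _ D(2)]]) auto
 have lc: "(%n. lincomb U \<alpha> \<beta> (emb (K n) (u n)) (emb (L n) (z n))) =
   (%n. emb (max (K n) (L n)) (%x. \<alpha> * u n x + \<beta> * z n x))"
  by (intro ext lincomb_emb A D)
 have eq: "lincomb F \<alpha> \<beta> v w = U.cls (%n. emb (max (K n) (L n)) (%x. \<alpha> * u n x + \<beta> * z n x))"
  using U.lincomb_cls[OF conjunct1[OF rv] conjunct1[OF rw], of \<alpha> \<beta>] conjunct2[OF rv] conjunct2[OF rw]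
  unfolding lc by (simp add: fractal_space_def)
 have cc: "(%n. emb (max (K n) (L n)) (%x. \<alpha> * u n x + \<beta> * z n x)) \<in> cauchy_seqs U"
  using U.lincomb_cauchy[OF conjunct1[OF rv] conjunct1[OF rw], of \<alpha> \<beta>] unfolding lc .
 show "approximates (lincomb F \<alpha> \<beta> v w) (%n. max (K n) (L n)) (%n x. \<alpha> * u n x + \<beta> * z n x)"
  unfolding approximates_def eq using M c1 U.cls_self[OF cc] by blast
 show "lincomb F \<alpha> \<beta> v w \<in> points F" unfolding eq unfolding fractal_space_def by (rule U.cls_point[OF cc])
qed

lemma approximates_eqI:
 assumes v: "v \<in> points F" and w: "w \<in> points F" and au: "approximates v K u" and az: "approximates w L z"
  and lim: "(%n. sdist (u n) (z n)) ----> 0"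
 shows "v = w"
proof -
 note A = approximatesD(1,2)[OF au] and D = approximatesD(1,2)[OF az]
 have "(%n. emb (L n) (z n)) \<in> v"
  by (rule U.close_sequence_in_class[OF v[unfolded fractal_space_def] approximatesD(3)[OF au] emb_rep(1)[OF D]])
   (simp add: pdist_emb[OF A D] lim)
 from fractal_rep[OF v this] fractal_rep[OF w approximatesD(3)[OF az]] show ?thesis by simp
qed

lemma approximates_of_smooth:
 assumes "1 <= K" "u \<in> C1 K"
 shows "approximates (of_smooth N c K u) (%_. K) (%_. u)" "of_smooth N c K u \<in> points F"
proof -
 have c: "(%_. emb K u) \<in> cauchy_seqs U" by (rule U.const_cauchy[OF emb_rep(1)[OF assms]])
 have eq: "of_smooth N c K u = U.cls (%_. emb K u)" by (simp add: of_smooth_def emb_def to_completion_def)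
 show "approximates (of_smooth N c K u) (%_. K) (%_. u)" "of_smooth N c K u \<in> points F"
  unfolding approximates_def eq fractal_space_def using assms U.cls_self[OF c] U.cls_point[OF c] by auto
qed

end

section \<open>Square integrable limits\<close>

lemma tendsto_ennreal_0I:
 fixes f :: "'a => ennreal"
 assumes "\<And>e::real. e > 0 ==> eventually (%x. f x <= ennreal e) F"
 shows "(f \<longlongrightarrow> 0) F"
proof (rule order_tendstoI)
 fix a :: ennreal assume "0 < a"
 then obtain y where y: "0 < y" "y < a" using dense by blast
 then obtain e where "y = ennreal e" by (cases y) auto
 then have e: "0 < e" "ennreal e < a" using y by (auto simp: ennreal_less_zero_iff)
 show "\<forall>\<^sub>F x in F. f x < a" using assms[OF e(1)] by eventually_elim (use e(2) in auto)
qed simp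

lemma l2_sq_diff_commute: "l2_sq M (%x. f x - g x) = l2_sq M (%x. g x - f x)"
 unfolding l2_sq_def by (simp add: norm_minus_commute)

lemma l2_sq_triangle:
 fixes f g h :: "'a => 'b::{real_normed_vector,second_countable_topology}"
 assumes [measurable]: "f \<in> borel_measurable M" "g \<in> borel_measurable M" "h \<in> borel_measurable M"
 shows "l2_sq M (%x. f x - h x) <= 2 * l2_sq M (%x. f x - g x) + 2 * l2_sq M (%x. g x - h x)"
 using l2_sq_lincomb[of "%x. f x - g x" M "%x. g x - h x" 1 1] by simp

text \<open>Young's inequality with a parameter: as \<open>\<delta>\<close> tends to 0, the factor
  of the main term tends to 1, so squares pass to limits without loss in the constant.\<close>

lemma norm_sq_young:
 fixes p q :: "'b::real_normed_vector"
 assumes d: "\<delta> > 0"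
 shows "(norm p)^2 <= (1 + \<delta>) * (norm q)^2 + (1 + 1/\<delta>) * (norm (p - q))^2"
proof -
 have "norm p <= norm q + norm (p - q)" by (metis add.commute diff_add_cancel norm_triangle_ineq)
 then have "(norm p)^2 <= (norm q + norm (p - q))^2" by (intro power_mono) auto
 also have "2 * (sqrt \<delta> * norm q) * (norm (p - q) / sqrt \<delta>) <= (sqrt \<delta> * norm q)^2 + (norm (p - q) / sqrt \<delta>)^2"
  by (rule sum_squares_bound)
 then have "(norm q + norm (p - q))^2 <= (1 + \<delta>) * (norm q)^2 + (1 + 1/\<delta>) * (norm (p - q))^2"
  using d by (simp add: power2_sum power_mult_distrib power_divide algebra_simps)
 finally show ?thesis .
qed

lemma l2_sq_young:
 fixes f g :: "'a => 'b::{real_normed_vector,second_countable_topology}"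
 assumes [measurable]: "f \<in> borel_measurable M" "g \<in> borel_measurable M" and d: "\<delta> > 0"
 shows "l2_sq M f <= ennreal (1 + \<delta>) * l2_sq M g + ennreal (1 + 1/\<delta>) * l2_sq M (%x. f x - g x)"
proof -
 have "l2_sq M f <= (\<integral>\<^sup>+x. ennreal (1 + \<delta>) * ennreal ((norm (g x))^2) + ennreal (1 + 1/\<delta>) * ennreal ((norm (f x - g x))^2) \<partial>M)"
  unfolding l2_sq_def using d
  by (intro nn_integral_mono)
   (auto simp: ennreal_mult[symmetric] ennreal_plus[symmetric] simp del: ennreal_plus intro!: ennreal_leI norm_sq_young)
 also have "... = ennreal (1 + \<delta>) * l2_sq M g + ennreal (1 + 1/\<delta>) * l2_sq M (%x. f x - g x)"
  unfolding l2_sq_def by (simp add: nn_integral_add nn_integral_cmult)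
 finally show ?thesis .
qed

text \<open>A rapidly converging subsequence converges almost everywhere, because
 \<open>t \<le> 2 ^ k t\<^sup>2 + 2 ^ - k\<close>.\<close>

lemma l2_rapid_AE_convergent:
 fixes f :: "nat => 'a => 'b::euclidean_space"
 assumes [measurable]: "\<And>n. f n \<in> borel_measurable M"
  and rapid: "\<And>k. l2_sq M (%x. f (Suc k) x - f k x) <= ennreal ((1/4)^k)"
 shows "AE x in M. convergent (%k. f k x)"
proof -
 let ?d = "%k x. norm (f (Suc k) x - f k x)"
 have "(\<integral>\<^sup>+x. (\<Sum>k. ennreal (2^k) * ennreal ((?d k x)^2)) \<partial>M) = (\<Sum>k. ennreal (2^k) * l2_sq M (%x. f (Suc k) x - f k x))"
  by (subst nn_integral_suminf) (auto simp: nn_integral_cmult l2_sq_def)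
 also have "... <= (\<Sum>k. ennreal (2^k) * ennreal ((1/4)^k))" by (intro suminf_le mult_left_mono rapid) auto
 also have "... = (\<Sum>k. ennreal ((1/2)^k))"
  by (intro suminf_cong) (simp add: ennreal_mult[symmetric] power_mult_distrib[symmetric])
 also have "... < top"
 proof -
  have gs: "(%k. (1/2::real)^k) sums (1 / (1 - 1/2))" by (rule geometric_sums) simp
  have "(\<Sum>k. ennreal ((1/2)^k)) = ennreal (1 / (1 - 1/2))" by (rule suminf_ennreal_eq[OF _ gs]) simp
  then show ?thesis by simp
 qed
 finally have "(\<integral>\<^sup>+x. (\<Sum>k. ennreal (2^k) * ennreal ((?d k x)^2)) \<partial>M) ~= \<infinity>" by (simp add: less_top)
 then have "AE x in M. (\<Sum>k. ennreal (2^k) * ennreal ((?d k x)^2)) ~= \<infinity>"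
  by (rule nn_integral_PInf_AE[rotated]) measurable
 then show ?thesis
 proof eventually_elim
  case (elim x)
  have "summable (%k. 2^k * (?d k x)^2)"
   using elim by (intro summable_suminf_not_top) (auto simp: ennreal_mult)
  moreover have "summable (%k. (1/2::real)^k)" by (rule summable_geometric) simp
  ultimately have "summable (%k. 2^k * (?d k x)^2 + (1/2)^k)" by (rule summable_add)
  have "summable (%k. ?d k x)"
  proof (rule summable_comparison_test'[OF \<open>summable (%k. 2^k * (?d k x)^2 + (1/2)^k)\<close>])
   fix k :: nat
   have p: "sqrt (2^k) > (0::real)" "(sqrt (2^k))^2 = (2::real)^k" by simp_all
   have "2 * (sqrt (2^k) * ?d k x) * (1 / sqrt (2^k)) <= (sqrt (2^k) * ?d k x)^2 + (1 / sqrt (2^k))^2"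
    by (rule sum_squares_bound)
   moreover have "2 * (sqrt (2^k) * ?d k x) * (1 / sqrt (2^k)) = 2 * ?d k x" using p by simp
   moreover have "(1 / sqrt (2^k))^2 = (1/2::real)^k" by (simp add: power_divide power_one_over)
   ultimately show "norm (?d k x) <= 2^k * (?d k x)^2 + (1/2)^k"
    by (simp add: power_mult_distrib) (smt (verit) norm_ge_zero)
  qed
  then have "summable (%k. f (Suc k) x - f k x)" by (rule summable_norm_cancel)
  then have "convergent (%n. \<Sum>k<n. f (Suc k) x - f k x)" by (simp add: summable_iff_convergent)
  moreover have "(%n. \<Sum>k<n. f (Suc k) x - f k x) = (%n. f n x - f 0 x)" using sum_lessThan_telescope[of "%k. f k x"] by simp
  ultimately obtain L where "(%n. f n x - f 0 x) ----> L" by (auto simp: convergent_def)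
  from tendsto_add[OF this tendsto_const[of "f 0 x"]] have "convergent (%n. f n x)" by (auto simp: convergent_def)
  then show ?case by simp
 qed
qed

text \<open>Riesz-Fischer: a rapid subsequence converges almost everywhere, and Fatou's lemma shows
  that its limit is the limit of the whole sequence in the square norm.\<close>

theorem l2_complete:
 fixes f :: "nat => 'a => 'b::euclidean_space"
 assumes f: "\<And>n. f n \<in> l2_space M"
  and cauchy: "\<And>e. e > 0 ==> \<exists>n0. \<forall>m\<ge>n0. \<forall>n\<ge>n0. l2_sq M (%x. f m x - f n x) <= ennreal e"
 shows "\<exists>g\<in>l2_space M. (%n. l2_sq M (%x. f n x - g x)) ----> 0"
proof -
 have [measurable]: "f n \<in> borel_measurable M" for n using f by (simp add: l2_space_def)
 have "\<exists>n0. \<forall>m\<ge>n0. \<forall>n\<ge>n0. l2_sq M (%x. f m x - f n x) <= ennreal ((1/4)^k)" for k :: nat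
  by (rule cauchy) simp
 then obtain n0 where n0: "\<And>k m n. m >= n0 k ==> n >= n0 k ==> l2_sq M (%x. f m x - f n x) <= ennreal ((1/4)^k)"
  by metis
 \<comment> \<open>Summing the thresholds puts \<open>r k\<close> and \<open>r (Suc k)\<close> above
   \<open>n0 k\<close> without a recursive choice; the summand \<open>k\<close> makes
   \<open>r\<close> tend to infinity.\<close>
 define r where "r k = (\<Sum>j\<le>k. n0 j) + k" for k
 have rge: "r k >= n0 k" "r (Suc k) >= n0 k" "r k >= k" for k
 proof -
  have "n0 k <= (\<Sum>j\<le>k. n0 j)" by (rule member_le_sum) auto
  then show "r k >= n0 k" "r (Suc k) >= n0 k" "r k >= k" by (auto simp: r_def)
 qed
 have conv: "AE x in M. convergent (%k. f (r k) x)"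
  by (rule l2_rapid_AE_convergent) (auto intro!: n0 rge)
 define g where "g x = lim (%k. f (r k) x)" for x
 have [measurable]: "g \<in> borel_measurable M" unfolding g_def by measurable
 have le: "l2_sq M (%x. f n x - g x) <= ennreal e" if nm: "\<And>m. m >= m0 ==> l2_sq M (%x. f n x - f m x) <= ennreal e" for n m0 e
 proof -
  have "l2_sq M (%x. f n x - g x) = (\<integral>\<^sup>+x. liminf (%k. ennreal ((norm (f n x - f (r k) x))^2)) \<partial>M)"
   unfolding l2_sq_def
  proof (rule nn_integral_cong_AE)
   show "AE x in M. ennreal ((norm (f n x - g x))^2) = liminf (%k. ennreal ((norm (f n x - f (r k) x))^2))"
    using conv
   proof eventually_elim
    case (elim x)
    then have "(%k. f (r k) x) ----> g x" by (simp add: g_def convergent_LIMSEQ_iff)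
    then have "(%k. ennreal ((norm (f n x - f (r k) x))^2)) ----> ennreal ((norm (f n x - g x))^2)"
     by (intro tendsto_intros tendsto_ennrealI)
    from lim_imp_Liminf[OF _ this] show ?case by simp
   qed
  qed
  also have "... <= liminf (%k. l2_sq M (%x. f n x - f (r k) x))"
   unfolding l2_sq_def by (rule nn_integral_liminf) measurable
  also have "... <= liminf (%k. ennreal e)"
  proof (rule Liminf_mono)
   show "\<forall>\<^sub>F k in sequentially. l2_sq M (%x. f n x - f (r k) x) <= ennreal e"
    unfolding eventually_sequentially using nm rge(3) order_trans by blast
  qed
  finally show ?thesis by (simp add: Liminf_const)
 qed
 have lim: "(%n. l2_sq M (%x. f n x - g x)) ----> 0"
 proof (rule tendsto_ennreal_0I)
  fix e :: real assume e: "e > 0"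
  obtain n1 where n1: "\<forall>m\<ge>n1. \<forall>n\<ge>n1. l2_sq M (%x. f m x - f n x) <= ennreal e" using cauchy[OF e] by blast
  then have "\<forall>n\<ge>n1. l2_sq M (%x. f n x - g x) <= ennreal e" using le[of n1] by blast
  then show "\<forall>\<^sub>F n in sequentially. l2_sq M (%x. f n x - g x) <= ennreal e"
   unfolding eventually_sequentially by blast
 qed
 obtain n1 where n1: "\<forall>m\<ge>n1. \<forall>n\<ge>n1. l2_sq M (%x. f m x - f n x) <= ennreal 1" using cauchy[of 1] by auto
 have "l2_sq M (%x. f n1 x - g x) <= ennreal 1" using n1 le[of n1 n1] by blast
 then have "(%x. f n1 x - g x) \<in> l2_space M" by (simp add: l2_space_def order_le_less_trans)
 from l2_space_lincomb[OF f[of n1] this, of 1 "- 1"] have "g \<in> l2_space M" by simp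
 then show ?thesis using lim by blast
qed

section \<open>Limits along approximating sequences\<close>

lemma jump_sq_le_add:
 assumes le: "\<And>k. 1 <= k ==> l2_sq (surface N k) (j k) <= \<alpha> * l2_sq (surface N k) (i k) + \<beta> * l2_sq (surface N k) (l k)"
 shows "jump_sq N c j <= \<alpha> * jump_sq N c i + \<beta> * jump_sq N c l"
proof -
 let ?w = "%k. ennreal ((1 + c) ^ Suc k * real (crossings N (Suc k)))"
 have "jump_sq N c j <= (\<Sum>k. \<alpha> * (?w k * l2_sq (surface N (Suc k)) (i (Suc k))) + \<beta> * (?w k * l2_sq (surface N (Suc k)) (l (Suc k))))"
  unfolding jump_sq_def
 proof (intro suminf_le allI)
  fix k
  have "?w k * l2_sq (surface N (Suc k)) (j (Suc k)) <= ?w k * (\<alpha> * l2_sq (surface N (Suc k)) (i (Suc k)) + \<beta> * l2_sq (surface N (Suc k)) (l (Suc k)))"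
   by (intro mult_left_mono le) auto
  then show "?w k * l2_sq (surface N (Suc k)) (j (Suc k)) \<le>
    \<alpha> * (?w k * l2_sq (surface N (Suc k)) (i (Suc k))) + \<beta> * (?w k * l2_sq (surface N (Suc k)) (l (Suc k)))"
   by (simp add: distrib_left mult.left_commute)
 qed auto
 also have "... = \<alpha> * jump_sq N c i + \<beta> * jump_sq N c l"
  by (simp add: jump_sq_def suminf_add[symmetric])
 finally show ?thesis .
qed

lemma ennreal_le_limit:
 fixes x :: ennreal
 assumes "\<And>n. x <= f n" "f ----> y"
 shows "x <= y"
 by (rule LIMSEQ_le_const[OF assms(2)]) (use assms(1) in auto)

lemma tendsto_ennreal_0_cmult:
 fixes f :: "nat => ennreal"
 assumes "f ----> 0" "\<alpha> < top"
 shows "(%n. \<alpha> * f n) ----> 0"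
 using ennreal_tendsto_cmult[OF assms(2,1)] by simp

lemma tendsto_ennreal_0_le:
 fixes f g :: "nat => ennreal"
 assumes "g ----> 0" "\<And>n. f n <= g n"
 shows "f ----> 0"
 by (rule tendsto_sandwich[OF _ _ tendsto_const assms(1)]) (use assms(2) in auto)

lemma tendsto_ennreal_0D:
 fixes f :: "nat => ennreal"
 assumes "f ----> 0" "(e::real) > 0"
 shows "\<exists>n0. \<forall>n\<ge>n0. f n <= ennreal e"
proof -
 have "\<forall>\<^sub>F n in sequentially. f n < ennreal e" using order_tendstoD(2)[OF assms(1)] assms(2) by simp
 then show ?thesis by (auto simp: eventually_sequentially intro: less_imp_le)
qed

lemma tendsto_ennreal_0_trans:
 fixes d :: "'z => 'z => ennreal"
 assumes tri: "\<And>n. d (x n) (z n) <= 2 * d (x n) (y n) + 2 * d (y n) (z n)"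
  and lim: "(%n. d (x n) (y n)) ----> 0" "(%n. d (y n) (z n)) ----> 0"
 shows "(%n. d (x n) (z n)) ----> 0"
proof (rule tendsto_ennreal_0_le[OF _ tri])
 show "(%n. 2 * d (x n) (y n) + 2 * d (y n) (z n)) ----> 0"
  using tendsto_add[OF tendsto_ennreal_0_cmult[OF lim(1), of 2] tendsto_ennreal_0_cmult[OF lim(2), of 2]] by simp
qed

section \<open>Completeness of the jump space and distances of smooth functions\<close>

context fractal_network
begin

lemma jump_space_diff_measurable:
 assumes "j \<in> jump_space N c" "1 <= k"
 shows "j k \<in> borel_measurable (surface N k)"
 using assms by (auto simp: jump_space_def l2_space_def)

lemma jump_sq_triangle:
 assumes "i \<in> jump_space N c" "j \<in> jump_space N c" "l \<in> jump_space N c"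
 shows "jump_sq N c (%k \<xi>. i k \<xi> - l k \<xi>) <= 2 * jump_sq N c (%k \<xi>. i k \<xi> - j k \<xi>) + 2 * jump_sq N c (%k \<xi>. j k \<xi> - l k \<xi>)"
 by (rule jump_sq_le_add) (intro l2_sq_triangle jump_space_diff_measurable assms)

lemma jump_sq_young:
 assumes "i \<in> jump_space N c" "j \<in> jump_space N c" "\<delta> > 0"
 shows "jump_sq N c i <= ennreal (1 + \<delta>) * jump_sq N c j + ennreal (1 + 1/\<delta>) * jump_sq N c (%k \<xi>. i k \<xi> - j k \<xi>)"
 by (rule jump_sq_le_add) (intro l2_sq_young jump_space_diff_measurable assms)

lemma jump_weight_ge_1:
 assumes "1 <= k"
 shows "1 <= jump_weight c k"
proof -
 have "1 <= crossings N k" using network assms by (auto simp: multiscale_interface_network_def)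
 then have "1 * 1 <= (1 + c)^k * real (crossings N k)" using c_pos by (intro mult_mono) auto
 then show ?thesis unfolding jump_weight_def by (metis ennreal_1 ennreal_leI mult_1)
qed

lemma jump_sq_eq: "jump_sq N c j = (\<Sum>k. jump_weight c (Suc k) * l2_sq (surface N (Suc k)) (j (Suc k)))"
 by (simp add: jump_sq_def jump_weight_def)

lemma jump_sq_component:
 assumes "1 <= k"
 shows "l2_sq (surface N k) (j k) <= jump_sq N c j"
proof -
 obtain m where k: "k = Suc m" using assms by (cases k) auto
 have "1 * l2_sq (surface N k) (j k) <= jump_weight c k * l2_sq (surface N k) (j k)"
  by (intro mult_right_mono jump_weight_ge_1 assms) auto
 also have "... <= (\<Sum>i. jump_weight c (Suc i) * l2_sq (surface N (Suc i)) (j (Suc i)))"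
  using sum_le_suminf[of "%i. jump_weight c (Suc i) * l2_sq (surface N (Suc i)) (j (Suc i))" "{m}"] by (simp add: k)
 finally show ?thesis by (simp add: jump_sq_eq)
qed

text \<open>The weights are at least 1, so each component is Cauchy and has a limit. The bound in
  the weighted norm holds for finite partial sums in the limit, uniformly in their length.\<close>

lemma jump_space_complete:
 fixes f :: "nat => nat => 'n point => real"
 assumes f: "\<And>n. f n \<in> jump_space N c"
  and cauchy: "\<And>e. e > 0 ==> \<exists>n0. \<forall>m\<ge>n0. \<forall>n\<ge>n0. jump_sq N c (%k \<xi>. f m k \<xi> - f n k \<xi>) <= ennreal e"
 shows "\<exists>j\<in>jump_space N c. (%n. jump_sq N c (%k \<xi>. f n k \<xi> - j k \<xi>)) ----> 0"
proof -
 have "\<exists>g\<in>l2_space (surface N k). (%n. l2_sq (surface N k) (%\<xi>. f n k \<xi> - g \<xi>)) ----> 0" if k: "1 <= k" for k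
 proof (rule l2_complete)
  show "f n k \<in> l2_space (surface N k)" for n using f[of n] k by (auto simp: jump_space_def)
  fix e :: real assume "e > 0"
  from cauchy[OF this] show "\<exists>n0. \<forall>m\<ge>n0. \<forall>n\<ge>n0. l2_sq (surface N k) (%\<xi>. f m k \<xi> - f n k \<xi>) <= ennreal e"
   by (meson jump_sq_component[OF k] order_trans)
 qed
 then have "\<forall>k. \<exists>g. 1 <= k --> g \<in> l2_space (surface N k) & (%n. l2_sq (surface N k) (%\<xi>. f n k \<xi> - g \<xi>)) ----> 0" by blast
 from choice[OF this] obtain j where j: "\<And>k. 1 <= k ==> j k \<in> l2_space (surface N k)"
  and lim: "\<And>k. 1 <= k ==> (%n. l2_sq (surface N k) (%\<xi>. f n k \<xi> - j k \<xi>)) ----> 0" by blast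
 have meas: "f n k \<in> borel_measurable (surface N k)" "j k \<in> borel_measurable (surface N k)" if "1 <= k" for n k
  using jump_space_diff_measurable[OF f that] j[OF that] by (auto simp: l2_space_def)
 have close: "jump_sq N c (%k \<xi>. f n k \<xi> - j k \<xi>) <= ennreal (2 * e)"
  if n: "\<And>m. m >= n0 ==> jump_sq N c (%k \<xi>. f n k \<xi> - f m k \<xi>) <= ennreal e" and e: "e > 0" for n n0 e
  unfolding jump_sq_eq
 proof (rule suminf_le_const, simp)
  fix M
  let ?l = "%k g. l2_sq (surface N (Suc k)) (%\<xi>. g (Suc k) \<xi>)"
  have le: "(\<Sum>k<M. jump_weight c (Suc k) * ?l k (%k \<xi>. f n k \<xi> - j k \<xi>)) \<le>
    2 * ennreal e + (\<Sum>k<M. jump_weight c (Suc k) * (2 * ?l k (%k \<xi>. f (m + n0) k \<xi> - j k \<xi>)))" for m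
  proof -
   have "(\<Sum>k<M. jump_weight c (Suc k) * ?l k (%k \<xi>. f n k \<xi> - j k \<xi>)) \<le>
     (\<Sum>k<M. 2 * (jump_weight c (Suc k) * ?l k (%k \<xi>. f n k \<xi> - f (m + n0) k \<xi>)) +
      jump_weight c (Suc k) * (2 * ?l k (%k \<xi>. f (m + n0) k \<xi> - j k \<xi>)))"
   proof (rule sum_mono)
    fix k
    have "jump_weight c (Suc k) * ?l k (%k \<xi>. f n k \<xi> - j k \<xi>) \<le>
      jump_weight c (Suc k) * (2 * ?l k (%k \<xi>. f n k \<xi> - f (m + n0) k \<xi>) + 2 * ?l k (%k \<xi>. f (m + n0) k \<xi> - j k \<xi>))"
     by (intro mult_left_mono l2_sq_triangle meas) auto
    then show "jump_weight c (Suc k) * ?l k (%k \<xi>. f n k \<xi> - j k \<xi>) \<le>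
      2 * (jump_weight c (Suc k) * ?l k (%k \<xi>. f n k \<xi> - f (m + n0) k \<xi>)) +
      jump_weight c (Suc k) * (2 * ?l k (%k \<xi>. f (m + n0) k \<xi> - j k \<xi>))"
     by (simp add: distrib_left mult.left_commute)
   qed
   also have "... = 2 * (\<Sum>k<M. jump_weight c (Suc k) * ?l k (%k \<xi>. f n k \<xi> - f (m + n0) k \<xi>)) +
      (\<Sum>k<M. jump_weight c (Suc k) * (2 * ?l k (%k \<xi>. f (m + n0) k \<xi> - j k \<xi>)))"
    by (simp add: sum.distrib sum_distrib_left)
   also have "(\<Sum>k<M. jump_weight c (Suc k) * ?l k (%k \<xi>. f n k \<xi> - f (m + n0) k \<xi>)) <= ennreal e"
    by (rule order_trans[OF sum_le_suminf n[of "m + n0", unfolded jump_sq_eq]]) auto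
   finally show ?thesis by (simp add: add_right_mono mult_left_mono)
  qed
  have "(%m. 2 * ennreal e + (\<Sum>k<M. jump_weight c (Suc k) * (2 * ?l k (%k \<xi>. f (m + n0) k \<xi> - j k \<xi>)))) ----> 2 * ennreal e + (\<Sum>k<M. 0)"
  proof (intro tendsto_add tendsto_const tendsto_sum tendsto_ennreal_0_cmult)
   show "(%m. ?l k (%k \<xi>. f (m + n0) k \<xi> - j k \<xi>)) ----> 0" for k
    using LIMSEQ_ignore_initial_segment[OF lim[of "Suc k"], of n0] by simp
  qed (auto simp: jump_weight_def)
  from ennreal_le_limit[OF le this]
  show "(\<Sum>k<M. jump_weight c (Suc k) * ?l k (%k \<xi>. f n k \<xi> - j k \<xi>)) <= ennreal (2 * e)"
   using e by (simp add: ennreal_mult)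
 qed
 have conv: "(%n. jump_sq N c (%k \<xi>. f n k \<xi> - j k \<xi>)) ----> 0"
 proof (rule tendsto_ennreal_0I)
  fix e :: real assume e: "e > 0"
  obtain n0 where n0: "\<And>m n. m >= n0 ==> n >= n0 ==> jump_sq N c (%k \<xi>. f m k \<xi> - f n k \<xi>) <= ennreal (e/2)"
   using cauchy[of "e/2"] e by auto
  show "\<forall>\<^sub>F n in sequentially. jump_sq N c (%k \<xi>. f n k \<xi> - j k \<xi>) <= ennreal e"
   using close[of n0 _ "e/2"] n0 e by (auto simp: eventually_sequentially)
 qed
 obtain n where n: "jump_sq N c (%k \<xi>. f n k \<xi> - j k \<xi>) <= ennreal 1"
  using tendsto_ennreal_0D[OF conv, of 1] by auto
 have "jump_sq N c j <= 2 * jump_sq N c (f n) + 2 * jump_sq N c (%k \<xi>. f n k \<xi> - j k \<xi>)"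
 proof (rule jump_sq_le_add)
  fix k :: nat assume k: "1 <= k"
  show "l2_sq (surface N k) (j k) <= 2 * l2_sq (surface N k) (f n k) + 2 * l2_sq (surface N k) (%\<xi>. f n k \<xi> - j k \<xi>)"
   using l2_sq_lincomb[OF meas(1)[OF k, of n] borel_measurable_diff[OF meas(1)[OF k, of n] meas(2)[OF k]], where a = 1 and b = "- 1"]
   by simp
 qed
 also have "... < top"
  using f[of n] n by (auto simp: jump_space_def ennreal_mult_less_top intro: le_less_trans)
 finally have "j \<in> jump_space N c" using j by (simp add: jump_space_def)
 with conv show ?thesis by blast
qed

lemma energy_sdist:
 assumes "1 <= K" "u \<in> C1 K" "1 <= L" "w \<in> C1 L"
 shows "(%x. 1 * u x + (- 1) * w x) \<in> C1 (max K L)"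
  "energy c (%x. 1 * u x + (- 1) * w x) = ennreal ((sdist u w)^2)"
proof -
 show d: "(%x. 1 * u x + (- 1) * w x) \<in> C1 (max K L)"
  using c1_lincomb[of "max K L" u w 1 "- 1"] c1_mono[OF assms(1) max.cobounded1 assms(2)] c1_mono[OF assms(3) max.cobounded2 assms(4)] assms(1)
  by simp
 show "energy c (%x. 1 * u x + (- 1) * w x) = ennreal ((sdist u w)^2)"
  using energy_finite[OF _ d] assms(1) by (simp add: sdist_def snorm_def)
qed

lemma energy_snorm:
 assumes "1 <= K" "u \<in> C1 K"
 shows "energy c u = ennreal ((snorm c u)^2)"
 using energy_finite[OF assms, of c] by (simp add: snorm_def)

lemma AE_not_upto: "AE x in lborel. x \<notin> iface_upto N K"
 using AE_not_iface_all by eventually_elim (auto simp: iface_all_eq)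

text \<open>Only almost everywhere, because the extensions at the two levels may disagree on
  interfaces that belong to the higher level alone.\<close>

lemma AE_ubar_gbar_lincomb:
 assumes "1 <= K" "u \<in> C1 K" "1 <= L" "w \<in> C1 L"
 shows "AE x in lborel. \<alpha> * ubar K u x + \<beta> * ubar L w x = ubar (max K L) (%x. \<alpha> * u x + \<beta> * w x) x \<and>
  \<alpha> *\<^sub>R gbar K u x + \<beta> *\<^sub>R gbar L w x = gbar (max K L) (%x. \<alpha> * u x + \<beta> * w x) x"
 using AE_not_upto[of "max K L"]
proof eventually_elim
 case (elim x)
 have M: "1 <= max K L" using assms by simp
 have "x \<notin> iface_upto N K" "x \<notin> iface_upto N L" using elim iface_upto_mono[of _ "max K L"] by (meson max.cobounded1 max.cobounded2 subsetD)+
 then show ?case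
  using gradient_lincomb[OF M c1_mono[OF assms(1) max.cobounded1 assms(2)] c1_mono[OF assms(3) max.cobounded2 assms(4)], of x \<alpha> \<beta>] elim
  by (cases "x \<in> region N") (auto simp: ubar_def gbar_def)
qed

lemma AE_ubar_gbar_diff:
 assumes "1 <= K" "u \<in> C1 K" "1 <= L" "w \<in> C1 L"
 shows "AE x in lborel. ubar K u x - ubar L w x = ubar (max K L) (%x. 1 * u x + (- 1) * w x) x \<and>
  gbar K u x - gbar L w x = gbar (max K L) (%x. 1 * u x + (- 1) * w x) x"
 using AE_ubar_gbar_lincomb[OF assms, of 1 "- 1"] by eventually_elim simp

lemma gbar_dist:
 assumes "1 <= K" "u \<in> C1 K" "1 <= L" "w \<in> C1 L"
 shows "l2_sq lborel (%x. gbar K u x - gbar L w x) <= ennreal ((sdist u w)^2)"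
proof -
 have "l2_sq lborel (%x. gbar K u x - gbar L w x) = Gsq (max K L) (%x. 1 * u x + (- 1) * w x)"
  unfolding Gsq_def l2_sq_def[symmetric] using AE_ubar_gbar_diff[OF assms] by (intro l2_sq_cong) (auto elim: eventually_mono)
 also have "... <= energy c (%x. 1 * u x + (- 1) * w x)" using energy_smooth[OF _ energy_sdist(1)[OF assms]] assms(1) by simp
 finally show ?thesis using energy_sdist(2)[OF assms] by simp
qed

lemma ubar_bound:
 assumes "1 <= K" "u \<in> C1 K"
 shows "l2_sq lborel (ubar K u) <= ennreal (poincare_const c) * ennreal ((snorm c u)^2)"
 using smooth_poincare[OF c_pos assms] energy_smooth[OF assms, of c] energy_snorm[OF assms] by (simp add: l2_sq_def)

lemma ubar_dist:
 assumes "1 <= K" "u \<in> C1 K" "1 <= L" "w \<in> C1 L"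
 shows "l2_sq lborel (%x. ubar K u x - ubar L w x) <= ennreal (poincare_const c) * ennreal ((sdist u w)^2)"
proof -
 have "l2_sq lborel (%x. ubar K u x - ubar L w x) = l2_sq lborel (ubar (max K L) (%x. 1 * u x + (- 1) * w x))"
  using AE_ubar_gbar_diff[OF assms] by (intro l2_sq_cong) (auto elim: eventually_mono)
 also have "... <= ennreal (poincare_const c) * ennreal ((sdist u w)^2)"
  using ubar_bound[OF _ energy_sdist(1)[OF assms]] assms(1) by (simp add: sdist_def)
 finally show ?thesis .
qed

lemma AE_jump_diff:
 assumes "1 <= K" "u \<in> C1 K" "1 <= L" "w \<in> C1 L" "1 <= k"
 shows "AE \<xi> in surface N k. jmp k u \<xi> - jmp k w \<xi> = jmp k (%x. 1 * u x + (- 1) * w x) \<xi>"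
 using AE_surface_regular[OF assms(5)] AE_space
proof eventually_elim
 case (elim \<xi>)
 \<comment> \<open>The level is raised to at least \<open>k\<close>, so that linearity of jumps is
   available also on interfaces above both levels.\<close>
 let ?M = "max k (max K L)"
 have "u \<in> C1 ?M" "w \<in> C1 ?M" using c1_mono[OF assms(1) _ assms(2)] c1_mono[OF assms(3) _ assms(4)] by auto
 from jump_lincomb[OF assms(5) max.cobounded1 this, of \<xi> 1 "- 1"] show ?case using elim by simp
qed

lemma jump_dist:
 assumes "1 <= K" "u \<in> C1 K" "1 <= L" "w \<in> C1 L"
 shows "jump_sq N c (%k \<xi>. jmp k u \<xi> - jmp k w \<xi>) <= ennreal ((sdist u w)^2)"
proof -
 have "jump_sq N c (%k \<xi>. jmp k u \<xi> - jmp k w \<xi>) = jump_sq N c (%k. jmp k (%x. 1 * u x + (- 1) * w x))"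
  unfolding jump_sq_def by (intro suminf_cong arg_cong2[where f = "(*)"] refl l2_sq_cong AE_jump_diff[OF assms]) simp
 also have "... <= energy c (%x. 1 * u x + (- 1) * w x)" unfolding energy_def by simp
 finally show ?thesis using energy_sdist(2)[OF assms] by simp
qed

lemma jump_in_space:
 assumes "1 <= K" "u \<in> C1 K"
 shows "(%k. jmp k u) \<in> jump_space N c"
proof -
 have "jmp k u \<in> l2_space (surface N k)" if k: "1 <= k" for k
  using c1_jump_l2[OF c1_mono[OF assms(1) max.cobounded1 assms(2)], of k k] k by simp
 moreover have "jump_sq N c (%k. jmp k u) <= energy c u" by (simp add: energy_def)
 ultimately show ?thesis using energy_finite[OF assms, of c] by (auto simp: jump_space_def intro: le_less_trans)
qed

lemma ubar_gbar_l2: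
 assumes "1 <= K" "u \<in> C1 K"
 shows "ubar K u \<in> l2_space lborel" "gbar K u \<in> l2_space lborel"
proof -
 have "ennreal (poincare_const c) * ennreal ((snorm c u)^2) < top" by (simp add: ennreal_mult_less_top)
 then show "ubar K u \<in> l2_space lborel"
  using borel_ubar_gbar(1)[OF assms] ubar_bound[OF assms] by (auto simp: l2_space_def intro: le_less_trans)
 show "gbar K u \<in> l2_space lborel"
  using borel_ubar_gbar(2)[OF assms] Gsq_finite[OF assms] by (auto simp: l2_space_def Gsq_def l2_sq_def)
qed

text \<open>In the applications \<open>T K u\<close> is \<open>u\<close>, its gradient or its family of jumps.\<close>

lemma limit_along_approximations:
 fixes d :: "'z => 'z => ennreal" and T :: "nat => ('n point => real) => 'z"
 assumes T: "\<And>K u. 1 <= K ==> u \<in> C1 K ==> T K u \<in> Z"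
  and sym: "\<And>x y. d x y = d y x"
  and tri: "\<And>x y z. x \<in> Z ==> y \<in> Z ==> z \<in> Z ==> d x z <= 2 * d x y + 2 * d y z"
  and complete: "\<And>f. (\<And>n. f n \<in> Z) ==> (\<And>e. e > 0 ==> \<exists>n0. \<forall>m\<ge>n0. \<forall>n\<ge>n0. d (f m) (f n) <= ennreal e) ==>
   \<exists>g\<in>Z. (%n. d (f n) g) ----> 0"
  and lip: "\<And>K u L w. 1 <= K ==> u \<in> C1 K ==> 1 <= L ==> w \<in> C1 L ==>
   d (T K u) (T L w) <= ennreal C * ennreal ((sdist u w)^2)"
  and v: "v \<in> points F"
 shows "\<exists>g\<in>Z. (\<forall>V\<in>v. \<exists>h. (\<forall>n. h n \<in> Z & (\<forall>X\<in>snd (V n). (%m. d (T (fst (V n)) (X m)) (h n)) ----> 0)) \<and>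
   (%n. d (h n) g) ----> 0) & (\<forall>K u. approximates v K u --> (%n. d (T (K n) (u n)) g) ----> 0)"
proof -
 have small: "\<exists>r>0. \<forall>t\<ge>0. t < r --> ennreal C * ennreal (t\<^sup>2) <= ennreal e" if e: "e > 0" for e
 proof (intro exI[of _ "min 1 (e / (\<bar>C\<bar> + 1))"] conjI allI impI)
  fix t assume t: "0 <= t" "t < min 1 (e / (\<bar>C\<bar> + 1))"
  have "t\<^sup>2 <= t" using t by (simp add: power2_eq_square mult_left_le)
  then have "\<bar>C\<bar> * t\<^sup>2 <= (\<bar>C\<bar> + 1) * t" using t by (intro mult_mono) auto
  also have "... <= e" using t by (simp add: field_simps)
  finally have "\<bar>C\<bar> * t\<^sup>2 <= e" .
  moreover have "ennreal C * ennreal (t\<^sup>2) <= ennreal (\<bar>C\<bar> * t\<^sup>2)" by (simp add: ennreal_mult ennreal_leI mult_right_mono)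
  ultimately show "ennreal C * ennreal (t\<^sup>2) <= ennreal e" by (meson ennreal_leI order_trans)
 qed (use e in simp)
 have nn: "sdist u w >= 0" for u w by (simp add: sdist_def snorm_def)
 have to0: "(%n. d (T (K n) (u n)) (T (L n) (w n))) ----> 0"
  if "\<And>n. 1 <= K n" "\<And>n. u n \<in> C1 (K n)" "\<And>n. 1 <= L n" "\<And>n. w n \<in> C1 (L n)" "(%n. sdist (u n) (w n)) ----> 0" for K L u w
 proof (rule tendsto_ennreal_0_le[OF _ lip[OF that(1-4)]])
  have "(%n. ennreal ((sdist (u n) (w n))^2)) ----> ennreal (0\<^sup>2)" by (intro tendsto_ennrealI tendsto_power that(5))
  then show "(%n. ennreal C * ennreal ((sdist (u n) (w n))^2)) ----> 0" by (intro tendsto_ennreal_0_cmult) auto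
 qed
 have converges: "\<exists>g\<in>Z. (%n. d (T (K n) (u n)) g) ----> 0"
  if Ku: "\<And>n. 1 <= K n" "\<And>n. u n \<in> C1 (K n)" and cau: "\<And>e. e > 0 ==> \<exists>n0. \<forall>m\<ge>n0. \<forall>n\<ge>n0. sdist (u m) (u n) < e" for K u
 proof (rule complete)
  show "T (K n) (u n) \<in> Z" for n by (rule T[OF Ku])
  fix e :: real assume "e > 0"
  then obtain r where r: "r > 0" "\<And>t. t >= 0 ==> t < r ==> ennreal C * ennreal (t\<^sup>2) <= ennreal e" using small by blast
  obtain n0 where "\<forall>m\<ge>n0. \<forall>n\<ge>n0. sdist (u m) (u n) < r" using cau[OF r(1)] by blast
  then show "\<exists>n0. \<forall>m\<ge>n0. \<forall>n\<ge>n0. d (T (K m) (u m)) (T (K n) (u n)) <= ennreal e"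
   using r(2)[OF nn] lip[OF Ku(1) Ku(2) Ku(1) Ku(2)] by (meson order_trans)
 qed
 obtain K u where a: "approximates v K u" using approximates_exists[OF v] by blast
 obtain g where g: "g \<in> Z" "(%n. d (T (K n) (u n)) g) ----> 0"
  using converges[OF approximatesD(1,2)[OF a] approximates_cauchy[OF v a]] by blast
 have all: "(%n. d (T (L n) (w n)) g) ----> 0" if a': "approximates v L w" for L w
 proof (rule tendsto_ennreal_0_trans[where d = d and y = "%n. T (K n) (u n)", OF tri _ g(2)])
  have "(%n. pdist U (emb (L n) (w n)) (emb (K n) (u n))) ----> 0"
   using fractal_rep[OF v approximatesD(3)[OF a']] approximatesD(3)[OF a] U.null_relD(3) by blast
  then have "(%n. sdist (w n) (u n)) ----> 0"
   by (simp add: pdist_emb[OF approximatesD(1,2)[OF a'] approximatesD(1,2)[OF a]])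
  then show "(%n. d (T (L n) (w n)) (T (K n) (u n))) ----> 0" by (rule to0[OF approximatesD(1,2)[OF a'] approximatesD(1,2)[OF a]])
 qed (intro T[OF approximatesD(1,2)[OF a]] T[OF approximatesD(1,2)[OF a']] g(1))+
 have "\<exists>h. (\<forall>n. h n \<in> Z & (\<forall>X\<in>snd (V n). (%m. d (T (fst (V n)) (X m)) (h n)) ----> 0)) & (%n. d (h n) g) ----> 0"
  if V: "V \<in> v" for V
 proof -
  have Vp: "V n \<in> points U" for n using fractal_rep[OF v V] U.cauchy_points by blast
  have lev: "\<exists>h\<in>Z. \<forall>X\<in>snd (V n). (%m. d (T (fst (V n)) (X m)) h) ----> 0" for n
  proof -
   obtain L P X where p: "V n = (L, P)" "(L, P) \<in> points U" "X \<in> P" "1 <= L" "X \<in> cauchy_seqs (Sm L)" "\<And>m. X m \<in> C1 L"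
    by (rule union_rep[OF Vp[of n]]) blast
   have "\<exists>h\<in>Z. (%m. d (T L (X m)) h) ----> 0"
   proof (rule converges)
    show "\<exists>n0. \<forall>m\<ge>n0. \<forall>n\<ge>n0. sdist (X m) (X n) < e" if "e > 0" for e
     using p(5) that by (auto simp: cauchy_seqs_def pdist_smooth[OF p(4) p(6) p(6)])
   qed (use p in auto)
   then obtain h where h: "h \<in> Z" "(%m. d (T L (X m)) h) ----> 0" by blast
   have "(%m. d (T L (Y m)) h) ----> 0" if Y: "Y \<in> P" for Y
   proof (rule tendsto_ennreal_0_trans[where d = d and y = "%m. T L (X m)", OF tri _ h(2)])
    have P: "P \<in> points (W L)" using p(2) by (simp add: points_union)
    have Yc: "Y m \<in> C1 L" for m using level_rep(1)[OF p(4) P Y] by (simp add: cauchy_seqs_def)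
    have "(Y, X) \<in> null_rel (Sm L)" using level_rep(2)[OF p(4) P Y] p(3) by blast
    then have "(%m. sdist (Y m) (X m)) ----> 0" by (simp add: null_rel_def pdist_smooth[OF p(4) Yc p(6)])
    then show "(%m. d (T L (Y m)) (T L (X m))) ----> 0" by (rule to0[OF p(4) Yc p(4) p(6)])
    show "T L (Y m) \<in> Z" for m by (rule T[OF p(4) Yc])
   qed (intro T[OF p(4) p(6)] h(1))+
   then show ?thesis using h p(1) by auto
  qed
  then obtain h where h: "\<And>n. h n \<in> Z" "\<And>n X. X \<in> snd (V n) ==> (%m. d (T (fst (V n)) (X m)) (h n)) ----> 0" by metis
  have half_less: "r / 2 < r" if "r > 0" for r :: real using that by simp
  \<comment> \<open>Diagonal choice: \<open>w n\<close> is close to \<open>V n\<close> in the union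
    and at the same time \<open>T (fst (V n)) (w n)\<close> is close to \<open>h n\<close>. The
    sequence \<open>w\<close> then approximates \<open>v\<close>, and \<open>h n\<close> inherits
    the limit \<open>g\<close>.\<close>
  have "\<exists>w. w \<in> C1 (fst (V n)) & pdist U (V n) (emb (fst (V n)) w) < 1 / real (Suc n) & d (T (fst (V n)) w) (h n) <= ennreal (1 / real (Suc n))" for n
  proof -
   obtain L P X where p: "V n = (L, P)" "(L, P) \<in> points U" "X \<in> P" "1 <= L" "X \<in> cauchy_seqs (Sm L)" "\<And>m. X m \<in> C1 L"
    by (rule union_rep[OF Vp[of n]]) blast
   interpret S: seminormed "Sm L" by (rule seminormed_smooth[OF p(4)])
   have e: "1 / real (Suc n) > 0" by simp
   have P: "P \<in> points (W L)" using p(2) by (simp add: points_union)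
   obtain n1 where n1: "\<And>m. m >= n1 ==> d (T L (X m)) (h n) <= ennreal (1 / real (Suc n))"
    using tendsto_ennreal_0D[OF h(2)[of X n] e] p(1,3) by auto
   obtain n2 where n2: "\<And>m m'. m >= n2 ==> m' >= n2 ==> sdist (X m) (X m') < 1 / real (Suc n) / 2"
   proof -
    have "\<exists>n0. \<forall>m\<ge>n0. \<forall>m'\<ge>n0. pdist (Sm L) (X m) (X m') < 1 / real (Suc n) / 2"
     using p(5) half_gt_zero[OF e] unfolding cauchy_seqs_def by blast
    then show ?thesis using that unfolding pdist_smooth[OF p(4) p(6) p(6)] by blast
   qed
   let ?w = "X (max n1 n2)"
   have "(%m. sdist (X m) ?w) ----> pdist U (L, P) (emb L ?w)"
    using union_pdist[OF p(2) emb_rep(1)[OF p(4) p(6), unfolded emb_def] p(3) emb_rep(2)[OF p(4) p(6)]] by (simp add: emb_def)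
   moreover have "\<exists>n0. \<forall>m\<ge>n0. sdist (X m) ?w <= 1 / real (Suc n) / 2" using n2 by (intro exI[of _ n2]) (auto intro: less_imp_le)
   ultimately have "pdist U (L, P) (emb L ?w) <= 1 / real (Suc n) / 2" by (rule LIMSEQ_le_const2)
   also have "1 / real (Suc n) / 2 < 1 / real (Suc n)" by (rule half_less[OF e])
   finally show ?thesis using n1[of "max n1 n2"] p by (intro exI[of _ ?w]) auto
  qed
  then obtain w where w: "\<And>n. w n \<in> C1 (fst (V n))" "\<And>n. pdist U (V n) (emb (fst (V n)) (w n)) < 1 / real (Suc n)"
   "\<And>n. d (T (fst (V n)) (w n)) (h n) <= ennreal (1 / real (Suc n))" by metis
  have lim0: "(%n. 1 / real (Suc n)) ----> 0" by (rule LIMSEQ_Suc[OF lim_1_over_n])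
  have fV: "1 <= fst (V n)" for n using Vp[of n] by (cases "V n") (simp add: points_union)
  have "approximates v (%n. fst (V n)) w"
  proof (rule approximates_near[OF v V w(1)])
   show "(%n. pdist U (V n) (emb (fst (V n)) (w n))) ----> 0"
    by (rule tendsto_sandwich[OF _ _ tendsto_const lim0])
     (use w(2) U.pdist_nonneg[OF Vp emb_rep(1)[OF fV w(1)]] in \<open>auto intro!: always_eventually less_imp_le\<close>)
  qed
  from all[OF this] have 1: "(%n. d (T (fst (V n)) (w n)) g) ----> 0" .
  have "(%n. ennreal (1 / real (Suc n))) ----> ennreal 0" by (intro tendsto_ennrealI lim0)
  then have z: "(%n. ennreal (1 / real (Suc n))) ----> 0" by (simp only: ennreal_0)
  have 2: "(%n. d (h n) (T (fst (V n)) (w n))) ----> 0"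
   by (rule tendsto_ennreal_0_le[OF z]) (metis sym w(3))
  have "(%n. d (h n) g) ----> 0"
   by (rule tendsto_ennreal_0_trans[where d = d, OF tri 2 1]) (intro T[OF fV w(1)] h(1) g(1))+
  then show ?thesis using h by blast
 qed
 then show ?thesis using g(1) all by blast
qed

end

section \<open>The embedding\<close>

lemma nn_integral_lebesgue_on:
 fixes f :: "'a::euclidean_space => ennreal"
 assumes [measurable]: "f \<in> borel_measurable borel" "S \<in> sets borel"
 shows "(\<integral>\<^sup>+x. f x \<partial>lebesgue_on S) = (LB x. indicator S x * f x)"
proof -
 have "S \<in> sets lebesgue" using assms(2) by (simp add: sets_completionI_sets)
 then have "(\<integral>\<^sup>+x. f x \<partial>lebesgue_on S) = (\<integral>\<^sup>+x. f x * indicator S x \<partial>lebesgue)" by (subst nn_integral_restrict_space) simp_all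
 also have "... = (LB x. f x * indicator S x)" by (subst nn_integral_completion) simp_all
 finally show ?thesis by (simp add: mult.commute)
qed

lemma AE_lebesgue_onI:
 assumes "S \<in> sets borel" "AE x in lborel. x \<in> S --> P x"
 shows "AE x in lebesgue_on S. P x"
proof -
 have "S \<in> sets lebesgue" using assms(1) by (simp add: sets_completionI_sets)
 then show ?thesis using assms(2) by (subst AE_restrict_space_iff) (auto intro: AE_completion)
qed

lemma l2_limit_unique:
 fixes f :: "nat => 'a => 'b::{real_normed_vector,second_countable_topology}"
 assumes [measurable]: "\<And>n. f n \<in> borel_measurable M" "g \<in> borel_measurable M" "h \<in> borel_measurable M"
  and lim: "(%n. l2_sq M (%x. f n x - g x)) ----> 0" "(%n. l2_sq M (%x. f n x - h x)) ----> 0"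
 shows "AE x in M. g x = h x"
proof -
 have "(%n::nat. l2_sq M (%x. g x - h x)) ----> 0"
  using lim by (intro tendsto_ennreal_0_trans[where d = "%f g. l2_sq M (%x. f x - g x)" and x = "%_. g" and y = f and z = "%_. h"] l2_sq_triangle)
   (simp_all add: l2_sq_diff_commute[of M g])
 then have "l2_sq M (%x. g x - h x) = 0" by (simp add: LIMSEQ_const_iff)
 then have "AE x in M. ennreal ((norm (g x - h x))^2) = 0" unfolding l2_sq_def by (subst (asm) nn_integral_0_iff_AE) auto
 then show ?thesis by eventually_elim (simp add: ennreal_eq_0_iff)
qed

lemma ennreal_le_suminf: "f k <= (\<Sum>k. f k)" for f :: "nat => ennreal"
 using sum_le_suminf[of f "{k}"] by simp

lemma measurable_l2_space: "f \<in> l2_space M ==> f \<in> borel_measurable M"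
 by (simp add: l2_space_def)

lemma nn_integral_shift_le:
 fixes f g :: "'a::euclidean_space => real"
 assumes [measurable]: "f \<in> borel_measurable borel" "g \<in> borel_measurable borel" "E \<in> sets borel"
 shows "(LB x. indicator E x * ennreal ((g (x + h) - g x)^2)) \<le>
  2 * (LB x. indicator E x * ennreal ((f (x + h) - f x)^2)) + 8 * l2_sq lborel (%x. f x - g x)"
proof -
 have pt: "(g (x + h) - g x)^2 <= 2 * (f (x + h) - f x)^2 + 4 * (f (x + h) - g (x + h))^2 + 4 * (f x - g x)^2" for x
 proof -
  have sq: "(p - q)^2 <= 2 * p\<^sup>2 + 2 * q\<^sup>2" for p q :: real using sum_squares_bound[of p "- q"] by (simp add: power2_diff)
  have "(g (x + h) - g x)^2 = ((f (x + h) - f x) - ((f (x + h) - g (x + h)) - (f x - g x)))^2" by simp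
  also have "... <= 2 * (f (x + h) - f x)^2 + 2 * ((f (x + h) - g (x + h)) - (f x - g x))^2" by (rule sq)
  finally show ?thesis using sq[of "f (x + h) - g (x + h)" "f x - g x"] by simp
 qed
 have "(LB x. indicator E x * ennreal ((g (x + h) - g x)^2)) \<le>
   (LB x. 2 * (indicator E x * ennreal ((f (x + h) - f x)^2)) + 4 * ennreal ((f (h + x) - g (h + x))^2) + 4 * ennreal ((f x - g x)^2))"
 proof (intro nn_integral_mono)
  fix x
  have "ennreal ((g (x + h) - g x)^2) <= ennreal (2 * (f (x + h) - f x)^2 + 4 * (f (x + h) - g (x + h))^2 + 4 * (f x - g x)^2)"
   by (rule ennreal_leI[OF pt])
  then show "indicator E x * ennreal ((g (x + h) - g x)^2) \<le>
    2 * (indicator E x * ennreal ((f (x + h) - f x)^2)) + 4 * ennreal ((f (h + x) - g (h + x))^2) + 4 * ennreal ((f x - g x)^2)"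
   by (cases "x \<in> E") (simp_all add: ennreal_mult add.commute[of h])
 qed
 also have "... = 2 * (LB x. indicator E x * ennreal ((f (x + h) - f x)^2)) +
   4 * (LB x. ennreal ((f (h + x) - g (h + x))^2)) + 4 * (LB x. ennreal ((f x - g x)^2))"
  by (subst nn_integral_add; (subst nn_integral_add)?; simp add: nn_integral_cmult)
 also have "(LB x. ennreal ((f (h + x) - g (h + x))^2)) = (LB x. ennreal ((f x - g x)^2))"
  by (rule nn_integral_lborel_translate[of "%x. ennreal ((f x - g x)^2)"]) measurable
 also have "2 * (LB x. indicator E x * ennreal ((f (x + h) - f x)^2)) + 4 * (LB x. ennreal ((f x - g x)^2)) +
   4 * (LB x. ennreal ((f x - g x)^2)) =
   2 * (LB x. indicator E x * ennreal ((f (x + h) - f x)^2)) + (4 + 4) * (LB x. ennreal ((f x - g x)^2))"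
  by (simp only: distrib_right add.assoc)
 finally show ?thesis by (simp add: l2_sq_def)
qed

text \<open>The factor 2 comes from the triangle inequality for squares and is harmless for
  continuity and injectivity. The bound is asked only from \<open>m\<close> on, since along a Cauchy
  sequence it holds for late terms.\<close>

lemma nn_integral_shift_limit:
 fixes f :: "nat => 'a::euclidean_space => real"
 assumes [measurable]: "\<And>n. f n \<in> borel_measurable borel" "g \<in> borel_measurable borel" "E \<in> sets borel"
  and lim: "(%n. l2_sq lborel (%x. f n x - g x)) ----> 0"
  and le: "\<And>n. n >= m ==> (LB x. indicator E x * ennreal ((f n (x + h) - f n x)^2)) <= A n" and A: "A ----> A'"
 shows "(LB x. indicator E x * ennreal ((g (x + h) - g x)^2)) <= 2 * A'"
proof (rule LIMSEQ_le_const)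
 show "(%n. 2 * A n + 8 * l2_sq lborel (%x. f n x - g x)) ----> 2 * A'"
  using tendsto_add[OF ennreal_tendsto_cmult[OF _ A, of 2] tendsto_ennreal_0_cmult[OF lim, of 8]] by simp
 show "\<exists>n0. \<forall>n\<ge>n0. (LB x. indicator E x * ennreal ((g (x + h) - g x)^2)) <= 2 * A n + 8 * l2_sq lborel (%x. f n x - g x)"
 proof (intro exI[of _ m] allI impI)
  fix n assume "n >= m"
  then show "(LB x. indicator E x * ennreal ((g (x + h) - g x)^2)) <= 2 * A n + 8 * l2_sq lborel (%x. f n x - g x)"
   by (intro order_trans[OF nn_integral_shift_le[of "f n" g E h]] add_mono mult_left_mono le) auto
 qed
qed

text \<open>On the dyadic shell between radii \<open>r (Suc k)\<close> and \<open>r k\<close> the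
  integrand is at most \<open>1 / r (Suc k) powr p\<close>, and the ball has volume proportional to
  \<open>r k ^ d\<close>. The products form a geometric series with ratio
  \<open>2 powr (p - d)\<close>, below 1.\<close>

lemma nn_integral_radial_power:
 assumes p: "0 <= p" "p < real DIM('a::euclidean_space)" and D: "D > 0"
 shows "(\<integral>\<^sup>+x. indicator (cball 0 D) x * ennreal (1 / norm x powr p) \<partial>(lborel::'a measure)) < \<infinity>"
proof -
 let ?d = "DIM('a)"
 define r where "r k = D / 2^k" for k :: nat
 have r: "r k > 0" "r (Suc k) = r k / 2" for k using D by (simp_all add: r_def)
 have "(\<integral>\<^sup>+x. indicator (cball 0 D) x * ennreal (1 / norm x powr p) \<partial>(lborel::'a measure)) \<le>
   (\<integral>\<^sup>+x. (\<Sum>k. ennreal (1 / r (Suc k) powr p) * indicator (cball 0 (r k)) x) \<partial>(lborel::'a measure))"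
 proof (rule nn_integral_mono)
  fix x :: 'a
  show "indicator (cball 0 D) x * ennreal (1 / norm x powr p) <= (\<Sum>k. ennreal (1 / r (Suc k) powr p) * indicator (cball 0 (r k)) x)"
  \<comment> \<open>At \<open>x = 0\<close> the integrand is 0, because \<open>0 powr p\<close> is 0
    and so is a quotient with denominator 0.\<close>
  proof (cases "x ~= 0 & norm x <= D")
   case True
   have "(%k. r k) ----> 0" unfolding r_def by (rule LIMSEQ_divide_realpow_zero) simp
   then have "\<forall>\<^sub>F k in sequentially. r k < norm x" using True by (intro order_tendstoD(2)) auto
   then obtain k0 where "r k0 < norm x" by (auto simp: eventually_sequentially)
   then have ex: "\<exists>k. r k < norm x" by blast
   define m where "m = (LEAST k. r k < norm x)"
   have m: "r m < norm x" unfolding m_def by (rule LeastI_ex[OF ex])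
   have "m ~= 0" using m True by (cases m) (simp_all add: r_def)
   then obtain k where k: "m = Suc k" by (cases m) auto
   have "\<not> r k < norm x" using not_less_Least[of k "%k. r k < norm x"] k by (simp add: m_def)
   then have "x \<in> cball 0 (r k)" by simp
   moreover have "1 / norm x powr p <= 1 / r (Suc k) powr p"
    using m r(1)[of "Suc k"] p(1) by (intro divide_left_mono powr_mono2 mult_pos_pos) (auto simp: k)
   ultimately have "indicator (cball 0 D) x * ennreal (1 / norm x powr p) <= ennreal (1 / r (Suc k) powr p) * indicator (cball 0 (r k)) x"
    using True by (simp add: ennreal_leI)
   also have "... <= (\<Sum>k. ennreal (1 / r (Suc k) powr p) * indicator (cball 0 (r k)) x)"
    by (rule ennreal_le_suminf)
   finally show ?thesis .
  qed (auto simp: indicator_def)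
 qed
 also have "... = (\<Sum>k. ennreal (1 / r (Suc k) powr p) * emeasure (lborel::'a measure) (cball 0 (r k)))"
 proof -
  have cb: "cball (0::'a) \<rho> \<in> sets lborel" for \<rho> unfolding sets_lborel by (rule borel_closed[OF closed_cball])
  have m: "(%x. ennreal t * indicator (cball (0::'a) \<rho>) x) \<in> borel_measurable lborel" for t \<rho>
   by (intro borel_measurable_times_ennreal borel_measurable_const borel_measurable_indicator cb)
  show ?thesis unfolding nn_integral_suminf[OF m] nn_integral_cmult_indicator[OF cb] ..
 qed
 also have "... = (\<Sum>k. ennreal (2 powr p * unit_ball_vol (real ?d) * D powr (real ?d - p) * (2 powr (p - real ?d))^k))"
 proof (intro suminf_cong)
  fix k
  have "1 / r (Suc k) powr p * (unit_ball_vol (real ?d) * r k ^ ?d) =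
    2 powr p * unit_ball_vol (real ?d) * (r k powr (real ?d - p))"
  proof -
   have "r (Suc k) powr p = r k powr p / 2 powr p" using r(1)[of k] by (simp add: r(2) powr_divide)
   moreover have "r k powr (real ?d - p) = r k ^ ?d / r k powr p" using r(1)[of k] by (simp add: powr_diff powr_realpow)
   ultimately show ?thesis by simp
  qed
  also have "r k powr (real ?d - p) = D powr (real ?d - p) * (2 powr (p - real ?d))^k"
  proof -
   have "r k powr (real ?d - p) = D powr (real ?d - p) / (2^k) powr (real ?d - p)" using D by (simp add: r_def powr_divide)
   also have "((2::real)^k) powr (real ?d - p) = 2 powr (real k * (real ?d - p))" by (simp add: powr_realpow[symmetric] powr_powr)
   finally have 1: "r k powr (real ?d - p) = D powr (real ?d - p) / 2 powr (real k * (real ?d - p))" .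
   have "(2 powr (p - real ?d))^k = 2 powr (real k * (p - real ?d))" by (rule powr_power) simp
   also have "real k * (p - real ?d) = - (real k * (real ?d - p))" by (simp add: algebra_simps)
   finally show ?thesis unfolding 1 by (simp only: powr_minus_divide) simp
  qed
  finally show "ennreal (1 / r (Suc k) powr p) * emeasure (lborel::'a measure) (cball 0 (r k)) =
    ennreal (2 powr p * unit_ball_vol (real ?d) * D powr (real ?d - p) * (2 powr (p - real ?d))^k)"
   using r(1)[of k] by (simp add: emeasure_cball ennreal_mult[symmetric] mult.assoc)
 qed
 also have "... < top"
 proof -
  have "(2::real) powr (p - real ?d) < 2 powr 0" using p by (intro powr_less_mono) auto
  then have "summable (%k. 2 powr p * unit_ball_vol (real ?d) * D powr (real ?d - p) * (2 powr (p - real ?d))^k)"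
   by (intro summable_mult summable_geometric) simp
  then have "(%k. 2 powr p * unit_ball_vol (real ?d) * D powr (real ?d - p) * (2 powr (p - real ?d))^k) sums
   (\<Sum>k. 2 powr p * unit_ball_vol (real ?d) * D powr (real ?d - p) * (2 powr (p - real ?d))^k)" by (rule summable_sums)
  then have "(\<Sum>k. ennreal (2 powr p * unit_ball_vol (real ?d) * D powr (real ?d - p) * (2 powr (p - real ?d))^k)) =
    ennreal (\<Sum>k. 2 powr p * unit_ball_vol (real ?d) * D powr (real ?d - p) * (2 powr (p - real ?d))^k)"
   by (rule suminf_ennreal_eq[rotated]) (intro mult_nonneg_nonneg zero_le_power powr_ge_zero unit_ball_vol_nonneg of_nat_0_le_iff)
  then show ?thesis by (simp only: ennreal_less_top)
 qed
 finally show ?thesis by simp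
qed

section \<open>The limit function and its translates\<close>

context fractal_network
begin

text \<open>A representative on the whole space that vanishes outside the domain, so that its
  translates need no further extension. All approximating sequences share the limit, hence the
  choice is determined up to a null set.\<close>

definition limfun :: "'n fractal_element => 'n point => real" where
 "limfun v = (SOME g. g \<in> l2_space lborel & (\<forall>x. x \<notin> region N --> g x = 0) \<and>
  (\<forall>K u. approximates v K u --> (%n. l2_sq lborel (%x. ubar (K n) (u n) x - g x)) ----> 0))"

lemma limfun:
 assumes v: "v \<in> points F"
 shows "limfun v \<in> l2_space lborel" "\<And>x. x \<notin> region N ==> limfun v x = 0"
  "\<And>K u. approximates v K u ==> (%n. l2_sq lborel (%x. ubar (K n) (u n) x - limfun v x)) ----> 0"
proof -
 have "\<exists>g\<in>l2_space lborel. (\<forall>V\<in>v. \<exists>h. (\<forall>n. h n \<in> l2_space lborel & (\<forall>X\<in>snd (V n). (%m. l2_sq lborel (%x. ubar (fst (V n)) (X m) x - h n x)) ----> 0)) \<and>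
   (%n. l2_sq lborel (%x. h n x - g x)) ----> 0) & (\<forall>K u. approximates v K u --> (%n. l2_sq lborel (%x. ubar (K n) (u n) x - g x)) ----> 0)"
 proof (rule limit_along_approximations[where d = "%f g. l2_sq lborel (%x. f x - g x)" and C = "poincare_const c"])
  show "l2_sq lborel (%t. x t - z t) <= 2 * l2_sq lborel (%t. x t - y t) + 2 * l2_sq lborel (%t. y t - z t)"
   if "x \<in> l2_space lborel" "y \<in> l2_space lborel" "z \<in> l2_space lborel" for x y z :: "'n point => real"
   by (intro l2_sq_triangle measurable_l2_space that)
  show "\<exists>g\<in>l2_space lborel. (%n. l2_sq lborel (%x. f n x - g x)) ----> 0"
   if "\<And>n. f n \<in> l2_space lborel" "\<And>e. 0 < e ==> \<exists>n0. \<forall>m\<ge>n0. \<forall>n\<ge>n0. l2_sq lborel (%x. f m x - f n x) <= ennreal e"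
   for f :: "nat => 'n point => real"
   by (rule l2_complete[OF that])
 qed (rule ubar_gbar_l2(1) l2_sq_diff_commute ubar_dist v; assumption)+
 then obtain g where g: "g \<in> l2_space lborel"
  "\<And>K u. approximates v K u ==> (%n. l2_sq lborel (%x. ubar (K n) (u n) x - g x)) ----> 0" by blast
 have [measurable]: "g \<in> borel_measurable borel" using g(1) by (simp add: l2_space_def)
 have "\<exists>g. g \<in> l2_space lborel & (\<forall>x. x \<notin> region N --> g x = 0) \<and>
  (\<forall>K u. approximates v K u --> (%n. l2_sq lborel (%x. ubar (K n) (u n) x - g x)) ----> 0)"
 proof (intro exI[of _ "%x. indicator (region N) x * g x"] conjI allI impI)
  have "l2_sq lborel (%x. indicator (region N) x * g x) <= l2_sq lborel g"
   unfolding l2_sq_def by (intro nn_integral_mono) (auto simp: indicator_def)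
  then show "(%x. indicator (region N) x * g x) \<in> l2_space lborel"
   using g(1) by (auto simp: l2_space_def intro: le_less_trans)
  fix K u assume a: "approximates v K u"
  show "(%n. l2_sq lborel (%x. ubar (K n) (u n) x - indicator (region N) x * g x)) ----> 0"
  proof (rule tendsto_ennreal_0_le[OF g(2)[OF a]])
   show "l2_sq lborel (%x. ubar (K n) (u n) x - indicator (region N) x * g x) <= l2_sq lborel (%x. ubar (K n) (u n) x - g x)" for n
    unfolding l2_sq_def by (intro nn_integral_mono ennreal_leI) (auto simp: indicator_def ubar_def)
  qed
 qed simp
 from someI_ex[OF this]
 show "limfun v \<in> l2_space lborel" "\<And>x. x \<notin> region N ==> limfun v x = 0"
  "\<And>K u. approximates v K u ==> (%n. l2_sq lborel (%x. ubar (K n) (u n) x - limfun v x)) ----> 0"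
  unfolding limfun_def[symmetric] by blast+
qed

lemma limfun_borel: "v \<in> points F ==> limfun v \<in> borel_measurable borel"
 using limfun(1)[of v] by (simp add: l2_space_def)

lemma l2_sq_limfun: "v \<in> points F ==> l2_sq (lebesgue_on (region N)) (limfun v) = l2_sq lborel (limfun v)"
 using limfun(2)[of v] limfun_borel[of v]
 by (subst l2_sq_lebesgue_on[where F = "limfun v"]) (auto simp: l2_sq_def)

lemma limfun_measurable: "v \<in> points F ==> limfun v \<in> borel_measurable (lebesgue_on (region N))"
 using limfun_borel[of v] by (intro measurable_restrict_space1 measurable_completion) simp

lemma limfun_smooth:
 assumes "1 <= K" "u \<in> C1 K"
 shows "AE x in lebesgue_on (region N). limfun (of_smooth N c K u) x = u x"
proof (rule AE_lebesgue_onI[OF region_borel])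
 note a = approximates_of_smooth[OF assms]
 have [measurable]: "ubar K u \<in> borel_measurable borel" by (rule borel_ubar_gbar[OF assms])
 have "AE x in lborel. limfun (of_smooth N c K u) x = ubar K u x"
  by (rule l2_limit_unique[OF _ _ _ limfun(3)[OF a(2) a(1)]])
   (auto simp: l2_sq_def limfun_borel[OF a(2)])
 then show "AE x in lborel. x \<in> region N --> limfun (of_smooth N c K u) x = u x"
  using AE_not_upto[of K] by eventually_elim (auto simp: ubar_def)
qed

lemma limfun_lincomb:
 assumes v: "v \<in> points F" and w: "w \<in> points F"
 shows "AE x in lborel. limfun (lincomb F \<alpha> \<beta> v w) x = \<alpha> * limfun v x + \<beta> * limfun w x"
proof -
 obtain K u where a: "approximates v K u" using approximates_exists[OF v] by blast
 obtain L z where a': "approximates w L z" using approximates_exists[OF w] by blast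
 note al = approximates_lincomb[OF v w a a', of \<alpha> \<beta>]
 note [measurable] = limfun_borel[OF v] limfun_borel[OF w] limfun_borel[OF al(2)]
 have [measurable]: "ubar (K n) (u n) \<in> borel_measurable borel" "ubar (L n) (z n) \<in> borel_measurable borel"
  "ubar (max (K n) (L n)) (%x. \<alpha> * u n x + \<beta> * z n x) \<in> borel_measurable borel" for n
  using borel_ubar_gbar(1) approximatesD[OF a] approximatesD[OF a'] approximatesD[OF al(1)] by blast+
 show ?thesis
 proof (rule l2_limit_unique[OF _ _ _ limfun(3)[OF al(2,1)]])
  show "(%n. l2_sq lborel (%x. ubar (max (K n) (L n)) (%x. \<alpha> * u n x + \<beta> * z n x) x - (\<alpha> * limfun v x + \<beta> * limfun w x))) ----> 0"
  proof (rule tendsto_ennreal_0_le)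
   show "(%n. ennreal (2 * \<alpha>\<^sup>2) * l2_sq lborel (%x. ubar (K n) (u n) x - limfun v x) +
     ennreal (2 * \<beta>\<^sup>2) * l2_sq lborel (%x. ubar (L n) (z n) x - limfun w x)) ----> 0"
    using tendsto_add[OF tendsto_ennreal_0_cmult[OF limfun(3)[OF v a], of "ennreal (2 * \<alpha>\<^sup>2)"]
      tendsto_ennreal_0_cmult[OF limfun(3)[OF w a'], of "ennreal (2 * \<beta>\<^sup>2)"]] by simp
   fix n
   have "l2_sq lborel (%x. ubar (max (K n) (L n)) (%x. \<alpha> * u n x + \<beta> * z n x) x - (\<alpha> * limfun v x + \<beta> * limfun w x)) =
     l2_sq lborel (%x. \<alpha> *\<^sub>R (ubar (K n) (u n) x - limfun v x) + \<beta> *\<^sub>R (ubar (L n) (z n) x - limfun w x))"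
   proof (rule l2_sq_cong)
    show "AE x in lborel. ubar (max (K n) (L n)) (%x. \<alpha> * u n x + \<beta> * z n x) x - (\<alpha> * limfun v x + \<beta> * limfun w x) =
      \<alpha> *\<^sub>R (ubar (K n) (u n) x - limfun v x) + \<beta> *\<^sub>R (ubar (L n) (z n) x - limfun w x)"
     using AE_ubar_gbar_lincomb[OF approximatesD(1,2)[OF a, of n] approximatesD(1,2)[OF a', of n], of \<alpha> \<beta>]
     by eventually_elim (simp add: algebra_simps)
   qed
   then show "l2_sq lborel (%x. ubar (max (K n) (L n)) (%x. \<alpha> * u n x + \<beta> * z n x) x - (\<alpha> * limfun v x + \<beta> * limfun w x)) \<le>
     ennreal (2 * \<alpha>\<^sup>2) * l2_sq lborel (%x. ubar (K n) (u n) x - limfun v x) +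
     ennreal (2 * \<beta>\<^sup>2) * l2_sq lborel (%x. ubar (L n) (z n) x - limfun w x)"
    using l2_sq_lincomb[of "%x. ubar (K n) (u n) x - limfun v x" lborel "%x. ubar (L n) (z n) x - limfun w x" \<alpha> \<beta>] by simp
  qed
 qed simp_all
qed

lemma snorm_sq_tendsto:
 assumes "v \<in> points F" "approximates v K u"
 shows "(%n. ennreal ((snorm c (u n))^2)) ----> ennreal ((pnorm F v)^2)"
 by (intro tendsto_ennrealI tendsto_power approximates_pnorm[OF assms])

text \<open>The factor 2 stems from Young's inequality with parameter 1. For continuity any factor
  will do; the exact constant is treated separately.\<close>

lemma limfun_bound:
 assumes v: "v \<in> points F"
 shows "l2_sq lborel (limfun v) <= ennreal (2 * poincare_const c * (pnorm F v)^2)"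
proof -
 obtain K u where a: "approximates v K u" using approximates_exists[OF v] by blast
 note [measurable] = limfun_borel[OF v]
 have [measurable]: "ubar (K n) (u n) \<in> borel_measurable borel" for n
  using borel_ubar_gbar(1) approximatesD[OF a] by blast
 have le: "l2_sq lborel (limfun v) <= 2 * (ennreal (poincare_const c) * ennreal ((snorm c (u n))^2)) +
   2 * l2_sq lborel (%x. ubar (K n) (u n) x - limfun v x)" for n
 proof -
  have "l2_sq lborel (limfun v) <= 2 * l2_sq lborel (ubar (K n) (u n)) + 2 * l2_sq lborel (%x. ubar (K n) (u n) x - limfun v x)"
   using l2_sq_young[of "limfun v" lborel "ubar (K n) (u n)" 1] by (simp add: l2_sq_diff_commute[of lborel "limfun v"])
  then show ?thesis
   by (rule order_trans) (intro add_mono mult_left_mono ubar_bound approximatesD[OF a]; simp)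
 qed
 have "(%n. 2 * (ennreal (poincare_const c) * ennreal ((snorm c (u n))^2)) + 2 * l2_sq lborel (%x. ubar (K n) (u n) x - limfun v x)) ---->
   2 * (ennreal (poincare_const c) * ennreal ((pnorm F v)^2)) + 0"
  by (intro tendsto_add ennreal_tendsto_cmult snorm_sq_tendsto[OF v a] tendsto_ennreal_0_cmult limfun(3)[OF v a]) auto
 from ennreal_le_limit[OF le this] show ?thesis using c_pos
  by (simp add: ennreal_mult poincare_const_def diameter_ge_0[OF bounded_region] mult.assoc)
qed

lemma shift_energy:
 assumes K: "1 <= K" and u: "u \<in> C1 K"
 shows "(LB x. indicator (region N) x * ennreal ((ubar K u (x + h) - ubar K u x)^2)) \<le>
  ennreal ((1 + 1/c) * ((norm h)^2 + norm h)) * energy c u"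
proof -
 have "(LB x. indicator (region N) x * ennreal ((ubar K u (x + h) - ubar K u x)^2)) \<le>
   ennreal (1 + 1/c) * (ennreal ((norm h)^2) * Gsq K u + ennreal (norm h) * (\<Sum>k\<in>{1..K}. jump_weight c k * Jsq k u))"
  by (rule integrated_estimate[OF c_pos K u region_borel]) auto
 also have "... <= ennreal (1 + 1/c) * (ennreal ((norm h)^2) * energy c u + ennreal (norm h) * energy c u)"
  by (intro mult_left_mono add_mono) (auto simp: energy_smooth[OF K u])
 also have "... = ennreal ((1 + 1/c) * ((norm h)^2 + norm h)) * energy c u"
  using c_pos by (subst distrib_right[symmetric]) (simp add: ennreal_plus[symmetric] ennreal_mult mult.assoc del: ennreal_plus)
 finally show ?thesis .
qed

lemma limfun_shift:
 assumes v: "v \<in> points F"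
 shows "(LB x. indicator (region N) x * ennreal ((limfun v (x + h) - limfun v x)^2)) \<le>
  ennreal (2 * (1 + 1/c) * ((norm h)^2 + norm h) * (pnorm F v)^2)"
proof -
 obtain K u where a: "approximates v K u" using approximates_exists[OF v] by blast
 have "(LB x. indicator (region N) x * ennreal ((limfun v (x + h) - limfun v x)^2)) \<le>
   2 * (ennreal ((1 + 1/c) * ((norm h)^2 + norm h)) * ennreal ((pnorm F v)^2))"
 proof (rule nn_integral_shift_limit[OF _ limfun_borel[OF v] region_borel limfun(3)[OF v a], where m = 0
    and A = "%n. ennreal ((1 + 1/c) * ((norm h)^2 + norm h)) * ennreal ((snorm c (u n))^2)"])
  show "ubar (K n) (u n) \<in> borel_measurable borel" for n using borel_ubar_gbar(1) approximatesD[OF a] by blast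
  show "(LB x. indicator (region N) x * ennreal ((ubar (K n) (u n) (x + h) - ubar (K n) (u n) x)^2)) \<le>
   ennreal ((1 + 1/c) * ((norm h)^2 + norm h)) * ennreal ((snorm c (u n))^2)" for n
   unfolding energy_snorm[OF approximatesD(1,2)[OF a], symmetric] by (rule shift_energy[OF approximatesD(1,2)[OF a]])
  show "(%n. ennreal ((1 + 1/c) * ((norm h)^2 + norm h)) * ennreal ((snorm c (u n))^2)) ---->
    ennreal ((1 + 1/c) * ((norm h)^2 + norm h)) * ennreal ((pnorm F v)^2)"
   by (intro ennreal_tendsto_cmult snorm_sq_tendsto[OF v a]) auto
 qed
 also have "... = ennreal (2 * (1 + 1/c) * ((norm h)^2 + norm h) * (pnorm F v)^2)"
 proof -
  have "2 * (ennreal X * ennreal Y) = ennreal (2 * (X * Y))" if "X >= 0" "Y >= 0" for X Y using that by (simp add: ennreal_mult)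
  from this[of "(1 + 1/c) * ((norm h)^2 + norm h)" "(pnorm F v)^2"] show ?thesis using c_pos by (simp only: mult.assoc) simp
 qed
 finally show ?thesis .
qed

end

section \<open>The Sobolev bound and the two embeddings\<close>

context fractal_network
begin

text \<open>With \<open>y = x + h\<close> and Fubini, the shift estimate gains one power of
  \<open>norm h\<close>. The remaining exponent \<open>d + 2 s - 1\<close> is below \<open>d\<close>
  exactly for \<open>s < 1/2\<close>, and only \<open>h\<close> no longer than the diameter
  occur.\<close>

lemma sobolev_bound:
 assumes s: "0 < s" "s < 1/2"
 shows "\<exists>C\<ge>0. \<forall>v\<in>points F. (\<integral>\<^sup>+x. (\<integral>\<^sup>+y. ennreal (\<bar>limfun v x - limfun v y\<bar>\<^sup>2 / norm (x - y) powr (real DIM('n point) + 2 * s))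
   \<partial>lebesgue_on (region N)) \<partial>lebesgue_on (region N)) <= ennreal (C * (pnorm F v)^2)"
proof -
 let ?Q = "region N" and ?D = "diameter (region N)" and ?q = "real DIM('n point) + 2 * s"
 let ?R = "\<integral>\<^sup>+h. indicator (cball 0 ?D) h * ennreal (1 / norm h powr (?q - 1)) \<partial>(lborel :: 'n point measure)"
 define A where "A = 2 * (1 + 1/c) * (?D + 1)"
 have D: "?D > 0" by (rule diameter_region_pos)
 have A: "A >= 0" using c_pos D by (simp add: A_def)
 have "1 <= real CARD('n)" using zero_less_card_finite[where 'a = 'n] by linarith
 moreover have "real DIM('n point) = real CARD('n)" by simp
 ultimately have "0 <= ?q - 1" "?q - 1 < real DIM('n point)" using s by linarith+
 then have R: "?R < \<infinity>" by (rule nn_integral_radial_power[OF _ _ D])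
 have main: "(\<integral>\<^sup>+x. (\<integral>\<^sup>+y. ennreal (\<bar>limfun v x - limfun v y\<bar>\<^sup>2 / norm (x - y) powr ?q) \<partial>lebesgue_on ?Q) \<partial>lebesgue_on ?Q)
   <= ennreal (A * (pnorm F v)^2) * ?R" if v: "v \<in> points F" for v
 proof -
  define f where "f = limfun v"
  have [measurable]: "f \<in> borel_measurable borel" using limfun_borel[OF v] by (simp add: f_def)
  let ?k = "%x y. ennreal (\<bar>f x - f y\<bar>\<^sup>2 / norm (x - y) powr ?q)"
  have "(\<integral>\<^sup>+x. (\<integral>\<^sup>+y. ?k x y \<partial>lebesgue_on ?Q) \<partial>lebesgue_on ?Q) =
    (\<integral>\<^sup>+x. (LB y. indicator ?Q y * ?k x y) \<partial>lebesgue_on ?Q)"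
   by (intro nn_integral_cong nn_integral_lebesgue_on) measurable
  also have "... = (LB x. indicator ?Q x * (LB y. indicator ?Q y * ?k x y))"
   by (intro nn_integral_lebesgue_on) measurable
  also have "... = (LB x. (LB h. indicator ?Q x * (indicator ?Q (x + h) * ?k x (x + h))))"
  proof (intro nn_integral_cong)
   fix x
   have "(LB y. indicator ?Q y * ?k x y) = (LB h. indicator ?Q (x + h) * ?k x (x + h))"
    by (rule nn_integral_lborel_translate[symmetric]) measurable
   then show "indicator ?Q x * (LB y. indicator ?Q y * ?k x y) = (LB h. indicator ?Q x * (indicator ?Q (x + h) * ?k x (x + h)))"
    by (subst nn_integral_cmult) simp_all
  qed
  also have "... = (LB h. (LB x. indicator ?Q x * (indicator ?Q (x + h) * ?k x (x + h))))"
   by (rule lborel_pair.Fubini') measurable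
  also have "... <= (\<integral>\<^sup>+h. ennreal (A * (pnorm F v)^2) * (indicator (cball 0 ?D) h * ennreal (1 / norm h powr (?q - 1))) \<partial>(lborel :: 'n point measure))"
  proof (rule nn_integral_mono)
   fix h :: "'n point"
   show "(LB x. indicator ?Q x * (indicator ?Q (x + h) * ?k x (x + h))) \<le>
     ennreal (A * (pnorm F v)^2) * (indicator (cball 0 ?D) h * ennreal (1 / norm h powr (?q - 1)))"
   proof (cases "h ~= 0 & norm h <= ?D")
    case True
    have "(LB x. indicator ?Q x * (indicator ?Q (x + h) * ?k x (x + h))) \<le>
      (LB x. ennreal (1 / norm h powr ?q) * (indicator ?Q x * ennreal ((f (x + h) - f x)^2)))"
     by (intro nn_integral_mono) (auto simp: indicator_def ennreal_mult[symmetric] power2_commute)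
    also have "... = ennreal (1 / norm h powr ?q) * (LB x. indicator ?Q x * ennreal ((f (x + h) - f x)^2))"
     by (rule nn_integral_cmult) measurable
    also have "... <= ennreal (1 / norm h powr ?q) * ennreal (2 * (1 + 1/c) * ((norm h)^2 + norm h) * (pnorm F v)^2)"
     unfolding f_def by (intro mult_left_mono limfun_shift[OF v]) simp
    also have "... <= ennreal (1 / norm h powr ?q) * ennreal (2 * (1 + 1/c) * (norm h * (?D + 1)) * (pnorm F v)^2)"
    proof (intro mult_left_mono ennreal_leI mult_right_mono)
     show "(norm h)^2 + norm h <= norm h * (?D + 1)" using True by (simp add: power2_eq_square algebra_simps mult_left_mono)
    qed (use c_pos in auto)
    also have "... = ennreal (A * (pnorm F v)^2 * (1 / norm h powr (?q - 1)))"
    proof -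
     have "1 / norm h powr ?q * (2 * (1 + 1/c) * (norm h * (?D + 1)) * (pnorm F v)^2) = A * (pnorm F v)^2 * (norm h / norm h powr ?q)"
      by (simp add: A_def)
     also have "norm h / norm h powr ?q = 1 / norm h powr (?q - 1)" using True by (simp add: powr_diff)
     finally show ?thesis by (subst ennreal_mult[symmetric]) (use c_pos D in auto)
    qed
    also have "... = ennreal (A * (pnorm F v)^2) * (indicator (cball 0 ?D) h * ennreal (1 / norm h powr (?q - 1)))"
     using True A by (simp add: ennreal_mult[symmetric])
    finally show ?thesis .
   next
    case False
    \<comment> \<open>For longer \<open>h\<close> no pair of points of the domain differs by
      \<open>h\<close>; for \<open>h = 0\<close> the numerator is 0.\<close>
    have "indicator ?Q x * (indicator ?Q (x + h) * ?k x (x + h)) = 0" for x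
    proof (cases "x \<in> ?Q & x + h \<in> ?Q")
     case True
     then have "dist x (x + h) <= ?D" by (intro diameter_bounded_bound bounded_region) auto
     then have "h = 0" using False by (simp add: dist_norm)
     then show ?thesis by simp
    qed auto
    then show ?thesis by (simp only: nn_integral_const mult_zero_left zero_le)
   qed
  qed
  also have "... = ennreal (A * (pnorm F v)^2) * ?R"
  proof (rule nn_integral_cmult)
   have "(%h::'n point. ennreal (1 / norm h powr (?q - 1))) \<in> borel_measurable borel"
    by (intro measurable_compose[OF _ measurable_ennreal] borel_measurable_divide borel_measurable_const
      powr_real_measurable borel_measurable_continuous_onI[OF continuous_on_norm_id])
   then show "(%h. indicator (cball 0 ?D) h * ennreal (1 / norm h powr (?q - 1))) \<in> borel_measurable (lborel :: 'n point measure)"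
    using borel_closed[OF closed_cball[of "0::'n point" ?D]]
    by (intro borel_measurable_times_ennreal borel_measurable_indicator) simp_all
  qed
  finally show ?thesis unfolding f_def .
 qed
 show ?thesis
 proof (intro exI[of _ "A * enn2real ?R"] conjI ballI)
  show "0 <= A * enn2real ?R" using A by simp
  fix v assume v: "v \<in> points F"
  have "ennreal (A * (pnorm F v)^2) * ?R = ennreal (A * (pnorm F v)^2) * ennreal (enn2real ?R)" using R by simp
  also have "... = ennreal (A * enn2real ?R * (pnorm F v)^2)" using A by (subst ennreal_mult[symmetric]) (auto simp: mult_ac)
  finally show "(\<integral>\<^sup>+x. (\<integral>\<^sup>+y. ennreal (\<bar>limfun v x - limfun v y\<bar>\<^sup>2 / norm (x - y) powr ?q) \<partial>lebesgue_on ?Q) \<partial>lebesgue_on ?Q)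
   <= ennreal (A * enn2real ?R * (pnorm F v)^2)" using main[OF v] by simp
 qed
qed

lemma sqrt_enn2real_le:
 assumes "x <= ennreal (C * p\<^sup>2)" "C >= 0" "p >= 0"
 shows "sqrt (enn2real x) <= sqrt C * p"
proof -
 have "enn2real x <= C * p\<^sup>2" using enn2real_mono[OF assms(1)] assms by simp
 then have "sqrt (enn2real x) <= sqrt (C * p\<^sup>2)" by simp
 then show ?thesis using assms by (simp add: real_sqrt_mult)
qed

lemma pnorm_fractal_nonneg: "v \<in> points F ==> pnorm F v >= 0"
 using seminormed.pnorm_nonneg[OF U.seminormed_completion] by (simp add: fractal_space_def)

lemma poincare_const_nonneg: "poincare_const c >= 0"
 using c_pos by (simp add: poincare_const_def diameter_ge_0[OF bounded_region])

lemma continuous_embedding_limfun: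
 assumes inj: "\<And>v w. v \<in> points F ==> w \<in> points F ==> AE x in lebesgue_on (region N). limfun v x = limfun w x ==> v = w"
  and Y: "\<And>v. v \<in> points F ==> limfun v \<in> Y" and bound: "\<And>v. v \<in> points F ==> \<phi> (limfun v) <= A * pnorm F v"
 shows "continuous_embedding N c Y \<phi> limfun"
 unfolding continuous_embedding_def
proof (intro conjI ballI allI impI)
 show "AE x in lebesgue_on (region N). limfun (lincomb F a b v w) x = a * limfun v x + b * limfun w x"
  if "v \<in> points F" "w \<in> points F" for a b v w
 proof (rule AE_lebesgue_onI[OF region_borel])
  show "AE x in lborel. x \<in> region N --> limfun (lincomb F a b v w) x = a * limfun v x + b * limfun w x"
   using limfun_lincomb[OF that, of a b] by eventually_elim simp
 qed
 show "\<exists>A. \<forall>v\<in>points F. \<phi> (limfun v) <= A * pnorm F v" using bound by blast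
qed (use inj Y limfun_smooth in auto)

lemma l2_embedding:
 assumes inj: "\<And>v w. v \<in> points F ==> w \<in> points F ==> AE x in lebesgue_on (region N). limfun v x = limfun w x ==> v = w"
 shows "continuous_embedding N c (l2_space (lebesgue_on (region N))) (l2_norm (lebesgue_on (region N))) limfun"
proof (rule continuous_embedding_limfun[OF inj])
 fix v assume v: "v \<in> points F"
 show "limfun v \<in> l2_space (lebesgue_on (region N))"
  using limfun_measurable[OF v] limfun(1)[OF v] by (simp add: l2_space_def l2_sq_limfun[OF v])
 show "l2_norm (lebesgue_on (region N)) (limfun v) <= sqrt (2 * poincare_const c) * pnorm F v"
  unfolding l2_norm_def l2_sq_limfun[OF v]
  by (intro sqrt_enn2real_le limfun_bound v pnorm_fractal_nonneg) (simp add: poincare_const_nonneg)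
qed

lemma sobolev_embedding:
 assumes s: "0 <= s" "s < 1/2"
  and inj: "\<And>v w. v \<in> points F ==> w \<in> points F ==> AE x in lebesgue_on (region N). limfun v x = limfun w x ==> v = w"
 shows "continuous_embedding N c (sobolev_space (region N) s) (sobolev_norm (region N) s) limfun"
proof -
 have "\<exists>C\<ge>0. \<forall>v\<in>points F. sobolev_sq (region N) s (limfun v) <= ennreal (C * (pnorm F v)^2)"
 proof (cases "s = 0")
  case True
  then show ?thesis using limfun_bound poincare_const_nonneg
   by (intro exI[of _ "2 * poincare_const c"]) (simp add: sobolev_sq_def l2_sq_limfun)
 next
  case False
  then obtain C where C: "C >= 0" "\<And>v. v \<in> points F ==> (\<integral>\<^sup>+x. (\<integral>\<^sup>+y. ennreal (\<bar>limfun v x - limfun v y\<bar>\<^sup>2 / norm (x - y) powr (real DIM('n point) + 2 * s))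
   \<partial>lebesgue_on (region N)) \<partial>lebesgue_on (region N)) <= ennreal (C * (pnorm F v)^2)"
   using sobolev_bound[of s] s by auto
  show ?thesis
  proof (intro exI[of _ "2 * poincare_const c + C"] conjI ballI)
   fix v assume v: "v \<in> points F"
   show "sobolev_sq (region N) s (limfun v) <= ennreal ((2 * poincare_const c + C) * (pnorm F v)^2)"
    using add_mono[OF limfun_bound[OF v] C(2)[OF v]] False C(1) poincare_const_nonneg
    unfolding sobolev_sq_def l2_sq_limfun[OF v] distrib_right
    by (subst ennreal_plus) auto
  qed (use C(1) poincare_const_nonneg in simp)
 qed
 then obtain C where C: "C >= 0" "\<And>v. v \<in> points F ==> sobolev_sq (region N) s (limfun v) <= ennreal (C * (pnorm F v)^2)" by blast
 show ?thesis
 proof (rule continuous_embedding_limfun[OF inj])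
  fix v assume v: "v \<in> points F"
  show "limfun v \<in> sobolev_space (region N) s"
   using limfun_measurable[OF v] C(2)[OF v] by (auto simp: sobolev_space_def intro: le_less_trans)
  show "sobolev_norm (region N) s (limfun v) <= sqrt C * pnorm F v"
   unfolding sobolev_norm_def by (intro sqrt_enn2real_le C v pnorm_fractal_nonneg)
 qed
qed

section \<open>Weak gradients and jumps\<close>

lemma AE_lebesgue_on_smaller:
 assumes "S \<in> sets borel" "T \<in> sets borel" "T \<subseteq> S" "AE x in lebesgue_on S. P x"
 shows "AE x in lebesgue_on T. P x"
proof -
 have "S \<in> sets lebesgue" "T \<in> sets lebesgue" using assms by (simp_all add: sets_completionI_sets)
 then show ?thesis using assms(3,4) by (simp add: AE_restrict_space_iff) (auto elim: eventually_mono)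
qed

lemma smooth_parts:
 "smooth K \<in> sets borel" "region N - iface_all N \<in> sets borel" "region N - iface_all N \<subseteq> smooth K"
 by (auto simp: iface_all_eq)

lemma l2_sq_gbar:
 assumes "1 <= K" "u \<in> C1 K" and g: "g \<in> borel_measurable borel" "\<And>x. x \<notin> region N ==> g x = 0"
  and S: "S = smooth L \<or> S = region N - iface_all N"
 shows "l2_sq (lebesgue_on S) (%x. gradient u x - g x) = l2_sq lborel (%x. gbar K u x - g x)"
proof -
 note [measurable] = borel_ubar_gbar(2)[OF assms(1,2)] g(1)
 have "l2_sq (lebesgue_on S) (%x. gradient u x - g x) = (LB x. ennreal ((norm (gbar K u x - g x))^2))"
 proof (rule l2_sq_lebesgue_on)
  show "S \<in> sets borel" using S smooth_parts by auto
  show "AE x in lborel. norm (gbar K u x - g x) = (if x \<in> S then norm (gradient u x - g x) else 0)"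
   using AE_not_iface_all by eventually_elim (use S g(2) in \<open>auto simp: gbar_def iface_all_eq\<close>)
 qed measurable
 then show ?thesis by (simp add: l2_sq_def)
qed

lemma l2_space_restrict:
 assumes g: "g \<in> l2_space lborel" and S: "S \<in> sets borel"
 shows "g \<in> l2_space (lebesgue_on S)"
proof -
 have [measurable]: "g \<in> borel_measurable borel" using g by (simp add: l2_space_def)
 have "l2_sq (lebesgue_on S) g = (LB x. indicator S x * ennreal ((norm (g x))^2))"
  unfolding l2_sq_def by (rule nn_integral_lebesgue_on[OF _ S]) measurable
 also have "... <= l2_sq lborel g" unfolding l2_sq_def by (intro nn_integral_mono) (auto simp: indicator_def)
 also have "... < \<infinity>" using g by (simp add: l2_space_def)
 finally have "l2_sq (lebesgue_on S) g < \<infinity>" .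
 moreover have "g \<in> borel_measurable (lebesgue_on S)"
  by (intro measurable_restrict_space1 measurable_completion) simp
 ultimately show ?thesis by (simp add: l2_space_def)
qed

lemma weak_gradient_exists:
 assumes v: "v \<in> points F"
 shows "\<exists>g. is_weak_gradient N v g"
proof -
 \<comment> \<open>Fields on the whole space that vanish outside the domain: the gradients of all
   levels live in this one complete space.\<close>
 define Z where "Z = {g :: 'n point => 'n point. g \<in> l2_space lborel & (\<forall>x. x \<notin> region N --> g x = 0)}"
 have "\<exists>g\<in>Z. (\<forall>V\<in>v. \<exists>h. (\<forall>n. h n \<in> Z & (\<forall>X\<in>snd (V n). (%m. l2_sq lborel (%x. gbar (fst (V n)) (X m) x - h n x)) ----> 0)) \<and>
   (%n. l2_sq lborel (%x. h n x - g x)) ----> 0) & (\<forall>K u. approximates v K u --> (%n. l2_sq lborel (%x. gbar (K n) (u n) x - g x)) ----> 0)"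
 proof (rule limit_along_approximations[where d = "%f g. l2_sq lborel (%x. f x - g x)" and C = 1])
  fix f :: "nat => 'n point => 'n point"
  assume f: "\<And>n. f n \<in> Z" and cau: "\<And>e. 0 < e ==> \<exists>n0. \<forall>m\<ge>n0. \<forall>n\<ge>n0. l2_sq lborel (%x. f m x - f n x) <= ennreal e"
  obtain g where g: "g \<in> l2_space lborel" "(%n. l2_sq lborel (%x. f n x - g x)) ----> 0"
   using l2_complete[of f lborel] f cau by (auto simp: Z_def)
  have [measurable]: "g \<in> borel_measurable borel" using g(1) by (simp add: l2_space_def)
  have "l2_sq lborel (%x. indicator (region N) x *\<^sub>R g x) <= l2_sq lborel g"
   unfolding l2_sq_def by (intro nn_integral_mono) (auto simp: indicator_def)
  then have "(%x. indicator (region N) x *\<^sub>R g x) \<in> Z" using g(1) by (auto simp: Z_def l2_space_def intro: le_less_trans)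
  moreover have "(%n. l2_sq lborel (%x. f n x - indicator (region N) x *\<^sub>R g x)) ----> 0"
  proof (rule tendsto_ennreal_0_le[OF g(2)])
   show "l2_sq lborel (%x. f n x - indicator (region N) x *\<^sub>R g x) <= l2_sq lborel (%x. f n x - g x)" for n
    unfolding l2_sq_def using f[of n] by (intro nn_integral_mono ennreal_leI) (auto simp: indicator_def Z_def)
  qed
  ultimately show "\<exists>g\<in>Z. (%n. l2_sq lborel (%x. f n x - g x)) ----> 0"
   by (intro bexI[of _ "%x. indicator (region N) x *\<^sub>R g x"])
 next
  show "gbar K u \<in> Z" if "1 <= K" "u \<in> C1 K" for K u using ubar_gbar_l2[OF that] by (auto simp: Z_def gbar_def)
  show "l2_sq lborel (%x. gbar K u x - gbar L w x) <= ennreal 1 * ennreal ((sdist u w)^2)"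
   if "1 <= K" "u \<in> C1 K" "1 <= L" "w \<in> C1 L" for K u L w using gbar_dist[OF that] by simp
 qed (use v in \<open>auto simp: Z_def intro: l2_sq_diff_commute l2_sq_triangle[OF measurable_l2_space measurable_l2_space measurable_l2_space]\<close>)
 then obtain g where g: "g \<in> Z" and V: "\<And>V. V \<in> v ==> \<exists>h. (\<forall>n. h n \<in> Z & (\<forall>X\<in>snd (V n). (%m. l2_sq lborel (%x. gbar (fst (V n)) (X m) x - h n x)) ----> 0)) \<and>
   (%n. l2_sq lborel (%x. h n x - g x)) ----> 0" by blast
 have Zb: "h \<in> borel_measurable borel" "\<And>x. x \<notin> region N ==> h x = 0" "h \<in> l2_space lborel" if "h \<in> Z" for h using that by (auto simp: Z_def l2_space_def)
 have "is_weak_gradient N v g"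
  unfolding is_weak_gradient_def
 proof (intro conjI ballI)
  show "g \<in> l2_space (lebesgue_on (region N - iface_all N))" by (intro l2_space_restrict Zb g smooth_parts)
  fix V' assume V': "V' \<in> v"
  obtain h where h: "\<And>n. h n \<in> Z" "\<And>n X. X \<in> snd (V' n) ==> (%m. l2_sq lborel (%x. gbar (fst (V' n)) (X m) x - h n x)) ----> 0"
   "(%n. l2_sq lborel (%x. h n x - g x)) ----> 0" using V[OF V'] by blast
  have Vp: "V' n \<in> points U" for n using fractal_rep[OF v V'] U.cauchy_points by blast
  show "\<exists>h. (\<forall>n. is_level_gradient N (fst (V' n)) (snd (V' n)) (h n)) & (%n. l2_sq (lebesgue_on (region N - iface_all N)) (%x. h n x - g x)) ----> 0"
  proof (intro exI[of _ h] conjI allI)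
   fix n
   show "is_level_gradient N (fst (V' n)) (snd (V' n)) (h n)"
    unfolding is_level_gradient_def
   proof (intro conjI ballI)
    show "h n \<in> l2_space (lebesgue_on (smooth (fst (V' n))))" by (intro l2_space_restrict Zb h smooth_parts)
    fix X assume X: "X \<in> snd (V' n)"
    obtain L P where p: "V' n = (L, P)" "1 <= L" "P \<in> points (W L)" using Vp[of n] by (cases "V' n") (auto simp: points_union)
    have Xc: "X m \<in> C1 L" for m using level_rep(1)[OF p(2,3)] X p(1) by (simp add: cauchy_seqs_def)
    show "(%m. l2_sq (lebesgue_on (smooth (fst (V' n)))) (%x. gradient (X m) x - h n x)) ----> 0"
    proof -
     have "l2_sq (lebesgue_on (smooth L)) (%x. gradient (X m) x - h n x) = l2_sq lborel (%x. gbar L (X m) x - h n x)" for m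
      by (rule l2_sq_gbar[OF p(2) Xc Zb(1)[OF h(1)] Zb(2)[OF h(1)] disjI1[OF refl]])
     then show ?thesis using h(2)[OF X] p(1) by simp
    qed
   qed
  next
   show "(%n. l2_sq (lebesgue_on (region N - iface_all N)) (%x. h n x - g x)) ----> 0"
   proof (rule tendsto_ennreal_0_le[OF h(3)])
    fix n
    have [measurable]: "h n \<in> borel_measurable borel" "g \<in> borel_measurable borel" using Zb(1) h(1) g by auto
    have "l2_sq (lebesgue_on (region N - iface_all N)) (%x. h n x - g x) =
      (LB x. indicator (region N - iface_all N) x * ennreal ((norm (h n x - g x))^2))"
     unfolding l2_sq_def by (rule nn_integral_lebesgue_on[OF _ smooth_parts(2)]) measurable
    also have "... <= l2_sq lborel (%x. h n x - g x)" unfolding l2_sq_def by (intro nn_integral_mono) (auto simp: indicator_def)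
    finally show "l2_sq (lebesgue_on (region N - iface_all N)) (%x. h n x - g x) <= l2_sq lborel (%x. h n x - g x)" .
   qed
  qed
 qed
 then show ?thesis by blast
qed

text \<open>The constant sequence \<open>u n\<close> belongs to the class embedded at level
  \<open>K n\<close>, so the level gradient of this class is the classical gradient of
  \<open>u n\<close> almost everywhere.\<close>

lemma weak_gradient_limit:
 assumes g: "is_weak_gradient N v g" and a: "approximates v K u"
 shows "(%n. l2_sq (lebesgue_on (region N - iface_all N)) (%x. gradient (u n) x - g x)) ----> 0"
proof -
 obtain h where h: "\<And>n. is_level_gradient N (K n) (to_completion (Sm (K n)) (u n)) (h n)"
  "(%n. l2_sq (lebesgue_on (region N - iface_all N)) (%x. h n x - g x)) ----> 0"
  using g approximatesD(3)[OF a] by (fastforce simp: is_weak_gradient_def emb_def)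
 have "l2_sq (lebesgue_on (region N - iface_all N)) (%x. gradient (u n) x - g x) = l2_sq (lebesgue_on (region N - iface_all N)) (%x. h n x - g x)" for n
 proof (rule l2_sq_cong)
  let ?M = "lebesgue_on (smooth (K n))"
  have "(%m::nat. l2_sq ?M (%x. gradient (u n) x - h n x)) ----> 0"
   using h(1)[of n] emb_rep(2)[OF approximatesD(1,2)[OF a, of n]] by (auto simp: is_level_gradient_def)
  then have "l2_sq ?M (%x. gradient (u n) x - h n x) = 0" by (simp add: LIMSEQ_const_iff)
  moreover have "h n \<in> borel_measurable ?M" "gradient (u n) \<in> borel_measurable ?M"
   using h(1)[of n] c1_gradient_l2[OF approximatesD(2)[OF a, of n]] by (auto simp: is_level_gradient_def l2_space_def)
  ultimately have "AE x in ?M. ennreal ((norm (gradient (u n) x - h n x))^2) = 0"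
   unfolding l2_sq_def by (subst (asm) nn_integral_0_iff_AE) auto
  then have "AE x in lebesgue_on (region N - iface_all N). ennreal ((norm (gradient (u n) x - h n x))^2) = 0"
   by (rule AE_lebesgue_on_smaller[OF smooth_parts(1,2,3)])
  then show "AE x in lebesgue_on (region N - iface_all N). gradient (u n) x - g x = h n x - g x"
   by eventually_elim (simp add: ennreal_eq_0_iff)
 qed
 then show ?thesis using h(2) by simp
qed

lemma jump_exists:
 assumes v: "v \<in> points F"
 shows "\<exists>j. is_jump N c v j"
proof -
 have "\<exists>g\<in>jump_space N c. (\<forall>V\<in>v. \<exists>h. (\<forall>n. h n \<in> jump_space N c & (\<forall>X\<in>snd (V n). (%m. jump_sq N c (%k \<xi>. jmp k (X m) \<xi> - h n k \<xi>)) ----> 0)) \<and>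
   (%n. jump_sq N c (%k \<xi>. h n k \<xi> - g k \<xi>)) ----> 0) & (\<forall>K u. approximates v K u --> (%n. jump_sq N c (%k \<xi>. jmp k (u n) \<xi> - g k \<xi>)) ----> 0)"
 proof (rule limit_along_approximations[where d = "%f g. jump_sq N c (%k \<xi>. f k \<xi> - g k \<xi>)" and T = "%K u k. jmp k u" and C = 1])
  show "jump_sq N c (%k \<xi>. jmp k u \<xi> - jmp k w \<xi>) <= ennreal 1 * ennreal ((sdist u w)^2)"
   if "1 <= K" "u \<in> C1 K" "1 <= L" "w \<in> C1 L" for K u L w using jump_dist[OF that] by simp
  show "jump_sq N c (%k \<xi>. x k \<xi> - y k \<xi>) = jump_sq N c (%k \<xi>. y k \<xi> - x k \<xi>)" for x y
   unfolding jump_sq_def by (intro suminf_cong arg_cong2[where f = "(*)"] refl l2_sq_diff_commute)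
 qed (use v jump_space_complete in \<open>auto intro: jump_in_space jump_sq_triangle\<close>)
 then show ?thesis unfolding is_jump_def is_level_jump_def by blast
qed

lemma jump_limit:
 assumes j: "is_jump N c v j" and a: "approximates v K u"
 shows "(%n. jump_sq N c (%k \<xi>. jmp k (u n) \<xi> - j k \<xi>)) ----> 0"
proof -
 obtain h where h: "\<And>n. is_level_jump N c (to_completion (Sm (K n)) (u n)) (h n)"
  "(%n. jump_sq N c (%k \<xi>. h n k \<xi> - j k \<xi>)) ----> 0"
  using j approximatesD(3)[OF a] by (fastforce simp: is_jump_def emb_def)
 show ?thesis
 proof (rule tendsto_ennreal_0_trans[where d = "%f g. jump_sq N c (%k \<xi>. f k \<xi> - g k \<xi>)" and y = h, OF jump_sq_triangle _ h(2)])
  have "(%m::nat. jump_sq N c (%k \<xi>. jmp k (u n) \<xi> - h n k \<xi>)) ----> 0" for n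
   using h(1)[of n] emb_rep(2)[OF approximatesD(1,2)[OF a, of n]] by (auto simp: is_level_jump_def)
  then have "jump_sq N c (%k \<xi>. jmp k (u n) \<xi> - h n k \<xi>) = 0" for n by (simp add: LIMSEQ_const_iff)
  then show "(%n. jump_sq N c (%k \<xi>. jmp k (u n) \<xi> - h n k \<xi>)) ----> 0" by simp
  show "h n \<in> jump_space N c" "j \<in> jump_space N c" "(%k. jmp k (u n)) \<in> jump_space N c" for n
   using h(1)[of n] j jump_in_space approximatesD[OF a] by (auto simp: is_level_jump_def is_jump_def)
 qed
qed

end

section \<open>Injectivity of the embedding\<close>

lemma nn_integral_hyper_map:
 fixes f :: "'a::euclidean_space => ennreal"
 assumes \<nu>: "norm \<nu> = 1" and h: "h \<bullet> \<nu> ~= 0" and [measurable]: "f \<in> borel_measurable borel"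
 shows "(LB x. f x) = ennreal \<bar>h \<bullet> \<nu>\<bar> * (LB z. f (a + hyper_map \<nu> h z))"
proof -
 have [measurable]: "hyper_map \<nu> h \<in> borel_measurable borel" by (rule borel_measurable_linear[OF linear_hyper_map])
 have "lborel = density (distr lborel borel (%z. a + hyper_map \<nu> h z)) (%_. ennreal \<bar>h \<bullet> \<nu>\<bar>)"
 proof (rule measure_eqI)
  fix A :: "'a set" assume "A \<in> sets lborel"
  then have [measurable]: "A \<in> sets borel" by simp
  show "emeasure lborel A = emeasure (density (distr lborel borel (%z. a + hyper_map \<nu> h z)) (%_. ennreal \<bar>h \<bullet> \<nu>\<bar>)) A"
   by (subst emeasure_density) (auto simp: nn_integral_cmult_indicator emeasure_distr vimage_def emeasure_hyper_map_vimage[OF \<nu> h, of A a])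
 qed simp
 then have "(LB x. f x) = (\<integral>\<^sup>+x. f x \<partial>density (distr lborel borel (%z. a + hyper_map \<nu> h z)) (%_. ennreal \<bar>h \<bullet> \<nu>\<bar>))" by (rule arg_cong)
 also have "... = ennreal \<bar>h \<bullet> \<nu>\<bar> * (LB z. f (a + hyper_map \<nu> h z))"
  by (simp add: nn_integral_density nn_integral_cmult nn_integral_distr)
 finally show ?thesis .
qed

text \<open>Fatou's lemma; convergence is required only where \<open>g\<close> is nonzero, since
  elsewhere the lower limit is trivially large enough.\<close>

lemma nn_integral_le_limit:
 fixes f :: "nat => 'a => ennreal"
 assumes [measurable]: "\<And>n. f n \<in> borel_measurable M" and lim: "\<And>x. g x = 0 \<or> (%n. f n x) ----> g x"
  and bound: "\<And>n. (\<integral>\<^sup>+x. f n x \<partial>M) <= C"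
 shows "(\<integral>\<^sup>+x. g x \<partial>M) <= C"
proof -
 have "g x <= liminf (%n. f n x)" for x using lim[of x] lim_imp_Liminf[of sequentially "%n. f n x" "g x"] by auto
 then have "(\<integral>\<^sup>+x. g x \<partial>M) <= (\<integral>\<^sup>+x. liminf (%n. f n x) \<partial>M)" by (rule nn_integral_mono)
 also have "... <= liminf (%n. \<integral>\<^sup>+x. f n x \<partial>M)" by (rule nn_integral_liminf) measurable
 also have "... <= liminf (%n. C)" by (rule Liminf_mono) (simp add: bound)
 also have "... = C" by (rule Liminf_const) simp
 finally show ?thesis .
qed

context fractal_network
begin

lemma step_sequence:
 defines "t \<equiv> %n::nat. 1 / real (Suc (Suc n))"
 shows "t n > 0" "t n < 1" "t ----> 0"
proof -
 show "t n > 0" "t n < 1" by (simp_all add: t_def)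
 show "t ----> 0" unfolding t_def by (rule LIMSEQ_Suc[OF LIMSEQ_Suc[OF lim_1_over_n]])
qed

text \<open>The map \<open>z \<mapsto> z + (1 - t) (\<beta> - z \<bullet> \<mu>) \<mu>\<close> squeezes the layer of width 1 below the hyperplane into
 the layer of width \<open>t\<close>, whose shift by \<open>t \<mu>\<close> crosses the hyperplane.\<close>

lemma jump_le_shifts:
 assumes k: "1 <= k" "k <= K" and u: "u \<in> C1 K"
  and bound: "\<And>t. 0 < t ==> t < 1 ==>
   (LB x. indicator (region N) x * ennreal ((ubar K u (x + t *\<^sub>R \<nu> i) - ubar K u x)^2)) <= ennreal t * C"
 shows "(\<integral>\<^sup>+\<xi>. piece_density k u i \<xi> \<partial>hausdorff_measure (CARD('n) - 1)) <= ennreal (hausdorff_const CARD('n)) * C"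
proof -
 let ?\<mu> = "\<nu> i" and ?\<beta> = "b i"
 define t where "t n = 1 / real (Suc (Suc n))" for n
 have t: "t n > 0" "t n < 1" "t ----> 0" for n using step_sequence(1,2)[of n] step_sequence(3) by (simp_all add: t_def[abs_def])
 have K: "1 <= K" using k by simp
 note [measurable] = piece_density_borel[OF k u, of i] borel_ubar_gbar(1)[OF K u]
 have [measurable]: "hyper_map ?\<mu> h \<in> borel_measurable borel" for h by (rule borel_measurable_linear[OF linear_hyper_map])
 define f where "f n x = indicator (region N) x * ennreal ((ubar K u (x + t n *\<^sub>R ?\<mu>) - ubar K u x)^2)" for n x
 have [measurable]: "f n \<in> borel_measurable borel" for n unfolding f_def[abs_def] by measurable
 \<comment> \<open>This squeezing map multiplies volumes by \<open>t n\<close>, which cancels the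
   factor \<open>t\<close> in \<open>bound\<close>. A point at distance \<open>\<sigma>\<close>
   below the hyperplane is moved to distance \<open>t n * \<sigma>\<close>, so its shift ends at
   distance \<open>t n * (1 - \<sigma>)\<close> above it.\<close>
 define \<Phi> where "\<Phi> n z = ((1 - t n) * ?\<beta>) *\<^sub>R ?\<mu> + hyper_map ?\<mu> (t n *\<^sub>R ?\<mu>) z" for n z
 have [measurable]: "\<Phi> n \<in> borel_measurable borel" for n unfolding \<Phi>_def[abs_def] by measurable
 have int: "(LB z. f n (\<Phi> n z)) <= C" for n
 proof -
  have "ennreal (t n) * (LB z. f n (\<Phi> n z)) = (LB x. f n x)"
   using nn_integral_hyper_map[of ?\<mu> "t n *\<^sub>R ?\<mu>" "f n" "((1 - t n) * ?\<beta>) *\<^sub>R ?\<mu>"] t(1)[of n] by (simp add: norm_normal \<Phi>_def)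
  also have "... <= ennreal (t n) * C" unfolding f_def by (rule bound[OF t(1,2)])
  finally show ?thesis using t(1)[of n] by (subst (asm) ennreal_mult_le_mult_iff) auto
 qed
 have lim: "indicator (cyl ?\<mu> ?\<beta> ?\<mu> UNIV) z * piece_density k u i (hit_point ?\<mu> ?\<beta> ?\<mu> z) = 0 \<or>
   (%n. f n (\<Phi> n z)) ----> indicator (cyl ?\<mu> ?\<beta> ?\<mu> UNIV) z * piece_density k u i (hit_point ?\<mu> ?\<beta> ?\<mu> z)" for z
 proof (cases "z \<in> cyl ?\<mu> ?\<beta> ?\<mu> UNIV & hit_point ?\<mu> ?\<beta> ?\<mu> z \<in> piece k i")
  case True
  define p where "p = hit_point ?\<mu> ?\<beta> ?\<mu> z"
  define \<sigma> where "\<sigma> = ?\<beta> - z \<bullet> ?\<mu>"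
  have \<sigma>: "0 < \<sigma>" "\<sigma> < 1" using True by (auto simp: cyl_def hit_time_def \<sigma>_def)
  have pz: "p = z + \<sigma> *\<^sub>R ?\<mu>" by (simp add: p_def hit_point_def hit_time_def \<sigma>_def)
  have p: "p \<in> iface N k" "p \<notin> B" "p \<bullet> ?\<mu> = ?\<beta>" using True by (auto simp: piece_def p_def)
  obtain e vp vm where st: "side_traces k u i p e vp vm" using side_traces_exist[OF k u p] by blast
  then have e: "e > 0" "p \<in> ball p e" by (simp_all add: side_traces_def)
  have tr: "(u \<longlongrightarrow> vp p) (at p within {y. y \<bullet> ?\<mu> > ?\<beta>})" "(u \<longlongrightarrow> vm p) (at p within {y. y \<bullet> ?\<mu> < ?\<beta>})"
   "jmp k u p = vp p - vm p" using st e(2) p(2,3) unfolding side_traces_def by blast+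
  obtain r where r: "r > 0" "ball p r \<subseteq> region N" "\<And>y. y \<in> ball p r ==> y \<in> iface_upto N K \<longleftrightarrow> y \<bullet> ?\<mu> = ?\<beta>"
   using locally_flat[OF k p] by blast
  define y where "y n = p + (t n * (1 - \<sigma>)) *\<^sub>R ?\<mu>" for n
  define x where "x n = p + (- (t n * \<sigma>)) *\<^sub>R ?\<mu>" for n
  have xy: "\<Phi> n z = x n" "\<Phi> n z + t n *\<^sub>R ?\<mu> = y n" for n
  proof -
   show "\<Phi> n z = x n" by (simp add: \<Phi>_def hyper_map_def x_def pz \<sigma>_def algebra_simps)
   then show "\<Phi> n z + t n *\<^sub>R ?\<mu> = y n" by (simp add: x_def y_def algebra_simps)
  qed
  have yl: "y ----> p"
  proof -
   have "(%n. p + (t n * (1 - \<sigma>)) *\<^sub>R ?\<mu>) ----> p + (0 * (1 - \<sigma>)) *\<^sub>R ?\<mu>" by (intro tendsto_intros t)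
   then show ?thesis by (simp add: y_def[abs_def])
  qed
  have xl: "x ----> p"
  proof -
   have "(%n. p + (- (t n * \<sigma>)) *\<^sub>R ?\<mu>) ----> p + (- (0 * \<sigma>)) *\<^sub>R ?\<mu>" by (intro tendsto_intros t)
   then show ?thesis by (simp add: x_def[abs_def])
  qed
  have yx: "y n \<bullet> ?\<mu> > ?\<beta>" "x n \<bullet> ?\<mu> < ?\<beta>" for n
   using p(3) \<sigma> t(1)[of n] by (simp_all add: y_def x_def inner_add_left inner_diff_left)
  have "filterlim y (at p within {y. y \<bullet> ?\<mu> > ?\<beta>}) sequentially"
   unfolding filterlim_at using yl yx(1) p(3) by (auto intro!: always_eventually) (metis less_irrefl)
  from filterlim_compose[OF tr(1) this] have 1: "(%n. u (y n)) ----> vp p" .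
  have "filterlim x (at p within {y. y \<bullet> ?\<mu> < ?\<beta>}) sequentially"
   unfolding filterlim_at using xl yx(2) p(3) by (auto intro!: always_eventually) (metis less_irrefl)
  from filterlim_compose[OF tr(2) this] have 2: "(%n. u (x n)) ----> vm p" .
  have "(%n. ennreal ((u (y n) - u (x n))^2)) ----> ennreal ((vp p - vm p)^2)"
   by (intro tendsto_ennrealI tendsto_power tendsto_diff 1 2)
  moreover have "\<forall>\<^sub>F n in sequentially. f n (\<Phi> n z) = ennreal ((u (y n) - u (x n))^2)"
  proof -
   have "\<forall>\<^sub>F n in sequentially. y n \<in> ball p r" "\<forall>\<^sub>F n in sequentially. x n \<in> ball p r"
    using topological_tendstoD[OF yl, of "ball p r"] topological_tendstoD[OF xl, of "ball p r"] r(1) by simp_all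
   then show ?thesis
   proof eventually_elim
    case (elim n)
    have "y n \<in> smooth K" "x n \<in> smooth K"
     using elim r(2) r(3)[OF elim(1)] r(3)[OF elim(2)] yx[of n] by auto
    then show ?case unfolding f_def xy(2) unfolding xy(1) by (simp add: ubar_def)
   qed
  qed
  ultimately have "(%n. f n (\<Phi> n z)) ----> ennreal ((vp p - vm p)^2)" by (rule tendsto_cong[THEN iffD2, rotated])
  then show ?thesis using True tr(3) by (simp add: piece_density_def jsq_def p_def[symmetric])
 qed (auto simp: piece_density_def)
 have "(\<integral>\<^sup>+\<xi>. piece_density k u i \<xi> \<partial>hausdorff_measure (DIM('n point) - 1)) \<le>
   ennreal (hausdorff_const DIM('n point)) * (\<integral>\<^sup>+\<xi>. piece_density k u i \<xi> \<partial>cyl_measure ?\<mu> ?\<beta> ?\<mu>)"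
  by (rule nn_integral_hausdorff_le_cyl[OF norm_normal piece_density_borel[OF k u]]) (auto simp: piece_density_def piece_def)
 also have "(\<integral>\<^sup>+\<xi>. piece_density k u i \<xi> \<partial>cyl_measure ?\<mu> ?\<beta> ?\<mu>) =
   (LB z. indicator (cyl ?\<mu> ?\<beta> ?\<mu> UNIV) z * piece_density k u i (hit_point ?\<mu> ?\<beta> ?\<mu> z))"
  by (rule nn_integral_cyl_measure) measurable
 also have "... <= C" by (rule nn_integral_le_limit[OF _ lim int]) measurable
 finally show ?thesis by (simp add: mult_left_mono)
qed

text \<open>A bound quadratic in \<open>t\<close> is asked only for shifts that cross no interface
  up to level \<open>K\<close>. Each point of the open smooth part admits such shifts for all small
  \<open>t\<close>, so the difference quotients converge there and Fatou's lemma applies.\<close>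

lemma gradient_le_shifts:
 assumes K: "1 <= K" and u: "u \<in> C1 K"
  and bound: "\<And>t E. 0 < t ==> E \<in> sets borel ==> E \<subseteq> region N ==>
   (\<And>x s. x \<in> E ==> s \<in> {0<..<1} ==> x + s *\<^sub>R t *\<^sub>R e \<notin> iface_upto N K) ==>
   (LB x. indicator E x * ennreal ((ubar K u (x + t *\<^sub>R e) - ubar K u x)^2)) <= ennreal (t\<^sup>2) * C"
 shows "(LB x. ennreal ((gbar K u x \<bullet> e)^2)) <= C"
proof -
 let ?O = "smooth K"
 define t where "t n = 1 / real (Suc (Suc n))" for n
 have t: "t n > 0" "t n < 1" "t ----> 0" for n using step_sequence(1,2)[of n] step_sequence(3) by (simp_all add: t_def[abs_def])
 note [measurable] = borel_ubar_gbar(1)[OF K u]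
 define E where "E n = {x. \<forall>s\<in>{0..1}. x + s *\<^sub>R t n *\<^sub>R e \<in> ?O}" for n
 have E [measurable]: "E n \<in> sets borel" for n
 proof -
  \<comment> \<open>The complement of \<open>E n\<close> consists of the differences between points
    of a closed set, the complement of \<open>?O\<close>, and points of a compact segment; it is
    therefore closed.\<close>
  have "compact ((%s. s *\<^sub>R t n *\<^sub>R e) ` {0..1::real})" by (intro compact_continuous_image continuous_intros compact_Icc)
  moreover have "closed (- ?O)" using open_smooth_region[OF K] by (simp only: closed_def double_complement)
  ultimately have "closed (\<Union>x\<in>- ?O. \<Union>y\<in>(%s. s *\<^sub>R t n *\<^sub>R e) ` {0..1::real}. {x - y})" by (intro closed_compact_differences)
  moreover have "(\<Union>x\<in>- ?O. \<Union>y\<in>(%s. s *\<^sub>R t n *\<^sub>R e) ` {0..1::real}. {x - y}) = - E n"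
  proof (intro set_eqI iffI)
   fix x assume "x \<in> - E n"
   then obtain s where "s \<in> {0..1}" "x + s *\<^sub>R t n *\<^sub>R e \<in> - ?O" by (auto simp: E_def)
   then show "x \<in> (\<Union>x\<in>- ?O. \<Union>y\<in>(%s. s *\<^sub>R t n *\<^sub>R e) ` {0..1::real}. {x - y})"
    by (intro UN_I[of "x + s *\<^sub>R t n *\<^sub>R e"] UN_I[of "s *\<^sub>R t n *\<^sub>R e"]) auto
  next
   fix x assume "x \<in> (\<Union>x\<in>- ?O. \<Union>y\<in>(%s. s *\<^sub>R t n *\<^sub>R e) ` {0..1::real}. {x - y})"
   then obtain x' s where s: "x' \<in> - ?O" "s \<in> {0..1::real}" "x = x' - s *\<^sub>R t n *\<^sub>R e" by blast
   then have "x + s *\<^sub>R t n *\<^sub>R e = x'" by simp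
   with s(1,2) show "x \<in> - E n" unfolding E_def by blast
  qed
  ultimately have "closed (- E n)" by (simp only:)
  then have "open (E n)" by (simp add: closed_def)
  then show ?thesis by (rule borel_open)
 qed
 have EO: "E n \<subseteq> ?O" for n by (auto simp: E_def dest: bspec[of _ _ 0])
 define f where "f n x = ennreal (1 / (t n)^2) * (indicator (E n) x * ennreal ((ubar K u (x + t n *\<^sub>R e) - ubar K u x)^2))" for n x
 show ?thesis
 proof (rule nn_integral_le_limit[where f = f])
  show "f n \<in> borel_measurable lborel" for n unfolding f_def[abs_def] by measurable
  show "(LB x. f n x) <= C" for n
  proof -
   have "(LB x. f n x) = ennreal (1 / (t n)^2) * (LB x. indicator (E n) x * ennreal ((ubar K u (x + t n *\<^sub>R e) - ubar K u x)^2))"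
    unfolding f_def by (rule nn_integral_cmult) measurable
   also have "... <= ennreal (1 / (t n)^2) * (ennreal ((t n)^2) * C)"
    using EO[of n] by (intro mult_left_mono bound t E) (auto simp: E_def)
   also have "... = C" using t(1)[of n] by (simp add: mult.assoc[symmetric] ennreal_mult[symmetric])
   finally show ?thesis .
  qed
  show "ennreal ((gbar K u x \<bullet> e)^2) = 0 \<or> (%n. f n x) ----> ennreal ((gbar K u x \<bullet> e)^2)" for x
  proof (cases "x \<in> ?O")
   case True
   obtain r where r: "r > 0" "ball x r \<subseteq> ?O" using open_smooth_region[OF K] True by (meson openE)
   have "GDERIV u (x + 0 *\<^sub>R e) :> gradient u x" using c1_gradient[OF K u True] by simp
   from has_derivative_along_line[OF this]
   have "((%s. (u (x + (0 + s) *\<^sub>R e) - u (x + 0 *\<^sub>R e)) / s) \<longlongrightarrow> gradient u x \<bullet> e) (at 0)" by (rule DERIV_D)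
   moreover have "filterlim t (at 0) sequentially" unfolding filterlim_at using t(3) by (auto simp: t_def)
   ultimately have "(%n. (u (x + (0 + t n) *\<^sub>R e) - u (x + 0 *\<^sub>R e)) / t n) ----> gradient u x \<bullet> e" by (rule filterlim_compose)
   then have "(%n. ennreal (((u (x + t n *\<^sub>R e) - u x) / t n)^2)) ----> ennreal ((gradient u x \<bullet> e)^2)"
    by (intro tendsto_ennrealI tendsto_power) simp
   moreover have "\<forall>\<^sub>F n in sequentially. f n x = ennreal (((u (x + t n *\<^sub>R e) - u x) / t n)^2)"
   proof -
    have "(%n. t n * norm e) ----> 0 * norm e" by (intro tendsto_intros t)
    then have "\<forall>\<^sub>F n in sequentially. t n * norm e < r" using r(1) by (intro order_tendstoD(2)) auto
    then show ?thesis
    proof eventually_elim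
     case (elim n)
     have in_O: "x + s *\<^sub>R t n *\<^sub>R e \<in> ?O" if "s \<in> {0..1}" for s
     proof -
      have "norm (s *\<^sub>R t n *\<^sub>R e) <= 1 * (t n * norm e)" using that t(1)[of n] by (simp add: mult_left_le_one_le)
      then have "dist x (x + s *\<^sub>R t n *\<^sub>R e) < r" using elim by (simp add: dist_norm)
      then show ?thesis using r(2) by (meson mem_ball subsetD)
     qed
     then have "x \<in> E n" by (simp add: E_def)
     moreover have "x + t n *\<^sub>R e \<in> ?O" using in_O[of 1] by simp
     ultimately show ?case using True t(1)[of n]
      by (simp add: f_def ubar_def ennreal_mult[symmetric] power_divide)
    qed
   qed
   ultimately have "(%n. f n x) ----> ennreal ((gradient u x \<bullet> e)^2)" by (rule tendsto_cong[THEN iffD2, rotated])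
   then show ?thesis using True by (simp add: gbar_def)
  qed (simp add: gbar_def)
 qed
qed

section \<open>Null sequences in the square norm have vanishing energy\<close>

lemma l2_sq_difference_error:
 assumes "1 <= K" "u \<in> C1 K" "1 <= L" "w \<in> C1 L"
 shows "l2_sq lborel (%x. ubar (max K L) (%x. 1 * u x + (- 1) * w x) x - ubar K u x) = l2_sq lborel (ubar L w)"
proof -
 have *: "AE x in lborel. norm (ubar (max K L) (%x. 1 * u x + (- 1) * w x) x - ubar K u x) = norm (ubar L w x)"
  using AE_ubar_gbar_diff[OF assms] by eventually_elim (metis (no_types) add_diff_cancel_left' diff_add_cancel minus_diff_eq norm_minus_commute norm_minus_cancel)
 show ?thesis unfolding l2_sq_def by (rule nn_integral_cong_AE, rule eventually_mono[OF *], simp only:)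
qed

lemma shift_of_null_sequence:
 assumes a: "approximates v K z" and null: "(%n. l2_sq lborel (ubar (K n) (z n))) ----> 0"
  and close: "\<And>n. n >= n0 ==> (sdist (z m) (z n))^2 <= \<epsilon>"
 shows "(LB x. indicator (region N) x * ennreal ((ubar (K m) (z m) (x + h) - ubar (K m) (z m) x)^2)) \<le>
  2 * (ennreal ((1 + 1/c) * ((norm h)^2 + norm h)) * ennreal \<epsilon>)"
proof (rule nn_integral_shift_limit[where m = n0 and f = "%n. ubar (max (K m) (K n)) (%x. 1 * z m x + (- 1) * z n x)"])
 note aD = approximatesD(1,2)[OF a]
 note d = energy_sdist[OF aD aD]
 have M: "1 <= max (K m) (K n)" for n using aD(1)[of m] by simp
 show "ubar (max (K m) (K n)) (%x. 1 * z m x + (- 1) * z n x) \<in> borel_measurable borel" for n by (rule borel_ubar_gbar(1)[OF M d(1)])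
 show "ubar (K m) (z m) \<in> borel_measurable borel" by (rule borel_ubar_gbar(1)[OF aD])
 show "(%n. l2_sq lborel (%x. ubar (max (K m) (K n)) (%x. 1 * z m x + (- 1) * z n x) x - ubar (K m) (z m) x)) ----> 0"
  unfolding l2_sq_difference_error[OF aD aD] by (rule null)
 show "(LB x. indicator (region N) x * ennreal ((ubar (max (K m) (K n)) (%x. 1 * z m x + (- 1) * z n x) (x + h) -
   ubar (max (K m) (K n)) (%x. 1 * z m x + (- 1) * z n x) x)^2)) <= ennreal ((1 + 1/c) * ((norm h)^2 + norm h)) * ennreal \<epsilon>" if "n >= n0" for n
  by (rule order_trans[OF shift_energy[OF M d(1)]], unfold d(2)) (intro mult_left_mono ennreal_leI close[OF that], simp)
qed (use region_borel in auto)

text \<open>On each single piece the shift estimate makes the jumps tend to 0, but it says nothing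
  about the sum over all pieces and levels. The limit \<open>j\<close> in the weighted jump space
  exists by completeness; it vanishes on every piece, hence it is 0, and convergence to it holds in
  the full norm.\<close>

lemma jumps_of_null_sequence:
 assumes v: "v \<in> points F" and a: "approximates v K z" and null: "(%n. l2_sq lborel (ubar (K n) (z n))) ----> 0"
 shows "(%n. jump_sq N c (%k. jmp k (z n))) ----> 0"
proof -
 note aD = approximatesD(1,2)[OF a]
 let ?H = "hausdorff_measure (CARD('n) - 1) :: 'n point measure"
 let ?hc = "hausdorff_const CARD('n)"
 have pieces: "(%m. \<integral>\<^sup>+\<xi>. piece_density k (z m) i \<xi> \<partial>?H) ----> 0" if k: "1 <= k" for k i
 proof (rule tendsto_ennreal_0I)
  fix e :: real assume e: "e > 0"
  \<comment> \<open>The factor 4 consists of 2 from the passage to the limit and 2 from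
    \<open>t^2 + t <= 2 * t\<close>; taking \<open>\<bar>?hc\<bar> + 1\<close> makes the denominator
    positive at once.\<close>
  define \<epsilon> where "\<epsilon> = e / ((\<bar>?hc\<bar> + 1) * 4 * (1 + 1/c))"
  have pos: "(\<bar>?hc\<bar> + 1) * 4 * (1 + 1/c) > 0" using c_pos by (intro mult_pos_pos add_nonneg_pos) auto
  then have \<epsilon>: "\<epsilon> > 0" using e by (simp add: \<epsilon>_def)
  obtain n0 where n0: "\<And>m n. m >= n0 ==> n >= n0 ==> sdist (z m) (z n) < sqrt \<epsilon>"
   using approximates_cauchy[OF v a, of "sqrt \<epsilon>"] \<epsilon> by auto
  have "(\<integral>\<^sup>+\<xi>. piece_density k (z m) i \<xi> \<partial>?H) <= ennreal e" if m: "m >= n0" for m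
  proof (cases "k <= K m")
   case True
   have "(sdist (z m) (z n))^2 <= \<epsilon>" if "n >= n0" for n
    using power_mono[of "sdist (z m) (z n)" "sqrt \<epsilon>" 2] n0[OF m that] \<epsilon> by (simp add: sdist_def snorm_def)
   note sh = shift_of_null_sequence[OF a null this]
   have "(\<integral>\<^sup>+\<xi>. piece_density k (z m) i \<xi> \<partial>?H) <= ennreal ?hc * ennreal (4 * (1 + 1/c) * \<epsilon>)"
   proof (rule jump_le_shifts[OF k True aD(2)])
    fix t :: real assume t: "0 < t" "t < 1"
    have "(LB x. indicator (region N) x * ennreal ((ubar (K m) (z m) (x + t *\<^sub>R \<nu> i) - ubar (K m) (z m) x)^2)) \<le>
      2 * (ennreal ((1 + 1/c) * ((norm (t *\<^sub>R \<nu> i))^2 + norm (t *\<^sub>R \<nu> i))) * ennreal \<epsilon>)"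
     by (rule sh)
    also have "... <= 2 * (ennreal ((1 + 1/c) * (2 * t)) * ennreal \<epsilon>)"
     using t c_pos by (intro mult_left_mono mult_right_mono ennreal_leI) (auto simp: norm_normal power2_eq_square)
    also have "... = ennreal (2 * ((1 + 1/c) * (2 * t) * \<epsilon>))"
    proof -
     have "2 * (ennreal x * ennreal y) = ennreal (2 * (x * y))" if "x >= 0" "y >= 0" for x y using that by (simp add: ennreal_mult)
     then show ?thesis by this (use t \<epsilon> c_pos in auto)
    qed
    also have "2 * ((1 + 1/c) * (2 * t) * \<epsilon>) = t * (4 * (1 + 1/c) * \<epsilon>)" by simp
    also have "ennreal \<dots> = ennreal t * ennreal (4 * (1 + 1/c) * \<epsilon>)" using t \<epsilon> c_pos by (intro ennreal_mult) auto
    finally show "(LB x. indicator (region N) x * ennreal ((ubar (K m) (z m) (x + t *\<^sub>R \<nu> i) - ubar (K m) (z m) x)^2)) \<le>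
      ennreal t * ennreal (4 * (1 + 1/c) * \<epsilon>)" .
   qed
   also have "... <= ennreal (\<bar>?hc\<bar> + 1) * ennreal (4 * (1 + 1/c) * \<epsilon>)" by (intro mult_right_mono ennreal_leI) auto
   also have "... = ennreal ((\<bar>?hc\<bar> + 1) * (4 * (1 + 1/c) * \<epsilon>))" using \<epsilon> c_pos by (intro ennreal_mult[symmetric]) auto
   also have "(\<bar>?hc\<bar> + 1) * (4 * (1 + 1/c) * \<epsilon>) = (\<bar>?hc\<bar> + 1) * 4 * (1 + 1/c) * \<epsilon>" by (simp only: mult.assoc)
   also have "... = e" unfolding \<epsilon>_def using pos by (metis less_irrefl nonzero_mult_div_cancel_left times_divide_eq_right)
   finally show ?thesis .
  next
   case False
   have "(\<integral>\<^sup>+\<xi>. piece_density k (z m) i \<xi> \<partial>?H) <= (\<Sum>i. \<integral>\<^sup>+\<xi>. piece_density k (z m) i \<xi> \<partial>?H)" by (rule ennreal_le_suminf)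
   also have "... <= Jsq k (z m)" using False by (intro sum_piece_density[OF k order_refl] c1_mono[OF aD(1) _ aD(2)]) simp
   also have "... = 0" using False by (intro Jsq_above[OF aD(1)[of m] aD(2)[of m]]) simp
   finally show ?thesis by simp
  qed
  then show "\<forall>\<^sub>F m in sequentially. (\<integral>\<^sup>+\<xi>. piece_density k (z m) i \<xi> \<partial>?H) <= ennreal e" by (auto simp: eventually_sequentially)
 qed
 obtain j where j: "is_jump N c v j" using jump_exists[OF v] by blast
 then have js: "j \<in> jump_space N c" by (simp add: is_jump_def)
 note jl = jump_limit[OF j a]
 note zs = jump_in_space[OF aD]
 have j0: "l2_sq (surface N k) (j k) = 0" if k: "1 <= k" for k
 proof -
  note [measurable] = jump_space_diff_measurable[OF js k] jump_space_diff_measurable[OF zs k]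
  have ind [measurable]: "piece k i \<in> sets (surface N k)" for i
   using hausdorff_sets[OF piece_borel[OF k]] by (auto simp: sets_surface[OF k] piece_def)
  have "AE \<xi> in surface N k. indicator (piece k i) \<xi> * ennreal ((j k \<xi>)^2) = 0" for i
  proof -
   have le: "(\<integral>\<^sup>+\<xi>. indicator (piece k i) \<xi> * ennreal ((j k \<xi>)^2) \<partial>surface N k) \<le>
     2 * (\<integral>\<^sup>+\<xi>. piece_density k (z n) i \<xi> \<partial>?H) + 2 * jump_sq N c (%k \<xi>. jmp k (z n) \<xi> - j k \<xi>)" for n
   proof -
    have "(\<integral>\<^sup>+\<xi>. indicator (piece k i) \<xi> * ennreal ((j k \<xi>)^2) \<partial>surface N k) \<le>
      (\<integral>\<^sup>+\<xi>. 2 * (indicator (piece k i) \<xi> * ennreal ((jmp k (z n) \<xi>)^2)) + 2 * ennreal ((jmp k (z n) \<xi> - j k \<xi>)^2) \<partial>surface N k)"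
    proof (rule nn_integral_mono)
     fix \<xi>
     let ?p = "jmp k (z n) \<xi>"
     have "(j k \<xi>)^2 <= 2 * ?p\<^sup>2 + 2 * (?p - j k \<xi>)^2"
      using norm_sq_young[of 1 "j k \<xi>" ?p] by (simp add: power2_commute)
     then have "ennreal ((j k \<xi>)^2) <= ennreal (2 * ?p\<^sup>2 + 2 * (?p - j k \<xi>)^2)" by (rule ennreal_leI)
     then show "indicator (piece k i) \<xi> * ennreal ((j k \<xi>)^2) <= 2 * (indicator (piece k i) \<xi> * ennreal (?p\<^sup>2)) + 2 * ennreal ((?p - j k \<xi>)^2)"
      by (cases "\<xi> \<in> piece k i") (simp_all add: ennreal_mult)
    qed
    also have "... = 2 * (\<integral>\<^sup>+\<xi>. indicator (piece k i) \<xi> * ennreal ((jmp k (z n) \<xi>)^2) \<partial>surface N k) +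
      2 * l2_sq (surface N k) (%\<xi>. jmp k (z n) \<xi> - j k \<xi>)"
     by (simp add: nn_integral_add nn_integral_cmult l2_sq_def)
    also have "... <= 2 * (\<integral>\<^sup>+\<xi>. piece_density k (z n) i \<xi> \<partial>?H) + 2 * jump_sq N c (%k \<xi>. jmp k (z n) \<xi> - j k \<xi>)"
    proof (intro add_mono mult_left_mono jump_sq_component[OF k, of "%k \<xi>. jmp k (z n) \<xi> - j k \<xi>"])
     show "(\<integral>\<^sup>+\<xi>. indicator (piece k i) \<xi> * ennreal ((jmp k (z n) \<xi>)^2) \<partial>surface N k) <= (\<integral>\<^sup>+\<xi>. piece_density k (z n) i \<xi> \<partial>?H)"
      unfolding nn_integral_surface[OF k] by (intro nn_integral_mono) (auto simp: piece_density_def jsq_def indicator_def)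
    qed auto
    finally show ?thesis .
   qed
   have "(%n. 2 * (\<integral>\<^sup>+\<xi>. piece_density k (z n) i \<xi> \<partial>?H) + 2 * jump_sq N c (%k \<xi>. jmp k (z n) \<xi> - j k \<xi>)) ----> 0 + 0"
    by (intro tendsto_add tendsto_ennreal_0_cmult pieces k jl) auto
   from ennreal_le_limit[OF le this] show ?thesis by (subst (asm) add_0) (simp add: nn_integral_0_iff_AE)
  qed
  then have "AE \<xi> in surface N k. \<forall>i. indicator (piece k i) \<xi> * ennreal ((j k \<xi>)^2) = 0" by (subst AE_all_countable) blast
  then have "AE \<xi> in surface N k. ennreal ((norm (j k \<xi>))^2) = 0"
   using AE_surface_regular[OF k] AE_space
  proof eventually_elim
   case (elim \<xi>)
   then obtain i where "\<xi> \<in> piece k i" using piece_cover[OF k, of \<xi>] by auto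
   then show ?case using elim(1)[rule_format, of i] by simp
  qed
  then show ?thesis unfolding l2_sq_def by (subst nn_integral_0_iff_AE) auto
 qed
 have "jump_sq N c j = 0" unfolding jump_sq_eq using j0 by simp
 then have "jump_sq N c (%k. jmp k (z n)) <= 2 * jump_sq N c (%k \<xi>. jmp k (z n) \<xi> - j k \<xi>)" for n
  using jump_sq_young[OF zs js, of 1 n] by simp
 from tendsto_ennreal_0_le[OF tendsto_ennreal_0_cmult[OF jl] this] show ?thesis by simp
qed

text \<open>Shifts that cross no interface up to level \<open>K m\<close> meet only higher ones, and
  there the jumps of \<open>z m - z n\<close> are those of \<open>z n\<close> up to sign. For fixed
  \<open>t\<close> they tend to 0 as \<open>n\<close> grows, which removes the term linear in
  \<open>t\<close> before the division by \<open>t^2\<close>.\<close>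

lemma gradients_of_null_sequence:
 assumes v: "v \<in> points F" and a: "approximates v K z" and null: "(%n. l2_sq lborel (ubar (K n) (z n))) ----> 0"
 shows "(%n. Gsq (K n) (z n)) ----> 0"
proof (rule tendsto_ennreal_0I)
 note aD = approximatesD(1,2)[OF a]
 note d = energy_sdist[OF aD aD]
 have M: "1 <= max (K m) (K n)" for m n using aD(1)[of m] by simp
 fix r :: real assume r: "r > 0"
 \<comment> \<open>Each of the \<open>CARD('n)\<close> coordinate directions contributes
   \<open>2 * (1 + 1/c) * \<epsilon>\<close>, the 2 again from the passage to the limit.\<close>
 define \<epsilon> where "\<epsilon> = r / (real CARD('n) * (2 * (1 + 1/c)))"
 have pos: "real CARD('n) * (2 * (1 + 1/c)) > 0" using c_pos by (intro mult_pos_pos add_nonneg_pos) auto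
 then have \<epsilon>: "\<epsilon> > 0" using r by (simp add: \<epsilon>_def)
 obtain n0 where n0: "\<And>m n. m >= n0 ==> n >= n0 ==> sdist (z m) (z n) < sqrt \<epsilon>"
  using approximates_cauchy[OF v a, of "sqrt \<epsilon>"] \<epsilon> by auto
 have "Gsq (K m) (z m) <= ennreal r" if m: "m >= n0" for m
 proof -
  have close: "energy c (%x. 1 * z m x + (- 1) * z n x) <= ennreal \<epsilon>" if "n >= n0" for n
   using power_mono[of "sdist (z m) (z n)" "sqrt \<epsilon>" 2] n0[OF m that] \<epsilon> unfolding d(2)
   by (intro ennreal_leI) (simp add: sdist_def snorm_def)
  have jumps: "(\<Sum>k\<in>{Suc (K m)..max (K m) (K n)}. jump_weight c k * Jsq k (%x. 1 * z m x + (- 1) * z n x)) \<le>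
    jump_sq N c (%k. jmp k (z n))" for n
  proof -
   have "Jsq k (%x. 1 * z m x + (- 1) * z n x) = Jsq k (z n)" if k: "k >= Suc (K m)" for k
   proof -
    have k1: "1 <= k" using k by simp
    have *: "AE \<xi> in surface N k. norm (jmp k (%x. 1 * z m x + (- 1) * z n x) \<xi>) = norm (jmp k (z n) \<xi>)"
     using AE_jump_diff[OF aD(1)[of m] aD(2)[of m] aD(1)[of n] aD(2)[of n] k1] AE_space
    proof eventually_elim
     case (elim \<xi>)
     have "jmp k (z m) \<xi> = 0"
      using elim(2) k by (intro jump_smooth_point[OF aD] iface_above_smooth[OF k1]) auto
     then show ?case unfolding elim(1)[symmetric] by simp
    qed
    show ?thesis unfolding l2_sq_jump[symmetric] l2_sq_def by (rule nn_integral_cong_AE, rule eventually_mono[OF *], simp only:)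
   qed
   then have "(\<Sum>k\<in>{Suc (K m)..max (K m) (K n)}. jump_weight c k * Jsq k (%x. 1 * z m x + (- 1) * z n x)) =
     (\<Sum>k\<in>{Suc (K m)..max (K m) (K n)}. jump_weight c k * Jsq k (z n))" by (intro sum.cong) auto
   also have "... <= (\<Sum>k\<in>{1..max (K m) (K n)}. jump_weight c k * Jsq k (z n))" by (intro sum_mono2) auto
   also have "... = jump_sq N c (%k. jmp k (z n))"
    by (rule jump_sq_smooth[symmetric, OF M c1_mono[OF aD(1) max.cobounded2 aD(2)]])
   finally show ?thesis .
  qed
  have part: "(LB x. ennreal ((gbar (K m) (z m) x \<bullet> e)^2)) <= ennreal (2 * (1 + 1/c) * \<epsilon>)" if e: "e \<in> Basis" for e
  proof (rule gradient_le_shifts[OF aD])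
   fix t :: real and E assume t: "0 < t" and E: "E \<in> sets borel" "E \<subseteq> region N"
    "\<And>x s. x \<in> E ==> s \<in> {0<..<1} ==> x + s *\<^sub>R t *\<^sub>R e \<notin> iface_upto N (K m)"
   have nt: "norm (t *\<^sub>R e) = t" using e t by simp
   have "(LB x. indicator E x * ennreal ((ubar (K m) (z m) (x + t *\<^sub>R e) - ubar (K m) (z m) x)^2)) \<le>
     2 * (ennreal (1 + 1/c) * (ennreal (t\<^sup>2) * ennreal \<epsilon> + ennreal t * 0))"
   proof (rule nn_integral_shift_limit[where m = n0 and f = "%n. ubar (max (K m) (K n)) (%x. 1 * z m x + (- 1) * z n x)"
      and A = "%n. ennreal (1 + 1/c) * (ennreal (t\<^sup>2) * ennreal \<epsilon> + ennreal t * jump_sq N c (%k. jmp k (z n)))"])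
    show "ubar (max (K m) (K n)) (%x. 1 * z m x + (- 1) * z n x) \<in> borel_measurable borel" for n by (rule borel_ubar_gbar(1)[OF M d(1)])
    show "ubar (K m) (z m) \<in> borel_measurable borel" by (rule borel_ubar_gbar(1)[OF aD])
    show "(%n. l2_sq lborel (%x. ubar (max (K m) (K n)) (%x. 1 * z m x + (- 1) * z n x) x - ubar (K m) (z m) x)) ----> 0"
     unfolding l2_sq_difference_error[OF aD aD] by (rule null)
    show "(%n. ennreal (1 + 1/c) * (ennreal (t\<^sup>2) * ennreal \<epsilon> + ennreal t * jump_sq N c (%k. jmp k (z n)))) ---->
      ennreal (1 + 1/c) * (ennreal (t\<^sup>2) * ennreal \<epsilon> + ennreal t * 0)"
     by (intro ennreal_tendsto_cmult tendsto_add tendsto_const jumps_of_null_sequence[OF v a null]) auto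
    fix n assume n: "n >= n0"
    let ?d = "%x. 1 * z m x + (- 1) * z n x" and ?M = "max (K m) (K n)"
    have "(LB x. indicator E x * ennreal ((ubar ?M ?d (x + t *\<^sub>R e) - ubar ?M ?d x)^2)) \<le>
      ennreal (1 + 1/c) * (ennreal ((norm (t *\<^sub>R e))^2) * Gsq ?M ?d +
       ennreal (norm (t *\<^sub>R e)) * (\<Sum>k\<in>{Suc (K m)..?M}. jump_weight c k * Jsq k ?d))"
    proof (rule integrated_estimate[OF c_pos M d(1) E(1,2)])
     fix x k s assume "x \<in> E" "k \<in> {1..?M} - {Suc (K m)..?M}" "s \<in> {0<..<1::real}"
     then show "x + s *\<^sub>R t *\<^sub>R e \<notin> iface N k" using E(3)[of x s] by (auto simp: iface_upto_def)
    qed auto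
    also have "... <= ennreal (1 + 1/c) * (ennreal (t\<^sup>2) * ennreal \<epsilon> + ennreal t * jump_sq N c (%k. jmp k (z n)))"
    proof -
     have "Gsq ?M ?d <= ennreal \<epsilon>" using order_trans[OF _ close[OF n], of "Gsq ?M ?d"] energy_smooth[OF M d(1)] by simp
     then show ?thesis unfolding nt by (intro mult_left_mono add_mono jumps) auto
    qed
    finally show "(LB x. indicator E x * ennreal ((ubar ?M ?d (x + t *\<^sub>R e) - ubar ?M ?d x)^2)) \<le>
      ennreal (1 + 1/c) * (ennreal (t\<^sup>2) * ennreal \<epsilon> + ennreal t * jump_sq N c (%k. jmp k (z n)))" .
   qed (rule E(1))
   also have "... = ennreal (t\<^sup>2) * ennreal (2 * (1 + 1/c) * \<epsilon>)"
   proof -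
    have "2 * (ennreal x * (ennreal y * ennreal w)) = ennreal y * ennreal (2 * x * w)" if "x >= 0" "y >= 0" "w >= 0" for x y w
     using that by (simp add: ennreal_mult mult_ac)
    from this[of "1 + 1/c" "t\<^sup>2" \<epsilon>] show ?thesis using c_pos \<epsilon> by simp
   qed
   finally show "(LB x. indicator E x * ennreal ((ubar (K m) (z m) (x + t *\<^sub>R e) - ubar (K m) (z m) x)^2)) \<le>
     ennreal (t\<^sup>2) * ennreal (2 * (1 + 1/c) * \<epsilon>)" .
  qed
  have [measurable]: "gbar (K m) (z m) \<in> borel_measurable borel" by (rule borel_ubar_gbar(2)[OF aD])
  have "Gsq (K m) (z m) = (LB x. (\<Sum>e\<in>Basis. ennreal ((gbar (K m) (z m) x \<bullet> e)^2)))"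
   unfolding Gsq_def
  proof (intro nn_integral_cong)
   fix x
   have "(norm (gbar (K m) (z m) x))^2 = (\<Sum>e\<in>Basis. (gbar (K m) (z m) x \<bullet> e)^2)"
    unfolding power2_norm_eq_inner by (subst euclidean_inner) (simp add: power2_eq_square)
   then show "ennreal ((norm (gbar (K m) (z m) x))^2) = (\<Sum>e\<in>Basis. ennreal ((gbar (K m) (z m) x \<bullet> e)^2))"
    by (simp only: sum_ennreal zero_le_power2)
  qed
  also have "... = (\<Sum>e\<in>Basis. \<integral>\<^sup>+x. ennreal ((gbar (K m) (z m) x \<bullet> e)^2) \<partial>lborel)" by (rule nn_integral_sum) measurable
  also have "... <= (\<Sum>e\<in>(Basis :: 'n point set). ennreal (2 * (1 + 1/c) * \<epsilon>))" by (intro sum_mono part)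
  also have "... = ennreal (\<Sum>e\<in>(Basis :: 'n point set). 2 * (1 + 1/c) * \<epsilon>)" using c_pos \<epsilon> by (subst sum_ennreal) auto
  also have "(\<Sum>e\<in>(Basis :: 'n point set). 2 * (1 + 1/c) * \<epsilon>) = real DIM('n point) * (2 * (1 + 1/c)) * \<epsilon>" by (simp only: sum_constant mult.assoc)
  also have "... = real CARD('n) * (2 * (1 + 1/c)) * \<epsilon>" by simp
  also have "... = r" unfolding \<epsilon>_def using pos by (metis less_irrefl nonzero_mult_div_cancel_left times_divide_eq_right)
  finally show ?thesis .
 qed
 then show "\<forall>\<^sub>F m in sequentially. Gsq (K m) (z m) <= ennreal r" by (auto simp: eventually_sequentially)
qed

lemma snorm_of_null_sequence:
 assumes v: "v \<in> points F" and a: "approximates v K z" and null: "(%n. l2_sq lborel (ubar (K n) (z n))) ----> 0"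
 shows "(%n. snorm c (z n)) ----> 0"
proof -
 note aD = approximatesD(1,2)[OF a]
 have "(%n. Gsq (K n) (z n) + jump_sq N c (%k. jmp k (z n))) ----> 0 + 0"
  by (intro tendsto_add gradients_of_null_sequence[OF assms] jumps_of_null_sequence[OF assms])
 then have "(%n. ennreal ((snorm c (z n))^2)) ----> ennreal 0"
  unfolding energy_snorm[OF aD, symmetric] energy_smooth[OF aD] jump_sq_smooth[OF aD] by simp
 then have "(%n. (snorm c (z n))^2) ----> 0" by (subst (asm) tendsto_ennreal_iff) auto
 then have "(%n. sqrt ((snorm c (z n))^2)) ----> sqrt 0" by (rule tendsto_real_sqrt)
 then show ?thesis by (simp add: snorm_def)
qed

theorem limfun_injective:
 assumes v: "v \<in> points F" and w: "w \<in> points F"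
  and eq: "AE x in lebesgue_on (region N). limfun v x = limfun w x"
 shows "v = w"
proof -
 obtain K u where a: "approximates v K u" using approximates_exists[OF v] by blast
 obtain L z where a': "approximates w L z" using approximates_exists[OF w] by blast
 note al = approximates_lincomb[OF v w a a', of 1 "- 1"]
 have "region N \<in> sets lebesgue" using region_borel by (simp add: sets_completionI_sets)
 then have "AE x in lborel. x \<in> region N --> limfun v x = limfun w x"
  using eq by (simp add: AE_restrict_space_iff AE_completion_iff)
 then have z: "AE x in lborel. limfun (lincomb F 1 (- 1) v w) x = 0"
  using limfun_lincomb[OF v w, of 1 "- 1"]
  by eventually_elim (use limfun(2)[OF v] limfun(2)[OF w] in fastforce)
 have "(%n. l2_sq lborel (ubar (max (K n) (L n)) (%x. 1 * u n x + (- 1) * z n x))) ----> 0"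
 proof (rule tendsto_ennreal_0_le[OF limfun(3)[OF al(2,1)]])
  fix n
  show "l2_sq lborel (ubar (max (K n) (L n)) (%x. 1 * u n x + (- 1) * z n x)) \<le>
    l2_sq lborel (%x. ubar (max (K n) (L n)) (%x. 1 * u n x + (- 1) * z n x) x - limfun (lincomb F 1 (- 1) v w) x)"
   using z by (intro eq_refl l2_sq_cong) (auto elim: eventually_mono)
 qed
 from snorm_of_null_sequence[OF al(2,1) this] have "(%n. sdist (u n) (z n)) ----> 0" by (simp add: sdist_def)
 then show ?thesis by (rule approximates_eqI[OF v w a a'])
qed

text \<open>Young's inequality is applied once to the limit function and once to gradient and jumps;
  its error terms vanish along the approximation. What is left is the factor
  \<open>(1 + \<delta>)^2\<close>, and \<open>\<delta>\<close> tends to 0 only afterwards, so the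
  constant of the smooth case is kept.\<close>

lemma poincare_inequality:
 assumes v: "v \<in> points F" and g: "is_weak_gradient N v g" and j: "is_jump N c v j"
 shows "l2_sq (lebesgue_on (region N)) (limfun v) \<le>
  ennreal (poincare_const c) * (l2_sq (lebesgue_on (region N - iface_all N)) g + jump_sq N c j)"
proof -
 let ?M = "lebesgue_on (region N - iface_all N)" and ?P = "ennreal (poincare_const c)"
 let ?S = "?P * (l2_sq ?M g + jump_sq N c j)"
 obtain K u where a: "approximates v K u" using approximates_exists[OF v] by blast
 note aD = approximatesD(1,2)[OF a]
 have js: "j \<in> jump_space N c" using j by (simp add: is_jump_def)
 have [measurable]: "g \<in> borel_measurable ?M" using g by (simp add: is_weak_gradient_def l2_space_def)
 have [measurable]: "gradient (u n) \<in> borel_measurable ?M" for n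
 proof -
  have "gradient (u n) \<in> borel_measurable (lebesgue_on (smooth (K n)))"
   using c1_gradient_l2[OF aD(2)] by (simp add: l2_space_def)
  moreover have "smooth (K n) \<in> sets lebesgue" "region N - iface_all N \<in> sets lebesgue"
   using smooth_parts by (simp_all add: sets_completionI_sets)
  ultimately show ?thesis using smooth_parts(3) by (metis measurable_restrict_mono)
 qed
 note [measurable] = limfun_borel[OF v] borel_ubar_gbar(1)[OF aD]
 have fin: "l2_sq ?M g < top" "jump_sq N c j < top" using g js by (auto simp: is_weak_gradient_def l2_space_def jump_space_def)
 have young: "l2_sq lborel (limfun v) <= ennreal (1 + \<delta>) * (ennreal (1 + \<delta>) * ?S)" if \<delta>: "\<delta> > 0" for \<delta>
 proof (rule ennreal_le_limit)
  let ?A = "%n. l2_sq ?M (%x. gradient (u n) x - g x)" and ?J = "%n. jump_sq N c (%k \<xi>. jmp k (u n) \<xi> - j k \<xi>)"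
   and ?E = "%n. l2_sq lborel (%x. ubar (K n) (u n) x - limfun v x)"
  fix n
  have "l2_sq lborel (limfun v) <= ennreal (1 + \<delta>) * l2_sq lborel (ubar (K n) (u n)) + ennreal (1 + 1/\<delta>) * ?E n"
   using l2_sq_young[of "limfun v" lborel "ubar (K n) (u n)", OF _ _ \<delta>] by (simp add: l2_sq_diff_commute[of lborel "limfun v"])
  also have "l2_sq lborel (ubar (K n) (u n)) <= ?P * (l2_sq ?M (gradient (u n)) + jump_sq N c (%k. jmp k (u n)))"
   using smooth_poincare[OF c_pos aD] unfolding l2_sq_gradient(2)[OF aD] jump_sq_smooth[OF aD] by (simp add: l2_sq_def)
  also have "... <= ?P * ((ennreal (1 + \<delta>) * l2_sq ?M g + ennreal (1 + 1/\<delta>) * ?A n) + (ennreal (1 + \<delta>) * jump_sq N c j + ennreal (1 + 1/\<delta>) * ?J n))"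
   by (intro mult_left_mono add_mono l2_sq_young jump_sq_young[OF jump_in_space[OF aD] js] \<delta>) auto
  finally show "l2_sq lborel (limfun v) <= ennreal (1 + \<delta>) * (?P * ((ennreal (1 + \<delta>) * l2_sq ?M g + ennreal (1 + 1/\<delta>) * ?A n) +
    (ennreal (1 + \<delta>) * jump_sq N c j + ennreal (1 + 1/\<delta>) * ?J n))) + ennreal (1 + 1/\<delta>) * ?E n"
   by (simp add: mult_left_mono add_right_mono)
 next
  have "(%n. ennreal (1 + \<delta>) * (?P * ((ennreal (1 + \<delta>) * l2_sq ?M g + ennreal (1 + 1/\<delta>) * l2_sq ?M (%x. gradient (u n) x - g x)) +
    (ennreal (1 + \<delta>) * jump_sq N c j + ennreal (1 + 1/\<delta>) * jump_sq N c (%k \<xi>. jmp k (u n) \<xi> - j k \<xi>)))) +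
    ennreal (1 + 1/\<delta>) * l2_sq lborel (%x. ubar (K n) (u n) x - limfun v x)) ---->
   ennreal (1 + \<delta>) * (?P * ((ennreal (1 + \<delta>) * l2_sq ?M g + 0) + (ennreal (1 + \<delta>) * jump_sq N c j + 0))) + 0"
   by (intro tendsto_add tendsto_const ennreal_tendsto_cmult[of "ennreal (1 + \<delta>)"] ennreal_tendsto_cmult[of ?P] tendsto_ennreal_0_cmult
     weak_gradient_limit[OF g a] jump_limit[OF j a] limfun(3)[OF v a]) auto
  moreover have "ennreal (1 + \<delta>) * (?P * ((ennreal (1 + \<delta>) * l2_sq ?M g + 0) + (ennreal (1 + \<delta>) * jump_sq N c j + 0))) + 0 =
    ennreal (1 + \<delta>) * (ennreal (1 + \<delta>) * ?S)" by (simp only: add_0_right distrib_left mult.left_commute mult.assoc)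
  ultimately show "(%n. ennreal (1 + \<delta>) * (?P * ((ennreal (1 + \<delta>) * l2_sq ?M g + ennreal (1 + 1/\<delta>) * l2_sq ?M (%x. gradient (u n) x - g x)) +
    (ennreal (1 + \<delta>) * jump_sq N c j + ennreal (1 + 1/\<delta>) * jump_sq N c (%k \<xi>. jmp k (u n) \<xi> - j k \<xi>)))) +
    ennreal (1 + 1/\<delta>) * l2_sq lborel (%x. ubar (K n) (u n) x - limfun v x)) ----> ennreal (1 + \<delta>) * (ennreal (1 + \<delta>) * ?S)" by metis
 qed
 have "?S < top" using fin by (simp add: ennreal_mult_less_top)
 then obtain S where S: "?S = ennreal S" "S >= 0" by (cases ?S) auto
 have "l2_sq lborel (limfun v) <= ennreal ((1 + 1 / real (Suc n)) * ((1 + 1 / real (Suc n)) * S))" for n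
 proof -
  have "ennreal ((1 + \<delta>) * ((1 + \<delta>) * S)) = ennreal (1 + \<delta>) * (ennreal (1 + \<delta>) * ennreal S)" if "\<delta> > 0" for \<delta>
   using that S(2) ennreal_mult[of "1 + \<delta>" S] ennreal_mult[of "1 + \<delta>" "(1 + \<delta>) * S"] by (simp only: mult_nonneg_nonneg add_nonneg_nonneg zero_le_one less_imp_le)
  then show ?thesis using young[of "1 / real (Suc n)"] unfolding S(1) by simp
 qed
 moreover have "(%n. ennreal ((1 + 1 / real (Suc n)) * ((1 + 1 / real (Suc n)) * S))) ----> ennreal ((1 + 0) * ((1 + 0) * S))"
  by (intro tendsto_ennrealI tendsto_mult tendsto_add tendsto_const LIMSEQ_Suc[OF lim_1_over_n])
 ultimately have "l2_sq lborel (limfun v) <= ennreal ((1 + 0) * ((1 + 0) * S))" by (rule ennreal_le_limit)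
 then show ?thesis unfolding l2_sq_limfun[OF v] S(1) by simp
qed

end

theorem theorem3p6:
 fixes N :: "'n::{finite,linorder} network" and c :: real
 assumes "multiscale_interface_network N" and "c > 0"
 shows "\<exists>E.
  continuous_embedding N c (l2_space (lebesgue_on (region N))) (l2_norm (lebesgue_on (region N))) E \<and>
  (\<forall>s. 0 <= s & s < 1/2 \<longrightarrow>
   continuous_embedding N c (sobolev_space (region N) s) (sobolev_norm (region N) s) E) \<and>
  (\<forall>v\<in>points (fractal_space N c).
   (\<exists>g j. is_weak_gradient N v g & is_jump N c v j) \<and>
   (\<forall>g j. is_weak_gradient N v g & is_jump N c v j \<longrightarrow>
    l2_sq (lebesgue_on (region N)) (E v) \<le>
     ennreal ((1 + 1/c) * diameter (region N) * max (diameter (region N)) 1) *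
     (l2_sq (lebesgue_on (region N - iface_all N)) g +
      (\<Sum>k. ennreal ((1 + c) ^ Suc k * real (crossings N (Suc k))) *
         l2_sq (surface N (Suc k)) (j (Suc k))))))"
proof -
 obtain \<nu> b B where "regular_network N \<nu> b B" using regular_network_exists[OF assms(1)] by blast
 then interpret fractal_network N \<nu> b B c
  using assms(2) by (intro fractal_network.intro fractal_network_axioms.intro)
 have inj: "v = w" if "v \<in> points F" "w \<in> points F" "AE x in lebesgue_on (region N). limfun v x = limfun w x" for v w
  by (rule limfun_injective[OF that])
 show ?thesis
  unfolding poincare_const_def[symmetric] jump_sq_def[symmetric]
  using l2_embedding[OF inj] sobolev_embedding[OF _ _ inj] weak_gradient_exists jump_exists poincare_inequality by blast
qed

end
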